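(* Let $V$ be a finite-dimensional highest weight representation of a quantised enveloping algebra $U_q(\mathfrak g)$ and let $n>0$. Let $t_1,\dots,t_n$ act on $\otimes^{n+1}V$ through the braiding, let $J_n=(t_n\cdots t_2t_1)(t_1t_2\cdots t_n)$ (with $J_0=1$), and let $\tau_n=\tau^{\otimes^{n-1}V}_{V,V}$ be the local rule on $\otimes^{n+1}V=\otimes^{n-1}V\otimes V\otimes V$ for the coboundary structure given by Drinfel'd unitarisation. Then, as endomorphisms of $\otimes^{n+1}V$, $$\tau_n = J_{n-1}^{1/2}\,t_n\,J_n^{-1/2}.$$
   Context: Products of maps are composed right to left. Let $\mathfrak g$ be a finite-dimensional complex semisimple Lie algebra, and let $U_q(\mathfrak g)$ be its quantised enveloping algebra over a field of characteristic $0$ containing all rational powers of an indeterminate $q$, e.g. $\bigcup_m\mathbb Q(q^{1/m})$. Work in the (semisimple, braided) monoidal category of finite-dimensional type-1 modules, treated as strict. Write $R_{M,N}\colon M\otimes N\to N\otimes M$ for the standard braiding given by the $R$-matrix. If $L_\lambda$ denotes the irreducible module of highest weight $\lambda$, then $R_{L_\mu,L_\lambda}R_{L_\lambda,L_\mu}$ acts on the $L_\nu$-isotypic part of $L_\lambda\otimes L_\mu$ as the scalar $q^{c(\nu)-c(\lambda)-c(\mu)}$, where $c(\lambda)=(\lambda,\lambda+2\rho)$. The powers $(R_{N,M}R_{M,N})^{\pm1/2}$ are the natural diagonalisable operators obtained by replacing each such eigenvalue $q^x$ by $q^{\pm x/2}$. Drinfel'd unitarisation: $\sigma_{M,N}=R_{M,N}(R_{N,M}R_{M,N})^{-1/2}$.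 This makes the category a coboundary category: the $\sigma_{A,B}\colon A\otimes B\to B\otimes A$ are natural, $\sigma_{A,I}=1_A$, $\sigma_{I,B}=1_B$, $\sigma_{A,B}\sigma_{B,A}=1$, and $\sigma_{A,C\otimes B}(1_A\otimes\sigma_{B,C})=\sigma_{B\otimes A,C}(\sigma_{A,B}\otimes1_C)$. The local rule is $\tau^A_{B,C}=\sigma_{B,A\otimes C}\circ(\sigma_{A,B}\otimes 1_C)\colon A\otimes B\otimes C\to A\otimes C\otimes B$. The braid group $\mathfrak B_{n+1}$ has generators $t_1,\dots,t_n$ with relations $t_it_{i+1}t_i=t_{i+1}t_it_{i+1}$ and $t_it_j=t_jt_i$ for $|i-j|>1$. It acts on $\otimes^{n+1}V$ with $t_i$ acting as $R_{V,V}$ on tensor factors $i,i+1$. The Jucys–Murphy element $J_k$ ($1\le k\le n$) is $(t_k\cdots t_1)(t_1\cdots t_k)$. It acts on the first $k+1$ tensor factors as $R_{V,W}R_{W,V}$ with $W=\otimes^kV$, and $J_k^{\pm1/2}$ is the corresponding square root as specified above. *)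

theory Defs
  imports "Jordan_Normal_Form.VS_Connect" "HOL-Library.Multiset"
begin

section \<open>Quantised enveloping algebra data\<close>

text \<open>
  A semisimple Lie algebra is given by its Cartan matrix a, of finite type, with rows and columns
  indexed by the simple roots (the elements of the type 'i), together with positive integers d
  such that (d i * a i j) is symmetric; this matrix consists of the values of the invariant form
  on the simple roots. The field 'k has characteristic 0 and contains all rational powers
  (qp x = q to the power x) of the element q = qp 1, which is an indeterminate over the rationals.
\<close>

record ('i, 'k) quantum_datum =
  cartan :: "'i \<Rightarrow> 'i \<Rightarrow> int"
  symm :: "'i \<Rightarrow> nat"
  qp :: "rat \<Rightarrow> 'k"

text \<open>
  Elements of the rational span of the root lattice are written in the basis of simple roots:
  x stands for the sum of the x i times the i-th simple root.
\<close>

definition form :: "('i::finite, 'k) quantum_datum \<Rightarrow> ('i \<Rightarrow> rat) \<Rightarrow> ('i \<Rightarrow> rat) \<Rightarrow> rat" where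
  "form Q x y = (\<Sum>i\<in>UNIV. \<Sum>j\<in>UNIV. x i * of_nat (symm Q i) * of_int (cartan Q i j) * y j)"

definition simple_root :: "'i \<Rightarrow> 'i \<Rightarrow> rat" where
  "simple_root i = (\<lambda>j. if j = i then 1 else 0)"

definition coroot_pairing :: "('i::finite, 'k) quantum_datum \<Rightarrow> ('i \<Rightarrow> rat) \<Rightarrow> 'i \<Rightarrow> rat" where
  "coroot_pairing Q x i = (\<Sum>j\<in>UNIV. of_int (cartan Q i j) * x j)"

definition weights :: "('i::finite, 'k) quantum_datum \<Rightarrow> ('i \<Rightarrow> rat) set" where
  "weights Q = {x. \<forall>i. coroot_pairing Q x i \<in> \<int>}"

definition finite_type :: "('i::finite, 'k) quantum_datum \<Rightarrow> bool" where
  "finite_type Q \<longleftrightarrow>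
     (\<forall>i. cartan Q i i = 2) \<and>
     (\<forall>i j. i \<noteq> j \<longrightarrow> cartan Q i j \<le> 0) \<and>
     (\<forall>i. symm Q i > 0) \<and>
     (\<forall>i j. int (symm Q i) * cartan Q i j = int (symm Q j) * cartan Q j i) \<and>
     (\<forall>x. x \<noteq> (\<lambda>_. 0) \<longrightarrow> form Q x x > 0)"

definition rational_powers :: "('i, 'k::field_char_0) quantum_datum \<Rightarrow> bool" where
  "rational_powers Q \<longleftrightarrow>
     qp Q 0 = 1 \<and> (\<forall>x y. qp Q (x + y) = qp Q x * qp Q y) \<and> \<not> algebraic (qp Q 1)"

definition is_quantum_datum :: "('i::finite, 'k::field_char_0) quantum_datum \<Rightarrow> bool" where
  "is_quantum_datum Q \<longleftrightarrow> finite_type Q \<and> rational_powers Q"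

definition q_int :: "('i, 'k::field) quantum_datum \<Rightarrow> 'i \<Rightarrow> nat \<Rightarrow> 'k" where
  "q_int Q i m =
     (qp Q (of_nat (symm Q i * m)) - qp Q (- of_nat (symm Q i * m))) /
     (qp Q (of_nat (symm Q i)) - qp Q (- of_nat (symm Q i)))"

definition q_fact :: "('i, 'k::field) quantum_datum \<Rightarrow> 'i \<Rightarrow> nat \<Rightarrow> 'k" where
  "q_fact Q i m = (\<Prod>k = 1..m. q_int Q i k)"

definition q_binomial :: "('i, 'k::field) quantum_datum \<Rightarrow> 'i \<Rightarrow> nat \<Rightarrow> nat \<Rightarrow> 'k" where
  "q_binomial Q i m s = q_fact Q i m / (q_fact Q i s * q_fact Q i (m - s))"


section \<open>Matrices\<close>

text \<open>
  Tensor products are Kronecker products: the basis vector of index i * n + j is the tensor product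
  of the basis vectors of indices i and j, where n is the dimension of the second factor.
  This product is strictly associative, and strictly unital on modules.
\<close>

definition kron :: "'k::semiring_1 mat \<Rightarrow> 'k mat \<Rightarrow> 'k mat" where
  "kron A B = mat (dim_row A * dim_row B) (dim_col A * dim_col B)
     (\<lambda>(i, j). A $$ (i div dim_row B, j div dim_col B) * B $$ (i mod dim_row B, j mod dim_col B))"

definition kron_vec :: "'k::semiring_1 vec \<Rightarrow> 'k vec \<Rightarrow> 'k vec" where
  "kron_vec v w = vec (dim_vec v * dim_vec w) (\<lambda>i. v $ (i div dim_vec w) * w $ (i mod dim_vec w))"

text \<open>The matrix of the flip, sending the tensor product of v (in dimension m) and w (in dimension
  n) to that of w and v.\<close>

definition flip_mat :: "nat \<Rightarrow> nat \<Rightarrow> 'k::semiring_1 mat" where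
  "flip_mat m n = mat (n * m) (m * n) (\<lambda>(r, c). if r = (c mod n) * m + c div n then 1 else 0)"

definition mat_lincomb :: "nat \<Rightarrow> ('x \<Rightarrow> 'k::semiring_1) \<Rightarrow> ('x \<Rightarrow> 'k mat) \<Rightarrow> 'x set \<Rightarrow> 'k mat" where
  "mat_lincomb d c X S = mat d d (\<lambda>ij. \<Sum>s\<in>S. c s * X s $$ ij)"

definition mat_product :: "nat \<Rightarrow> 'k::semiring_1 mat list \<Rightarrow> 'k mat" where
  "mat_product d As = foldr (*) As (1\<^sub>m d)"

text \<open>
  For a diagonalisable T whose eigenvalues are of the form q to the power x, the operator
  obtained from T by replacing each eigenvalue (q to the power x) by (q to the power s * x).
\<close>

definition q_power :: "('i, 'k::field) quantum_datum \<Rightarrow> rat \<Rightarrow> 'k mat \<Rightarrow> 'k mat" where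
  "q_power Q s T = (THE S. S \<in> carrier_mat (dim_row T) (dim_row T) \<and>
     (\<forall>x. \<forall>v \<in> carrier_vec (dim_row T).
        T *\<^sub>v v = qp Q x \<cdot>\<^sub>v v \<longrightarrow> S *\<^sub>v v = qp Q (s * x) \<cdot>\<^sub>v v))"


section \<open>Modules\<close>

text \<open>
  A module over the quantised enveloping algebra, on the coordinate space of dimension mdim, is
  given by the actions of the generators; actKi is the action of the inverses of the generators K.
\<close>

record ('i, 'k) qmodule =
  mdim :: nat
  actE :: "'i \<Rightarrow> 'k mat"
  actF :: "'i \<Rightarrow> 'k mat"
  actK :: "'i \<Rightarrow> 'k mat"
  actKi :: "'i \<Rightarrow> 'k mat"

definition q_serre :: "('i, 'k::field) quantum_datum \<Rightarrow> nat \<Rightarrow> ('i \<Rightarrow> 'k mat) \<Rightarrow> bool" where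
  "q_serre Q d X \<longleftrightarrow> (\<forall>i j. i \<noteq> j \<longrightarrow>
     (let m = nat (1 - cartan Q i j) in
        mat_lincomb d (\<lambda>s. (- 1) ^ s * q_binomial Q i m s)
          (\<lambda>s. (X i ^\<^sub>m (m - s)) * X j * (X i ^\<^sub>m s)) {0..m} = 0\<^sub>m d d))"

definition is_module :: "('i, 'k::field) quantum_datum \<Rightarrow> ('i, 'k) qmodule \<Rightarrow> bool" where
  "is_module Q M \<longleftrightarrow>
     (\<forall>i. actE M i \<in> carrier_mat (mdim M) (mdim M) \<and> actF M i \<in> carrier_mat (mdim M) (mdim M) \<and>
          actK M i \<in> carrier_mat (mdim M) (mdim M) \<and> actKi M i \<in> carrier_mat (mdim M) (mdim M)) \<and>
     (\<forall>i. actK M i * actKi M i = 1\<^sub>m (mdim M) \<and> actKi M i * actK M i = 1\<^sub>m (mdim M)) \<and>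
     (\<forall>i j. actK M i * actK M j = actK M j * actK M i) \<and>
     (\<forall>i j. actK M i * actE M j * actKi M i =
        qp Q (of_int (int (symm Q i) * cartan Q i j)) \<cdot>\<^sub>m actE M j) \<and>
     (\<forall>i j. actK M i * actF M j * actKi M i =
        qp Q (- of_int (int (symm Q i) * cartan Q i j)) \<cdot>\<^sub>m actF M j) \<and>
     (\<forall>i j. actE M i * actF M j - actF M j * actE M i =
        (if i = j
         then (1 / (qp Q (of_nat (symm Q i)) - qp Q (- of_nat (symm Q i)))) \<cdot>\<^sub>m
                (actK M i - actKi M i)
         else 0\<^sub>m (mdim M) (mdim M))) \<and>
     q_serre Q (mdim M) (actE M) \<and> q_serre Q (mdim M) (actF M)"

definition weight_space ::
    "('i::finite, 'k::field) quantum_datum \<Rightarrow> ('i, 'k) qmodule \<Rightarrow> ('i \<Rightarrow> rat) \<Rightarrow> 'k vec set" where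
  "weight_space Q M l = {v \<in> carrier_vec (mdim M).
     \<forall>i. actK M i *\<^sub>v v = qp Q (form Q (simple_root i) l) \<cdot>\<^sub>v v}"

text \<open>The finite-dimensional modules of type 1 are those spanned by vectors of integral weight.\<close>

definition type1_module :: "('i::finite, 'k::field) quantum_datum \<Rightarrow> ('i, 'k) qmodule \<Rightarrow> bool" where
  "type1_module Q M \<longleftrightarrow> is_module Q M \<and>
     LinearCombinations.module.span class_ring (module_vec TYPE('k) (mdim M))
       (\<Union>l\<in>weights Q. weight_space Q M l) = carrier_vec (mdim M)"

definition is_submodule :: "('i, 'k::field) qmodule \<Rightarrow> 'k vec set \<Rightarrow> bool" where
  "is_submodule M W \<longleftrightarrow>
     VectorSpace.subspace class_ring W (module_vec TYPE('k) (mdim M)) \<and>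
     (\<forall>i. \<forall>w\<in>W. actE M i *\<^sub>v w \<in> W \<and> actF M i *\<^sub>v w \<in> W \<and> actK M i *\<^sub>v w \<in> W \<and> actKi M i *\<^sub>v w \<in> W)"

definition highest_weight_module ::
    "('i::finite, 'k::field) quantum_datum \<Rightarrow> ('i, 'k) qmodule \<Rightarrow> bool" where
  "highest_weight_module Q M \<longleftrightarrow> type1_module Q M \<and>
     (\<exists>l\<in>weights Q. \<exists>v\<in>weight_space Q M l. v \<noteq> 0\<^sub>v (mdim M) \<and>
        (\<forall>i. actE M i *\<^sub>v v = 0\<^sub>v (mdim M)) \<and>
        (\<forall>W. is_submodule M W \<and> v \<in> W \<longrightarrow> W = carrier_vec (mdim M)))"

definition module_hom ::
    "('i, 'k::field) qmodule \<Rightarrow> ('i, 'k) qmodule \<Rightarrow> 'k mat \<Rightarrow> bool" where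
  "module_hom M N f \<longleftrightarrow> f \<in> carrier_mat (mdim N) (mdim M) \<and>
     (\<forall>i. f * actE M i = actE N i * f \<and> f * actF M i = actF N i * f \<and>
          f * actK M i = actK N i * f \<and> f * actKi M i = actKi N i * f)"

text \<open>The comultiplication is normalised by
  E \<open>\<mapsto>\<close> E \<open>\<otimes>\<close> K + 1 \<open>\<otimes>\<close> E,  F \<open>\<mapsto>\<close> F \<open>\<otimes>\<close> 1 + (inverse of K) \<open>\<otimes>\<close> F,  K \<open>\<mapsto>\<close> K \<open>\<otimes>\<close> K.\<close>

definition tensor :: "('i, 'k::field) qmodule \<Rightarrow> ('i, 'k) qmodule \<Rightarrow> ('i, 'k) qmodule" where
  "tensor M N = \<lparr>
     mdim = mdim M * mdim N,
     actE = (\<lambda>i. kron (actE M i) (actK N i) + kron (1\<^sub>m (mdim M)) (actE N i)),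
     actF = (\<lambda>i. kron (actF M i) (1\<^sub>m (mdim N)) + kron (actKi M i) (actF N i)),
     actK = (\<lambda>i. kron (actK M i) (actK N i)),
     actKi = (\<lambda>i. kron (actKi M i) (actKi N i)) \<rparr>"

definition unit_module :: "('i, 'k::field) qmodule" where
  "unit_module = \<lparr> mdim = 1, actE = (\<lambda>_. 0\<^sub>m 1 1), actF = (\<lambda>_. 0\<^sub>m 1 1),
     actK = (\<lambda>_. 1\<^sub>m 1), actKi = (\<lambda>_. 1\<^sub>m 1) \<rparr>"

fun tensor_power :: "nat \<Rightarrow> ('i, 'k::field) qmodule \<Rightarrow> ('i, 'k) qmodule" where
  "tensor_power 0 V = unit_module"
| "tensor_power (Suc n) V = tensor (tensor_power n V) V"


section \<open>The braiding given by the R-matrix\<close>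

definition word_act :: "nat \<Rightarrow> ('i \<Rightarrow> 'k::field mat) \<Rightarrow> 'i list \<Rightarrow> 'k mat" where
  "word_act d X u = mat_product d (map X u)"

text \<open>
  A formal sum of weight zero in the completed tensor product of the positive and the negative part
  of the algebra is given by coefficients c u w for all words u in the generators E and w in the
  generators F with the same content (they are not unique, owing to the q-Serre relations).
  A word u of length at least mdim M acts as zero on a module M of type 1, since it would produce
  a chain of more than mdim M nonzero vectors of distinct weights; so the following is the action
  of the whole sum.
\<close>

definition quasi_R_action ::
    "('i list \<Rightarrow> 'i list \<Rightarrow> 'k) \<Rightarrow> ('i, 'k::field) qmodule \<Rightarrow> ('i, 'k) qmodule \<Rightarrow> 'k mat" where
  "quasi_R_action c M N = mat_lincomb (mdim M * mdim N) (\<lambda>(u, w). c u w)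
     (\<lambda>(u, w). kron (word_act (mdim M) (actE M) u) (word_act (mdim N) (actF N) w))
     {(u, w). mset u = mset w \<and> length u < mdim M}"

text \<open>The operator acting on the tensor product of the weight spaces of weights l and m as
  q to the power (l, m).\<close>

definition weight_form_action ::
    "('i::finite, 'k::field) quantum_datum \<Rightarrow> ('i, 'k) qmodule \<Rightarrow> ('i, 'k) qmodule \<Rightarrow> 'k mat" where
  "weight_form_action Q M N = (THE D. D \<in> carrier_mat (mdim M * mdim N) (mdim M * mdim N) \<and>
     (\<forall>l\<in>weights Q. \<forall>m\<in>weights Q. \<forall>x\<in>weight_space Q M l. \<forall>y\<in>weight_space Q N m.
        D *\<^sub>v kron_vec x y = qp Q (form Q l m) \<cdot>\<^sub>v kron_vec x y))"

text \<open>
  The R-matrix is the product of the above operator and a formal sum with constant term 1, and is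
  determined by the condition that its composite with the flip is linear over the quantised
  enveloping algebra. With the chosen comultiplication, the resulting double braiding acts on
  the component of highest weight n of the tensor product of the irreducible modules of highest
  weights l and m as q to the power c(n) - c(l) - c(m).
\<close>

definition standard_braiding ::
    "('i::finite, 'k::field) quantum_datum \<Rightarrow>
     (('i, 'k) qmodule \<Rightarrow> ('i, 'k) qmodule \<Rightarrow> 'k mat) \<Rightarrow> bool" where
  "standard_braiding Q R \<longleftrightarrow> (\<exists>c. c [] [] = 1 \<and>
     (\<forall>M N. type1_module Q M \<and> type1_module Q N \<longrightarrow>
        R M N = flip_mat (mdim M) (mdim N) * (weight_form_action Q M N * quasi_R_action c M N) \<and>
        module_hom (tensor M N) (tensor N M) (R M N)))"


section \<open>Drinfel'd unitarisation, the local rule and Jucys-Murphy elements\<close>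

definition unitarised ::
    "('i, 'k::field) quantum_datum \<Rightarrow> (('i, 'k) qmodule \<Rightarrow> ('i, 'k) qmodule \<Rightarrow> 'k mat) \<Rightarrow>
     ('i, 'k) qmodule \<Rightarrow> ('i, 'k) qmodule \<Rightarrow> 'k mat" where
  "unitarised Q R M N = R M N * q_power Q (- 1 / 2) (R N M * R M N)"

text \<open>The argument sg is the family of commutors of a coboundary structure.\<close>

definition local_rule ::
    "(('i, 'k::field) qmodule \<Rightarrow> ('i, 'k) qmodule \<Rightarrow> 'k mat) \<Rightarrow>
     ('i, 'k) qmodule \<Rightarrow> ('i, 'k) qmodule \<Rightarrow> ('i, 'k) qmodule \<Rightarrow> 'k mat" where
  "local_rule sg A B C = sg B (tensor A C) * kron (sg A B) (1\<^sub>m (mdim C))"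

text \<open>The action of the i-th generator of the braid group on the (n+1)-st tensor power of V.\<close>

definition braid_gen ::
    "(('i, 'k::field) qmodule \<Rightarrow> ('i, 'k) qmodule \<Rightarrow> 'k mat) \<Rightarrow>
     ('i, 'k) qmodule \<Rightarrow> nat \<Rightarrow> nat \<Rightarrow> 'k mat" where
  "braid_gen R V n i = kron (1\<^sub>m (mdim V ^ (i - 1))) (kron (R V V) (1\<^sub>m (mdim V ^ (n - i))))"

text \<open>The action of the k-th Jucys-Murphy element on the (n+1)-st tensor power of V.\<close>

definition jucys_murphy ::
    "(('i, 'k::field) qmodule \<Rightarrow> ('i, 'k) qmodule \<Rightarrow> 'k mat) \<Rightarrow>
     ('i, 'k) qmodule \<Rightarrow> nat \<Rightarrow> nat \<Rightarrow> 'k mat" where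
  "jucys_murphy R V n k =
     mat_product (mdim V ^ (n + 1)) (map (braid_gen R V n) (rev [1..<k + 1])) *
     mat_product (mdim V ^ (n + 1)) (map (braid_gen R V n) [1..<k + 1])"

end

theory Submission
  imports Defs "Jordan_Normal_Form.Determinant" "HOL-Library.Function_Algebras"
begin

text \<open>
  Each module M carries a Casimir operator \<open>C\<^sub>M\<close>, obtained by multiplying the two legs of the quasi-R-matrix after applying
  an antipode to one of them. On vectors killed by all E one computes \<open>J C = C\<^sub>M \<otimes> C\<^sub>N\<close> for the double braiding J and the
  Casimir operator C of \<open>M \<otimes> N\<close>, and by complete reducibility this holds everywhere. It follows that J is
  diagonalisable with eigenvalues powers of q, so that its powers are given by a functional calculus.

  Since V is generated by a vector \<open>v\<^sub>0\<close> killed by all E, the hexagon identities need only be compared on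
  \<open>v\<^sub>0 \<otimes> z\<close>. They identify \<open>t\<^sub>n \<dots> t\<^sub>1\<close> and \<open>t\<^sub>1 \<dots> t\<^sub>n\<close> with braidings between V and its n-th power, so that \<open>J\<^sub>n\<close> is a double
  braiding and the local rule equals \<open>J\<^sub>n\<close> to the power -1/2, times \<open>t\<^sub>n\<close>, times \<open>J\<^sub>n\<^sub>-\<^sub>1\<close> to the power 1/2. Finally \<open>J\<^sub>n = t\<^sub>n J\<^sub>n\<^sub>-\<^sub>1 t\<^sub>n\<close> commutes
  with \<open>J\<^sub>n\<^sub>-\<^sub>1\<close>, so \<open>t\<^sub>n\<close> commutes with their product and with its square root, which allows moving the two
  half powers to the other sides of \<open>t\<^sub>n\<close>.
\<close>

section \<open>Linear algebra\<close>

text \<open>\<open>standard_braiding\<close> prescribes only the shape of R, with one family of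
  coefficients c for all modules, and its linearity for each pair. Naturality, hexagons, eigenvalues
  of the double braiding and semisimplicity all have to come out of that. The uniformity of c is the
  lever: linearity for the pair consisting of the dual of N and N, evaluated at the canonical
  invariant, turns into identities between operators on N, and these say that the Casimir operator
  commutes with E and F. This uses linearity on duals and tensor products, hence their q-Serre
  relations; instead of being verified there, these are first derived from the other relations for
  every module spanned by weight vectors. The Casimir operator itself then yields complete
  reducibility. The hexagons are established with V as the leftmost factor, because E acts by zero
  on \<open>v0\<close> and the R-matrix becomes computable there; the splitting that is needed on
  the other side is read off from the resulting braid words.\<close>

inductive_set lin :: "nat \<Rightarrow> 'k::field vec set \<Rightarrow> 'k vec set" for d S where
  zero: "0\<^sub>v d \<in> lin d S"
| base: "x \<in> S \<Longrightarrow> x \<in> lin d S"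
| add: "x \<in> lin d S \<Longrightarrow> y \<in> lin d S \<Longrightarrow> x + y \<in> lin d S"
| smult: "x \<in> lin d S \<Longrightarrow> a \<cdot>\<^sub>v x \<in> lin d S"

definition spans :: "nat \<Rightarrow> 'k::field vec set \<Rightarrow> bool" where
  "spans d S \<longleftrightarrow> S \<subseteq> carrier_vec d \<and> carrier_vec d \<subseteq> lin d S"

lemma lin_carrier: "x \<in> lin d S \<Longrightarrow> S \<subseteq> carrier_vec d \<Longrightarrow> x \<in> carrier_vec d"
  by (induction rule: lin.induct) auto

lemma lin_least:
  assumes "x \<in> lin d S" "S \<subseteq> T" "0\<^sub>v d \<in> T" "\<And>x y. x \<in> T \<Longrightarrow> y \<in> T \<Longrightarrow> x + y \<in> T"
    "\<And>a x. x \<in> T \<Longrightarrow> a \<cdot>\<^sub>v x \<in> T"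
  shows "x \<in> T"
  using assms(1) by (induction rule: lin.induct) (use assms in auto)

lemma lin_lin: "x \<in> lin d S \<Longrightarrow> S \<subseteq> lin d T \<Longrightarrow> x \<in> lin d T"
  by (erule lin_least) (auto intro: lin.intros)

lemma lin_mono: "x \<in> lin d S \<Longrightarrow> S \<subseteq> T \<Longrightarrow> x \<in> lin d T"
  by (erule lin_lin) (auto intro: lin.base)

lemma spans_lin: "spans d S \<Longrightarrow> S \<subseteq> lin d T \<Longrightarrow> T \<subseteq> carrier_vec d \<Longrightarrow> spans d T"
  unfolding spans_def by (blast intro: lin_lin)

lemma spans_mono: "spans d S \<Longrightarrow> S \<subseteq> T \<Longrightarrow> T \<subseteq> carrier_vec d \<Longrightarrow> spans d T"
  by (erule spans_lin) (auto intro: lin.base)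

lemma spans_induct:
  assumes "spans d S" "v \<in> carrier_vec d" "\<And>x. x \<in> S \<Longrightarrow> x \<in> carrier_vec d \<Longrightarrow> Pr x" "Pr (0\<^sub>v d)"
    "\<And>x y. x \<in> carrier_vec d \<Longrightarrow> y \<in> carrier_vec d \<Longrightarrow> Pr x \<Longrightarrow> Pr y \<Longrightarrow> Pr (x + y)"
    "\<And>a x. x \<in> carrier_vec d \<Longrightarrow> Pr x \<Longrightarrow> Pr (a \<cdot>\<^sub>v x)"
  shows "Pr v"
proof -
  have "v \<in> lin d S" using assms(1,2) by (auto simp: spans_def)
  moreover have "S \<subseteq> {x \<in> carrier_vec d. Pr x}" using assms(1,3) by (auto simp: spans_def)
  ultimately have "v \<in> {x \<in> carrier_vec d. Pr x}" by (rule lin_least) (use assms in auto)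
  then show ?thesis by simp
qed

lemma mult_mat_unit_vec:
  fixes A :: "'k::field mat"
  assumes "A \<in> carrier_mat n d" "k < d"
  shows "A *\<^sub>v unit_vec d k = col A k"
  using assms by (intro eq_vecI) auto

lemma square_mult_carrier[simp]:
  "A \<in> carrier_mat d d \<Longrightarrow> B \<in> carrier_mat d d \<Longrightarrow> A * B \<in> carrier_mat d d"
  by (rule mult_carrier_mat)

lemma square_mult_vec_carrier[simp]:
  "A \<in> carrier_mat d d \<Longrightarrow> x \<in> carrier_vec d \<Longrightarrow> A *\<^sub>v x \<in> carrier_vec d"
  by (rule mult_mat_vec_carrier)

lemma smult_mat_vec:
  fixes A :: "'k::field mat"
  shows "A \<in> carrier_mat n d \<Longrightarrow> x \<in> carrier_vec d \<Longrightarrow> (a \<cdot>\<^sub>m A) *\<^sub>v x = a \<cdot>\<^sub>v (A *\<^sub>v x)"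
  by (intro eq_vecI) auto

lemma mult_mat_zero_vec:
  fixes A :: "'k::field mat"
  shows "A \<in> carrier_mat n d \<Longrightarrow> A *\<^sub>v 0\<^sub>v d = 0\<^sub>v n"
  by (intro eq_vecI) (auto simp: scalar_prod_def)

lemma square_mult_zero_vec[simp]:
  fixes A :: "'k::field mat"
  shows "A \<in> carrier_mat d d \<Longrightarrow> A *\<^sub>v 0\<^sub>v d = 0\<^sub>v d"
  by (rule mult_mat_zero_vec)

lemma smult_zero_vec'[simp]: "a \<cdot>\<^sub>v 0\<^sub>v d = (0\<^sub>v d :: 'k::field vec)"
  by (intro eq_vecI) auto

lemma smult_zero_scalar[simp]: "0 \<cdot>\<^sub>v (x :: 'k::field vec) = 0\<^sub>v (dim_vec x)"
  by (intro eq_vecI) auto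

lemma mat_eqI_vec:
  fixes A B :: "'k::field mat"
  assumes "A \<in> carrier_mat n d" "B \<in> carrier_mat n d"
    and "\<And>x. x \<in> carrier_vec d \<Longrightarrow> A *\<^sub>v x = B *\<^sub>v x"
  shows "A = B"
proof (rule mat_col_eqI)
  fix i assume "i < dim_col B"
  then have "i < d" using assms by auto
  then show "col A i = col B i"
    using assms(3)[of "unit_vec d i"] assms(1,2) mult_mat_unit_vec[of A n d i] mult_mat_unit_vec[of B n d i] \<open>i < d\<close> by simp
qed (use assms in auto)

lemma mat_eqI_spans:
  fixes A B :: "'k::field mat"
  assumes A: "A \<in> carrier_mat n d" and B: "B \<in> carrier_mat n d" and S: "spans d S"
    and eq: "\<And>x. x \<in> S \<Longrightarrow> A *\<^sub>v x = B *\<^sub>v x"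
  shows "A = B"
proof (rule mat_eqI_vec[OF A B])
  fix x :: "'k vec" assume "x \<in> carrier_vec d"
  from S this show "A *\<^sub>v x = B *\<^sub>v x"
    by (rule spans_induct)
      (use A B eq in \<open>auto simp: mult_add_distrib_mat_vec[OF A] mult_add_distrib_mat_vec[OF B]
         mult_mat_vec[OF A] mult_mat_vec[OF B]\<close>)
qed

text \<open>The inductive span allows rule induction over generators, whereas
  \<open>type1_module\<close> and \<open>is_submodule\<close> speak of spans and subspaces of vector
  spaces. This identity is the passage between the two.\<close>

lemma lin_eq_span:
  fixes S :: "'k::field vec set"
  assumes S: "S \<subseteq> carrier_vec d"
  shows "lin d S = LinearCombinations.module.span class_ring (module_vec TYPE('k) d) S"
proof -
  interpret V: vec_space "TYPE('k)" d .
  have "x \<in> V.span S" if "x \<in> lin d S" for x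
    using that
  proof (induction rule: lin.induct)
    case zero then show ?case by (simp add: V.span_zero)
  next
    case (base x) then show ?case using V.in_own_span[OF S] by auto
  next
    case (add x y) then show ?case using V.span_add1[OF S] by auto
  next
    case (smult x a) then show ?case using V.smult_in_span[OF S] by auto
  qed
  moreover have "x \<in> lin d S" if "x \<in> V.span S" for x
  proof -
    from that obtain a A where x: "x = V.lincomb a A" "finite A" "A \<subseteq> S"
      using V.in_spanE by blast
    from x(2,3) have "V.lincomb a A \<in> lin d S"
    proof (induction A rule: finite_induct)
      case empty
      then show ?case by (simp add: V.lincomb_def lin.zero)
    next
      case (insert y A)
      then have "V.lincomb a (insert y A) = a y \<cdot>\<^sub>v y + V.lincomb a A"
        using S by (subst V.lincomb_insert2) auto
      then show ?case using insert by (auto intro: lin.intros)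
    qed
    then show ?thesis using x by simp
  qed
  ultimately show ?thesis by blast
qed

lemma spans_iff_span:
  fixes S :: "'k::field vec set"
  assumes "S \<subseteq> carrier_vec d"
  shows "spans d S \<longleftrightarrow>
    LinearCombinations.module.span class_ring (module_vec TYPE('k) d) S = carrier_vec d"
  using lin_eq_span[OF assms] assms by (auto simp: spans_def dest: lin_carrier)

text \<open>A maximal independent subset of \<open>S\<close> is a basis. It is delivered as an
  invertible matrix whose columns lie in \<open>S\<close>, so that a property shared by the vectors
  of \<open>S\<close>, such as being eigenvectors, becomes a matrix equation.\<close>

lemma spans_imp_basis:
  fixes S :: "'k::field vec set"
  assumes "spans d S"
  obtains f B B' where "\<And>k. k < d \<Longrightarrow> f k \<in> S" "B \<in> carrier_mat d d" "B' \<in> carrier_mat d d"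
    "B * B' = 1\<^sub>m d" "B' * B = 1\<^sub>m d" "\<And>k. k < d \<Longrightarrow> col B k = f k"
proof -
  interpret V: vec_space "TYPE('k)" d .
  have S: "S \<subseteq> carrier_vec d" and sp: "V.span S = carrier_vec d"
    using assms spans_iff_span[of S d] by (auto simp: spans_def)
  let ?P = "\<lambda>A. A \<subseteq> S \<and> V.lin_indpt A"
  have "V.lin_indpt {}" unfolding V.lin_dep_def by auto
  then have "?P {}" by simp
  moreover have "finite A \<and> card A \<le> d" if "?P A" for A
    using that S V.li_le_dim[OF V.fin_dim, of A] by (auto simp: V.dim_is_n)
  ultimately obtain A where A: "finite A" "maximal A ?P"
    using maximal_exists[of ?P d "{}"] by auto
  then have AS: "A \<subseteq> S" "V.lin_indpt A" by (auto simp: maximal_def)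
  have AC: "A \<subseteq> carrier_vec d" using AS S by auto
  \<comment> \<open>A vector of \<open>S\<close> outside the span of \<open>A\<close> could be added
    to \<open>A\<close>, against maximality.\<close>
  have "S \<subseteq> V.span A"
  proof (rule ccontr)
    assume "\<not> S \<subseteq> V.span A"
    then obtain v where v: "v \<in> S" "v \<notin> V.span A" by auto
    then have "v \<notin> A" using V.in_own_span[OF AC] by auto
    then have "V.lin_indpt (A \<union> {v})"
      using V.lin_dep_iff_in_span[OF AC AS(2)] v S by auto
    then have "A \<union> {v} = A" using A(2) v AS by (auto simp: maximal_def)
    then show False using \<open>v \<notin> A\<close> by auto
  qed
  then have spA: "V.span A = carrier_vec d"
    using V.span_subsetI[OF AC \<open>S \<subseteq> V.span A\<close>] sp V.span_is_subset2[OF AC] by auto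
  have "card A = d"
    using V.li_le_dim(2)[OF V.fin_dim AC AS(2)] V.gen_ge_dim[OF A(1) AC] spA V.dim_is_n
    by auto
  then obtain f where f: "bij_betw f {0..<d} A" using ex_bij_betw_nat_finite[OF A(1)] by auto
  have fA: "k < d \<Longrightarrow> f k \<in> A" for k using f by (auto simp: bij_betw_def)
  define B where "B = mat_of_cols d (map f [0..<d])"
  have B: "B \<in> carrier_mat d d" using mat_of_cols_carrier(1)[of d "map f [0..<d]"] by (simp add: B_def)
  have colB: "col B k = f k" if "k < d" for k
    using that fA[OF that] AC by (subst B_def, subst col_mat_of_cols) auto
  \<comment> \<open>The image of \<open>B\<close> is a subspace containing all columns, hence
    everything. Preimages of the unit vectors form a right inverse, which is two-sided because
    \<open>B\<close> is square.\<close>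
  have "\<exists>y\<in>carrier_vec d. B *\<^sub>v y = x" if "x \<in> carrier_vec d" for x
  proof -
    have "x \<in> lin d A" using that spA lin_eq_span[OF AC] by simp
    then have "x \<in> {B *\<^sub>v y | y. y \<in> carrier_vec d}"
    proof (rule lin_least)
      show "A \<subseteq> {B *\<^sub>v y | y. y \<in> carrier_vec d}"
      proof
        fix x assume "x \<in> A"
        then obtain k where "k < d" "x = f k" using f by (auto simp: bij_betw_def)
        then have "x = B *\<^sub>v unit_vec d k" using colB mult_mat_unit_vec[OF B] by simp
        then show "x \<in> {B *\<^sub>v y | y. y \<in> carrier_vec d}" by auto
      qed
      show "0\<^sub>v d \<in> {B *\<^sub>v y | y. y \<in> carrier_vec d}"
        using B by (auto intro!: exI[of _ "0\<^sub>v d"])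
      show "x + y \<in> {B *\<^sub>v y | y. y \<in> carrier_vec d}"
        if "x \<in> {B *\<^sub>v y | y. y \<in> carrier_vec d}" "y \<in> {B *\<^sub>v y | y. y \<in> carrier_vec d}" for x y
        using that by (auto simp: mult_add_distrib_mat_vec[OF B, symmetric])
      show "a \<cdot>\<^sub>v x \<in> {B *\<^sub>v y | y. y \<in> carrier_vec d}"
        if "x \<in> {B *\<^sub>v y | y. y \<in> carrier_vec d}" for a x
        using that by (auto simp: mult_mat_vec[OF B, symmetric])
    qed
    then show ?thesis by auto
  qed
  then have "\<forall>k. \<exists>y\<in>carrier_vec d. B *\<^sub>v y = unit_vec d k" by simp
  then obtain g where g: "\<And>k. g k \<in> carrier_vec d" "\<And>k. B *\<^sub>v g k = unit_vec d k" by metis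
  define B' where "B' = mat_of_cols d (map g [0..<d])"
  have B': "B' \<in> carrier_mat d d" using mat_of_cols_carrier(1)[of d "map g [0..<d]"] by (simp add: B'_def)
  have BB: "B * B' = 1\<^sub>m d"
  proof (rule mat_col_eqI)
    fix k assume "k < dim_col (1\<^sub>m d :: 'k mat)"
    then have k: "k < d" by simp
    then have "col B' k = g k" using g by (subst B'_def, subst col_mat_of_cols) auto
    then show "col (B * B') k = col (1\<^sub>m d) k"
      using k B B' g by (subst col_mult2[OF B B' k]) auto
  qed (use B B' in auto)
  show ?thesis
    by (rule that[of f B B']) (use fA AS B B' BB colB mat_mult_left_right_inverse[OF B B' BB] in auto)
qed

lemma spans_units: "spans d {unit_vec d k :: 'k::field vec | k. k < d}"
proof -
  interpret V: vec_space "TYPE('k)" d .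
  have "{unit_vec d k | k. k < d} = set (unit_vecs d :: 'k vec list)" by (auto simp: unit_vecs_def)
  moreover have "spans d (set (unit_vecs d :: 'k vec list))"
    using V.span_unit_vecs_is_carrier by (subst spans_iff_span) (auto simp: unit_vecs_def)
  ultimately show ?thesis by simp
qed

lemma spans_carrier: "spans d (carrier_vec d)"
  by (auto simp: spans_def intro: lin.base)

section \<open>Simultaneous diagonalisation\<close>

definition joint_eigenspace :: "nat \<Rightarrow> ('j \<Rightarrow> 'k::field mat) \<Rightarrow> ('j \<Rightarrow> 'k) \<Rightarrow> 'k vec set" where
  "joint_eigenspace d T x = {v \<in> carrier_vec d. \<forall>j. T j *\<^sub>v v = x j \<cdot>\<^sub>v v}"

text \<open>In a basis of joint eigenvectors with labels \<open>wt k\<close>, a joint eigenvector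
  with label w has nonzero coordinates only where \<open>wt k = w\<close>, because
  \<open>chi\<close> separates labels. Hence at most d labels occur, and every function
  \<open>phi\<close> of the label is realised by an operator that is diagonal in this basis. The
  family \<open>T\<close> will consist of the K_i (labels are weights), of the K_i on two tensor
  factors (pairs of weights), or of a single operator (exponents of q).\<close>

lemma joint_eigenspaces:
  fixes T :: "'j \<Rightarrow> 'k::field mat" and chi :: "'w \<Rightarrow> 'j \<Rightarrow> 'k"
  assumes T: "\<And>j. T j \<in> carrier_mat d d" and inj: "inj_on chi I"
    and sp: "spans d (\<Union>w\<in>I. joint_eigenspace d T (chi w))"
  shows "\<exists>L. finite L \<and> card L \<le> d \<and> L \<subseteq> I \<and> (\<forall>w\<in>I - L. joint_eigenspace d T (chi w) \<subseteq> {0\<^sub>v d})"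
    and "\<exists>S\<in>carrier_mat d d. \<forall>w\<in>I. \<forall>v\<in>joint_eigenspace d T (chi w). S *\<^sub>v v = phi w \<cdot>\<^sub>v v"
proof -
  obtain f B B' where f: "\<And>k. k < d \<Longrightarrow> f k \<in> (\<Union>w\<in>I. joint_eigenspace d T (chi w))"
    and B: "B \<in> carrier_mat d d" and B': "B' \<in> carrier_mat d d"
    and BB': "B * B' = 1\<^sub>m d" "B' * B = 1\<^sub>m d" and colB: "\<And>k. k < d \<Longrightarrow> col B k = f k"
    using spans_imp_basis[OF sp] by metis
  have "\<forall>k. \<exists>w. k < d \<longrightarrow> w \<in> I \<and> f k \<in> joint_eigenspace d T (chi w)" using f by blast
  then obtain wt where wt: "\<And>k. k < d \<Longrightarrow> wt k \<in> I"
    and fwt: "\<And>k. k < d \<Longrightarrow> f k \<in> joint_eigenspace d T (chi (wt k))"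
    by metis
  define Dg where "Dg = (\<lambda>g. mat d d (\<lambda>(i, j). if i = j then g (wt i) else 0) :: 'k mat)"
  have Dg: "Dg g \<in> carrier_mat d d" for g by (simp add: Dg_def)
  have Dg_unit: "Dg g *\<^sub>v unit_vec d k = g (wt k) \<cdot>\<^sub>v unit_vec d k" if "k < d" for g k
    using that by (auto simp: mult_mat_unit_vec[OF Dg] Dg_def intro!: eq_vecI)
  have Dg_ix: "(Dg g *\<^sub>v y) $ k = g (wt k) * y $ k" if "k < d" "y \<in> carrier_vec d" for g k y
  proof -
    have "(Dg g *\<^sub>v y) $ k = (\<Sum>i = 0..<d. (if k = i then g (wt k) else 0) * y $ i)"
      using that by (auto simp: Dg_def scalar_prod_def intro!: sum.cong)
    also have "\<dots> = (\<Sum>i = 0..<d. if k = i then g (wt k) * y $ i else 0)"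
      by (intro sum.cong) auto
    finally show ?thesis using that by simp
  qed
  have TB: "T j * B = B * Dg (\<lambda>w. chi w j)" for j
  proof (rule mat_eqI_spans[OF _ _ spans_units])
    fix x :: "'k vec" assume "x \<in> {unit_vec d k | k. k < d}"
    then obtain k where k: "k < d" "x = unit_vec d k" by auto
    have "T j * B *\<^sub>v x = T j *\<^sub>v f k"
      using k T B colB by (simp add: assoc_mult_mat_vec[OF T B] mult_mat_unit_vec[OF B])
    also have "\<dots> = chi (wt k) j \<cdot>\<^sub>v f k" using fwt[OF k(1)] by (auto simp: joint_eigenspace_def)
    also have "\<dots> = B *\<^sub>v (Dg (\<lambda>w. chi w j) *\<^sub>v x)"
      using k B colB by (simp add: Dg_unit mult_mat_vec[OF B] mult_mat_unit_vec[OF B])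
    finally show "T j * B *\<^sub>v x = B * Dg (\<lambda>w. chi w j) *\<^sub>v x"
      using k B Dg by (simp add: assoc_mult_mat_vec[OF B Dg])
  qed (rule mult_carrier_mat[OF T B] mult_carrier_mat[OF B Dg])+
  \<comment> \<open>Where the coordinate is nonzero, the eigenvalues of every \<open>T j\<close> for
    the labels \<open>wt k\<close> and w agree; then so do the labels.\<close>
  have coord: "(B' *\<^sub>v v) $ k = 0 \<or> wt k = w"
    if w: "w \<in> I" and v: "v \<in> joint_eigenspace d T (chi w)" and k: "k < d" for w v k
  proof -
    have vc: "v \<in> carrier_vec d" using v by (auto simp: joint_eigenspace_def)
    define y where "y = B' *\<^sub>v v"
    have y: "y \<in> carrier_vec d" using B' vc by (simp add: y_def)
    have v_y: "v = B *\<^sub>v y"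
      using assoc_mult_mat_vec[OF B B' vc] BB' vc by (simp add: y_def)
    have "Dg (\<lambda>w. chi w j) *\<^sub>v y = chi w j \<cdot>\<^sub>v y" for j
    proof -
      have "B *\<^sub>v (Dg (\<lambda>w. chi w j) *\<^sub>v y) = T j *\<^sub>v v"
        using TB[of j] assoc_mult_mat_vec[OF B Dg y] assoc_mult_mat_vec[OF T B y] v_y by metis
      also have "\<dots> = chi w j \<cdot>\<^sub>v v" using v by (auto simp: joint_eigenspace_def)
      also have "\<dots> = B *\<^sub>v (chi w j \<cdot>\<^sub>v y)" using v_y mult_mat_vec[OF B y] by simp
      finally have "B' *\<^sub>v (B *\<^sub>v (Dg (\<lambda>w. chi w j) *\<^sub>v y)) = B' *\<^sub>v (B *\<^sub>v (chi w j \<cdot>\<^sub>v y))" by simp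
      then show ?thesis
        using assoc_mult_mat_vec[OF B' B, of "Dg (\<lambda>w. chi w j) *\<^sub>v y"]
          assoc_mult_mat_vec[OF B' B, of "chi w j \<cdot>\<^sub>v y"] y Dg BB' by (metis mult_mat_vec_carrier one_mult_mat_vec smult_carrier_vec)
    qed
    then have "chi (wt k) j * y $ k = chi w j * y $ k" for j
      using Dg_ix[OF k y, of "\<lambda>w. chi w j"] k y by auto
    then have "y $ k = 0 \<or> chi (wt k) = chi w" by auto
    then show ?thesis using inj wt[OF k] w by (auto simp: inj_on_def y_def)
  qed
  show "\<exists>L. finite L \<and> card L \<le> d \<and> L \<subseteq> I \<and> (\<forall>w\<in>I - L. joint_eigenspace d T (chi w) \<subseteq> {0\<^sub>v d})"
  proof (intro exI conjI ballI subsetI)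
    show "finite (wt ` {..<d})" "card (wt ` {..<d}) \<le> d"
      using card_image_le[of "{..<d}" wt] by auto
    show "x \<in> I" if "x \<in> wt ` {..<d}" for x using that wt by auto
    fix w v assume w: "w \<in> I - wt ` {..<d}" and v: "v \<in> joint_eigenspace d T (chi w)"
    have vc: "v \<in> carrier_vec d" using v by (auto simp: joint_eigenspace_def)
    have "B' *\<^sub>v v = 0\<^sub>v d"
      using coord[OF _ v] w B' by (intro eq_vecI) auto
    then have "B *\<^sub>v (B' *\<^sub>v v) = 0\<^sub>v d" using B by simp
    then show "v \<in> {0\<^sub>v d}" using assoc_mult_mat_vec[OF B B' vc] BB' vc by simp
  qed
  show "\<exists>S\<in>carrier_mat d d. \<forall>w\<in>I. \<forall>v\<in>joint_eigenspace d T (chi w). S *\<^sub>v v = phi w \<cdot>\<^sub>v v"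
  proof (intro bexI[of _ "B * Dg phi * B'"] ballI)
    show "B * Dg phi * B' \<in> carrier_mat d d" using B B' Dg by simp
    fix w v assume w: "w \<in> I" and v: "v \<in> joint_eigenspace d T (chi w)"
    have vc: "v \<in> carrier_vec d" using v by (auto simp: joint_eigenspace_def)
    define y where "y = B' *\<^sub>v v"
    have y: "y \<in> carrier_vec d" using B' vc by (simp add: y_def)
    have "Dg phi *\<^sub>v y = phi w \<cdot>\<^sub>v y"
    proof (rule eq_vecI)
      fix k assume "k < dim_vec (phi w \<cdot>\<^sub>v y)"
      then have k: "k < d" using y by simp
      then show "(Dg phi *\<^sub>v y) $ k = (phi w \<cdot>\<^sub>v y) $ k"
        using coord[OF w v k] y by (auto simp: Dg_ix[OF k y] y_def[symmetric])
    qed (use y Dg in auto)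
    then have "B *\<^sub>v (Dg phi *\<^sub>v y) = phi w \<cdot>\<^sub>v (B *\<^sub>v y)" using mult_mat_vec[OF B y] by simp
    moreover have "B *\<^sub>v y = v" using assoc_mult_mat_vec[OF B B' vc] BB' vc by (simp add: y_def)
    moreover have "B * Dg phi * B' *\<^sub>v v = B *\<^sub>v (Dg phi *\<^sub>v y)"
      using B B' Dg[of phi] vc y by (simp add: assoc_mult_mat_vec[of _ d d _ d] y_def)
    ultimately show "B * Dg phi * B' *\<^sub>v v = phi w \<cdot>\<^sub>v v" by simp
  qed
qed

section \<open>Kronecker products\<close>

lemma sum_div_mod:
  fixes f :: "nat \<Rightarrow> nat \<Rightarrow> 'a::comm_monoid_add"
  shows "(\<Sum>k = 0..<m * n. f (k div n) (k mod n)) = (\<Sum>i = 0..<m. \<Sum>j = 0..<n. f i j)"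
proof -
  have "(\<Sum>k = 0..<m * n. f (k div n) (k mod n)) =
      (\<Sum>i<m. sum (\<lambda>k. f (k div n) (k mod n)) {i * n..<i * n + n})"
    by (simp add: sum.nat_group atLeast0LessThan)
  also have "\<dots> = (\<Sum>i<m. \<Sum>j = 0..<n. f i j)"
  proof (rule sum.cong[OF refl])
    fix i
    have "sum (\<lambda>k. f (k div n) (k mod n)) {i * n..<i * n + n} =
        (\<Sum>j = 0..<n. f ((j + i * n) div n) ((j + i * n) mod n))"
      using sum.shift_bounds_nat_ivl[of "\<lambda>k. f (k div n) (k mod n)" 0 "i * n" n]
      by (simp add: add.commute)
    also have "\<dots> = (\<Sum>j = 0..<n. f i j)"
      by (intro sum.cong) auto
    finally show "sum (\<lambda>k. f (k div n) (k mod n)) {i * n..<i * n + n} = (\<Sum>j = 0..<n. f i j)" .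
  qed
  finally show ?thesis by (simp add: atLeast0LessThan)
qed

lemma div_mod_less:
  fixes k m n :: nat
  assumes "k < m * n"
  shows "k div n < m" "k mod n < n" "0 < n"
  using assms by (cases "n = 0"; simp add: less_mult_imp_div_less)+

lemma index_less:
  fixes i j m n :: nat
  assumes "i < m" "j < n"
  shows "i * n + j < m * n"
proof -
  have "i * n + j < (i + 1) * n" using assms by simp
  also have "\<dots> \<le> m * n" using assms by (intro mult_right_mono) auto
  finally show ?thesis .
qed

text \<open>The index arithmetic behind the strict associativity of \<open>kron\<close> and
  \<open>kron_vec\<close>.\<close>

lemma div_mod_assoc:
  fixes i p r :: nat
  shows "i div r div p = i div (p * r)"
    and "0 < r \<Longrightarrow> i div r mod p = i mod (p * r) div r"
    and "i mod (p * r) mod r = i mod r"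
proof -
  have *: "i mod (p * r) = r * (i div r mod p) + i mod r" by (metis mod_mult2_eq mult.commute)
  show "i div r div p = i div (p * r)" by (metis div_mult2_eq mult.commute)
  show "0 < r \<Longrightarrow> i div r mod p = i mod (p * r) div r" unfolding * by simp
  show "i mod (p * r) mod r = i mod r" unfolding * by simp
qed

lemma kron_carrier[simp]:
  "A \<in> carrier_mat a b \<Longrightarrow> B \<in> carrier_mat c d \<Longrightarrow> kron A B \<in> carrier_mat (a * c) (b * d)"
  by (auto simp: kron_def)

lemma kron_vec_carrier[simp]:
  "x \<in> carrier_vec m \<Longrightarrow> y \<in> carrier_vec n \<Longrightarrow> kron_vec x y \<in> carrier_vec (m * n)"
  by (auto simp: kron_vec_def)

lemma dim_kron[simp]:
  "dim_row (kron A B) = dim_row A * dim_row B" "dim_col (kron A B) = dim_col A * dim_col B"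
  "dim_vec (kron_vec x y) = dim_vec x * dim_vec y"
  by (auto simp: kron_def kron_vec_def)

lemma index_kron_mult_vec:
  assumes "A \<in> carrier_mat a b" "B \<in> carrier_mat c d" "z \<in> carrier_vec (b * d)" "k < a * c"
  shows "(kron A B *\<^sub>v z) $ k =
    (\<Sum>i = 0..<b. \<Sum>j = 0..<d. A $$ (k div c, i) * B $$ (k mod c, j) * z $ (i * d + j))"
proof -
  have "(kron A B *\<^sub>v z) $ k =
      (\<Sum>l = 0..<b * d. A $$ (k div c, l div d) * B $$ (k mod c, l mod d) * z $ (l div d * d + l mod d))"
    using assms by (auto simp: kron_def scalar_prod_def intro!: sum.cong)
  then show ?thesis
    by (simp only: sum_div_mod[of "\<lambda>i j. A $$ (k div c, i) * B $$ (k mod c, j) * z $ (i * d + j)"])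
qed

lemma index_kron_vec:
  assumes "x \<in> carrier_vec m" "y \<in> carrier_vec n" "i < m" "j < n"
  shows "kron_vec x y $ (i * n + j) = x $ i * y $ j"
proof -
  have "i * n + j < m * n" using assms(3,4) by (rule index_less)
  then show ?thesis using assms by (simp add: kron_vec_def)
qed

lemma kron_mult_kron_vec:
  fixes A B :: "'k::field mat"
  assumes "A \<in> carrier_mat a b" "B \<in> carrier_mat c d" "x \<in> carrier_vec b" "y \<in> carrier_vec d"
  shows "kron A B *\<^sub>v kron_vec x y = kron_vec (A *\<^sub>v x) (B *\<^sub>v y)"
proof (rule eq_vecI)
  fix k assume "k < dim_vec (kron_vec (A *\<^sub>v x) (B *\<^sub>v y))"
  then have k: "k < a * c" using assms by simp
  note dm = div_mod_less[OF k]
  have "(kron A B *\<^sub>v kron_vec x y) $ k =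
      (\<Sum>i = 0..<b. \<Sum>j = 0..<d. A $$ (k div c, i) * B $$ (k mod c, j) * (x $ i * y $ j))"
    using assms k by (subst index_kron_mult_vec[OF assms(1,2)]) (auto simp: index_kron_vec intro!: sum.cong)
  also have "\<dots> = (\<Sum>i = 0..<b. A $$ (k div c, i) * x $ i) * (\<Sum>j = 0..<d. B $$ (k mod c, j) * y $ j)"
    by (simp add: sum_product algebra_simps)
  also have "\<dots> = kron_vec (A *\<^sub>v x) (B *\<^sub>v y) $ k"
    using assms k dm by (auto simp: kron_vec_def scalar_prod_def)
  finally show "(kron A B *\<^sub>v kron_vec x y) $ k = kron_vec (A *\<^sub>v x) (B *\<^sub>v y) $ k" .
qed (use assms in auto)

lemma kron_vec_linear:
  fixes x x' y y' :: "'k::field vec"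
  shows "x \<in> carrier_vec m \<Longrightarrow> x' \<in> carrier_vec m \<Longrightarrow> y \<in> carrier_vec n \<Longrightarrow>
      kron_vec (x + x') y = kron_vec x y + kron_vec x' y"
    and "x \<in> carrier_vec m \<Longrightarrow> y \<in> carrier_vec n \<Longrightarrow> y' \<in> carrier_vec n \<Longrightarrow>
      kron_vec x (y + y') = kron_vec x y + kron_vec x y'"
    and "kron_vec (a \<cdot>\<^sub>v x) y = a \<cdot>\<^sub>v kron_vec x y"
    and "kron_vec x (a \<cdot>\<^sub>v y) = a \<cdot>\<^sub>v kron_vec x y"
    and "kron_vec (0\<^sub>v m) y = 0\<^sub>v (m * dim_vec y)"
    and "kron_vec x (0\<^sub>v n) = 0\<^sub>v (dim_vec x * n)"
proof -
  have *: "i mod c < c" if "i < a * c" for i a c :: nat using div_mod_less(2)[OF that] .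
  show "kron_vec (x + x') y = kron_vec x y + kron_vec x' y"
    if "x \<in> carrier_vec m" "x' \<in> carrier_vec m" "y \<in> carrier_vec n"
    using that by (intro eq_vecI) (auto simp: kron_vec_def div_mod_less(1) algebra_simps)
  show "kron_vec x (y + y') = kron_vec x y + kron_vec x y'"
    if "x \<in> carrier_vec m" "y \<in> carrier_vec n" "y' \<in> carrier_vec n"
    using that * by (intro eq_vecI) (auto simp: kron_vec_def *[of _ m n] algebra_simps)
  show "kron_vec (a \<cdot>\<^sub>v x) y = a \<cdot>\<^sub>v kron_vec x y" 
    by (intro eq_vecI) (auto simp: kron_vec_def div_mod_less(1))
  show "kron_vec x (a \<cdot>\<^sub>v y) = a \<cdot>\<^sub>v kron_vec x y" 
    using * by (intro eq_vecI) (auto simp: kron_vec_def *[of _ "dim_vec x" "dim_vec y"])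
  show "kron_vec (0\<^sub>v m) y = 0\<^sub>v (m * dim_vec y)"
    by (intro eq_vecI) (auto simp: kron_vec_def div_mod_less(1))
  show "kron_vec x (0\<^sub>v n) = 0\<^sub>v (dim_vec x * n)"
    using * by (intro eq_vecI) (auto simp: kron_vec_def *[of _ "dim_vec x" n])
qed

lemma unit_vec_kron:
  "k < m * n \<Longrightarrow> unit_vec (m * n) k = kron_vec (unit_vec m (k div n)) (unit_vec n (k mod n) :: 'k::field vec)"
  by (rule eq_vecI)
    (auto simp: kron_vec_def unit_vec_def div_mod_less, metis div_mult_mod_eq)

text \<open>By bilinearity, membership in the span passes from generators to all vectors, one factor
  at a time. This suffices because the unit vectors of the product space are pure tensors.\<close>

lemma spans_kron_vec:
  fixes S T :: "'k::field vec set"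
  assumes S: "spans m S" and T: "spans n T"
  shows "spans (m * n) {kron_vec x y | x y. x \<in> S \<and> y \<in> T}" (is "spans _ ?U")
proof -
  have SC: "S \<subseteq> carrier_vec m" and TC: "T \<subseteq> carrier_vec n" using S T by (auto simp: spans_def)
  have step1: "kron_vec x y \<in> lin (m * n) ?U" if x: "x \<in> S" and y: "y \<in> carrier_vec n" for x y
    using T y
  proof (rule spans_induct)
    show "kron_vec x (0\<^sub>v n) \<in> lin (m * n) ?U"
      using x SC lin.zero[of "m * n" ?U] by (auto simp: kron_vec_linear(6))
    show "kron_vec x (y + y') \<in> lin (m * n) ?U"
      if "y \<in> carrier_vec n" "y' \<in> carrier_vec n" "kron_vec x y \<in> lin (m * n) ?U"
        "kron_vec x y' \<in> lin (m * n) ?U" for y y'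
      using that x SC by (subst kron_vec_linear(2)[of _ m _ n]) (auto intro: lin.add)
  qed (use x in \<open>auto simp: kron_vec_linear(4) intro: lin.smult lin.base\<close>)
  have step2: "kron_vec x y \<in> lin (m * n) ?U" if x: "x \<in> carrier_vec m" and y: "y \<in> carrier_vec n" for x y
    using S x
  proof (rule spans_induct)
    show "kron_vec (0\<^sub>v m) y \<in> lin (m * n) ?U"
      using y lin.zero[of "m * n" ?U] by (auto simp: kron_vec_linear(5))
    show "kron_vec (x + x') y \<in> lin (m * n) ?U"
      if "x \<in> carrier_vec m" "x' \<in> carrier_vec m" "kron_vec x y \<in> lin (m * n) ?U"
        "kron_vec x' y \<in> lin (m * n) ?U" for x x'
      using that y by (subst kron_vec_linear(1)[of _ m _ _ n]) (auto intro: lin.add)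
  qed (use y in \<open>auto simp: kron_vec_linear(3) intro: lin.smult step1\<close>)
  have "{unit_vec (m * n) k :: 'k vec | k. k < m * n} \<subseteq> lin (m * n) ?U"
    using step2 by (auto simp: unit_vec_kron)
  moreover have "?U \<subseteq> carrier_vec (m * n)"
    using SC TC by (auto intro: kron_vec_carrier)
  ultimately show ?thesis using spans_lin[OF spans_units] by blast
qed

text \<open>Operators on tensor products are compared below on pure tensors of conveniently chosen
  vectors, mostly weight vectors.\<close>

lemma mat_eqI_kron:
  fixes A B :: "'k::field mat"
  assumes "A \<in> carrier_mat a (m * n)" "B \<in> carrier_mat a (m * n)" "spans m S" "spans n T"
    and "\<And>x y. x \<in> S \<Longrightarrow> y \<in> T \<Longrightarrow> x \<in> carrier_vec m \<Longrightarrow> y \<in> carrier_vec n \<Longrightarrow>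
      A *\<^sub>v kron_vec x y = B *\<^sub>v kron_vec x y"
  shows "A = B"
proof (rule mat_eqI_spans[OF assms(1,2) spans_kron_vec[OF assms(3,4)]])
  fix z assume "z \<in> {kron_vec x y | x y. x \<in> S \<and> y \<in> T}"
  then obtain x y where "z = kron_vec x y" "x \<in> S" "y \<in> T" by auto
  then show "A *\<^sub>v z = B *\<^sub>v z" using assms(3-5) unfolding spans_def by blast
qed

lemma kron_mult:
  fixes A B C D :: "'k::field mat"
  assumes A: "A \<in> carrier_mat a b" and C: "C \<in> carrier_mat b c"
    and B: "B \<in> carrier_mat a' b'" and D: "D \<in> carrier_mat b' c'"
  shows "kron A B * kron C D = kron (A * C) (B * D)"
proof (rule mat_eqI_kron[OF _ _ spans_carrier spans_carrier])
  fix x y :: "'k vec" assume xy: "x \<in> carrier_vec c" "y \<in> carrier_vec c'"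
  have "kron A B * kron C D *\<^sub>v kron_vec x y = kron A B *\<^sub>v kron_vec (C *\<^sub>v x) (D *\<^sub>v y)"
    using A B C D xy by (simp add: assoc_mult_mat_vec[of _ "a * a'" "b * b'" _ "c * c'"] kron_mult_kron_vec)
  also have "\<dots> = kron_vec (A * C *\<^sub>v x) (B * D *\<^sub>v y)"
    using A B C D xy by (simp add: kron_mult_kron_vec[OF A B])
  also have "\<dots> = kron (A * C) (B * D) *\<^sub>v kron_vec x y"
    using A B C D xy by (subst kron_mult_kron_vec[of _ a c _ a' c']) auto
  finally show "kron A B * kron C D *\<^sub>v kron_vec x y = kron (A * C) (B * D) *\<^sub>v kron_vec x y" .
qed (use assms in auto)

lemma kron_one: "kron (1\<^sub>m m) (1\<^sub>m n) = (1\<^sub>m (m * n) :: 'k::field mat)"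
  by (rule mat_eqI_kron[OF _ _ spans_carrier spans_carrier])
    (auto simp: kron_mult_kron_vec[of _ m m _ n n])

lemma kron_one_one: "kron (1\<^sub>m 1) A = A" "kron A (1\<^sub>m 1) = (A :: 'k::field mat)"
  by (auto simp: kron_def)

lemma kron_vec_one: "kron_vec (vec 1 (\<lambda>_. 1)) x = x" "kron_vec x (vec 1 (\<lambda>_. 1)) = (x :: 'k::field vec)"
  by (auto simp: kron_vec_def)

lemma kron_assoc:
  fixes A B C :: "'k::field mat"
  shows "kron (kron A B) C = kron A (kron B C)"
proof (rule eq_matI)
  fix i j
  assume ij: "i < dim_row (kron A (kron B C))" "j < dim_col (kron A (kron B C))"
  let ?p = "dim_row B" and ?q = "dim_col B" and ?r = "dim_row C" and ?s = "dim_col C"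
  have i: "i < dim_row A * (?p * ?r)" and j: "j < dim_col A * (?q * ?s)"
    using ij by auto
  then have i': "i < (dim_row A * ?p) * ?r" and j': "j < (dim_col A * ?q) * ?s"
    by (auto simp: mult.assoc)
  note 1 = div_mod_less[OF i] div_mod_less[OF j] div_mod_less[OF i'] div_mod_less[OF j']
  note 2 = 1 div_mod_less[OF 1(2)] div_mod_less[OF 1(5)] div_mod_less[OF 1(7)] div_mod_less[OF 1(10)]
  note e = div_mod_assoc[where ?i = i and ?p = ?p and ?r = ?r] div_mod_assoc[where ?i = j and ?p = ?q and ?r = ?s]
  have "kron (kron A B) C $$ (i, j) = A $$ (i div ?r div ?p, j div ?s div ?q) *
      B $$ (i div ?r mod ?p, j div ?s mod ?q) * C $$ (i mod ?r, j mod ?s)"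
    using 2 i' j' by (simp add: kron_def)
  moreover have "kron A (kron B C) $$ (i, j) = A $$ (i div (?p * ?r), j div (?q * ?s)) *
      (B $$ (i mod (?p * ?r) div ?r, j mod (?q * ?s) div ?s) * C $$ (i mod (?p * ?r) mod ?r, j mod (?q * ?s) mod ?s))"
    using 2 i j unfolding kron_def by simp
  ultimately show "kron (kron A B) C $$ (i, j) = kron A (kron B C) $$ (i, j)"
    using 1(9,12) by (simp only: e mult.assoc)
qed (auto simp: mult.assoc)

lemma kron_vec_assoc:
  fixes x y z :: "'k::field vec"
  shows "kron_vec (kron_vec x y) z = kron_vec x (kron_vec y z)"
proof (rule eq_vecI)
  fix i assume "i < dim_vec (kron_vec x (kron_vec y z))"
  then have i: "i < dim_vec x * (dim_vec y * dim_vec z)" by simp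
  then have i': "i < (dim_vec x * dim_vec y) * dim_vec z" by (auto simp: mult.assoc)
  note 1 = div_mod_less[OF i] div_mod_less[OF i']
  note 2 = 1 div_mod_less[OF 1(2)] div_mod_less[OF 1(4)]
  note e = div_mod_assoc[where ?i = i and ?p = "dim_vec y" and ?r = "dim_vec z"]
  have "kron_vec (kron_vec x y) z $ i = x $ (i div dim_vec z div dim_vec y) *
      y $ (i div dim_vec z mod dim_vec y) * z $ (i mod dim_vec z)"
    using 2 i' by (simp add: kron_vec_def)
  moreover have "kron_vec x (kron_vec y z) $ i = x $ (i div (dim_vec y * dim_vec z)) *
      (y $ (i mod (dim_vec y * dim_vec z) div dim_vec z) * z $ (i mod (dim_vec y * dim_vec z) mod dim_vec z))"
    using 2 i by (simp add: kron_vec_def)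
  ultimately show "kron_vec (kron_vec x y) z $ i = kron_vec x (kron_vec y z) $ i"
    using 1(6) by (simp only: e mult.assoc)
qed (auto simp: mult.assoc)

lemma kron_linear:
  fixes A A' B B' :: "'k::field mat"
  shows "A \<in> carrier_mat a b \<Longrightarrow> A' \<in> carrier_mat a b \<Longrightarrow> B \<in> carrier_mat c d \<Longrightarrow>
      kron (A + A') B = kron A B + kron A' B"
    and "A \<in> carrier_mat a b \<Longrightarrow> B \<in> carrier_mat c d \<Longrightarrow> B' \<in> carrier_mat c d \<Longrightarrow>
      kron A (B + B') = kron A B + kron A B'"
    and "kron (r \<cdot>\<^sub>m A) B = r \<cdot>\<^sub>m kron A B"
    and "kron A (r \<cdot>\<^sub>m B) = r \<cdot>\<^sub>m kron A B"
proof -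
  have *: "i mod c < c" if "i < a * c" for i a c :: nat using div_mod_less(2)[OF that] .
  show "A \<in> carrier_mat a b \<Longrightarrow> A' \<in> carrier_mat a b \<Longrightarrow> B \<in> carrier_mat c d \<Longrightarrow>
      kron (A + A') B = kron A B + kron A' B"
    by (rule eq_matI) (auto simp: kron_def algebra_simps div_mod_less(1))
  show "kron A (B + B') = kron A B + kron A B'"
    if A: "A \<in> carrier_mat a b" and B: "B \<in> carrier_mat c d" "B' \<in> carrier_mat c d"
  proof (rule eq_matI)
    fix i j assume "i < dim_row (kron A B + kron A B')" "j < dim_col (kron A B + kron A B')"
    then have ij: "i < a * c" "j < b * d" using A B by auto
    show "kron A (B + B') $$ (i, j) = (kron A B + kron A B') $$ (i, j)"
      using ij *[OF ij(1)] *[OF ij(2)] A B by (simp add: kron_def algebra_simps)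
  qed (use A B in auto)
  show "kron (r \<cdot>\<^sub>m A) B = r \<cdot>\<^sub>m kron A B"
    by (rule eq_matI) (auto simp: kron_def div_mod_less(1))
  show "kron A (r \<cdot>\<^sub>m B) = r \<cdot>\<^sub>m kron A B"
  proof (rule eq_matI)
    fix i j assume "i < dim_row (r \<cdot>\<^sub>m kron A B)" "j < dim_col (r \<cdot>\<^sub>m kron A B)"
    then have ij: "i < dim_row A * dim_row B" "j < dim_col A * dim_col B" by auto
    show "kron A (r \<cdot>\<^sub>m B) $$ (i, j) = (r \<cdot>\<^sub>m kron A B) $$ (i, j)"
      using ij *[OF ij(1)] *[OF ij(2)] by (simp add: kron_def)
  qed auto
qed

section \<open>Flips and the canonical invariant\<close>

lemma flip_mat_carrier[simp]: "flip_mat m n \<in> carrier_mat (n * m) (m * n)"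
  by (auto simp: flip_mat_def)

lemma flip_mat_kron_vec:
  fixes x y :: "'k::field vec"
  assumes x: "x \<in> carrier_vec m" and y: "y \<in> carrier_vec n"
  shows "flip_mat m n *\<^sub>v kron_vec x y = kron_vec y x"
proof (rule eq_vecI)
  fix r assume "r < dim_vec (kron_vec y x)"
  then have r: "r < n * m" using x y by simp
  note dm = div_mod_less[OF r]
  have "(flip_mat m n *\<^sub>v kron_vec x y) $ r =
      (\<Sum>c = 0..<m * n. (if r = (c mod n) * m + c div n then 1 else 0) * (x $ (c div n) * y $ (c mod n)))"
    using r x y by (auto simp: flip_mat_def kron_vec_def scalar_prod_def intro!: sum.cong)
  also have "\<dots> = (\<Sum>i = 0..<m. \<Sum>j = 0..<n. (if r = j * m + i then 1 else 0) * (x $ i * y $ j))"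
    by (rule sum_div_mod)
  \<comment> \<open>The flat index r determines i and j by division with remainder by m, so exactly
    one summand survives.\<close>
  also have "\<dots> = (\<Sum>i = 0..<m. \<Sum>j = 0..<n. if i = r mod m \<and> j = r div m then x $ i * y $ j else 0)"
    by (intro sum.cong refl) auto
  also have "\<dots> = (\<Sum>i = 0..<m. if i = r mod m then x $ i * y $ (r div m) else 0)"
    using dm by (intro sum.cong refl) (auto simp: sum.delta if_distrib cong: if_cong)
  also have "\<dots> = x $ (r mod m) * y $ (r div m)" using dm by simp
  finally show "(flip_mat m n *\<^sub>v kron_vec x y) $ r = kron_vec y x $ r"
    using r x y by (simp add: kron_vec_def mult.commute)
qed (use x y in \<open>auto simp: flip_mat_def\<close>)

lemma flip_mat_flip: "flip_mat n m * flip_mat m n = (1\<^sub>m (m * n) :: 'k::field mat)"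
proof (rule mat_eqI_kron[OF _ _ spans_carrier spans_carrier])
  fix x y :: "'k vec" assume "x \<in> carrier_vec m" "y \<in> carrier_vec n"
  then show "flip_mat n m * flip_mat m n *\<^sub>v kron_vec x y = 1\<^sub>m (m * n) *\<^sub>v kron_vec x y"
    by (subst assoc_mult_mat_vec[of _ "m * n" "n * m" _ "m * n"]) (auto simp: flip_mat_kron_vec)
qed (auto intro: mult_carrier_mat[of _ "m * n" "n * m"])

text \<open>The canonical invariant of the tensor product of a dual space with the space itself.\<close>

definition coev :: "nat \<Rightarrow> 'k::field vec" where
  "coev d = vec (d * d) (\<lambda>k. if k div d = k mod d then 1 else 0)"

lemma coev_carrier[simp]: "coev d \<in> carrier_vec (d * d)"
  by (simp add: coev_def)

lemma index_coev: "i < d \<Longrightarrow> j < d \<Longrightarrow> coev d $ (i * d + j) = (if i = j then 1 else 0)"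
proof -
  assume ij: "i < d" "j < d"
  then have "i * d + j < d * d" by (rule index_less)
  then show ?thesis using ij by (simp add: coev_def)
qed

text \<open>The coordinates of this vector are the entries of A, so A can be recovered from its
  effect on the canonical invariant.\<close>

lemma index_kron_one_coev:
  assumes A: "A \<in> carrier_mat d d" and k: "k < d * d"
  shows "(kron (1\<^sub>m d) A *\<^sub>v coev d) $ k = A $$ (k mod d, k div d)"
proof -
  note dm = div_mod_less[OF k]
  have "(kron (1\<^sub>m d) A *\<^sub>v coev d) $ k =
      (\<Sum>i = 0..<d. \<Sum>j = 0..<d. if i = k div d \<and> j = k div d then A $$ (k mod d, j) else 0)"
    using k dm A by (subst index_kron_mult_vec[of _ d d _ d d])
      (auto simp: index_coev intro!: sum.cong)
  also have "\<dots> = (\<Sum>i = 0..<d. if i = k div d then A $$ (k mod d, k div d) else 0)"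
    using dm by (intro sum.cong refl) auto
  finally show ?thesis using dm by simp
qed

text \<open>Operators on the dual leg slide to the other leg by transposition; all computations with
  the dual module rest on this.\<close>

lemma kron_transpose_coev:
  assumes A: "A \<in> carrier_mat d d"
  shows "kron (transpose_mat A) (1\<^sub>m d) *\<^sub>v coev d = kron (1\<^sub>m d) A *\<^sub>v coev d"
proof (rule eq_vecI)
  fix k assume "k < dim_vec (kron (1\<^sub>m d) A *\<^sub>v coev d)"
  then have k: "k < d * d" using A by simp
  note dm = div_mod_less[OF k]
  have "(kron (transpose_mat A) (1\<^sub>m d) *\<^sub>v coev d) $ k =
      (\<Sum>i = 0..<d. \<Sum>j = 0..<d. if i = k mod d \<and> j = k mod d then A $$ (k mod d, k div d) else 0)"
    using k dm A by (subst index_kron_mult_vec[of _ d d _ d d])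
      (auto simp: index_coev intro!: sum.cong)
  also have "\<dots> = (\<Sum>i = 0..<d. if i = k mod d then A $$ (k mod d, k div d) else 0)"
    using dm by (intro sum.cong refl) auto
  finally show "(kron (transpose_mat A) (1\<^sub>m d) *\<^sub>v coev d) $ k = (kron (1\<^sub>m d) A *\<^sub>v coev d) $ k"
    using dm k index_kron_one_coev[OF A k] by simp
qed (use A in auto)

lemma kron_one_coev_inj:
  assumes A: "A \<in> carrier_mat d d" and B: "B \<in> carrier_mat d d"
    and eq: "kron (1\<^sub>m d) A *\<^sub>v coev d = kron (1\<^sub>m d) B *\<^sub>v coev d"
  shows "A = B"
proof (rule eq_matI)
  fix i j assume "i < dim_row B" "j < dim_col B"
  then have ij: "i < d" "j < d" using B by auto
  then have k: "j * d + i < d * d" by (simp add: index_less)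
  show "A $$ (i, j) = B $$ (i, j)"
    using index_kron_one_coev[OF A k] index_kron_one_coev[OF B k] eq ij by simp
qed (use A B in auto)

section \<open>Weights and weight modules\<close>

locale qdatum =
  fixes Q :: "('i::finite, 'k::field_char_0) quantum_datum"
  assumes is_quantum_datum: "is_quantum_datum Q"
begin

section \<open>Powers of q\<close>

abbreviation q :: "rat \<Rightarrow> 'k" where "q \<equiv> qp Q"

abbreviation sy :: "'i \<Rightarrow> rat" where "sy i \<equiv> of_nat (symm Q i)"

abbreviation root_form :: "'i \<Rightarrow> ('i \<Rightarrow> rat) \<Rightarrow> rat" where
  "root_form i l \<equiv> form Q (simple_root i) l"

lemma q_zero[simp]: "q 0 = 1" and q_add: "q (x + y) = q x * q y"
  and q_transcendental: "\<not> algebraic (q 1)"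
  using is_quantum_datum by (auto simp: is_quantum_datum_def rational_powers_def)

lemma q_minus_mult[simp]: "q (- x) * q x = 1" "q x * q (- x) = 1"
  using q_add[of "- x" x] q_add[of x "- x"] by auto

lemma q_nonzero[simp]: "q x \<noteq> 0"
  using q_minus_mult[of x] by (metis mult_zero_right zero_neq_one)

lemma q_minus: "q (- x) = inverse (q x)"
  using q_minus_mult[of x] by (metis inverse_unique mult.commute)

lemma q_diff: "q (x - y) = q x * q (- y)"
  using q_add[of x "- y"] by simp

lemma q_of_nat_mult: "q (of_nat n * x) = q x ^ n"
  by (induction n) (auto simp: q_add algebra_simps)

text \<open>For x = a/b with a nonzero, q(x) = 1 would give q(1) to the power |a| equal to 1, so
  q(1) would be a root of the integer polynomial \<open>monom 1 n - 1\<close> with n = |a|.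
  Consequently an exponent is determined by its power of q, without which replacing eigenvalues by
  their powers would make no sense.\<close>

lemma q_eq_one_iff[simp]: "q x = 1 \<longleftrightarrow> x = 0"
proof
  assume x: "q x = 1"
  show "x = 0"
  proof (rule ccontr)
    assume "x \<noteq> 0"
    have pow: "q 1 ^ n \<noteq> 1" if "n > 0" for n :: nat
    proof
      assume 1: "q 1 ^ n = 1"
      define p :: "'k poly" where "p = monom 1 n - 1"
      have "coeff p n = 1" using that by (simp add: p_def)
      then have "p \<noteq> 0" by auto
      moreover have "coeff p i \<in> \<int>" for i by (auto simp: p_def coeff_1)
      moreover have "poly p (q 1) = 0" using 1 by (simp add: p_def poly_monom)
      ultimately show False using q_transcendental unfolding algebraic_def by blast
    qed
    obtain a b where ab: "quotient_of x = (a, b)" by fastforce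
    then have b: "b > 0" and x_ab: "x = of_int a / of_int b"
      using quotient_of_denom_pos quotient_of_div by auto
    have a: "a \<noteq> 0" using \<open>x \<noteq> 0\<close> x_ab by auto
    have "q (of_nat (nat b) * x) = 1" using x by (simp add: q_of_nat_mult)
    then have qa: "q (of_int a) = 1" using b x_ab by (simp add: field_simps)
    have "q (of_nat (nat \<bar>a\<bar>)) = 1"
    proof (cases "a > 0")
      case True then show ?thesis using qa by simp
    next
      case False
      then have "(of_nat (nat \<bar>a\<bar>) :: rat) = - of_int a" by simp
      then show ?thesis using qa q_minus[of "of_int a"] by simp
    qed
    then show False using pow[of "nat \<bar>a\<bar>"] a q_of_nat_mult[of "nat \<bar>a\<bar>" 1] by simp
  qed
qed simp

lemma q_inject[simp]: "q x = q y \<longleftrightarrow> x = y"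
proof
  assume "q x = q y"
  then have "q (x - y) = 1" by (simp add: q_diff)
  then show "x = y" by simp
qed simp

section \<open>The invariant form, weights and Casimir exponents\<close>

lemma cartan_diag: "cartan Q i i = 2"
  and cartan_off_diag: "i \<noteq> j \<Longrightarrow> cartan Q i j \<le> 0"
  and symm_pos: "symm Q i > 0"
  and cartan_symm: "int (symm Q i) * cartan Q i j = int (symm Q j) * cartan Q j i"
  and form_pos: "x \<noteq> (\<lambda>_. 0) \<Longrightarrow> form Q x x > 0"
  using is_quantum_datum by (auto simp: is_quantum_datum_def finite_type_def)

lemma q_sy[simp]: "q (sy i) - q (- sy i) \<noteq> 0"
  using symm_pos[of i] by simp

lemma sum_simple_root:
  fixes i :: 'i
  shows "(\<Sum>j\<in>UNIV. simple_root i j * f j) = f i"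
proof -
  have "(\<Sum>j\<in>UNIV. simple_root i j * f j) = (\<Sum>j\<in>UNIV. if j = i then f j else 0)"
    by (rule sum.cong) (auto simp: simple_root_def)
  then show ?thesis by simp
qed

lemma root_form_eq: "root_form i l = sy i * coroot_pairing Q l i"
proof -
  have "root_form i l = (\<Sum>j\<in>UNIV. simple_root i j * (\<Sum>k\<in>UNIV. sy j * of_int (cartan Q j k) * l k))"
    by (simp add: form_def sum_distrib_left mult.assoc)
  also have "\<dots> = (\<Sum>k\<in>UNIV. sy i * of_int (cartan Q i k) * l k)"
    by (rule sum_simple_root)
  finally show ?thesis by (simp add: coroot_pairing_def sum_distrib_left mult.assoc)
qed

lemma form_eq_sum: "form Q x y = (\<Sum>i\<in>UNIV. x i * root_form i y)"
  unfolding root_form_eq unfolding form_def coroot_pairing_def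
  by (simp add: sum_distrib_left mult.assoc)

lemma form_sym: "form Q x y = form Q y x"
proof -
  have "(of_int (int (symm Q i) * cartan Q i j) :: rat) = of_int (int (symm Q j) * cartan Q j i)" for i j
    using cartan_symm by simp
  then have *: "sy i * of_int (cartan Q i j) = sy j * of_int (cartan Q j i)" for i j by simp
  have "form Q x y = (\<Sum>j\<in>UNIV. \<Sum>i\<in>UNIV. x i * (sy i * of_int (cartan Q i j)) * y j)"
    unfolding form_def by (subst sum.swap) (simp add: mult.assoc)
  also have "\<dots> = form Q y x"
    unfolding form_def *[of _ ] by (intro sum.cong refl) (simp add: *[of _ ] ac_simps)
  finally show ?thesis .
qed

lemma form_add[simp]: "form Q (x + x') y = form Q x y + form Q x' y" "form Q x (y + y') = form Q x y + form Q x y'"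
proof -
  show *: "form Q (x + x') y = form Q x y + form Q x' y" for x x' y
    by (simp add: form_def algebra_simps sum.distrib)
  show "form Q x (y + y') = form Q x y + form Q x y'"
    using *[of y y' x] by (simp add: form_sym[of x])
qed

lemma form_minus[simp]: "form Q (- x) y = - form Q x y" "form Q x (- y) = - form Q x y"
proof -
  show *: "form Q (- x) y = - form Q x y" for x y
    by (simp add: form_def sum_negf)
  show "form Q x (- y) = - form Q x y"
    using *[of y x] by (simp add: form_sym[of x])
qed

lemma form_diff[simp]: "form Q (x - x') y = form Q x y - form Q x' y" "form Q x (y - y') = form Q x y - form Q x y'"
  using form_add(1)[of x "- x'" y] form_add(2)[of x y "- y'"] by simp_all

lemma form_zero[simp]: "form Q 0 y = 0" "form Q x 0 = 0"
  using form_add[of 0 0 y] form_add(2)[of x 0 0] by auto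

lemma coroot_pairing_simple_root: "coroot_pairing Q (simple_root j) i = of_int (cartan Q i j)"
proof -
  have "coroot_pairing Q (simple_root j) i = (\<Sum>k\<in>UNIV. simple_root j k * of_int (cartan Q i k))"
    by (simp add: coroot_pairing_def mult.commute)
  then show ?thesis by (simp add: sum_simple_root)
qed

lemma root_form_simple_root: "root_form i (simple_root j) = of_int (int (symm Q i) * cartan Q i j)"
  by (simp add: root_form_eq coroot_pairing_simple_root)

lemma root_form_self[simp]: "root_form i (simple_root i) = 2 * sy i"
  by (simp add: root_form_simple_root cartan_diag)

lemma coroot_pairing_add[simp]: "coroot_pairing Q (x + y) i = coroot_pairing Q x i + coroot_pairing Q y i"
  and coroot_pairing_minus[simp]: "coroot_pairing Q (- x) i = - coroot_pairing Q x i"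
  by (simp_all add: coroot_pairing_def algebra_simps sum.distrib sum_negf)

lemma weights_add[simp]: "x \<in> weights Q \<Longrightarrow> y \<in> weights Q \<Longrightarrow> x + y \<in> weights Q"
  and weights_minus[simp]: "x \<in> weights Q \<Longrightarrow> - x \<in> weights Q"
  by (auto simp: weights_def)

lemma weights_diff[simp]: "x \<in> weights Q \<Longrightarrow> y \<in> weights Q \<Longrightarrow> x - y \<in> weights Q"
  using weights_add[of x "- y"] by simp

lemma weights_zero[simp]: "0 \<in> weights Q"
  by (auto simp: weights_def coroot_pairing_def)

lemma weights_simple_root[simp]: "simple_root i \<in> weights Q"
  by (auto simp: weights_def coroot_pairing_simple_root)

definition weight_char :: "('i \<Rightarrow> rat) \<Rightarrow> 'i \<Rightarrow> 'k" where
  "weight_char l = (\<lambda>i. q (root_form i l))"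

text \<open>An element of the rational root space that is orthogonal to all simple roots vanishes,
  as the form is positive definite. So the action of the K_i determines the weight.\<close>

lemma inj_weight_char: "inj_on weight_char A"
proof (rule inj_onI)
  fix l m assume "weight_char l = weight_char m"
  then have "root_form i l = root_form i m" for i by (simp add: weight_char_def fun_eq_iff)
  then have "form Q (l - m) (l - m) = 0"
    by (subst form_eq_sum) simp
  then have "l - m = (\<lambda>_. 0)" using form_pos[of "l - m"] by fastforce
  then show "l = m" by (simp add: fun_eq_iff)
qed

text \<open>The value on the weight l of the function \<open>(l, l + 2\<rho>)\<close>, where \<open>2(l, \<rho>)\<close> is computed from
  \<open>(\<alpha>\<^sub>i, 2\<rho>) = (\<alpha>\<^sub>i, \<alpha>\<^sub>i)\<close>.\<close>

definition cas :: "('i \<Rightarrow> rat) \<Rightarrow> rat" where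
  "cas l = form Q l l + 2 * (\<Sum>i\<in>UNIV. l i * sy i)"

lemma cas_add: "cas (l + m) = cas l + cas m + 2 * form Q l m"
  by (simp add: cas_def form_sym[of m l] algebra_simps sum.distrib)

lemma cas_simple_root: "cas (simple_root i) = 4 * sy i"
  by (simp add: cas_def sum_simple_root)

lemma cas_minus_simple_root: "cas (- simple_root i) = 0"
  by (simp add: cas_def sum_negf sum_simple_root)

text \<open>With 2 rho as in the definition of \<open>cas\<close>, the difference is (l - m, l + m +
  2 rho). Here l - m is a nonzero combination of simple roots with nonnegative coefficients, and
  each simple root pairs positively with l + m + 2 rho. This separates Casimir eigenvalues in the
  proof of complete reducibility.\<close>

lemma cas_less:
  assumes "\<And>i. coroot_pairing Q l i \<ge> 0" "\<And>i. coroot_pairing Q m i \<ge> 0"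
    and "\<And>i. l i \<ge> m i" "l \<noteq> m"
  shows "cas m < cas l"
proof -
  have "cas l - cas m = form Q (l - m) (l + m) + 2 * (\<Sum>i\<in>UNIV. (l - m) i * sy i)"
    by (simp add: cas_def form_sym[of m l] algebra_simps sum_subtractf)
  also have "\<dots> = (\<Sum>i\<in>UNIV. (l - m) i * (root_form i l + root_form i m + 2 * sy i))"
    by (subst form_eq_sum) (simp add: algebra_simps sum.distrib sum_distrib_left sum_subtractf)
  also have "\<dots> > 0"
  proof -
    have pos: "root_form i l + root_form i m + 2 * sy i > 0" for i
      using assms(1,2)[of i] symm_pos[of i] by (simp add: root_form_eq add_nonneg_pos)
    obtain j where "l j \<noteq> m j" using assms(4) by auto
    then have "(l - m) j > 0" using assms(3)[of j] by simp
    then show ?thesis using pos less_imp_le[OF pos] assms(3)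
      by (intro sum_pos2[of _ j]) auto
  qed
  finally show ?thesis by simp
qed

text \<open>The q-integer, in the variable q to the power \<open>symm Q i\<close>, of the pairing of
  l with the i-th coroot: the scalar by which the commutator of E_i and F_i acts on weight
  l.\<close>

definition qbr :: "'i \<Rightarrow> ('i \<Rightarrow> rat) \<Rightarrow> 'k" where
  "qbr i l = (q (root_form i l) - q (- root_form i l)) / (q (sy i) - q (- sy i))"

definition qrel :: "('i, 'k) qmodule \<Rightarrow> bool" where
  "qrel M \<longleftrightarrow>
     (\<forall>i. actE M i \<in> carrier_mat (mdim M) (mdim M) \<and> actF M i \<in> carrier_mat (mdim M) (mdim M) \<and>
          actK M i \<in> carrier_mat (mdim M) (mdim M) \<and> actKi M i \<in> carrier_mat (mdim M) (mdim M)) \<and>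
     (\<forall>i. actK M i * actKi M i = 1\<^sub>m (mdim M) \<and> actKi M i * actK M i = 1\<^sub>m (mdim M)) \<and>
     (\<forall>i j. actK M i * actK M j = actK M j * actK M i) \<and>
     (\<forall>i j. actK M i * actE M j * actKi M i =
        q (of_int (int (symm Q i) * cartan Q i j)) \<cdot>\<^sub>m actE M j) \<and>
     (\<forall>i j. actK M i * actF M j * actKi M i =
        q (- of_int (int (symm Q i) * cartan Q i j)) \<cdot>\<^sub>m actF M j) \<and>
     (\<forall>i j. actE M i * actF M j - actF M j * actE M i =
        (if i = j
         then (1 / (q (sy i) - q (- sy i))) \<cdot>\<^sub>m (actK M i - actKi M i)
         else 0\<^sub>m (mdim M) (mdim M)))"

lemma is_module_iff:
  "is_module Q M \<longleftrightarrow> qrel M \<and> q_serre Q (mdim M) (actE M) \<and> q_serre Q (mdim M) (actF M)"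
  unfolding is_module_def qrel_def by blast

text \<open>The modules satisfying all the relations except possibly the q-Serre relations, which will
  turn out to hold automatically.\<close>

definition weight_module :: "('i, 'k) qmodule \<Rightarrow> bool" where
  "weight_module M \<longleftrightarrow> qrel M \<and> spans (mdim M) (\<Union>l\<in>weights Q. weight_space Q M l)"

lemma weight_space_eq: "weight_space Q M l = joint_eigenspace (mdim M) (actK M) (weight_char l)"
  by (auto simp: weight_space_def joint_eigenspace_def weight_char_def)

lemma type1_iff:
  "type1_module Q M \<longleftrightarrow> weight_module M \<and> q_serre Q (mdim M) (actE M) \<and> q_serre Q (mdim M) (actF M)"
proof -
  have "(\<Union>l\<in>weights Q. weight_space Q M l) \<subseteq> carrier_vec (mdim M)"
    by (auto simp: weight_space_def)
  from spans_iff_span[OF this] show ?thesis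
    by (auto simp: type1_module_def weight_module_def is_module_iff)
qed

lemma wt_carrier: "x \<in> weight_space Q M l \<Longrightarrow> x \<in> carrier_vec (mdim M)"
  by (auto simp: weight_space_def)

text \<open>All relations are identities between operators and so can be tested on spanning weight
  vectors. There the relations with K turn into the statement that E and F shift weights. The
  spanning set is left free: for tensor products it consists of pure tensors.\<close>

lemma weight_moduleI:
  assumes carr: "\<And>i. actE M i \<in> carrier_mat (mdim M) (mdim M)" "\<And>i. actF M i \<in> carrier_mat (mdim M) (mdim M)"
      "\<And>i. actK M i \<in> carrier_mat (mdim M) (mdim M)" "\<And>i. actKi M i \<in> carrier_mat (mdim M) (mdim M)"
    and S: "spans (mdim M) S"
    and rel: "\<And>x. x \<in> S \<Longrightarrow> \<exists>l\<in>weights Q. x \<in> weight_space Q M l \<and>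
      (\<forall>i. actKi M i *\<^sub>v x = q (- root_form i l) \<cdot>\<^sub>v x \<and>
        actE M i *\<^sub>v x \<in> weight_space Q M (l + simple_root i) \<and>
        actF M i *\<^sub>v x \<in> weight_space Q M (l - simple_root i) \<and>
        (\<forall>j. actE M i *\<^sub>v (actF M j *\<^sub>v x) =
          actF M j *\<^sub>v (actE M i *\<^sub>v x) + (if i = j then qbr i l else 0) \<cdot>\<^sub>v x))"
  shows "weight_module M"
proof -
  let ?d = "mdim M"
  have SC: "x \<in> carrier_vec ?d" if "x \<in> S" for x using S that by (auto simp: spans_def)
  note assoc = assoc_mult_mat_vec[of _ ?d ?d _ ?d] and scal = mult_mat_vec[of _ ?d ?d]
  have eqI: "A = B" if "A \<in> carrier_mat ?d ?d" "B \<in> carrier_mat ?d ?d"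
    "\<And>x l. x \<in> S \<Longrightarrow> x \<in> carrier_vec ?d \<Longrightarrow> x \<in> weight_space Q M l \<Longrightarrow>
      (\<forall>i. actKi M i *\<^sub>v x = q (- root_form i l) \<cdot>\<^sub>v x \<and>
        actE M i *\<^sub>v x \<in> weight_space Q M (l + simple_root i) \<and>
        actF M i *\<^sub>v x \<in> weight_space Q M (l - simple_root i) \<and>
        (\<forall>j. actE M i *\<^sub>v (actF M j *\<^sub>v x) =
          actF M j *\<^sub>v (actE M i *\<^sub>v x) + (if i = j then qbr i l else 0) \<cdot>\<^sub>v x)) \<Longrightarrow>
      A *\<^sub>v x = B *\<^sub>v x" for A B :: "'k mat"
  proof (rule mat_eqI_spans[OF that(1,2) S])
    fix x assume x: "x \<in> S"
    then show "A *\<^sub>v x = B *\<^sub>v x" using rel[OF x] that(3)[OF x SC[OF x]] by blast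
  qed
  have K: "actK M i *\<^sub>v x = q (root_form i l) \<cdot>\<^sub>v x" if "x \<in> weight_space Q M l" for i x l
    using that by (auto simp: weight_space_def)
  have 1: "actK M i * actKi M i = 1\<^sub>m ?d" for i
    by (rule eqI) (auto simp: carr assoc scal K smult_smult_assoc)
  have 2: "actKi M i * actK M i = 1\<^sub>m ?d" for i
    by (rule eqI) (auto simp: carr assoc scal K smult_smult_assoc)
  have 3: "actK M i * actK M j = actK M j * actK M i" for i j
    by (rule eqI) (auto simp: carr assoc scal K smult_smult_assoc mult.commute)
  have 4: "actK M i * actE M j * actKi M i = q (of_int (int (symm Q i) * cartan Q i j)) \<cdot>\<^sub>m actE M j" for i j
  proof (rule eqI)
    fix x l assume x: "x \<in> carrier_vec ?d" and h: "\<forall>i. actKi M i *\<^sub>v x = q (- root_form i l) \<cdot>\<^sub>v x \<and>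
        actE M i *\<^sub>v x \<in> weight_space Q M (l + simple_root i) \<and>
        actF M i *\<^sub>v x \<in> weight_space Q M (l - simple_root i) \<and>
        (\<forall>j. actE M i *\<^sub>v (actF M j *\<^sub>v x) =
          actF M j *\<^sub>v (actE M i *\<^sub>v x) + (if i = j then qbr i l else 0) \<cdot>\<^sub>v x)"
    have "actK M i * actE M j * actKi M i *\<^sub>v x = actK M i *\<^sub>v (actE M j *\<^sub>v (actKi M i *\<^sub>v x))"
      using carr x by (simp add: assoc)
    also have "\<dots> = (q (- root_form i l) * q (root_form i (l + simple_root j))) \<cdot>\<^sub>v (actE M j *\<^sub>v x)"
    proof -
      have "actE M j *\<^sub>v x \<in> weight_space Q M (l + simple_root j)" using h by blast
      from K[OF this, of i] show ?thesis using h carr x by (simp add: scal smult_smult_assoc)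
    qed
    also have "\<dots> = q (of_int (int (symm Q i) * cartan Q i j)) \<cdot>\<^sub>v (actE M j *\<^sub>v x)"
      by (simp add: q_add[symmetric] root_form_simple_root)
    finally show "actK M i * actE M j * actKi M i *\<^sub>v x =
        q (of_int (int (symm Q i) * cartan Q i j)) \<cdot>\<^sub>m actE M j *\<^sub>v x"
      using carr x by (simp add: smult_mat_vec[of _ ?d ?d])
  qed (simp_all add: carr)
  have 5: "actK M i * actF M j * actKi M i = q (- of_int (int (symm Q i) * cartan Q i j)) \<cdot>\<^sub>m actF M j" for i j
  proof (rule eqI)
    fix x l assume x: "x \<in> carrier_vec ?d" and h: "\<forall>i. actKi M i *\<^sub>v x = q (- root_form i l) \<cdot>\<^sub>v x \<and>
        actE M i *\<^sub>v x \<in> weight_space Q M (l + simple_root i) \<and>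
        actF M i *\<^sub>v x \<in> weight_space Q M (l - simple_root i) \<and>
        (\<forall>j. actE M i *\<^sub>v (actF M j *\<^sub>v x) =
          actF M j *\<^sub>v (actE M i *\<^sub>v x) + (if i = j then qbr i l else 0) \<cdot>\<^sub>v x)"
    have "actK M i * actF M j * actKi M i *\<^sub>v x = actK M i *\<^sub>v (actF M j *\<^sub>v (actKi M i *\<^sub>v x))"
      using carr x by (simp add: assoc)
    also have "\<dots> = (q (- root_form i l) * q (root_form i (l - simple_root j))) \<cdot>\<^sub>v (actF M j *\<^sub>v x)"
    proof -
      have "actF M j *\<^sub>v x \<in> weight_space Q M (l - simple_root j)" using h by blast
      from K[OF this, of i] show ?thesis using h carr x by (simp add: scal smult_smult_assoc)
    qed
    also have "\<dots> = q (- of_int (int (symm Q i) * cartan Q i j)) \<cdot>\<^sub>v (actF M j *\<^sub>v x)"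
      by (simp add: q_add[symmetric] root_form_simple_root)
    finally show "actK M i * actF M j * actKi M i *\<^sub>v x =
        q (- of_int (int (symm Q i) * cartan Q i j)) \<cdot>\<^sub>m actF M j *\<^sub>v x"
      using carr x by (simp add: smult_mat_vec[of _ ?d ?d])
  qed (simp_all add: carr)
  have 6: "actE M i * actF M j - actF M j * actE M i =
        (if i = j then (1 / (q (sy i) - q (- sy i))) \<cdot>\<^sub>m (actK M i - actKi M i)
         else 0\<^sub>m ?d ?d)" for i j
  proof (rule eqI)
    fix x l assume x: "x \<in> carrier_vec ?d" "x \<in> weight_space Q M l" and
      h: "\<forall>i. actKi M i *\<^sub>v x = q (- root_form i l) \<cdot>\<^sub>v x \<and>
        actE M i *\<^sub>v x \<in> weight_space Q M (l + simple_root i) \<and>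
        actF M i *\<^sub>v x \<in> weight_space Q M (l - simple_root i) \<and>
        (\<forall>j. actE M i *\<^sub>v (actF M j *\<^sub>v x) =
          actF M j *\<^sub>v (actE M i *\<^sub>v x) + (if i = j then qbr i l else 0) \<cdot>\<^sub>v x)"
    define y where "y = actF M j *\<^sub>v (actE M i *\<^sub>v x)"
    have y: "y \<in> carrier_vec ?d"
      using carr x by (simp add: y_def mult_mat_vec_carrier[of _ ?d ?d])
    have "(actE M i * actF M j - actF M j * actE M i) *\<^sub>v x =
        actE M i *\<^sub>v (actF M j *\<^sub>v x) - y"
      using carr x by (simp add: minus_mult_distrib_mat_vec[of _ ?d ?d] assoc y_def)
    also have "\<dots> = (if i = j then qbr i l else 0) \<cdot>\<^sub>v x"
      using h x y by (auto simp: y_def[symmetric])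
    also have "\<dots> = (if i = j then (1 / (q (sy i) - q (- sy i))) \<cdot>\<^sub>m (actK M i - actKi M i)
         else 0\<^sub>m ?d ?d) *\<^sub>v x"
    proof (cases "i = j")
      case True
      have "actK M i - actKi M i \<in> carrier_mat ?d ?d" using carr by (simp add: minus_carrier_mat)
      then have "(1 / (q (sy i) - q (- sy i))) \<cdot>\<^sub>m (actK M i - actKi M i) *\<^sub>v x =
          (1 / (q (sy i) - q (- sy i))) \<cdot>\<^sub>v (actK M i *\<^sub>v x - actKi M i *\<^sub>v x)"
        using x by (simp add: smult_mat_vec[of _ ?d ?d] minus_mult_distrib_mat_vec[OF carr(3,4)])
      also have "\<dots> = qbr i l \<cdot>\<^sub>v x"
        using h K[OF x(2)] x by (auto simp: qbr_def diff_divide_distrib left_diff_distrib intro!: eq_vecI)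
      finally show ?thesis using True by simp
    qed (use x in \<open>auto intro!: eq_vecI\<close>)
    finally show "(actE M i * actF M j - actF M j * actE M i) *\<^sub>v x =
      (if i = j then (1 / (q (sy i) - q (- sy i))) \<cdot>\<^sub>m (actK M i - actKi M i)
         else 0\<^sub>m ?d ?d) *\<^sub>v x" .
  qed (use carr in \<open>auto simp: minus_carrier_mat\<close>)
  have "spans ?d (\<Union>l\<in>weights Q. weight_space Q M l)"
    using S rel by (elim spans_mono) (auto simp: wt_carrier, blast)
  then show ?thesis
    unfolding weight_module_def qrel_def using carr 1 2 3 4 5 6 by blast
qed

end

section \<open>Linear combinations of matrices and words of generators\<close>

lemma mat_lincomb_carrier[simp]: "mat_lincomb d c X S \<in> carrier_mat d d"
  by (simp add: mat_lincomb_def)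

lemma index_mat_lincomb:
  "i < d \<Longrightarrow> j < d \<Longrightarrow> mat_lincomb d c X S $$ (i, j) = (\<Sum>s\<in>S. c s * X s $$ (i, j))"
  by (simp add: mat_lincomb_def)

lemma mat_lincomb_cong:
  assumes "\<And>s. s \<in> S \<Longrightarrow> X s = Y s"
  shows "mat_lincomb d c X S = mat_lincomb d c Y S"
  using assms by (auto simp: mat_lincomb_def intro!: eq_matI sum.cong)

lemma mult_mat_lincomb:
  fixes A :: "'k::field mat"
  assumes A: "A \<in> carrier_mat d d" and X: "\<And>s. s \<in> S \<Longrightarrow> X s \<in> carrier_mat d d"
  shows "A * mat_lincomb d c X S = mat_lincomb d c (\<lambda>s. A * X s) S"
    and "mat_lincomb d c X S * A = mat_lincomb d c (\<lambda>s. X s * A) S"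
proof -
  show "A * mat_lincomb d c X S = mat_lincomb d c (\<lambda>s. A * X s) S"
  proof (rule eq_matI)
    fix i j assume "i < dim_row (mat_lincomb d c (\<lambda>s. A * X s) S)" "j < dim_col (mat_lincomb d c (\<lambda>s. A * X s) S)"
    then have ij: "i < d" "j < d" by (auto simp: mat_lincomb_def)
    have "(A * mat_lincomb d c X S) $$ (i, j) = (\<Sum>k = 0..<d. \<Sum>s\<in>S. A $$ (i, k) * (c s * X s $$ (k, j)))"
      using ij A by (auto simp: scalar_prod_def mat_lincomb_def sum_distrib_left intro!: sum.cong)
    also have "\<dots> = (\<Sum>s\<in>S. c s * (\<Sum>k = 0..<d. A $$ (i, k) * X s $$ (k, j)))"
      by (subst sum.swap) (simp add: sum_distrib_left algebra_simps)
    also have "\<dots> = (\<Sum>s\<in>S. c s * (A * X s) $$ (i, j))"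
    proof (rule sum.cong[OF refl])
      fix s assume "s \<in> S"
      then have "X s \<in> carrier_mat d d" by (rule X)
      then show "c s * (\<Sum>k = 0..<d. A $$ (i, k) * X s $$ (k, j)) = c s * (A * X s) $$ (i, j)"
        using ij A by (auto simp: scalar_prod_def)
    qed
    finally show "(A * mat_lincomb d c X S) $$ (i, j) = mat_lincomb d c (\<lambda>s. A * X s) S $$ (i, j)"
      using ij by (simp add: mat_lincomb_def)
  qed (use A in \<open>auto simp: mat_lincomb_def\<close>)
  show "mat_lincomb d c X S * A = mat_lincomb d c (\<lambda>s. X s * A) S"
  proof (rule eq_matI)
    fix i j assume "i < dim_row (mat_lincomb d c (\<lambda>s. X s * A) S)" "j < dim_col (mat_lincomb d c (\<lambda>s. X s * A) S)"
    then have ij: "i < d" "j < d" by (auto simp: mat_lincomb_def)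
    have "(mat_lincomb d c X S * A) $$ (i, j) = (\<Sum>k = 0..<d. \<Sum>s\<in>S. c s * X s $$ (i, k) * A $$ (k, j))"
      using ij A by (auto simp: scalar_prod_def mat_lincomb_def sum_distrib_right intro!: sum.cong)
    also have "\<dots> = (\<Sum>s\<in>S. c s * (\<Sum>k = 0..<d. X s $$ (i, k) * A $$ (k, j)))"
      by (subst sum.swap) (simp add: sum_distrib_left algebra_simps)
    also have "\<dots> = (\<Sum>s\<in>S. c s * (X s * A) $$ (i, j))"
    proof (rule sum.cong[OF refl])
      fix s assume "s \<in> S"
      then have "X s \<in> carrier_mat d d" by (rule X)
      then show "c s * (\<Sum>k = 0..<d. X s $$ (i, k) * A $$ (k, j)) = c s * (X s * A) $$ (i, j)"
        using ij A by (auto simp: scalar_prod_def)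
    qed
    finally show "(mat_lincomb d c X S * A) $$ (i, j) = mat_lincomb d c (\<lambda>s. X s * A) S $$ (i, j)"
      using ij by (simp add: mat_lincomb_def)
  qed (use A in \<open>auto simp: mat_lincomb_def\<close>)
qed

lemma index_mat_lincomb_mult_vec:
  fixes x :: "'k::field vec"
  assumes X: "\<And>s. s \<in> S \<Longrightarrow> X s \<in> carrier_mat d d" and x: "x \<in> carrier_vec d" and i: "i < d"
  shows "(mat_lincomb d c X S *\<^sub>v x) $ i = (\<Sum>s\<in>S. c s * (X s *\<^sub>v x) $ i)"
proof -
  have "(mat_lincomb d c X S *\<^sub>v x) $ i = (\<Sum>k = 0..<d. \<Sum>s\<in>S. c s * X s $$ (i, k) * x $ k)"
    using i x by (auto simp: scalar_prod_def mat_lincomb_def sum_distrib_right intro!: sum.cong)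
  also have "\<dots> = (\<Sum>s\<in>S. c s * (\<Sum>k = 0..<d. X s $$ (i, k) * x $ k))"
    by (subst sum.swap) (simp add: sum_distrib_left algebra_simps)
  also have "\<dots> = (\<Sum>s\<in>S. c s * (X s *\<^sub>v x) $ i)"
  proof (rule sum.cong[OF refl])
    fix s assume "s \<in> S"
    then have "X s \<in> carrier_mat d d" by (rule X)
    then show "c s * (\<Sum>k = 0..<d. X s $$ (i, k) * x $ k) = c s * (X s *\<^sub>v x) $ i"
      using i x by (auto simp: scalar_prod_def)
  qed
  finally show ?thesis .
qed

lemma mat_lincomb_mult_vec_cong:
  fixes x :: "'k::field vec"
  assumes "\<And>s. s \<in> S \<Longrightarrow> X s \<in> carrier_mat d d" "\<And>s. s \<in> S \<Longrightarrow> Y s \<in> carrier_mat d d"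
    "x \<in> carrier_vec d" "y \<in> carrier_vec d" "\<And>s. s \<in> S \<Longrightarrow> X s *\<^sub>v x = Y s *\<^sub>v y"
  shows "mat_lincomb d c X S *\<^sub>v x = mat_lincomb d c Y S *\<^sub>v y"
proof (rule eq_vecI)
  fix i assume "i < dim_vec (mat_lincomb d c Y S *\<^sub>v y)"
  then have i: "i < d" by (simp add: mat_lincomb_def)
  show "(mat_lincomb d c X S *\<^sub>v x) $ i = (mat_lincomb d c Y S *\<^sub>v y) $ i"
    using index_mat_lincomb_mult_vec[OF assms(1,3) i, where ?c = c] index_mat_lincomb_mult_vec[OF assms(2,4) i, where ?c = c]
      sum.cong[of S S "\<lambda>s. c s * (X s *\<^sub>v x) $ i" "\<lambda>s. c s * (Y s *\<^sub>v y) $ i"] assms(5)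
    by simp
qed (simp add: mat_lincomb_def)

section \<open>Words of generators acting on weight vectors\<close>

lemma word_act_Nil[simp]: "word_act d X [] = 1\<^sub>m d"
  and word_act_Cons[simp]: "word_act d X (i # u) = X i * word_act d X u"
  by (simp_all add: word_act_def mat_product_def)

lemma word_act_carrier[simp]:
  "(\<And>i. X i \<in> carrier_mat d d) \<Longrightarrow> word_act d X u \<in> carrier_mat d d"
  by (induction u) auto

lemma word_act_append:
  assumes "\<And>i. X i \<in> carrier_mat d d"
  shows "word_act d X (u @ w) = word_act d X u * word_act d X w"
proof (induction u)
  case Nil
  have "word_act d X w \<in> carrier_mat d d" using assms by simp
  then show ?case by simp
next
  case (Cons i u)
  have c: "word_act d X v \<in> carrier_mat d d" for v using assms by simp
  show ?case using Cons assoc_mult_mat[OF assms c c, of i u w] by simp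
qed

lemma word_act_replicate:
  assumes "\<And>i. X i \<in> carrier_mat d d"
  shows "word_act d X (replicate n i) = X i ^\<^sub>m n"
proof (induction n)
  case 0
  then show ?case using assms[of i] by simp
next
  case (Suc n)
  have "word_act d X (replicate (Suc n) i) = word_act d X (replicate n i @ [i])"
    by (simp add: replicate_append_same)
  then show ?case using Suc assms right_mult_one_mat[OF assms] by (simp add: word_act_append[OF assms])
qed

definition root_sum :: "'i list \<Rightarrow> 'i \<Rightarrow> rat" where
  "root_sum u = sum_list (map simple_root u)"

lemma root_sum_simps[simp]: "root_sum [] = 0" "root_sum (i # u) = simple_root i + root_sum u"
  by (simp_all add: root_sum_def)

lemma root_sum_mset: "mset u = mset w \<Longrightarrow> root_sum u = root_sum w"
  unfolding root_sum_def by (metis mset_map sum_mset_sum_list)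

context qdatum
begin

lemma weight_module_carrier[simp]:
  assumes "weight_module M"
  shows "actE M i \<in> carrier_mat (mdim M) (mdim M)" "actF M i \<in> carrier_mat (mdim M) (mdim M)"
    "actK M i \<in> carrier_mat (mdim M) (mdim M)" "actKi M i \<in> carrier_mat (mdim M) (mdim M)"
  using assms by (auto simp: weight_module_def qrel_def)

lemma weight_module_rel:
  assumes "weight_module M"
  shows "actK M i * actKi M i = 1\<^sub>m (mdim M)" "actKi M i * actK M i = 1\<^sub>m (mdim M)"
    "actK M i * actE M j * actKi M i = q (of_int (int (symm Q i) * cartan Q i j)) \<cdot>\<^sub>m actE M j"
    "actK M i * actF M j * actKi M i = q (- of_int (int (symm Q i) * cartan Q i j)) \<cdot>\<^sub>m actF M j"
    "actE M i * actF M j - actF M j * actE M i =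
        (if i = j then (1 / (q (sy i) - q (- sy i))) \<cdot>\<^sub>m (actK M i - actKi M i)
         else 0\<^sub>m (mdim M) (mdim M))"
  using assms unfolding weight_module_def qrel_def by blast+

lemma weight_space_smult[simp]:
  assumes "weight_module M" "x \<in> weight_space Q M l"
  shows "a \<cdot>\<^sub>v x \<in> weight_space Q M l"
  using assms by (auto simp: weight_space_def mult_mat_vec[of _ "mdim M" "mdim M"] smult_smult_assoc mult.commute)

lemma weight_space_add[simp]:
  assumes "weight_module M" "x \<in> weight_space Q M l" "y \<in> weight_space Q M l"
  shows "x + y \<in> weight_space Q M l"
  using assms by (auto simp: weight_space_def mult_add_distrib_mat_vec[of _ "mdim M" "mdim M"] smult_add_distrib_vec[of _ "mdim M"])

lemma weight_space_zero[simp]: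
  assumes "weight_module M"
  shows "0\<^sub>v (mdim M) \<in> weight_space Q M l"
  using assms by (auto simp: weight_space_def)

lemma spans_weight_spaces:
  "weight_module M \<Longrightarrow> spans (mdim M) (\<Union>l\<in>weights Q. weight_space Q M l)"
  by (simp add: weight_module_def)

lemma weight_module_eqI:
  assumes "weight_module M" "A \<in> carrier_mat n (mdim M)" "B \<in> carrier_mat n (mdim M)"
    "\<And>l x. l \<in> weights Q \<Longrightarrow> x \<in> weight_space Q M l \<Longrightarrow> A *\<^sub>v x = B *\<^sub>v x"
  shows "A = B"
  by (rule mat_eqI_spans[OF assms(2,3) spans_weight_spaces[OF assms(1)]]) (use assms(4) in blast)

lemma K_weight: "x \<in> weight_space Q M l \<Longrightarrow> actK M i *\<^sub>v x = q (root_form i l) \<cdot>\<^sub>v x"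
  by (simp add: weight_space_def)

lemma Ki_weight:
  assumes M: "weight_module M" and x: "x \<in> weight_space Q M l"
  shows "actKi M i *\<^sub>v x = q (- root_form i l) \<cdot>\<^sub>v x"
proof -
  let ?d = "mdim M"
  have xc: "x \<in> carrier_vec ?d" using x by (rule wt_carrier)
  have "actKi M i *\<^sub>v (actK M i *\<^sub>v x) = x"
    using M xc assoc_mult_mat_vec[of "actKi M i" ?d ?d "actK M i" ?d x]
    by (simp add: weight_module_rel)
  then have "q (root_form i l) \<cdot>\<^sub>v (actKi M i *\<^sub>v x) = x"
    using M xc by (simp add: K_weight[OF x] mult_mat_vec[of _ ?d ?d])
  then have "q (- root_form i l) \<cdot>\<^sub>v (q (root_form i l) \<cdot>\<^sub>v (actKi M i *\<^sub>v x)) = q (- root_form i l) \<cdot>\<^sub>v x"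
    by simp
  then show ?thesis by (simp add: smult_smult_assoc)
qed

lemma K_conj_imp_commute:
  assumes M: "weight_module M" and A: "A \<in> carrier_mat (mdim M) (mdim M)"
    and eq: "actK M i * A * actKi M i = a \<cdot>\<^sub>m A"
  shows "actK M i * A = a \<cdot>\<^sub>m (A * actK M i)"
proof -
  let ?d = "mdim M"
  have c: "actK M i \<in> carrier_mat ?d ?d" "actKi M i \<in> carrier_mat ?d ?d" "actKi M i * actK M i = 1\<^sub>m ?d"
    using M by (simp_all add: weight_module_rel)
  have "actK M i * A = (actK M i * A) * (actKi M i * actK M i)"
    using c A by simp
  also have "\<dots> = (actK M i * A * actKi M i) * actK M i"
    using c A assoc_mult_mat[of "actK M i * A" ?d ?d "actKi M i" ?d "actK M i" ?d] by simp
  also have "\<dots> = a \<cdot>\<^sub>m (A * actK M i)"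
    using c A by (simp add: eq mult_smult_assoc_mat[of _ ?d ?d])
  finally show ?thesis .
qed

lemma E_weight:
  assumes M: "weight_module M" and x: "x \<in> weight_space Q M l"
  shows "actE M i *\<^sub>v x \<in> weight_space Q M (l + simple_root i)"
proof -
  let ?d = "mdim M"
  have xc: "x \<in> carrier_vec ?d" using x by (rule wt_carrier)
  have "actK M j *\<^sub>v (actE M i *\<^sub>v x) = q (root_form j (l + simple_root i)) \<cdot>\<^sub>v (actE M i *\<^sub>v x)" for j
  proof -
    have "actK M j * actE M i = q (of_int (int (symm Q j) * cartan Q j i)) \<cdot>\<^sub>m (actE M i * actK M j)"
      using M by (intro K_conj_imp_commute) (simp_all add: weight_module_rel del: of_int_mult)
    then have "actK M j *\<^sub>v (actE M i *\<^sub>v x) = q (root_form j (simple_root i)) \<cdot>\<^sub>v (actE M i *\<^sub>v (actK M j *\<^sub>v x))"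
      using M xc assoc_mult_mat_vec[of "actK M j" ?d ?d "actE M i" ?d x]
        assoc_mult_mat_vec[of "actE M i" ?d ?d "actK M j" ?d x]
      by (simp add: smult_mat_vec[of _ ?d ?d] root_form_simple_root)
    then show ?thesis
      using M xc by (simp add: K_weight[OF x] mult_mat_vec[of _ ?d ?d] smult_smult_assoc q_add mult.commute)
  qed
  then show ?thesis using M xc by (simp add: weight_space_def)
qed

lemma F_weight:
  assumes M: "weight_module M" and x: "x \<in> weight_space Q M l"
  shows "actF M i *\<^sub>v x \<in> weight_space Q M (l - simple_root i)"
proof -
  let ?d = "mdim M"
  have xc: "x \<in> carrier_vec ?d" using x by (rule wt_carrier)
  have "actK M j *\<^sub>v (actF M i *\<^sub>v x) = q (root_form j (l - simple_root i)) \<cdot>\<^sub>v (actF M i *\<^sub>v x)" for j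
  proof -
    have "actK M j * actF M i = q (- of_int (int (symm Q j) * cartan Q j i)) \<cdot>\<^sub>m (actF M i * actK M j)"
      using M by (intro K_conj_imp_commute) (simp_all add: weight_module_rel del: of_int_mult)
    then have "actK M j *\<^sub>v (actF M i *\<^sub>v x) = q (- root_form j (simple_root i)) \<cdot>\<^sub>v (actF M i *\<^sub>v (actK M j *\<^sub>v x))"
      using M xc assoc_mult_mat_vec[of "actK M j" ?d ?d "actF M i" ?d x]
        assoc_mult_mat_vec[of "actF M i" ?d ?d "actK M j" ?d x]
      by (simp add: smult_mat_vec[of _ ?d ?d] root_form_simple_root)
    then show ?thesis
      using M xc by (simp add: K_weight[OF x] mult_mat_vec[of _ ?d ?d] smult_smult_assoc q_diff mult.commute)
  qed
  then show ?thesis using M xc by (simp add: weight_space_def)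
qed

lemma EF_weight:
  assumes M: "weight_module M" and x: "x \<in> weight_space Q M l"
  shows "actE M i *\<^sub>v (actF M j *\<^sub>v x) = actF M j *\<^sub>v (actE M i *\<^sub>v x) + (if i = j then qbr i l else 0) \<cdot>\<^sub>v x"
proof -
  let ?d = "mdim M"
  have xc: "x \<in> carrier_vec ?d" using x by (rule wt_carrier)
  have "(actE M i * actF M j - actF M j * actE M i) *\<^sub>v x = (if i = j then qbr i l else 0) \<cdot>\<^sub>v x"
  proof (cases "i = j")
    case True
    have "actK M i - actKi M i \<in> carrier_mat ?d ?d" using M by (simp add: minus_carrier_mat)
    then have "(1 / (q (sy i) - q (- sy i))) \<cdot>\<^sub>m (actK M i - actKi M i) *\<^sub>v x =
        (1 / (q (sy i) - q (- sy i))) \<cdot>\<^sub>v (actK M i *\<^sub>v x - actKi M i *\<^sub>v x)"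
      using xc M by (simp add: smult_mat_vec[of _ ?d ?d] minus_mult_distrib_mat_vec[of _ ?d ?d])
    also have "\<dots> = qbr i l \<cdot>\<^sub>v x"
      using xc by (auto simp: K_weight[OF x] Ki_weight[OF M x] qbr_def diff_divide_distrib left_diff_distrib intro!: eq_vecI)
    finally show ?thesis using M True by (simp add: weight_module_rel)
  next
    case False
    then have "actE M i * actF M j - actF M j * actE M i = 0\<^sub>m ?d ?d"
      using M by (simp add: weight_module_rel)
    then show ?thesis using False xc by (auto intro!: eq_vecI)
  qed
  then have *: "actE M i *\<^sub>v (actF M j *\<^sub>v x) - actF M j *\<^sub>v (actE M i *\<^sub>v x) = (if i = j then qbr i l else 0) \<cdot>\<^sub>v x"
    using M xc by (simp add: minus_mult_distrib_mat_vec[of _ ?d ?d] assoc_mult_mat_vec[of _ ?d ?d _ ?d])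
  define y z where "y = actE M i *\<^sub>v (actF M j *\<^sub>v x)" and "z = actF M j *\<^sub>v (actE M i *\<^sub>v x)"
  have "y \<in> carrier_vec ?d" "z \<in> carrier_vec ?d" using M xc by (auto simp: y_def z_def)
  then have "y = z + (y - z)" by (auto intro!: eq_vecI)
  then show ?thesis using * by (simp add: y_def z_def)
qed

lemma finitely_many_weights:
  assumes M: "weight_module M"
  obtains L where "finite L" "card L \<le> mdim M" "L \<subseteq> weights Q"
    "\<And>l x. l \<in> weights Q \<Longrightarrow> x \<in> weight_space Q M l \<Longrightarrow> x \<noteq> 0\<^sub>v (mdim M) \<Longrightarrow> l \<in> L"
proof -
  have "\<exists>L. finite L \<and> card L \<le> mdim M \<and> L \<subseteq> weights Q \<and>
      (\<forall>l\<in>weights Q - L. joint_eigenspace (mdim M) (actK M) (weight_char l) \<subseteq> {0\<^sub>v (mdim M)})"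
    by (rule joint_eigenspaces(1))
      (use M inj_weight_char spans_weight_spaces[OF M] in \<open>simp_all add: weight_space_eq\<close>)
  then obtain L where L: "finite L" "card L \<le> mdim M" "L \<subseteq> weights Q"
    and *: "\<forall>l\<in>weights Q - L. weight_space Q M l \<subseteq> {0\<^sub>v (mdim M)}"
    unfolding weight_space_eq by auto
  from L show ?thesis by (rule that) (use * in blast)
qed

text \<open>On a weight module the choice is unique, as the weight vectors span. Suitable functions
  \<open>phi\<close> give the projections to weight spaces and the factor q(- cas l) of the Casimir
  operator.\<close>

definition weight_diag :: "('i, 'k) qmodule \<Rightarrow> (('i \<Rightarrow> rat) \<Rightarrow> 'k) \<Rightarrow> 'k mat" where
  "weight_diag M phi = (SOME S. S \<in> carrier_mat (mdim M) (mdim M) \<and>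
     (\<forall>l\<in>weights Q. \<forall>x\<in>weight_space Q M l. S *\<^sub>v x = phi l \<cdot>\<^sub>v x))"

lemma weight_diag:
  assumes M: "weight_module M"
  shows weight_diag_carrier[simp]: "weight_diag M phi \<in> carrier_mat (mdim M) (mdim M)"
    and weight_diag_apply: "l \<in> weights Q \<Longrightarrow> x \<in> weight_space Q M l \<Longrightarrow> weight_diag M phi *\<^sub>v x = phi l \<cdot>\<^sub>v x"
proof -
  have "\<exists>S. S \<in> carrier_mat (mdim M) (mdim M) \<and>
     (\<forall>l\<in>weights Q. \<forall>x\<in>weight_space Q M l. S *\<^sub>v x = phi l \<cdot>\<^sub>v x)"
    using joint_eigenspaces(2)[of "actK M" "mdim M" weight_char "weights Q" phi] inj_weight_char
      spans_weight_spaces[OF M] M unfolding weight_space_eq by auto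
  from someI_ex[OF this] show "weight_diag M phi \<in> carrier_mat (mdim M) (mdim M)"
    "l \<in> weights Q \<Longrightarrow> x \<in> weight_space Q M l \<Longrightarrow> weight_diag M phi *\<^sub>v x = phi l \<cdot>\<^sub>v x"
    unfolding weight_diag_def by auto
qed

lemma root_sum_weights[simp]: "root_sum u \<in> weights Q"
proof (induction u)
  case Nil
  show ?case unfolding root_sum_simps by (rule weights_zero)
next
  case (Cons i u)
  show ?case unfolding root_sum_simps by (rule weights_add[OF weights_simple_root Cons])
qed

lemma sum_root_sum:
  fixes u :: "'i list"
  shows "(\<Sum>i\<in>UNIV. root_sum u i) = of_nat (length u)"
proof (induction u)
  case (Cons j u)
  have "(\<Sum>i\<in>UNIV. simple_root j i) = (1 :: rat)" using sum_simple_root[of j "\<lambda>_. 1"] by simp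
  then show ?case using Cons by (simp add: sum.distrib)
qed simp

lemma word_act_E_weight:
  assumes M: "weight_module M" and x: "x \<in> weight_space Q M l"
  shows "word_act (mdim M) (actE M) u *\<^sub>v x \<in> weight_space Q M (l + root_sum u)"
proof (induction u)
  case Nil
  have "1\<^sub>m (mdim M) *\<^sub>v x \<in> weight_space Q M (l + root_sum [])"
    using x wt_carrier[OF x] by simp
  then show ?case by simp
next
  case (Cons i u)
  have 1: "word_act (mdim M) (actE M) (i # u) *\<^sub>v x = actE M i *\<^sub>v (word_act (mdim M) (actE M) u *\<^sub>v x)"
    using M wt_carrier[OF x] by (simp add: assoc_mult_mat_vec[of _ "mdim M" "mdim M" _ "mdim M"])
  have 2: "l + root_sum u + simple_root i = l + root_sum (i # u)" by (simp add: algebra_simps)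
  show ?case using E_weight[OF M Cons, of i] unfolding 1 2 .
qed

lemma word_act_F_weight:
  assumes M: "weight_module M" and x: "x \<in> weight_space Q M l"
  shows "word_act (mdim M) (actF M) u *\<^sub>v x \<in> weight_space Q M (l - root_sum u)"
proof (induction u)
  case Nil
  have "1\<^sub>m (mdim M) *\<^sub>v x \<in> weight_space Q M (l - root_sum [])"
    using x wt_carrier[OF x] by simp
  then show ?case by simp
next
  case (Cons i u)
  have 1: "word_act (mdim M) (actF M) (i # u) *\<^sub>v x = actF M i *\<^sub>v (word_act (mdim M) (actF M) u *\<^sub>v x)"
    using M wt_carrier[OF x] by (simp add: assoc_mult_mat_vec[of _ "mdim M" "mdim M" _ "mdim M"])
  have 2: "l - root_sum u - simple_root i = l - root_sum (i # u)" by (simp add: algebra_simps)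
  show ?case using F_weight[OF M Cons, of i] unfolding 1 2 .
qed

text \<open>If a word does not kill x, none of its suffixes does, and the suffixes produce nonzero
  vectors of pairwise distinct weights. There are one more of them than letters, but at most
  \<open>mdim M\<close> weights. The function g is addition for words in E and subtraction for words
  in F.\<close>

lemma word_act_vanish:
  assumes M: "weight_module M" and X: "\<And>i. X i \<in> carrier_mat (mdim M) (mdim M)"
    and wt: "\<And>l x u. l \<in> weights Q \<Longrightarrow> x \<in> weight_space Q M l \<Longrightarrow>
      word_act (mdim M) X u *\<^sub>v x \<in> weight_space Q M (g l (root_sum u))"
    and g: "g = (+) \<or> g = (-)"
    and u: "length u \<ge> mdim M"
  shows "word_act (mdim M) X u = 0\<^sub>m (mdim M) (mdim M)"
proof (rule weight_module_eqI[OF M, where ?n = "mdim M"])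
  let ?d = "mdim M"
  obtain L where L: "finite L" "card L \<le> ?d"
    and nz: "\<And>l x. l \<in> weights Q \<Longrightarrow> x \<in> weight_space Q M l \<Longrightarrow> x \<noteq> 0\<^sub>v ?d \<Longrightarrow> l \<in> L"
    using finitely_many_weights[OF M] by metis
  fix l x assume l: "l \<in> weights Q" and x: "x \<in> weight_space Q M l"
  have xc: "x \<in> carrier_vec ?d" using x by (rule wt_carrier)
  have "word_act ?d X u *\<^sub>v x = 0\<^sub>v ?d"
  proof (rule ccontr)
    assume non: "word_act ?d X u *\<^sub>v x \<noteq> 0\<^sub>v ?d"
    let ?w = "\<lambda>k. g l (root_sum (drop k u))"
    have c: "word_act ?d X v \<in> carrier_mat ?d ?d" for v using X by simp
    have "?w k \<in> L" for k
    proof (rule nz)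
      show "?w k \<in> weights Q" using l g by auto
      show "word_act ?d X (drop k u) *\<^sub>v x \<in> weight_space Q M (?w k)" using wt[OF l x] .
      have "word_act ?d X u *\<^sub>v x = word_act ?d X (take k u) *\<^sub>v (word_act ?d X (drop k u) *\<^sub>v x)"
        using assoc_mult_mat_vec[OF c c xc, of "take k u" "drop k u"]
        by (simp add: word_act_append[OF X, symmetric])
      then show "word_act ?d X (drop k u) *\<^sub>v x \<noteq> 0\<^sub>v ?d"
        using non square_mult_zero_vec[OF c, of "take k u"] by auto
    qed
    then have "?w ` {0..length u} \<subseteq> L" by auto
    \<comment> \<open>The coordinates of \<open>root_sum\<close> of a word add up to its length, so
      suffixes of different lengths shift the weight differently.\<close>
    moreover have "inj_on ?w {0..length u}"
    proof (rule inj_onI)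
      fix a b assume ab: "a \<in> {0..length u}" "b \<in> {0..length u}" and "?w a = ?w b"
      then have "root_sum (drop a u) = root_sum (drop b u)" using g by auto
      then have "of_nat (length (drop a u)) = (of_nat (length (drop b u)) :: rat)"
        by (metis sum_root_sum)
      then show "a = b" using ab by auto
    qed
    ultimately have "length u + 1 \<le> card L" using card_inj_on_le[of ?w "{0..length u}" L] L by simp
    then show False using L u by simp
  qed
  then show "word_act ?d X u *\<^sub>v x = 0\<^sub>m ?d ?d *\<^sub>v x" using xc by (auto intro!: eq_vecI)
qed (simp_all add: X)

lemma word_act_E_vanish:
  assumes "weight_module M" "length u \<ge> mdim M"
  shows "word_act (mdim M) (actE M) u = 0\<^sub>m (mdim M) (mdim M)"
  by (rule word_act_vanish[where ?g = "(+)"]) (use assms word_act_E_weight[OF assms(1)] in auto)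

lemma word_act_F_vanish:
  assumes "weight_module M" "length u \<ge> mdim M"
  shows "word_act (mdim M) (actF M) u = 0\<^sub>m (mdim M) (mdim M)"
  by (rule word_act_vanish[where ?g = "(-)"]) (use assms word_act_F_weight[OF assms(1)] in auto)

end

section \<open>The q-Serre relations\<close>

lemma vec_add_smult_cancel:
  fixes u w x :: "'k::field vec"
  assumes "w \<in> carrier_vec d" "x \<in> carrier_vec d" "u = w + a \<cdot>\<^sub>v x"
  shows "w = u + (- a) \<cdot>\<^sub>v x"
  using assms by (auto intro!: eq_vecI)

lemma bracket_identity:
  fixes a p D :: "'k::field"
  shows "(a * p - inverse (a * p)) / D - p * ((a - inverse a) / D) = (p - inverse p) / D * inverse a"
  by (simp add: diff_divide_distrib algebra_simps)

lemma add_fractions: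
  fixes b c f x y :: "'k::field"
  assumes "b \<noteq> 0" "c \<noteq> 0" "x \<noteq> 0" "y \<noteq> 0"
  shows "f * (r * y + t * x) / (b * x * (c * y)) = r * (f / (b * x * c)) + t * (f / (b * (c * y)))"
  using assms by (simp add: field_simps)

lemma ad_bracket_combine:
  fixes va vb vc ve vg :: "'k::field vec"
  assumes carr: "va \<in> carrier_vec d" "vb \<in> carrier_vec d" "vc \<in> carrier_vec d" "ve \<in> carrier_vec d" "vg \<in> carrier_vec d"
    and low: "b \<cdot>\<^sub>v vc - (b * p * r) \<cdot>\<^sub>v vg = b \<cdot>\<^sub>v vb" and coef: "s - p * t + y * b = y * b'"
  shows "(va + s \<cdot>\<^sub>v vb + (b * y) \<cdot>\<^sub>v vc) - p \<cdot>\<^sub>v (ve + (b * (y * r)) \<cdot>\<^sub>v vg + t \<cdot>\<^sub>v vb) =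
    (va - p \<cdot>\<^sub>v ve) + (b' * y) \<cdot>\<^sub>v vb"
proof (rule eq_vecI)
  fix k assume "k < dim_vec ((va - p \<cdot>\<^sub>v ve) + (b' * y) \<cdot>\<^sub>v vb)"
  then have k: "k < d" using carr by simp
  have low': "b * vc $ k - b * p * r * vg $ k = b * vb $ k"
    using arg_cong[OF low, of "\<lambda>v. v $ k"] k carr by simp
  have "(va $ k + s * vb $ k + b * y * vc $ k) - p * (ve $ k + b * (y * r) * vg $ k + t * vb $ k) =
      (va $ k - p * ve $ k) + (s - p * t) * vb $ k + y * (b * vc $ k - b * p * r * vg $ k)"
    by (simp add: algebra_simps)
  also have "\<dots> = (va $ k - p * ve $ k) + (s - p * t + y * b) * vb $ k"
    unfolding low' by (simp add: algebra_simps)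
  finally show "((va + s \<cdot>\<^sub>v vb + (b * y) \<cdot>\<^sub>v vc) - p \<cdot>\<^sub>v (ve + (b * (y * r)) \<cdot>\<^sub>v vg + t \<cdot>\<^sub>v vb)) $ k =
    ((va - p \<cdot>\<^sub>v ve) + (b' * y) \<cdot>\<^sub>v vb) $ k"
    using k carr unfolding coef by (simp add: ac_simps)
qed (use carr in simp)

fun ad_power :: "(nat \<Rightarrow> 'k::field) \<Rightarrow> 'k mat \<Rightarrow> 'k mat \<Rightarrow> nat \<Rightarrow> 'k mat" where
  "ad_power p E Y 0 = Y"
| "ad_power p E Y (Suc m) = E * ad_power p E Y m - p m \<cdot>\<^sub>m (ad_power p E Y m * E)"

lemma ad_power_carrier[simp]:
  "E \<in> carrier_mat d d \<Longrightarrow> Y \<in> carrier_mat d d \<Longrightarrow> ad_power p E Y m \<in> carrier_mat d d"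
  by (induction m) (auto simp: minus_carrier_mat)

lemma ad_power_Suc_mult_vec:
  assumes E: "E \<in> carrier_mat d d" and Y: "Y \<in> carrier_mat d d" and x: "x \<in> carrier_vec d"
  shows "ad_power p E Y (Suc m) *\<^sub>v x =
    E *\<^sub>v (ad_power p E Y m *\<^sub>v x) - p m \<cdot>\<^sub>v (ad_power p E Y m *\<^sub>v (E *\<^sub>v x))"
proof -
  let ?X = "ad_power p E Y m"
  have X: "?X \<in> carrier_mat d d" using E Y by simp
  have "(E * ?X - p m \<cdot>\<^sub>m (?X * E)) *\<^sub>v x = E * ?X *\<^sub>v x - (p m \<cdot>\<^sub>m (?X * E)) *\<^sub>v x"
    using E X x by (intro minus_mult_distrib_mat_vec) auto
  then show ?thesis
    using E X x by (simp add: smult_mat_vec[of _ d d] assoc_mult_mat_vec[of _ d d _ d])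
qed

text \<open>The coefficient bookkeeping for one more q-commutator: multiplying by E on the left
  keeps the summation index, multiplying on the right shifts it by one. The last assumption is a
  q-Pascal rule.\<close>

lemma sum_Pascal:
  fixes g :: "nat \<Rightarrow> 'k::field"
  assumes "c' 0 = c 0" "c' (Suc m) = - p * c m" "\<And>s. s < m \<Longrightarrow> c' (Suc s) = c (Suc s) - p * c s"
  shows "(\<Sum>s = 0..m. c s * g s) - p * (\<Sum>s = 0..m. c s * g (Suc s)) = (\<Sum>s = 0..Suc m. c' s * g s)"
proof -
  have first: "(\<Sum>s = 0..n. f s) = f 0 + (\<Sum>s = 0..<n. f (Suc s))" for f :: "nat \<Rightarrow> 'k" and n
    unfolding atLeastLessThanSuc_atLeastAtMost[symmetric] sum.atLeast0_lessThan_Suc_shift by simp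
  have "(\<Sum>s = 0..Suc m. c' s * g s) = c' 0 * g 0 + (\<Sum>s = 0..<m. c' (Suc s) * g (Suc s)) + c' (Suc m) * g (Suc m)"
    unfolding first by simp
  moreover have "(\<Sum>s = 0..m. c s * g s) = c 0 * g 0 + (\<Sum>s = 0..<m. c (Suc s) * g (Suc s))"
    by (rule first)
  moreover have "(\<Sum>s = 0..m. c s * g (Suc s)) = (\<Sum>s = 0..<m. c s * g (Suc s)) + c m * g (Suc m)"
    unfolding atLeastLessThanSuc_atLeastAtMost[symmetric] by simp
  moreover have "(\<Sum>s = 0..<m. c' (Suc s) * g (Suc s)) =
      (\<Sum>s = 0..<m. c (Suc s) * g (Suc s)) - p * (\<Sum>s = 0..<m. c s * g (Suc s))"
    using assms(3) by (simp add: sum_distrib_left sum_subtractf[symmetric] left_diff_distrib mult.assoc)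
  ultimately show ?thesis using assms by (simp add: algebra_simps)
qed

context qdatum
begin

lemma q_sy_mult_neq: "z \<noteq> 0 \<Longrightarrow> q (sy i * z) - q (- (sy i * z)) \<noteq> 0"
  using symm_pos[of i] by auto

lemma q_int_eq: "q_int Q i m = (q (sy i * of_nat m) - q (- (sy i * of_nat m))) / (q (sy i) - q (- sy i))"
  by (simp add: q_int_def)

lemma q_int_nonzero[simp]: "m > 0 \<Longrightarrow> q_int Q i m \<noteq> 0"
  using q_sy_mult_neq[of "of_nat m" i] by (simp add: q_int_eq)

lemma q_fact_nonzero[simp]: "q_fact Q i m \<noteq> 0"
  by (auto simp: q_fact_def prod_zero_iff)

lemma q_fact_simps[simp]: "q_fact Q i 0 = 1" "q_fact Q i (Suc m) = q_fact Q i m * q_int Q i (Suc m)"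
  by (simp_all add: q_fact_def)

lemma q_int_Pascal:
  assumes "s \<le> m"
  shows "q_int Q i (Suc m) = q (- sy i * of_nat (Suc s)) * q_int Q i (m - s) + q (sy i * of_nat (m - s)) * q_int Q i (Suc s)"
proof -
  have m: "(of_nat (m - s) :: rat) = of_nat m - of_nat s" using assms by (rule of_nat_diff)
  have num: "q (sy i * of_nat (Suc m)) - q (- (sy i * of_nat (Suc m))) =
      q (- sy i * of_nat (Suc s)) * (q (sy i * of_nat (m - s)) - q (- (sy i * of_nat (m - s)))) +
      q (sy i * of_nat (m - s)) * (q (sy i * of_nat (Suc s)) - q (- (sy i * of_nat (Suc s))))"
    unfolding right_diff_distrib q_add[symmetric] m by (simp add: algebra_simps)
  show ?thesis unfolding q_int_eq num by (simp add: add_divide_distrib)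
qed

lemma q_binomial_Pascal:
  assumes "s < m"
  shows "q_binomial Q i (Suc m) (Suc s) =
    q (- sy i * of_nat (Suc s)) * q_binomial Q i m (Suc s) + q (sy i * of_nat (m - s)) * q_binomial Q i m s"
proof -
  obtain r where r: "m - s = Suc r" "m - Suc s = r" using assms by (cases "m - s") auto
  have "q_binomial Q i (Suc m) (Suc s) = q_fact Q i m * q_int Q i (Suc m) /
      (q_fact Q i s * q_int Q i (Suc s) * (q_fact Q i r * q_int Q i (Suc r)))"
    using r by (simp add: q_binomial_def)
  also have "q_int Q i (Suc m) = q (- sy i * of_nat (Suc s)) * q_int Q i (Suc r) + q (sy i * of_nat (m - s)) * q_int Q i (Suc s)"
    using q_int_Pascal[of s m i] assms r by simp
  also have "q_fact Q i m * (q (- sy i * of_nat (Suc s)) * q_int Q i (Suc r) + q (sy i * of_nat (m - s)) * q_int Q i (Suc s)) /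
      (q_fact Q i s * q_int Q i (Suc s) * (q_fact Q i r * q_int Q i (Suc r))) =
    q (- sy i * of_nat (Suc s)) * (q_fact Q i m / (q_fact Q i s * q_int Q i (Suc s) * q_fact Q i r)) +
    q (sy i * of_nat (m - s)) * (q_fact Q i m / (q_fact Q i s * (q_fact Q i r * q_int Q i (Suc r))))"
    by (rule add_fractions) simp_all
  finally show ?thesis unfolding q_binomial_def r q_fact_simps .
qed

text \<open>The iterated q-commutators \<open>X\<^sub>m\<close> of \<open>E\<^sub>i\<close> with \<open>E\<^sub>j\<close> vanish for large m, as weights are bounded. The commutator of
  \<open>X\<^sub>m\<close> with \<open>F\<^sub>i\<close> is a multiple of \<open>X\<close> with index \<open>m - 1\<close>, which is nonzero for \<open>m > 1 - a\<^sub>i\<^sub>j\<close>; hence the vanishing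
  descends to \<open>m = 1 - a\<^sub>i\<^sub>j\<close>, which is the q-Serre relation.\<close>

context
  fixes M :: "('i, 'k) qmodule" and i j :: 'i
  assumes M: "weight_module M" and ij: "i \<noteq> j"
begin

text \<open>This is q to the power (alpha_i, alpha_j + m alpha_i), where alpha_j + m alpha_i is the
  weight of the m-th iterated commutator; so each step is a q-adjoint action of E_i.\<close>

definition ad_scalar :: "nat \<Rightarrow> 'k" where
  "ad_scalar m = q (sy i * (of_int (cartan Q i j) + 2 * of_nat m))"

text \<open>For m = 1 - a_ij the last power of q is 1 and what remains are the coefficients of
  \<open>q_serre\<close>.\<close>

definition ad_coeff :: "nat \<Rightarrow> nat \<Rightarrow> 'k" where
  "ad_coeff m s = (- 1) ^ s * q_binomial Q i m s * q (sy i * of_nat s * (of_int (cartan Q i j) + of_nat m - 1))"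

abbreviation ad_EE :: "nat \<Rightarrow> 'k mat" where
  "ad_EE m \<equiv> ad_power ad_scalar (actE M i) (actE M j) m"

lemma ad_EE_carrier[simp]: "ad_EE m \<in> carrier_mat (mdim M) (mdim M)"
  using M by simp

lemma ad_EE_expand:
  "ad_EE m = mat_lincomb (mdim M) (ad_coeff m) (\<lambda>s. (actE M i ^\<^sub>m (m - s)) * actE M j * (actE M i ^\<^sub>m s)) {0..m}"
proof (induction m)
  case 0
  let ?d = "mdim M"
  have E: "actE M k \<in> carrier_mat ?d ?d" for k using M by simp
  have c: "actE M i ^\<^sub>m 0 * actE M j * (actE M i ^\<^sub>m 0) = actE M j"
    using left_mult_one_mat[OF E] right_mult_one_mat[OF E] carrier_matD(1)[OF E] by simp
  have "mat_lincomb ?d (ad_coeff 0) (\<lambda>s. (actE M i ^\<^sub>m (0 - s)) * actE M j * (actE M i ^\<^sub>m s)) {0..0} = actE M j"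
  proof (rule eq_matI)
    fix a b assume "a < dim_row (actE M j)" "b < dim_col (actE M j)"
    then have "a < ?d" "b < ?d" using E[of j] by auto
    then show "mat_lincomb ?d (ad_coeff 0) (\<lambda>s. (actE M i ^\<^sub>m (0 - s)) * actE M j * (actE M i ^\<^sub>m s)) {0..0} $$ (a, b) =
        actE M j $$ (a, b)"
      by (simp add: index_mat_lincomb c ad_coeff_def q_binomial_def del: pow_mat.simps)
  qed (use E[of j] in \<open>simp_all add: mat_lincomb_def\<close>)
  then show ?case by simp
next
  case (Suc m)
  let ?d = "mdim M"
  let ?E = "actE M i" and ?Y = "actE M j"
  have E: "?E \<in> carrier_mat ?d ?d" and Y: "?Y \<in> carrier_mat ?d ?d" using M by auto
  have pow: "?E ^\<^sub>m n \<in> carrier_mat ?d ?d" for n using E by simp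
  have comm: "?E * ?E ^\<^sub>m n = ?E ^\<^sub>m Suc n" for n
    using word_act_replicate[of "\<lambda>_. ?E" ?d "Suc n" i] word_act_replicate[of "\<lambda>_. ?E" ?d n i] E by simp
  let ?T = "\<lambda>m s. (?E ^\<^sub>m (m - s)) * ?Y * (?E ^\<^sub>m s)"
  have T: "?T m s \<in> carrier_mat ?d ?d" for m s using pow Y by (intro square_mult_carrier) auto
  have left: "?E * ?T m s = ?T (Suc m) s" if "s \<in> {0..m}" for s
  proof -
    have "?E * ?T m s = ?E * (?E ^\<^sub>m (m - s) * ?Y) * ?E ^\<^sub>m s"
      by (rule assoc_mult_mat[symmetric, OF E mult_carrier_mat[OF pow Y] pow])
    also have "?E * (?E ^\<^sub>m (m - s) * ?Y) = ?E * ?E ^\<^sub>m (m - s) * ?Y"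
      by (rule assoc_mult_mat[symmetric, OF E pow Y])
    also have "?E * ?E ^\<^sub>m (m - s) = ?E ^\<^sub>m (Suc m - s)"
      using that comm[of "m - s"] by (simp add: Suc_diff_le del: pow_mat.simps)
    finally show ?thesis .
  qed
  have right: "?T m s * ?E = ?T (Suc m) (Suc s)" if "s \<in> {0..m}" for s
    using assoc_mult_mat[OF mult_carrier_mat[OF pow Y] pow E, of "m - s" s] by simp
  have "ad_EE (Suc m) = mat_lincomb ?d (ad_coeff m) (?T (Suc m)) {0..m} -
      ad_scalar m \<cdot>\<^sub>m mat_lincomb ?d (ad_coeff m) (\<lambda>s. ?T (Suc m) (Suc s)) {0..m}"
  proof -
    have "?E * ad_EE m = mat_lincomb ?d (ad_coeff m) (?T (Suc m)) {0..m}"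
      unfolding Suc using mult_mat_lincomb(1)[OF E, of "{0..m}" "?T m" "ad_coeff m", OF T]
        mat_lincomb_cong[of "{0..m}" "\<lambda>s. ?E * ?T m s" "?T (Suc m)" ?d "ad_coeff m", OF left]
      by (simp only:)
    moreover have "ad_EE m * ?E = mat_lincomb ?d (ad_coeff m) (\<lambda>s. ?T (Suc m) (Suc s)) {0..m}"
      unfolding Suc using mult_mat_lincomb(2)[OF E, of "{0..m}" "?T m" "ad_coeff m", OF T]
        mat_lincomb_cong[of "{0..m}" "\<lambda>s. ?T m s * ?E" "\<lambda>s. ?T (Suc m) (Suc s)" ?d "ad_coeff m", OF right]
      by (simp only:)
    ultimately show ?thesis by (simp only: ad_power.simps)
  qed
  also have "\<dots> = mat_lincomb ?d (ad_coeff (Suc m)) (?T (Suc m)) {0..Suc m}"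
  proof (rule eq_matI)
    fix a b assume "a < dim_row (mat_lincomb ?d (ad_coeff (Suc m)) (?T (Suc m)) {0..Suc m})"
      "b < dim_col (mat_lincomb ?d (ad_coeff (Suc m)) (?T (Suc m)) {0..Suc m})"
    then have ab: "a < ?d" "b < ?d" by (auto simp: mat_lincomb_def)
    have "(\<Sum>s = 0..m. ad_coeff m s * ?T (Suc m) s $$ (a, b)) -
        ad_scalar m * (\<Sum>s = 0..m. ad_coeff m s * ?T (Suc m) (Suc s) $$ (a, b)) =
        (\<Sum>s = 0..Suc m. ad_coeff (Suc m) s * ?T (Suc m) s $$ (a, b))"
    proof (rule sum_Pascal)
      show "ad_coeff (Suc m) 0 = ad_coeff m 0" by (simp add: ad_coeff_def q_binomial_def)
      show "ad_coeff (Suc m) (Suc m) = - ad_scalar m * ad_coeff m m"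
        by (simp add: ad_coeff_def ad_scalar_def q_binomial_def q_add[symmetric]) (simp add: algebra_simps)
      fix s assume s: "s < m"
      let ?a = "of_int (cartan Q i j) :: rat"
      have e1: "q (- sy i * of_nat (Suc s)) * q (sy i * of_nat (Suc s) * (?a + of_nat (Suc m) - 1)) =
          q (sy i * of_nat (Suc s) * (?a + of_nat m - 1))"
        by (simp add: q_add[symmetric]) (simp add: algebra_simps)
      have e2: "q (sy i * of_nat (m - s)) * q (sy i * of_nat (Suc s) * (?a + of_nat (Suc m) - 1)) =
          ad_scalar m * q (sy i * of_nat s * (?a + of_nat m - 1))"
        using s by (simp add: ad_scalar_def q_add[symmetric] of_nat_diff) (simp add: algebra_simps)
      have "ad_coeff (Suc m) (Suc s) = - ((- 1) ^ s) *
         (q_binomial Q i m (Suc s) * (q (- sy i * of_nat (Suc s)) * q (sy i * of_nat (Suc s) * (?a + of_nat (Suc m) - 1))) +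
          q_binomial Q i m s * (q (sy i * of_nat (m - s)) * q (sy i * of_nat (Suc s) * (?a + of_nat (Suc m) - 1))))"
        unfolding ad_coeff_def q_binomial_Pascal[OF s] by (simp add: algebra_simps)
      also have "\<dots> = ad_coeff m (Suc s) - ad_scalar m * ad_coeff m s"
        unfolding e1 e2 by (simp add: ad_coeff_def algebra_simps)
      finally show "ad_coeff (Suc m) (Suc s) = ad_coeff m (Suc s) - ad_scalar m * ad_coeff m s" .
    qed
    then show "(mat_lincomb ?d (ad_coeff m) (?T (Suc m)) {0..m} -
      ad_scalar m \<cdot>\<^sub>m mat_lincomb ?d (ad_coeff m) (\<lambda>s. ?T (Suc m) (Suc s)) {0..m}) $$ (a, b) =
      mat_lincomb ?d (ad_coeff (Suc m)) (?T (Suc m)) {0..Suc m} $$ (a, b)"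
      using ab by (simp add: mat_lincomb_def)
  qed (simp_all add: mat_lincomb_def)
  finally show ?case .
qed

text \<open>In each term of the expansion one of the two powers of E_i has exponent at least
  \<open>mdim M\<close>, hence vanishes.\<close>

lemma ad_EE_eventually_zero: "ad_EE (2 * mdim M) = 0\<^sub>m (mdim M) (mdim M)"
proof -
  let ?d = "mdim M" and ?m = "2 * mdim M"
  have E: "actE M k \<in> carrier_mat ?d ?d" for k using M by simp
  have zero: "actE M i ^\<^sub>m n = 0\<^sub>m ?d ?d" if "n \<ge> ?d" for n
    using word_act_replicate[of "actE M" ?d n i] word_act_E_vanish[OF M, of "replicate n i"] that E by simp
  have "(actE M i ^\<^sub>m (?m - s)) * actE M j * (actE M i ^\<^sub>m s) = 0\<^sub>m ?d ?d" for s
  proof (cases "s \<ge> ?d")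
    case True
    then show ?thesis using zero[of s] E by (simp add: right_mult_zero_mat[of _ ?d ?d])
  next
    case False
    then have "actE M i ^\<^sub>m (?m - s) = 0\<^sub>m ?d ?d" by (intro zero) simp
    then show ?thesis using E by (simp add: left_mult_zero_mat[of _ ?d ?d])
  qed
  then show ?thesis
    by (subst ad_EE_expand) (auto simp: mat_lincomb_def intro!: eq_matI)
qed

text \<open>The product of the q-integers of m and of a_ij + m - 1. For m > 0 it vanishes only at m
  = 1 - a_ij, which is where the descent from large m stops.\<close>

definition ad_bracket :: "nat \<Rightarrow> 'k" where
  "ad_bracket m = (q (sy i * of_nat m) - q (- (sy i * of_nat m))) *
     (q (sy i * (of_int (cartan Q i j) + of_nat m - 1)) - q (- (sy i * (of_int (cartan Q i j) + of_nat m - 1)))) /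
     (q (sy i) - q (- sy i)) ^ 2"

lemma ad_bracket_Suc:
  "ad_bracket (Suc m) = ad_bracket m + (ad_scalar m - inverse (ad_scalar m)) / (q (sy i) - q (- sy i))"
proof -
  let ?D = "q (sy i) - q (- sy i)" and ?a = "of_int (cartan Q i j) :: rat"
  have "(q (sy i * of_nat (Suc m)) - q (- (sy i * of_nat (Suc m)))) *
     (q (sy i * (?a + of_nat (Suc m) - 1)) - q (- (sy i * (?a + of_nat (Suc m) - 1)))) =
     (q (sy i * of_nat m) - q (- (sy i * of_nat m))) *
     (q (sy i * (?a + of_nat m - 1)) - q (- (sy i * (?a + of_nat m - 1)))) +
     (ad_scalar m - inverse (ad_scalar m)) * ?D"
    unfolding ad_scalar_def q_minus[symmetric] left_diff_distrib right_diff_distrib q_add[symmetric]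
    by (simp add: algebra_simps)
  then have "ad_bracket (Suc m) = ad_bracket m + (ad_scalar m - inverse (ad_scalar m)) * ?D / ?D ^ 2"
    unfolding ad_bracket_def by (simp add: add_divide_distrib)
  then show ?thesis by (simp add: power2_eq_square)
qed

text \<open>On a vector of weight l this expresses the commutator of the m-th iterated commutator
  with F_i as \<open>ad_bracket m\<close> times its predecessor times the inverse of K_i. At m = 0
  the truncated index \<open>m - 1\<close> does no harm since \<open>ad_bracket 0\<close> is 0; the
  base case itself says that E_j and F_i commute for distinct i and j. The weight is carried along
  because the inductive step applies the E_i, F_i relation to
  \<open>ad_EE m *\<^sub>v x\<close>.\<close>

lemma ad_EE_F:
  assumes x: "x \<in> weight_space Q M l"
  shows "ad_EE m *\<^sub>v (actF M i *\<^sub>v x) =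
    actF M i *\<^sub>v (ad_EE m *\<^sub>v x) + (ad_bracket m * q (- root_form i l)) \<cdot>\<^sub>v (ad_EE (m - 1) *\<^sub>v x) \<and>
    ad_EE m *\<^sub>v x \<in> weight_space Q M (l + simple_root j + (\<lambda>k. of_nat m * simple_root i k))"
  using x
proof (induction m arbitrary: l x)
  case 0
  let ?d = "mdim M"
  have x: "x \<in> carrier_vec ?d" using 0 by (rule wt_carrier)
  have "actE M j *\<^sub>v (actF M i *\<^sub>v x) = actF M i *\<^sub>v (actE M j *\<^sub>v x) + (ad_bracket 0 * q (- root_form i l)) \<cdot>\<^sub>v (actE M j *\<^sub>v x)"
  proof -
    have "actF M i *\<^sub>v (actE M j *\<^sub>v x) \<in> carrier_vec ?d" "actE M j *\<^sub>v x \<in> carrier_vec ?d"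
      using M x by auto
    then show ?thesis using EF_weight[OF M 0, of j i] ij x
      by (simp add: ad_bracket_def carrier_vecD[OF x] carrier_matD(1)[OF weight_module_carrier(1)[OF M]])
  qed
  moreover have "actE M j *\<^sub>v x \<in> weight_space Q M (l + simple_root j + (\<lambda>k. of_nat 0 * simple_root i k))"
  proof -
    have "l + simple_root j = l + simple_root j + (\<lambda>k. of_nat 0 * simple_root i k)" by (rule ext) simp
    then show ?thesis using E_weight[OF M 0, of j] by (simp only:)
  qed
  ultimately show ?case unfolding ad_power.simps diff_0_eq_0 by (rule conjI)
next
  case (Suc m)
  let ?d = "mdim M" and ?E = "actE M i" and ?F = "actF M i" and ?X = ad_EE
  define ll where "ll = l + simple_root j + (\<lambda>k. of_nat m * simple_root i k)"
  have x: "x \<in> carrier_vec ?d" using Suc.prems by (rule wt_carrier)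
  have E: "?E \<in> carrier_mat ?d ?d" "actE M j \<in> carrier_mat ?d ?d" and F: "?F \<in> carrier_mat ?d ?d"
    using M by simp_all
  have X: "?X n \<in> carrier_mat ?d ?d" for n by simp
  note IH = Suc.IH[OF Suc.prems] and IHE = Suc.IH[OF E_weight[OF M Suc.prems, of i]]
  have Xx: "?X m *\<^sub>v x \<in> weight_space Q M ll" using conjunct2[OF IH] unfolding ll_def .
  have XEx: "?X m *\<^sub>v (?E *\<^sub>v x) \<in> weight_space Q M (ll + simple_root i)"
  proof -
    have "l + simple_root i + simple_root j + (\<lambda>k. of_nat m * simple_root i k) = ll + simple_root i"
      by (rule ext) (simp add: ll_def)
    then show ?thesis using conjunct2[OF IHE] by (simp only:)
  qed
  note step = ad_power_Suc_mult_vec[OF E, of _ ad_scalar]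
  have wt: "?X (Suc m) *\<^sub>v x \<in> weight_space Q M (ll + simple_root i)"
  proof -
    have "- ad_scalar m \<cdot>\<^sub>v (?X m *\<^sub>v (?E *\<^sub>v x)) \<in> weight_space Q M (ll + simple_root i)"
      using M XEx by simp
    then have "?E *\<^sub>v (?X m *\<^sub>v x) + - ad_scalar m \<cdot>\<^sub>v (?X m *\<^sub>v (?E *\<^sub>v x)) \<in> weight_space Q M (ll + simple_root i)"
      using E_weight[OF M Xx, of i] M by simp
    moreover have "?E *\<^sub>v (?X m *\<^sub>v x) + - ad_scalar m \<cdot>\<^sub>v (?X m *\<^sub>v (?E *\<^sub>v x)) = ?X (Suc m) *\<^sub>v x"
      unfolding step[OF x] using E X x by (intro eq_vecI) auto
    ultimately show ?thesis by simp
  qed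
  have ll_root: "root_form i ll = root_form i l + sy i * (of_int (cartan Q i j) + 2 * of_nat m)"
  proof -
    have "root_form i (\<lambda>k. of_nat m * simple_root i k) = of_nat m * root_form i (simple_root i)"
      by (simp add: form_def sum_distrib_left algebra_simps)
    then show ?thesis by (simp add: ll_def root_form_simple_root algebra_simps)
  qed
  \<comment> \<open>The factor q(- 2 \<open>sy i\<close>) turns \<open>ad_scalar m\<close> into
    \<open>ad_scalar (m - 1)\<close>, so the left side is the recursion for \<open>ad_EE m\<close>
    again; at m = 0 every coefficient is 0.\<close>
  have low: "ad_bracket m \<cdot>\<^sub>v (?E *\<^sub>v (?X (m - 1) *\<^sub>v x)) - (ad_bracket m * ad_scalar m * q (- 2 * sy i)) \<cdot>\<^sub>v (?X (m - 1) *\<^sub>v (?E *\<^sub>v x)) =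
      ad_bracket m \<cdot>\<^sub>v (?X m *\<^sub>v x)"
  proof (cases m)
    case 0
    then show ?thesis using x E X by (auto simp: ad_bracket_def intro!: eq_vecI)
  next
    case (Suc n)
    have "ad_scalar (Suc n) * q (- 2 * sy i) = ad_scalar n"
      by (simp add: ad_scalar_def q_add[symmetric]) (simp add: algebra_simps)
    then have e: "ad_bracket (Suc n) * ad_scalar (Suc n) * q (- 2 * sy i) = ad_bracket (Suc n) * ad_scalar n"
      by (simp only: mult.assoc)
    define c where "c = ?E *\<^sub>v (?X n *\<^sub>v x)"
    define g where "g = ?X n *\<^sub>v (?E *\<^sub>v x)"
    have cg: "c \<in> carrier_vec ?d" "g \<in> carrier_vec ?d" using x E X by (auto simp: c_def g_def)
    show ?thesis
      unfolding Suc step[OF x] diff_Suc_1 c_def[symmetric] g_def[symmetric] e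
      using cg by (auto simp: right_diff_distrib intro!: eq_vecI)
  qed
  let ?p = "ad_scalar m" and ?b = "ad_bracket m" and ?ql = "q (- root_form i l)" and ?q2 = "q (- 2 * sy i)"
  note dist = mult_add_distrib_mat_vec[of _ ?d ?d] mult_minus_distrib_mat_vec[of _ ?d ?d] mult_mat_vec[of _ ?d ?d]
  have Fx: "?F *\<^sub>v x \<in> carrier_vec ?d" "?E *\<^sub>v x \<in> carrier_vec ?d" "?X n *\<^sub>v x \<in> carrier_vec ?d"
    "?X n *\<^sub>v (?E *\<^sub>v x) \<in> carrier_vec ?d" for n
    using E F X x by simp_all
  have 1: "?E *\<^sub>v (?X m *\<^sub>v (?F *\<^sub>v x)) = ?F *\<^sub>v (?E *\<^sub>v (?X m *\<^sub>v x)) + qbr i ll \<cdot>\<^sub>v (?X m *\<^sub>v x) +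
      (?b * ?ql) \<cdot>\<^sub>v (?E *\<^sub>v (?X (m - 1) *\<^sub>v x))"
    using conjunct1[OF IH] EF_weight[OF M Xx, of i i] E F Fx by (simp add: dist)
  have 2: "?X m *\<^sub>v (?E *\<^sub>v (?F *\<^sub>v x)) = ?F *\<^sub>v (?X m *\<^sub>v (?E *\<^sub>v x)) +
      (?b * (?ql * ?q2)) \<cdot>\<^sub>v (?X (m - 1) *\<^sub>v (?E *\<^sub>v x)) + qbr i l \<cdot>\<^sub>v (?X m *\<^sub>v x)"
  proof -
    have "q (- root_form i (l + simple_root i)) = ?ql * ?q2"
      unfolding q_add[symmetric] by simp
    then have "?X m *\<^sub>v (?F *\<^sub>v (?E *\<^sub>v x)) = ?F *\<^sub>v (?X m *\<^sub>v (?E *\<^sub>v x)) +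
      (?b * (?ql * ?q2)) \<cdot>\<^sub>v (?X (m - 1) *\<^sub>v (?E *\<^sub>v x))"
      using conjunct1[OF IHE] by (simp only:)
    then show ?thesis
      using EF_weight[OF M Suc.prems, of i i] E F X x Fx by (simp add: dist)
  qed
  have coef: "qbr i ll - ?p * qbr i l + ?ql * ?b = ?ql * ad_bracket (Suc m)"
  proof -
    have "qbr i ll - ?p * qbr i l = (?p - inverse ?p) / (q (sy i) - q (- sy i)) * ?ql"
    proof -
      have "q (root_form i ll) = q (root_form i l) * ?p" unfolding ll_root ad_scalar_def by (rule q_add)
      then show ?thesis
        unfolding qbr_def q_minus by (simp only: bracket_identity)
    qed
    then show ?thesis unfolding ad_bracket_Suc by (simp add: algebra_simps)
  qed
  have "?F *\<^sub>v (?X (Suc m) *\<^sub>v x) = ?F *\<^sub>v (?E *\<^sub>v (?X m *\<^sub>v x)) - ?p \<cdot>\<^sub>v (?F *\<^sub>v (?X m *\<^sub>v (?E *\<^sub>v x)))"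
    unfolding step[OF x] using E F Fx by (simp add: dist)
  moreover have "?X (Suc m) *\<^sub>v (?F *\<^sub>v x) = (?F *\<^sub>v (?E *\<^sub>v (?X m *\<^sub>v x)) - ?p \<cdot>\<^sub>v (?F *\<^sub>v (?X m *\<^sub>v (?E *\<^sub>v x)))) +
      (ad_bracket (Suc m) * ?ql) \<cdot>\<^sub>v (?X m *\<^sub>v x)"
    unfolding step[OF Fx(1)] 1 2
    by (rule ad_bracket_combine[where d = ?d, OF _ _ _ _ _ low coef]) (intro square_mult_vec_carrier E F X x)+
  ultimately have "?X (Suc m) *\<^sub>v (?F *\<^sub>v x) =
      ?F *\<^sub>v (?X (Suc m) *\<^sub>v x) + (ad_bracket (Suc m) * ?ql) \<cdot>\<^sub>v (?X m *\<^sub>v x)"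
    by (simp only:)
  moreover have "?X (Suc m) *\<^sub>v x \<in> weight_space Q M (l + simple_root j + (\<lambda>k. of_nat (Suc m) * simple_root i k))"
  proof -
    have "ll + simple_root i = l + simple_root j + (\<lambda>k. of_nat (Suc m) * simple_root i k)"
      by (rule ext) (simp add: ll_def algebra_simps)
    then show ?thesis using wt by (simp only:)
  qed
  ultimately show ?case unfolding diff_Suc_1 by (rule conjI)
qed

lemma ad_EE_zero:
  assumes "int m \<ge> 1 - cartan Q i j"
  shows "ad_EE m = 0\<^sub>m (mdim M) (mdim M)"
proof (cases "m \<le> 2 * mdim M")
  case True
  let ?d = "mdim M"
  have X: "ad_EE n \<in> carrier_mat ?d ?d" for n by simp
  show ?thesis
    using True assms
  proof (induction m rule: inc_induct)
    case base
    show ?case by (rule ad_EE_eventually_zero)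
  next
    case (step m)
    then have zero: "ad_EE (Suc m) = 0\<^sub>m ?d ?d" by simp
    have "of_int (cartan Q i j) + of_nat (Suc m) - 1 \<noteq> (0 :: rat)"
    proof -
      have "cartan Q i j + int (Suc m) - 1 \<noteq> 0" using step by simp
      then have "(of_int (cartan Q i j + int (Suc m) - 1) :: rat) \<noteq> 0" by (simp only: of_int_eq_0_iff not_False_eq_True)
      then show ?thesis by simp
    qed
    then have nz: "ad_bracket (Suc m) \<noteq> 0"
      unfolding ad_bracket_def using q_sy_mult_neq q_sy[of i] by (simp del: of_nat_Suc)
    show ?case
    proof (rule weight_module_eqI[OF M X])
      fix l x assume x: "x \<in> weight_space Q M l"
      have xc: "x \<in> carrier_vec ?d" using x by (rule wt_carrier)
      have F: "actF M i \<in> carrier_mat ?d ?d" using M by simp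
      have z: "0\<^sub>m ?d ?d *\<^sub>v v = 0\<^sub>v ?d" if "v \<in> carrier_vec ?d" for v :: "'k vec"
        using that by (auto intro!: eq_vecI)
      define z' where "z' = (ad_bracket (Suc m) * q (- root_form i l)) \<cdot>\<^sub>v (ad_EE m *\<^sub>v x)"
      have z': "z' \<in> carrier_vec ?d" using X[of m] xc by (simp add: z'_def)
      note f = conjunct1[OF ad_EE_F[OF x, of "Suc m"], unfolded zero diff_Suc_1, folded z'_def]
      have "z' = 0\<^sub>v ?d" using f F xc z' by (simp add: z)
      then have "(ad_bracket (Suc m) * q (- root_form i l)) \<cdot>\<^sub>v (ad_EE m *\<^sub>v x) = 0\<^sub>v ?d"
        by (simp only: z'_def)
      then have "inverse (ad_bracket (Suc m) * q (- root_form i l)) \<cdot>\<^sub>v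
          ((ad_bracket (Suc m) * q (- root_form i l)) \<cdot>\<^sub>v (ad_EE m *\<^sub>v x)) = 0\<^sub>v ?d" by simp
      then show "ad_EE m *\<^sub>v x = 0\<^sub>m ?d ?d *\<^sub>v x"
        using nz xc left_inverse[of "ad_bracket (Suc m) * q (- root_form i l)"] X[of m]
        by (simp add: smult_smult_assoc z del: inverse_mult_distrib)
    qed simp
  qed
next
  case False
  then obtain k where "m = 2 * mdim M + k" using le_Suc_ex[of "2 * mdim M" m] by auto
  moreover have "ad_EE (2 * mdim M + k) = 0\<^sub>m (mdim M) (mdim M)"
  proof (induction k)
    case 0
    show ?case using ad_EE_eventually_zero by simp
  next
    case (Suc k)
    have "actE M i \<in> carrier_mat (mdim M) (mdim M)" using M by simp
    then show ?case
      by (simp add: Suc left_mult_zero_mat[of _ "mdim M" "mdim M"] right_mult_zero_mat[of _ "mdim M" "mdim M"])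
  qed
  ultimately show ?thesis by simp
qed

lemma serre_E:
  "mat_lincomb (mdim M) (\<lambda>s. (- 1) ^ s * q_binomial Q i (nat (1 - cartan Q i j)) s)
     (\<lambda>s. (actE M i ^\<^sub>m (nat (1 - cartan Q i j) - s)) * actE M j * (actE M i ^\<^sub>m s)) {0..nat (1 - cartan Q i j)} =
   0\<^sub>m (mdim M) (mdim M)"
proof -
  let ?m = "nat (1 - cartan Q i j)"
  have m: "int ?m = 1 - cartan Q i j" using cartan_off_diag[OF ij] by simp
  have "(of_nat ?m :: rat) = of_int (int ?m)" by (simp only: of_int_of_nat_eq)
  also have "\<dots> = 1 - of_int (cartan Q i j)" unfolding m by simp
  \<comment> \<open>The exponent in \<open>ad_coeff\<close> vanishes exactly at this m, which leaves
    the plain q-Serre coefficients.\<close>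
  finally have e: "of_int (cartan Q i j) + of_nat ?m - 1 = (0 :: rat)" by simp
  have "ad_coeff ?m = (\<lambda>s. (- 1) ^ s * q_binomial Q i ?m s)"
    unfolding ad_coeff_def e by simp
  then show ?thesis using ad_EE_zero[of ?m] ad_EE_expand[of ?m] m by simp
qed

end

lemma q_serre_E: "weight_module M \<Longrightarrow> q_serre Q (mdim M) (actE M)"
  unfolding q_serre_def Let_def using serre_E by blast

text \<open>Twisting by the automorphism that exchanges E with F and K with its inverse. It converts
  the q-Serre relations for E, known for all weight modules, into those for F.\<close>

definition swapped :: "('i, 'k) qmodule \<Rightarrow> ('i, 'k) qmodule" where
  "swapped M = \<lparr> mdim = mdim M, actE = actF M, actF = actE M, actK = actKi M, actKi = actK M \<rparr>"

lemma swapped_weight: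
  "weight_module M \<Longrightarrow> x \<in> weight_space Q M l \<Longrightarrow> x \<in> weight_space Q (swapped M) (- l)"
  using Ki_weight[of M x l] by (auto simp: weight_space_def swapped_def)

lemma qbr_minus: "qbr i (- l) = - qbr i l"
  unfolding qbr_def form_minus minus_minus minus_divide_left minus_diff_eq ..

lemma weight_module_swapped:
  assumes M: "weight_module M"
  shows "weight_module (swapped M)"
proof (rule weight_moduleI[where ?S = "\<Union>l\<in>weights Q. weight_space Q M l"])
  fix x assume "x \<in> (\<Union>l\<in>weights Q. weight_space Q M l)"
  then obtain l where l: "l \<in> weights Q" and x: "x \<in> weight_space Q M l" by auto
  show "\<exists>l\<in>weights Q. x \<in> weight_space Q (swapped M) l \<and>
      (\<forall>i. actKi (swapped M) i *\<^sub>v x = q (- root_form i l) \<cdot>\<^sub>v x \<and>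
        actE (swapped M) i *\<^sub>v x \<in> weight_space Q (swapped M) (l + simple_root i) \<and>
        actF (swapped M) i *\<^sub>v x \<in> weight_space Q (swapped M) (l - simple_root i) \<and>
        (\<forall>j. actE (swapped M) i *\<^sub>v (actF (swapped M) j *\<^sub>v x) =
          actF (swapped M) j *\<^sub>v (actE (swapped M) i *\<^sub>v x) + (if i = j then qbr i l else 0) \<cdot>\<^sub>v x))"
  proof (intro bexI[of _ "- l"] conjI allI)
    show "- l \<in> weights Q" using l by simp
    show "x \<in> weight_space Q (swapped M) (- l)" using swapped_weight[OF M x] .
    fix i
    show "actKi (swapped M) i *\<^sub>v x = q (- root_form i (- l)) \<cdot>\<^sub>v x"
      using K_weight[OF x] by (simp add: swapped_def)
    show "actE (swapped M) i *\<^sub>v x \<in> weight_space Q (swapped M) (- l + simple_root i)"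
      using swapped_weight[OF M F_weight[OF M x, of i]] by (simp add: swapped_def)
    show "actF (swapped M) i *\<^sub>v x \<in> weight_space Q (swapped M) (- l - simple_root i)"
      using swapped_weight[OF M E_weight[OF M x, of i]] by (simp add: swapped_def)
    fix j
    have "actE M j *\<^sub>v (actF M i *\<^sub>v x) \<in> carrier_vec (mdim M)" "actF M i *\<^sub>v (actE M j *\<^sub>v x) \<in> carrier_vec (mdim M)"
      using M wt_carrier[OF x] by auto
    from vec_add_smult_cancel[OF this(2) wt_carrier[OF x] EF_weight[OF M x, of j i]]
    show "actE (swapped M) i *\<^sub>v (actF (swapped M) j *\<^sub>v x) =
          actF (swapped M) j *\<^sub>v (actE (swapped M) i *\<^sub>v x) + (if i = j then qbr i (- l) else 0) \<cdot>\<^sub>v x"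
      by (auto simp: swapped_def qbr_minus)
  qed
qed (use M spans_weight_spaces[OF M] in \<open>simp_all add: swapped_def\<close>)

lemma q_serre_F: "weight_module M \<Longrightarrow> q_serre Q (mdim M) (actF M)"
  using q_serre_E[OF weight_module_swapped, of M] by (simp add: swapped_def)

text \<open>From here on tensor products and duals count as modules of type 1, and R is defined and
  linear on them, as soon as the quadratic relations and the span of the weight vectors have been
  checked.\<close>

theorem type1_iff_weight_module: "type1_module Q M \<longleftrightarrow> weight_module M"
  using type1_iff q_serre_E q_serre_F by blast

end

section \<open>Tensor products and duals\<close>

lemma transpose_smult: "transpose_mat (a \<cdot>\<^sub>m A) = a \<cdot>\<^sub>m transpose_mat (A :: 'k::field mat)"
  by (auto intro!: eq_matI)

lemma tensor_sel[simp]: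
  "mdim (tensor M N) = mdim M * mdim N"
  "actE (tensor M N) i = kron (actE M i) (actK N i) + kron (1\<^sub>m (mdim M)) (actE N i)"
  "actF (tensor M N) i = kron (actF M i) (1\<^sub>m (mdim N)) + kron (actKi M i) (actF N i)"
  "actK (tensor M N) i = kron (actK M i) (actK N i)"
  "actKi (tensor M N) i = kron (actKi M i) (actKi N i)"
  by (simp_all add: tensor_def)

lemma kron_one_left_mult_vec:
  fixes A :: "'k::field mat"
  shows "A \<in> carrier_mat n n \<Longrightarrow> x \<in> carrier_vec m \<Longrightarrow> y \<in> carrier_vec n \<Longrightarrow>
    kron (1\<^sub>m m) A *\<^sub>v kron_vec x y = kron_vec x (A *\<^sub>v y)"
  by (simp add: kron_mult_kron_vec[of _ m m _ n n])

lemma kron_one_right_mult_vec: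
  fixes A :: "'k::field mat"
  shows "A \<in> carrier_mat m m \<Longrightarrow> x \<in> carrier_vec m \<Longrightarrow> y \<in> carrier_vec n \<Longrightarrow>
    kron A (1\<^sub>m n) *\<^sub>v kron_vec x y = kron_vec (A *\<^sub>v x) y"
  by (simp add: kron_mult_kron_vec[of _ m m _ n n])

context qdatum
begin

abbreviation weight_vectors :: "('i, 'k) qmodule \<Rightarrow> 'k vec set" where
  "weight_vectors M \<equiv> \<Union>l\<in>weights Q. weight_space Q M l"

lemma weight_kron_eqI:
  fixes A B :: "'k mat"
  assumes M: "weight_module M" and N: "weight_module N"
    and A: "A \<in> carrier_mat a (mdim M * mdim N)" and B: "B \<in> carrier_mat a (mdim M * mdim N)"
    and eq: "\<And>l m x y. l \<in> weights Q \<Longrightarrow> m \<in> weights Q \<Longrightarrow> x \<in> weight_space Q M l \<Longrightarrow> y \<in> weight_space Q N m \<Longrightarrow>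
      x \<in> carrier_vec (mdim M) \<Longrightarrow> y \<in> carrier_vec (mdim N) \<Longrightarrow> A *\<^sub>v kron_vec x y = B *\<^sub>v kron_vec x y"
  shows "A = B"
  by (rule mat_eqI_kron[OF A B spans_weight_spaces[OF M] spans_weight_spaces[OF N]]) (use eq in blast)

lemma tensor_carrier:
  assumes M: "weight_module M" and N: "weight_module N"
  shows "actE (tensor M N) i \<in> carrier_mat (mdim M * mdim N) (mdim M * mdim N)"
    "actF (tensor M N) i \<in> carrier_mat (mdim M * mdim N) (mdim M * mdim N)"
    "actK (tensor M N) i \<in> carrier_mat (mdim M * mdim N) (mdim M * mdim N)"
    "actKi (tensor M N) i \<in> carrier_mat (mdim M * mdim N) (mdim M * mdim N)"
  using M N by (simp_all add: kron_carrier)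

lemma tensor_apply:
  assumes M: "weight_module M" and N: "weight_module N"
    and x: "x \<in> weight_space Q M l" and y: "y \<in> weight_space Q N m"
  shows "actE (tensor M N) i *\<^sub>v kron_vec x y =
      q (root_form i m) \<cdot>\<^sub>v kron_vec (actE M i *\<^sub>v x) y + kron_vec x (actE N i *\<^sub>v y)"
    and "actF (tensor M N) i *\<^sub>v kron_vec x y =
      kron_vec (actF M i *\<^sub>v x) y + q (- root_form i l) \<cdot>\<^sub>v kron_vec x (actF N i *\<^sub>v y)"
    and "actK (tensor M N) i *\<^sub>v kron_vec x y = q (root_form i (l + m)) \<cdot>\<^sub>v kron_vec x y"
    and "actKi (tensor M N) i *\<^sub>v kron_vec x y = q (- root_form i (l + m)) \<cdot>\<^sub>v kron_vec x y"
proof -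
  let ?m = "mdim M" and ?n = "mdim N"
  note xc = wt_carrier[OF x] and yc = wt_carrier[OF y]
  note c = weight_module_carrier[OF M] weight_module_carrier[OF N]
  note k = kron_mult_kron_vec[of _ ?m ?m _ ?n ?n]
  have add: "(kron A B + kron A' B') *\<^sub>v kron_vec x y = kron A B *\<^sub>v kron_vec x y + kron A' B' *\<^sub>v kron_vec x y"
    if "A \<in> carrier_mat ?m ?m" "B \<in> carrier_mat ?n ?n" "A' \<in> carrier_mat ?m ?m" "B' \<in> carrier_mat ?n ?n" for A B A' B'
    using that xc yc by (intro add_mult_distrib_mat_vec[of _ "?m * ?n" "?m * ?n"] kron_carrier kron_vec_carrier)
  note sc = K_weight[OF x] K_weight[OF y] Ki_weight[OF M x] Ki_weight[OF N y]
  show "actE (tensor M N) i *\<^sub>v kron_vec x y =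
      q (root_form i m) \<cdot>\<^sub>v kron_vec (actE M i *\<^sub>v x) y + kron_vec x (actE N i *\<^sub>v y)"
    using c xc yc by (simp add: add k sc kron_vec_linear(3,4))
  show "actF (tensor M N) i *\<^sub>v kron_vec x y =
      kron_vec (actF M i *\<^sub>v x) y + q (- root_form i l) \<cdot>\<^sub>v kron_vec x (actF N i *\<^sub>v y)"
    using c xc yc by (simp add: add k sc kron_vec_linear(3,4))
  show "actK (tensor M N) i *\<^sub>v kron_vec x y = q (root_form i (l + m)) \<cdot>\<^sub>v kron_vec x y"
    using c xc yc by (simp add: k sc kron_vec_linear(3,4) smult_smult_assoc q_add mult.commute)
  show "actKi (tensor M N) i *\<^sub>v kron_vec x y = q (- root_form i (l + m)) \<cdot>\<^sub>v kron_vec x y"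
    using c xc yc by (simp add: k sc kron_vec_linear(3,4) smult_smult_assoc q_diff mult.commute)
qed

lemma kron_weight:
  assumes "weight_module M" "weight_module N"
    and x: "x \<in> weight_space Q M l" and y: "y \<in> weight_space Q N m"
  shows "kron_vec x y \<in> weight_space Q (tensor M N) (l + m)"
  using tensor_apply(3)[OF assms] wt_carrier[OF x] wt_carrier[OF y]
  unfolding weight_space_def by (simp del: tensor_sel(4))

lemma weight_space_add_smult:
  assumes "\<And>i. actK M i \<in> carrier_mat (mdim M) (mdim M)" "x \<in> weight_space Q M l" "y \<in> weight_space Q M l"
  shows "a \<cdot>\<^sub>v x + b \<cdot>\<^sub>v y \<in> weight_space Q M l"
  using assms by (auto simp: weight_space_def mult_add_distrib_mat_vec[of _ "mdim M" "mdim M"]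
      mult_mat_vec[of _ "mdim M" "mdim M"] smult_add_distrib_vec[of _ "mdim M"] smult_smult_assoc mult.commute)

lemma weight_module_tensor[simp]:
  assumes M: "weight_module M" and N: "weight_module N"
  shows "weight_module (tensor M N)"
proof (rule weight_moduleI)
  let ?m = "mdim M" and ?n = "mdim N" and ?T = "tensor M N"
  show "spans (mdim ?T) {kron_vec x y | x y. x \<in> weight_vectors M \<and> y \<in> weight_vectors N}"
    using spans_kron_vec[OF spans_weight_spaces[OF M] spans_weight_spaces[OF N]] by simp
  fix z assume "z \<in> {kron_vec x y | x y. x \<in> weight_vectors M \<and> y \<in> weight_vectors N}"
  then obtain x y l k where z: "z = kron_vec x y" and l: "l \<in> weights Q" "k \<in> weights Q"
    and x: "x \<in> weight_space Q M l" and y: "y \<in> weight_space Q N k" by auto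
  note xc = wt_carrier[OF x] and yc = wt_carrier[OF y]
  note c = weight_module_carrier[OF M] weight_module_carrier[OF N]
  have TK: "actK ?T i \<in> carrier_mat (mdim ?T) (mdim ?T)" for i using tensor_carrier[OF M N] by simp
  show "\<exists>l\<in>weights Q. z \<in> weight_space Q ?T l \<and>
      (\<forall>i. actKi ?T i *\<^sub>v z = q (- root_form i l) \<cdot>\<^sub>v z \<and>
        actE ?T i *\<^sub>v z \<in> weight_space Q ?T (l + simple_root i) \<and>
        actF ?T i *\<^sub>v z \<in> weight_space Q ?T (l - simple_root i) \<and>
        (\<forall>j. actE ?T i *\<^sub>v (actF ?T j *\<^sub>v z) =
          actF ?T j *\<^sub>v (actE ?T i *\<^sub>v z) + (if i = j then qbr i l else 0) \<cdot>\<^sub>v z))"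
    unfolding z
  proof (intro bexI[of _ "l + k"] conjI allI)
    show "l + k \<in> weights Q" using l by (rule weights_add)
    show "kron_vec x y \<in> weight_space Q ?T (l + k)" by (rule kron_weight[OF M N x y])
    fix i
    show "actKi ?T i *\<^sub>v kron_vec x y = q (- root_form i (l + k)) \<cdot>\<^sub>v kron_vec x y"
      by (rule tensor_apply(4)[OF M N x y])
    have "kron_vec (actE M i *\<^sub>v x) y \<in> weight_space Q ?T (l + k + simple_root i)"
      using kron_weight[OF M N E_weight[OF M x, of i] y] by (simp only: ac_simps)
    moreover have "kron_vec x (actE N i *\<^sub>v y) \<in> weight_space Q ?T (l + k + simple_root i)"
      using kron_weight[OF M N x E_weight[OF N y, of i]] by (simp only: ac_simps)
    ultimately show "actE ?T i *\<^sub>v kron_vec x y \<in> weight_space Q ?T (l + k + simple_root i)"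
      using weight_space_add_smult[OF TK, where b = 1] unfolding tensor_apply(1)[OF M N x y] by fastforce
    have "kron_vec (actF M i *\<^sub>v x) y \<in> weight_space Q ?T (l + k - simple_root i)"
      using kron_weight[OF M N F_weight[OF M x, of i] y] by (simp only: algebra_simps)
    moreover have "kron_vec x (actF N i *\<^sub>v y) \<in> weight_space Q ?T (l + k - simple_root i)"
      using kron_weight[OF M N x F_weight[OF N y, of i]] by (simp only: algebra_simps)
    ultimately show "actF ?T i *\<^sub>v kron_vec x y \<in> weight_space Q ?T (l + k - simple_root i)"
      using weight_space_add_smult[OF TK, where a = 1] unfolding tensor_apply(2)[OF M N x y] by fastforce
    fix j
    let ?Ti = "actE ?T i" and ?Tj = "actF ?T j"
    have Tc: "?Ti \<in> carrier_mat (?m * ?n) (?m * ?n)" "?Tj \<in> carrier_mat (?m * ?n) (?m * ?n)"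
      using tensor_carrier[OF M N] by blast+
    define P where "P = kron_vec (actF M j *\<^sub>v (actE M i *\<^sub>v x)) y"
    define U where "U = kron_vec (actF M j *\<^sub>v x) (actE N i *\<^sub>v y)"
    define W where "W = kron_vec (actE M i *\<^sub>v x) (actF N j *\<^sub>v y)"
    define T where "T = kron_vec x (actF N j *\<^sub>v (actE N i *\<^sub>v y))"
    define Z where "Z = kron_vec x y"
    define e where "e = (if i = j then 1 else 0 :: 'k)"
    have vc: "P \<in> carrier_vec (?m * ?n)" "U \<in> carrier_vec (?m * ?n)" "W \<in> carrier_vec (?m * ?n)"
      "T \<in> carrier_vec (?m * ?n)" "Z \<in> carrier_vec (?m * ?n)"
      unfolding P_def U_def W_def T_def Z_def using c xc yc by (auto intro!: kron_vec_carrier)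
    note dist = mult_add_distrib_mat_vec[of _ "?m * ?n" "?m * ?n"] mult_mat_vec[of _ "?m * ?n" "?m * ?n"]
    have kc: "kron_vec (actE M i *\<^sub>v x) y \<in> carrier_vec (?m * ?n)" "kron_vec x (actE N i *\<^sub>v y) \<in> carrier_vec (?m * ?n)"
      "kron_vec (actF M j *\<^sub>v x) y \<in> carrier_vec (?m * ?n)" "kron_vec x (actF N j *\<^sub>v y) \<in> carrier_vec (?m * ?n)"
      using c xc yc by (auto intro!: kron_vec_carrier)
    have EFx: "kron_vec (actE M i *\<^sub>v (actF M j *\<^sub>v x)) y = P + (e * qbr i l) \<cdot>\<^sub>v Z"
      unfolding EF_weight[OF M x] using c xc yc
      by (subst kron_vec_linear(1)[of _ ?m _ _ ?n]) (auto simp: P_def Z_def e_def kron_vec_linear(3))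
    have EFy: "kron_vec x (actE N i *\<^sub>v (actF N j *\<^sub>v y)) = T + (e * qbr i k) \<cdot>\<^sub>v Z"
      unfolding EF_weight[OF N y] using c xc yc
      by (subst kron_vec_linear(2)[of _ ?m _ ?n]) (auto simp: T_def Z_def e_def kron_vec_linear(4))
    have "?Ti *\<^sub>v (?Tj *\<^sub>v kron_vec x y) = ?Ti *\<^sub>v kron_vec (actF M j *\<^sub>v x) y +
        q (- root_form j l) \<cdot>\<^sub>v (?Ti *\<^sub>v kron_vec x (actF N j *\<^sub>v y))"
      unfolding tensor_apply(2)[OF M N x y] using Tc kc by (simp only: dist smult_carrier_vec)
    also have "\<dots> = (q (root_form i k) \<cdot>\<^sub>v (P + (e * qbr i l) \<cdot>\<^sub>v Z) + U) +
        q (- root_form j l) \<cdot>\<^sub>v (q (root_form i (k - simple_root j)) \<cdot>\<^sub>v W + (T + (e * qbr i k) \<cdot>\<^sub>v Z))"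
      unfolding tensor_apply(1)[OF M N F_weight[OF M x] y] tensor_apply(1)[OF M N x F_weight[OF N y]] EFx EFy
      by (simp only: U_def W_def)
    finally have LHS: "?Ti *\<^sub>v (?Tj *\<^sub>v kron_vec x y) = (q (root_form i k) \<cdot>\<^sub>v (P + (e * qbr i l) \<cdot>\<^sub>v Z) + U) +
        q (- root_form j l) \<cdot>\<^sub>v (q (root_form i (k - simple_root j)) \<cdot>\<^sub>v W + (T + (e * qbr i k) \<cdot>\<^sub>v Z))" .
    have "?Tj *\<^sub>v (?Ti *\<^sub>v kron_vec x y) = q (root_form i k) \<cdot>\<^sub>v (?Tj *\<^sub>v kron_vec (actE M i *\<^sub>v x) y) +
        ?Tj *\<^sub>v kron_vec x (actE N i *\<^sub>v y)"
      unfolding tensor_apply(1)[OF M N x y] using Tc kc by (simp only: dist smult_carrier_vec)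
    also have "\<dots> = q (root_form i k) \<cdot>\<^sub>v (P + q (- root_form j (l + simple_root i)) \<cdot>\<^sub>v W) + (U + q (- root_form j l) \<cdot>\<^sub>v T)"
      unfolding tensor_apply(2)[OF M N E_weight[OF M x] y] tensor_apply(2)[OF M N x E_weight[OF N y]]
      by (simp only: P_def U_def W_def T_def)
    finally have RHS: "?Tj *\<^sub>v (?Ti *\<^sub>v kron_vec x y) =
      q (root_form i k) \<cdot>\<^sub>v (P + q (- root_form j (l + simple_root i)) \<cdot>\<^sub>v W) + (U + q (- root_form j l) \<cdot>\<^sub>v T)" .
    \<comment> \<open>The mixed terms with E_i on x and F_j on y occur in both orders. K_i sees the
      shift of k by alpha_j, and the inverse of K_j sees the shift of l by alpha_i; symmetry of the
      form makes the factors equal.\<close>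
    have c1: "q (- root_form j l) * q (root_form i (k - simple_root j)) = q (root_form i k) * q (- root_form j (l + simple_root i))"
      by (simp add: q_add[symmetric] form_sym[of "simple_root j" "simple_root i"])
    \<comment> \<open>The numerators telescope: the brackets of l and k combine to that of l +
      k.\<close>
    have c2: "e * (q (root_form i k) * qbr i l + q (- root_form j l) * qbr i k) = (if i = j then qbr i (l + k) else 0)"
      by (auto simp: e_def qbr_def add_divide_distrib[symmetric] right_diff_distrib q_add[symmetric])
    show "?Ti *\<^sub>v (?Tj *\<^sub>v kron_vec x y) = ?Tj *\<^sub>v (?Ti *\<^sub>v kron_vec x y) + (if i = j then qbr i (l + k) else 0) \<cdot>\<^sub>v kron_vec x y"
      unfolding LHS RHS c2[symmetric] unfolding Z_def[symmetric]
    proof (rule eq_vecI)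
      let ?a1 = "q (root_form i k)" and ?a2 = "q (- root_form j l)" and ?a3 = "q (root_form i (k - simple_root j))"
        and ?a4 = "q (- root_form j (l + simple_root i))"
      fix r assume "r < dim_vec (?a1 \<cdot>\<^sub>v (P + ?a4 \<cdot>\<^sub>v W) + (U + ?a2 \<cdot>\<^sub>v T) +
          (e * (?a1 * qbr i l + ?a2 * qbr i k)) \<cdot>\<^sub>v Z)"
      then have r: "r < ?m * ?n" using vc by simp
      have "?a2 * (?a3 * W $ r) = ?a1 * (?a4 * W $ r)"
        unfolding mult.assoc[symmetric] c1 ..
      then show "(?a1 \<cdot>\<^sub>v (P + (e * qbr i l) \<cdot>\<^sub>v Z) + U + ?a2 \<cdot>\<^sub>v (?a3 \<cdot>\<^sub>v W + (T + (e * qbr i k) \<cdot>\<^sub>v Z))) $ r =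
        (?a1 \<cdot>\<^sub>v (P + ?a4 \<cdot>\<^sub>v W) + (U + ?a2 \<cdot>\<^sub>v T) + (e * (?a1 * qbr i l + ?a2 * qbr i k)) \<cdot>\<^sub>v Z) $ r"
        using r vc by (simp add: distrib_left distrib_right ac_simps)
    qed (use vc in simp)
  qed
qed (use tensor_carrier[OF M N] in simp_all)

section \<open>Duals\<close>

definition antipode :: "('i, 'k) qmodule \<Rightarrow> 'i \<Rightarrow> 'k mat" where
  "antipode M i = - (actKi M i * actE M i)"

text \<open>Together with \<open>antipode\<close> these are the values on F and E of the inverse of
  the antipode belonging to the comultiplication of \<open>tensor\<close>. The inverse is the right
  one for \<open>coev\<close> to be invariant in the tensor product of the dual (on the left) with
  the module.\<close>

definition antipode_F :: "('i, 'k) qmodule \<Rightarrow> 'i \<Rightarrow> 'k mat" where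
  "antipode_F M i = - (actF M i * actK M i)"

text \<open>The dual for an antipode with values \<open>-K\<^sup>-\<^sup>1E\<close>, \<open>-FK\<close>, \<open>K\<^sup>-\<^sup>1\<close> on the generators.\<close>

definition dual_module :: "('i, 'k) qmodule \<Rightarrow> ('i, 'k) qmodule" where
  "dual_module M = \<lparr> mdim = mdim M, actE = (\<lambda>i. transpose_mat (antipode M i)),
     actF = (\<lambda>i. transpose_mat (antipode_F M i)), actK = (\<lambda>i. transpose_mat (actKi M i)),
     actKi = (\<lambda>i. transpose_mat (actK M i)) \<rparr>"

lemma dual_sel[simp]: "mdim (dual_module M) = mdim M"
  "actE (dual_module M) i = transpose_mat (antipode M i)" "actF (dual_module M) i = transpose_mat (antipode_F M i)"
  "actK (dual_module M) i = transpose_mat (actKi M i)" "actKi (dual_module M) i = transpose_mat (actK M i)"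
  by (simp_all add: dual_module_def)

lemma antipode_carrier[simp]:
  assumes "weight_module M"
  shows "antipode M i \<in> carrier_mat (mdim M) (mdim M)" "antipode_F M i \<in> carrier_mat (mdim M) (mdim M)"
  using assms by (simp_all add: antipode_def antipode_F_def)

lemma antipode_apply:
  assumes M: "weight_module M" and x: "x \<in> weight_space Q M l"
  shows "antipode M i *\<^sub>v x = (- q (- root_form i (l + simple_root i))) \<cdot>\<^sub>v (actE M i *\<^sub>v x)"
    and "antipode_F M i *\<^sub>v x = (- q (root_form i l)) \<cdot>\<^sub>v (actF M i *\<^sub>v x)"
proof -
  let ?d = "mdim M"
  note xc = wt_carrier[OF x]
  note c = weight_module_carrier[OF M]
  have neg: "- A *\<^sub>v x = (- 1) \<cdot>\<^sub>v (A *\<^sub>v x)" if "A \<in> carrier_mat ?d ?d" for A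
    using that xc by (subst uminus_mult_mat_vec) (auto intro!: eq_vecI)
  have "antipode M i *\<^sub>v x = (- 1) \<cdot>\<^sub>v (actKi M i *\<^sub>v (actE M i *\<^sub>v x))"
    unfolding antipode_def using c xc by (subst neg) (auto simp: assoc_mult_mat_vec[of _ ?d ?d _ ?d])
  then show "antipode M i *\<^sub>v x = (- q (- root_form i (l + simple_root i))) \<cdot>\<^sub>v (actE M i *\<^sub>v x)"
    unfolding Ki_weight[OF M E_weight[OF M x]] smult_smult_assoc by (simp only: mult_minus1)
  have "antipode_F M i *\<^sub>v x = (- 1) \<cdot>\<^sub>v (actF M i *\<^sub>v (actK M i *\<^sub>v x))"
    unfolding antipode_F_def using c xc by (subst neg) (auto simp: assoc_mult_mat_vec[of _ ?d ?d _ ?d])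
  also have "actF M i *\<^sub>v (actK M i *\<^sub>v x) = q (root_form i l) \<cdot>\<^sub>v (actF M i *\<^sub>v x)"
    unfolding K_weight[OF x] using c xc by (simp add: mult_mat_vec[of _ ?d ?d])
  finally show "antipode_F M i *\<^sub>v x = (- q (root_form i l)) \<cdot>\<^sub>v (actF M i *\<^sub>v x)"
    unfolding smult_smult_assoc by (simp only: mult_minus1)
qed

lemma antipode_rel:
  assumes M: "weight_module M"
  shows "actKi M i * actKi M j = actKi M j * actKi M i"
    and "actK M i * antipode M j * actKi M i = q (root_form i (simple_root j)) \<cdot>\<^sub>m antipode M j"
    and "actK M i * antipode_F M j * actKi M i = q (- root_form i (simple_root j)) \<cdot>\<^sub>m antipode_F M j"
    and "antipode_F M j * antipode M i - antipode M i * antipode_F M j =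
      (if i = j then (1 / (q (sy i) - q (- sy i))) \<cdot>\<^sub>m (actKi M i - actK M i) else 0\<^sub>m (mdim M) (mdim M))"
proof -
  let ?d = "mdim M"
  note c = weight_module_carrier[OF M] antipode_carrier[OF M]
  note eqI = weight_module_eqI[OF M, where n = ?d]
  note assoc = assoc_mult_mat_vec[of _ ?d ?d _ ?d] and scal = mult_mat_vec[of _ ?d ?d]
  show "actKi M i * actKi M j = actKi M j * actKi M i"
  proof (rule eqI)
    fix l x assume x: "x \<in> weight_space Q M l"
    show "actKi M i * actKi M j *\<^sub>v x = actKi M j * actKi M i *\<^sub>v x"
      using c wt_carrier[OF x] by (simp add: assoc scal Ki_weight[OF M x] smult_smult_assoc mult.commute)
  qed (use c in simp_all)
  show "actK M i * antipode M j * actKi M i = q (root_form i (simple_root j)) \<cdot>\<^sub>m antipode M j"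
  proof (rule eqI)
    fix l x assume x: "x \<in> weight_space Q M l"
    note xc = wt_carrier[OF x]
    have "actK M i *\<^sub>v (antipode M j *\<^sub>v x) = q (root_form i (l + simple_root j)) \<cdot>\<^sub>v (antipode M j *\<^sub>v x)"
      unfolding antipode_apply[OF M x] using c xc K_weight[OF E_weight[OF M x, of j], of i]
      by (simp add: scal smult_smult_assoc mult.commute)
    then show "actK M i * antipode M j * actKi M i *\<^sub>v x = q (root_form i (simple_root j)) \<cdot>\<^sub>m antipode M j *\<^sub>v x"
      using c xc by (simp add: assoc scal Ki_weight[OF M x] smult_smult_assoc smult_mat_vec[of _ ?d ?d] q_add[symmetric])
  qed (use c in simp_all)
  show "actK M i * antipode_F M j * actKi M i = q (- root_form i (simple_root j)) \<cdot>\<^sub>m antipode_F M j"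
  proof (rule eqI)
    fix l x assume x: "x \<in> weight_space Q M l"
    note xc = wt_carrier[OF x]
    have "actK M i *\<^sub>v (antipode_F M j *\<^sub>v x) = q (root_form i (l - simple_root j)) \<cdot>\<^sub>v (antipode_F M j *\<^sub>v x)"
      unfolding antipode_apply[OF M x] using c xc K_weight[OF F_weight[OF M x, of j], of i]
      by (simp add: scal smult_smult_assoc mult.commute)
    then show "actK M i * antipode_F M j * actKi M i *\<^sub>v x = q (- root_form i (simple_root j)) \<cdot>\<^sub>m antipode_F M j *\<^sub>v x"
      using c xc by (simp add: assoc scal Ki_weight[OF M x] smult_smult_assoc smult_mat_vec[of _ ?d ?d] q_add[symmetric])
  qed (use c in simp_all)
  show "antipode_F M j * antipode M i - antipode M i * antipode_F M j =
      (if i = j then (1 / (q (sy i) - q (- sy i))) \<cdot>\<^sub>m (actKi M i - actK M i) else 0\<^sub>m ?d ?d)"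
  proof (rule eqI)
    fix l x assume x: "x \<in> weight_space Q M l"
    note xc = wt_carrier[OF x]
    define P where "P = actF M j *\<^sub>v (actE M i *\<^sub>v x)"
    have P: "P \<in> carrier_vec ?d" using c xc by (simp add: P_def)
    define cc where "cc = q (- root_form i (l + simple_root i)) * q (root_form j (l + simple_root i))"
    have "antipode_F M j *\<^sub>v (antipode M i *\<^sub>v x) = cc \<cdot>\<^sub>v P"
      unfolding antipode_apply(1)[OF M x] using c xc antipode_apply(2)[OF M E_weight[OF M x, of i], of j]
      by (simp add: scal smult_smult_assoc P_def cc_def)
    moreover have "antipode M i *\<^sub>v (antipode_F M j *\<^sub>v x) = cc \<cdot>\<^sub>v (P + (if i = j then qbr i l else 0) \<cdot>\<^sub>v x)"
    proof -
      have "q (root_form j l) * q (- root_form i (l - simple_root j + simple_root i)) = cc"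
        by (simp add: cc_def q_add[symmetric] form_sym[of "simple_root j" "simple_root i"])
      then show ?thesis
        unfolding antipode_apply(2)[OF M x] using c xc antipode_apply(1)[OF M F_weight[OF M x, of j], of i]
        by (simp add: scal smult_smult_assoc P_def EF_weight[OF M x, of i j])
    qed
    moreover have "(antipode_F M j * antipode M i - antipode M i * antipode_F M j) *\<^sub>v x =
        antipode_F M j *\<^sub>v (antipode M i *\<^sub>v x) - antipode M i *\<^sub>v (antipode_F M j *\<^sub>v x)"
      using c xc by (simp add: minus_mult_distrib_mat_vec[of _ ?d ?d] assoc)
    ultimately have "(antipode_F M j * antipode M i - antipode M i * antipode_F M j) *\<^sub>v x =
        (- (cc * (if i = j then qbr i l else 0))) \<cdot>\<^sub>v x"
      using P xc by (auto simp: distrib_left intro!: eq_vecI)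
    also have "\<dots> = (if i = j then (1 / (q (sy i) - q (- sy i))) \<cdot>\<^sub>m (actKi M i - actK M i) else 0\<^sub>m ?d ?d) *\<^sub>v x"
    proof (cases "i = j")
      case True
      have "cc = 1" unfolding cc_def True q_add[symmetric] by simp
      have "actKi M i - actK M i \<in> carrier_mat ?d ?d" using c by (simp add: minus_carrier_mat)
      then have "(1 / (q (sy i) - q (- sy i))) \<cdot>\<^sub>m (actKi M i - actK M i) *\<^sub>v x =
          (1 / (q (sy i) - q (- sy i))) \<cdot>\<^sub>v (actKi M i *\<^sub>v x - actK M i *\<^sub>v x)"
        using xc c by (simp add: smult_mat_vec[of _ ?d ?d] minus_mult_distrib_mat_vec[of _ ?d ?d])
      also have "\<dots> = (- qbr i l) \<cdot>\<^sub>v x"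
        using xc by (auto simp: K_weight[OF x] Ki_weight[OF M x] qbr_def diff_divide_distrib left_diff_distrib intro!: eq_vecI)
      finally show ?thesis using True \<open>cc = 1\<close> by simp
    qed (use xc in \<open>auto intro!: eq_vecI\<close>)
    finally show "(antipode_F M j * antipode M i - antipode M i * antipode_F M j) *\<^sub>v x =
      (if i = j then (1 / (q (sy i) - q (- sy i))) \<cdot>\<^sub>m (actKi M i - actK M i) else 0\<^sub>m ?d ?d) *\<^sub>v x" .
  qed (use c in \<open>simp_all add: minus_carrier_mat\<close>)
qed

lemma qrel_dual:
  assumes M: "weight_module M"
  shows "qrel (dual_module M)"
proof -
  let ?d = "mdim M"
  note c = weight_module_carrier[OF M] antipode_carrier[OF M]
  have tr: "transpose_mat A * transpose_mat B = transpose_mat (B * A)"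
    if "A \<in> carrier_mat ?d ?d" "B \<in> carrier_mat ?d ?d" for A B :: "'k mat"
    using transpose_mult[OF that(2,1)] by simp
  note sm = transpose_smult
  have conj: "transpose_mat (actKi M i) * transpose_mat A * transpose_mat (actK M i) = a \<cdot>\<^sub>m transpose_mat A"
    if "A \<in> carrier_mat ?d ?d" "actK M i * A * actKi M i = a \<cdot>\<^sub>m A" for A a i
  proof -
    have "transpose_mat (actKi M i) * transpose_mat A * transpose_mat (actK M i) = transpose_mat (actK M i * (A * actKi M i))"
      using that(1) c by (simp add: tr)
    also have "actK M i * (A * actKi M i) = a \<cdot>\<^sub>m A"
      using that c assoc_mult_mat[of "actK M i" ?d ?d A ?d "actKi M i" ?d] by simp
    finally show ?thesis by (simp only: sm)
  qed
  have 1: "transpose_mat (actKi M i) * transpose_mat (actK M i) = 1\<^sub>m ?d"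
    "transpose_mat (actK M i) * transpose_mat (actKi M i) = 1\<^sub>m ?d" for i
    using c by (simp_all add: tr weight_module_rel[OF M])
  have 2: "transpose_mat (actKi M i) * transpose_mat (actKi M j) = transpose_mat (actKi M j) * transpose_mat (actKi M i)" for i j
    using c antipode_rel(1)[OF M, of i j] by (simp add: tr)
  have 3: "transpose_mat (antipode M i) * transpose_mat (antipode_F M j) - transpose_mat (antipode_F M j) * transpose_mat (antipode M i) =
      (if i = j then (1 / (q (sy i) - q (- sy i))) \<cdot>\<^sub>m (transpose_mat (actKi M i) - transpose_mat (actK M i)) else 0\<^sub>m ?d ?d)" for i j
  proof -
    have "transpose_mat (antipode M i) * transpose_mat (antipode_F M j) - transpose_mat (antipode_F M j) * transpose_mat (antipode M i) =
        transpose_mat (antipode_F M j * antipode M i - antipode M i * antipode_F M j)"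
      using c by (simp add: tr transpose_minus[of _ ?d ?d])
    also have "\<dots> = (if i = j then (1 / (q (sy i) - q (- sy i))) \<cdot>\<^sub>m (transpose_mat (actKi M i) - transpose_mat (actK M i)) else 0\<^sub>m ?d ?d)"
      unfolding antipode_rel(4)[OF M] using c by (auto simp: sm transpose_minus[of _ ?d ?d])
    finally show ?thesis .
  qed
  show ?thesis
    unfolding qrel_def dual_sel
    using c 1 2 3 conj[OF c(5) antipode_rel(2)[OF M]] conj[OF c(6) antipode_rel(3)[OF M]]
    by (simp add: root_form_simple_root)
qed

lemma weight_diag_add:
  assumes M: "weight_module M"
  shows "weight_diag M (\<lambda>l. f l + g l) = weight_diag M f + weight_diag M g"
proof (rule weight_module_eqI[OF M, where n = "mdim M"])
  fix l x assume l: "l \<in> weights Q" and x: "x \<in> weight_space Q M l"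
  then show "weight_diag M (\<lambda>l. f l + g l) *\<^sub>v x = (weight_diag M f + weight_diag M g) *\<^sub>v x"
    using wt_carrier[OF x] M
    by (simp add: add_mult_distrib_mat_vec[of _ "mdim M" "mdim M"] weight_diag_apply[OF M l x] add_smult_distrib_vec)
qed (use M in simp_all)

lemma weight_module_dual[simp]:
  assumes M: "weight_module M"
  shows "weight_module (dual_module M)"
  unfolding weight_module_def
proof (intro conjI qrel_dual[OF M])
  let ?d = "mdim M" and ?S = "\<Union>l\<in>weights Q. weight_space Q (dual_module M) l"
  obtain L where L: "finite L" "L \<subseteq> weights Q"
    and nz: "\<And>l x. l \<in> weights Q \<Longrightarrow> x \<in> weight_space Q M l \<Longrightarrow> x \<noteq> 0\<^sub>v ?d \<Longrightarrow> l \<in> L"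
    using finitely_many_weights[OF M] by metis
  let ?P = "\<lambda>A. weight_diag M (\<lambda>l. if l \<in> A then 1 else 0)"
  have Pc: "?P A \<in> carrier_mat ?d ?d" for A using M by simp
  \<comment> \<open>\<open>?P A\<close> projects to the sum of the weight spaces with weight in A,
    and L contains every weight that occurs.\<close>
  have one: "?P L = 1\<^sub>m ?d"
  proof (rule weight_module_eqI[OF M Pc])
    fix l x assume l: "l \<in> weights Q" and x: "x \<in> weight_space Q M l"
    show "?P L *\<^sub>v x = 1\<^sub>m ?d *\<^sub>v x"
      using weight_diag_apply[OF M l x, of "\<lambda>l. if l \<in> L then 1 else 0"] nz[OF l x] wt_carrier[OF x] by fastforce
  qed simp
  \<comment> \<open>A transposed projection to weight l lands in weight -l of the dual. Splitting
    the identity into such projections therefore writes each vector as a sum of weight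
    vectors.\<close>
  have single: "transpose_mat (?P {l}) *\<^sub>v v \<in> weight_space Q (dual_module M) (- l)"
    if l: "l \<in> weights Q" and v: "v \<in> carrier_vec ?d" for l v
  proof -
    have "?P {l} * actKi M i = q (- root_form i l) \<cdot>\<^sub>m ?P {l}" for i
    proof (rule weight_module_eqI[OF M, where n = ?d])
      fix m x assume m: "m \<in> weights Q" and x: "x \<in> weight_space Q M m"
      show "?P {l} * actKi M i *\<^sub>v x = q (- root_form i l) \<cdot>\<^sub>m ?P {l} *\<^sub>v x"
        using M wt_carrier[OF x] weight_diag_apply[OF M m x, of "\<lambda>k. if k \<in> {l} then 1 else 0"]
        by (cases "m = l") (auto simp: assoc_mult_mat_vec[of _ ?d ?d _ ?d] Ki_weight[OF M x] mult_mat_vec[of _ ?d ?d] smult_mat_vec[of _ ?d ?d])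
    qed (use M in simp_all)
    note PKi = this
    have "transpose_mat (actKi M i) * transpose_mat (?P {l}) = q (- root_form i l) \<cdot>\<^sub>m transpose_mat (?P {l})" for i
      unfolding transpose_mult[OF Pc weight_module_carrier(4)[OF M], symmetric] PKi by (rule transpose_smult)
    note tr = this
    have Pt: "transpose_mat (?P {l}) \<in> carrier_mat ?d ?d" using Pc by (rule transpose_carrier_mat[THEN iffD2])
    have Kt: "transpose_mat (actKi M i) \<in> carrier_mat ?d ?d" for i using M by simp
    have "transpose_mat (actKi M i) *\<^sub>v (transpose_mat (?P {l}) *\<^sub>v v) = q (- root_form i l) \<cdot>\<^sub>v (transpose_mat (?P {l}) *\<^sub>v v)" for i
      unfolding assoc_mult_mat_vec[OF Kt Pt v, symmetric] tr by (rule smult_mat_vec[OF Pt v])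
    then show ?thesis using square_mult_vec_carrier[OF Pt v] unfolding weight_space_def dual_sel form_minus by blast
  qed
  have "transpose_mat (?P A) *\<^sub>v v \<in> lin ?d ?S" if "finite A" "A \<subseteq> weights Q" "v \<in> carrier_vec ?d" for A v
    using that
  proof (induction A rule: finite_induct)
    case empty
    have "?P {} = 0\<^sub>m ?d ?d"
    proof (rule weight_module_eqI[OF M Pc])
      fix l x assume l: "l \<in> weights Q" and x: "x \<in> weight_space Q M l"
      show "?P {} *\<^sub>v x = 0\<^sub>m ?d ?d *\<^sub>v x"
        using weight_diag_apply[OF M l x, of "\<lambda>l. if l \<in> {} then 1 else 0"] wt_carrier[OF x] by (auto intro!: eq_vecI)
    qed simp
    then have "transpose_mat (?P {}) *\<^sub>v v = 0\<^sub>v ?d" using empty by (auto intro!: eq_vecI)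
    then show ?case using lin.zero[of ?d ?S] by simp
  next
    case (insert l A)
    have "?P (insert l A) = weight_diag M (\<lambda>k. (if k \<in> {l} then 1 else 0) + (if k \<in> A then 1 else 0))"
      using insert(2) by (intro arg_cong[of _ _ "weight_diag M"] ext) auto
    also have "\<dots> = ?P {l} + ?P A" by (rule weight_diag_add[OF M])
    finally have sum: "?P (insert l A) = ?P {l} + ?P A" .
    have Pt: "transpose_mat (?P B) \<in> carrier_mat ?d ?d" for B using Pc by (rule transpose_carrier_mat[THEN iffD2])
    have "transpose_mat (?P (insert l A)) *\<^sub>v v = transpose_mat (?P {l}) *\<^sub>v v + transpose_mat (?P A) *\<^sub>v v"
      unfolding sum transpose_add[OF Pc Pc] by (rule add_mult_distrib_mat_vec[OF Pt Pt insert(5)])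
    moreover have "transpose_mat (?P {l}) *\<^sub>v v \<in> lin ?d ?S"
      using single[of l v] insert weights_minus[of l] by (intro lin.base) blast
    moreover have "transpose_mat (?P A) *\<^sub>v v \<in> lin ?d ?S" using insert by blast
    ultimately show ?case by (simp only: lin.add)
  qed
  from this[OF L] have "carrier_vec ?d \<subseteq> lin ?d ?S" unfolding one transpose_one by (auto simp del: dual_sel)
  moreover have "?S \<subseteq> carrier_vec ?d" using wt_carrier[of _ "dual_module M"] by auto
  ultimately show "spans (mdim (dual_module M)) ?S" by (simp add: spans_def)
qed

end

section \<open>The action of the R-matrix\<close>

lemma mat_lincomb_mono_neutral:
  assumes "finite T" "S \<subseteq> T" "\<And>s. s \<in> T - S \<Longrightarrow> X s = 0\<^sub>m d d"
  shows "mat_lincomb d c X S = mat_lincomb d c (X :: _ \<Rightarrow> 'k::field mat) T"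
proof (rule eq_matI)
  fix i j assume "i < dim_row (mat_lincomb d c X T)" "j < dim_col (mat_lincomb d c X T)"
  then have ij: "i < d" "j < d" by (simp_all add: mat_lincomb_def)
  show "mat_lincomb d c X S $$ (i, j) = mat_lincomb d c X T $$ (i, j)"
    unfolding index_mat_lincomb[OF ij] using assms ij by (intro sum.mono_neutral_left) auto
qed (simp_all add: mat_lincomb_def)

lemma kron_one_mat_lincomb:
  fixes X :: "'x \<Rightarrow> 'k::field mat"
  assumes X: "\<And>s. s \<in> S \<Longrightarrow> X s \<in> carrier_mat n n"
  shows "kron (1\<^sub>m m) (mat_lincomb n c X S) = mat_lincomb (m * n) c (\<lambda>s. kron (1\<^sub>m m) (X s)) S"
proof (rule eq_matI)
  fix i j assume "i < dim_row (mat_lincomb (m * n) c (\<lambda>s. kron (1\<^sub>m m) (X s)) S)"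
    "j < dim_col (mat_lincomb (m * n) c (\<lambda>s. kron (1\<^sub>m m) (X s)) S)"
  then have ij: "i < m * n" "j < m * n" by (simp_all add: mat_lincomb_def)
  note dm = div_mod_less[OF ij(1)] div_mod_less[OF ij(2)]
  have "kron (1\<^sub>m m) (X s) $$ (i, j) = (1\<^sub>m m) $$ (i div n, j div n) * X s $$ (i mod n, j mod n)" if "s \<in> S" for s
    using X[OF that] ij by (simp add: kron_def)
  then have "(\<Sum>s\<in>S. c s * kron (1\<^sub>m m) (X s) $$ (i, j)) =
      (\<Sum>s\<in>S. c s * ((1\<^sub>m m) $$ (i div n, j div n) * X s $$ (i mod n, j mod n)))"
    by (intro sum.cong refl) simp
  also have "\<dots> = (1\<^sub>m m) $$ (i div n, j div n) * (\<Sum>s\<in>S. c s * X s $$ (i mod n, j mod n))"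
    by (simp add: sum_distrib_left algebra_simps)
  also have "\<dots> = kron (1\<^sub>m m) (mat_lincomb n c X S) $$ (i, j)"
    using ij dm by (simp add: kron_def mat_lincomb_def)
  finally show "kron (1\<^sub>m m) (mat_lincomb n c X S) $$ (i, j) =
      mat_lincomb (m * n) c (\<lambda>s. kron (1\<^sub>m m) (X s)) S $$ (i, j)"
    using ij by (simp add: index_mat_lincomb)
qed (simp_all add: mat_lincomb_def)

lemma kron_zero:
  "kron (0\<^sub>m a b) (B :: 'k::field mat) = 0\<^sub>m (a * dim_row B) (b * dim_col B)"
  "kron (A :: 'k mat) (0\<^sub>m a b) = 0\<^sub>m (dim_row A * a) (dim_col A * b)"
proof -
  show "kron (0\<^sub>m a b) B = 0\<^sub>m (a * dim_row B) (b * dim_col B)"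
    by (auto simp: kron_def div_mod_less(1) intro!: eq_matI)
  show "kron A (0\<^sub>m a b) = 0\<^sub>m (dim_row A * a) (dim_col A * b)"
  proof (rule eq_matI)
    fix i j assume "i < dim_row (0\<^sub>m (dim_row A * a) (dim_col A * b) :: 'k mat)" "j < dim_col (0\<^sub>m (dim_row A * a) (dim_col A * b) :: 'k mat)"
    then have ij: "i < dim_row A * a" "j < dim_col A * b" by simp_all
    show "kron A (0\<^sub>m a b) $$ (i, j) = 0\<^sub>m (dim_row A * a) (dim_col A * b) $$ (i, j)"
      using ij div_mod_less(2)[OF ij(1)] div_mod_less(2)[OF ij(2)] by (simp add: kron_def)
  qed simp_all
qed

lemma kron_one_mult:
  fixes A A' B B' :: "'k::field mat"
  shows "A \<in> carrier_mat m m \<Longrightarrow> B \<in> carrier_mat n n \<Longrightarrow> kron A (1\<^sub>m n) * kron (1\<^sub>m m) B = kron A B"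
    and "A \<in> carrier_mat m m \<Longrightarrow> B \<in> carrier_mat n n \<Longrightarrow> kron (1\<^sub>m m) B * kron A (1\<^sub>m n) = kron A B"
    and "B \<in> carrier_mat n n \<Longrightarrow> B' \<in> carrier_mat n n \<Longrightarrow> kron (1\<^sub>m m) B * kron (1\<^sub>m m) B' = kron (1\<^sub>m m) (B * B')"
    and "A \<in> carrier_mat m m \<Longrightarrow> A' \<in> carrier_mat m m \<Longrightarrow> kron A (1\<^sub>m n) * kron A' (1\<^sub>m n) = kron (A * A') (1\<^sub>m n)"
  by (subst kron_mult[of _ m m _ m _ n n _ n]; simp)+

lemma kron_one_mult_vec:
  fixes A A' B B' :: "'k::field mat"
  assumes z: "z \<in> carrier_vec (m * n)"
  shows "A \<in> carrier_mat m m \<Longrightarrow> B \<in> carrier_mat n n \<Longrightarrow> kron A (1\<^sub>m n) *\<^sub>v (kron (1\<^sub>m m) B *\<^sub>v z) = kron A B *\<^sub>v z"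
    and "A \<in> carrier_mat m m \<Longrightarrow> B \<in> carrier_mat n n \<Longrightarrow> kron (1\<^sub>m m) B *\<^sub>v (kron A (1\<^sub>m n) *\<^sub>v z) = kron A B *\<^sub>v z"
    and "B \<in> carrier_mat n n \<Longrightarrow> B' \<in> carrier_mat n n \<Longrightarrow>
      kron (1\<^sub>m m) B *\<^sub>v (kron (1\<^sub>m m) B' *\<^sub>v z) = kron (1\<^sub>m m) (B * B') *\<^sub>v z"
    and "A \<in> carrier_mat m m \<Longrightarrow> A' \<in> carrier_mat m m \<Longrightarrow>
      kron A (1\<^sub>m n) *\<^sub>v (kron A' (1\<^sub>m n) *\<^sub>v z) = kron (A * A') (1\<^sub>m n) *\<^sub>v z"
proof -
  have L: "kron A (1\<^sub>m n) \<in> carrier_mat (m * n) (m * n)" if "A \<in> carrier_mat m m" for A :: "'k mat"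
    using that by (intro kron_carrier) auto
  have R: "kron (1\<^sub>m m) B \<in> carrier_mat (m * n) (m * n)" if "B \<in> carrier_mat n n" for B :: "'k mat"
    using that by (intro kron_carrier) auto
  show "kron A (1\<^sub>m n) *\<^sub>v (kron (1\<^sub>m m) B *\<^sub>v z) = kron A B *\<^sub>v z" if "A \<in> carrier_mat m m" "B \<in> carrier_mat n n"
    using assoc_mult_mat_vec[OF L[OF that(1)] R[OF that(2)] z] kron_one_mult(1)[OF that] by metis
  show "kron (1\<^sub>m m) B *\<^sub>v (kron A (1\<^sub>m n) *\<^sub>v z) = kron A B *\<^sub>v z" if "A \<in> carrier_mat m m" "B \<in> carrier_mat n n"
    using assoc_mult_mat_vec[OF R[OF that(2)] L[OF that(1)] z] kron_one_mult(2)[OF that] by metis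
  show "kron (1\<^sub>m m) B *\<^sub>v (kron (1\<^sub>m m) B' *\<^sub>v z) = kron (1\<^sub>m m) (B * B') *\<^sub>v z"
    if "B \<in> carrier_mat n n" "B' \<in> carrier_mat n n"
    using assoc_mult_mat_vec[OF R[OF that(1)] R[OF that(2)] z] kron_one_mult(3)[OF that, of m] by metis
  show "kron A (1\<^sub>m n) *\<^sub>v (kron A' (1\<^sub>m n) *\<^sub>v z) = kron (A * A') (1\<^sub>m n) *\<^sub>v z"
    if "A \<in> carrier_mat m m" "A' \<in> carrier_mat m m"
    using assoc_mult_mat_vec[OF L[OF that(1)] L[OF that(2)] z] kron_one_mult(4)[OF that, of n] by metis
qed

section \<open>Truncations of the quasi-R-matrix\<close>

definition word_pairs :: "nat \<Rightarrow> ('i list \<times> 'i list) set" where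
  "word_pairs B = {(u, w). mset u = mset w \<and> length u < B}"

lemma finite_word_pairs: "finite (word_pairs B :: ('i::finite list \<times> 'i list) set)"
proof -
  have "word_pairs B \<subseteq> {u :: 'i list. set u \<subseteq> UNIV \<and> length u \<le> B} \<times> {u. set u \<subseteq> UNIV \<and> length u \<le> B}"
    by (auto simp: word_pairs_def dest!: mset_eq_length)
  then show ?thesis
    using finite_lists_length_le[of "UNIV :: 'i set" B] by (meson finite_SigmaI finite_subset finite_UNIV)
qed

lemma word_pairs_mono: "A \<le> B \<Longrightarrow> word_pairs A \<subseteq> word_pairs B"
  by (auto simp: word_pairs_def)

context qdatum
begin

text \<open>The operators K_i on either factor, indexed by a sum type, have the pure tensors of
  weight vectors as joint eigenvectors, labelled by pairs of weights. Any function of the pair is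
  then an operator; q(form) gives the operator in the R-matrix and q(- form) its inverse.\<close>

lemma weight_pair_diag:
  fixes phi :: "('i \<Rightarrow> rat) \<Rightarrow> ('i \<Rightarrow> rat) \<Rightarrow> 'k"
  assumes M: "weight_module M" and N: "weight_module N"
  shows "\<exists>D\<in>carrier_mat (mdim M * mdim N) (mdim M * mdim N).
    \<forall>l\<in>weights Q. \<forall>m\<in>weights Q. \<forall>x\<in>weight_space Q M l. \<forall>y\<in>weight_space Q N m.
      D *\<^sub>v kron_vec x y = phi l m \<cdot>\<^sub>v kron_vec x y"
proof -
  let ?d = "mdim M * mdim N"
  let ?T = "case_sum (\<lambda>i. kron (actK M i) (1\<^sub>m (mdim N))) (\<lambda>i. kron (1\<^sub>m (mdim M)) (actK N i))"
  let ?chi = "\<lambda>(l, m). case_sum (weight_char l) (weight_char m)"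
  have T: "?T j \<in> carrier_mat ?d ?d" for j
    using M N by (cases j) (auto intro!: kron_carrier)
  have mem: "kron_vec x y \<in> joint_eigenspace ?d ?T (?chi (l, m))"
    if "x \<in> weight_space Q M l" "y \<in> weight_space Q N m" for x y l m
  proof -
    note xc = wt_carrier[OF that(1)] and yc = wt_carrier[OF that(2)]
    have "?T j *\<^sub>v kron_vec x y = ?chi (l, m) j \<cdot>\<^sub>v kron_vec x y" for j
      using M N xc yc K_weight[OF that(1)] K_weight[OF that(2)]
      by (cases j) (auto simp: kron_one_left_mult_vec[of _ "mdim N"] kron_one_right_mult_vec[of _ "mdim M" _ _ "mdim N"]
          kron_vec_linear weight_char_def)
    then show ?thesis using xc yc by (simp add: joint_eigenspace_def)
  qed
  have inj: "inj_on ?chi (weights Q \<times> weights Q)"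
  proof (rule inj_onI, clarify)
    fix l m l' m' assume eq: "case_sum (weight_char l) (weight_char m) = case_sum (weight_char l') (weight_char m')"
    have "weight_char l i = weight_char l' i" "weight_char m i = weight_char m' i" for i
      using fun_cong[OF eq, of "Inl i"] fun_cong[OF eq, of "Inr i"] by auto
    then have "weight_char l = weight_char l'" "weight_char m = weight_char m'" by auto
    then show "l = l' \<and> m = m'" using inj_weight_char[of UNIV] by (auto dest: injD)
  qed
  have sp: "spans ?d (\<Union>w\<in>weights Q \<times> weights Q. joint_eigenspace ?d ?T (?chi w))"
  proof (rule spans_mono[OF spans_kron_vec[OF spans_weight_spaces[OF M] spans_weight_spaces[OF N]]])
    show "{kron_vec x y | x y. x \<in> weight_vectors M \<and> y \<in> weight_vectors N} \<subseteq>
        (\<Union>w\<in>weights Q \<times> weights Q. joint_eigenspace ?d ?T (?chi w))"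
      using mem by blast
  qed (auto simp: joint_eigenspace_def)
  obtain D where D: "D \<in> carrier_mat ?d ?d"
    and D': "\<forall>w\<in>weights Q \<times> weights Q. \<forall>v\<in>joint_eigenspace ?d ?T (?chi w). D *\<^sub>v v = (case w of (l, m) \<Rightarrow> phi l m) \<cdot>\<^sub>v v"
    using joint_eigenspaces(2)[OF T inj sp] by blast
  show ?thesis
  proof (rule bexI[OF _ D], intro ballI)
    fix l m x y assume "l \<in> weights Q" "m \<in> weights Q" "x \<in> weight_space Q M l" "y \<in> weight_space Q N m"
    then show "D *\<^sub>v kron_vec x y = phi l m \<cdot>\<^sub>v kron_vec x y"
      using bspec[OF D', of "(l, m)"] mem[of x l y m] by simp
  qed
qed

lemma weight_form_action:
  assumes M: "weight_module M" and N: "weight_module N"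
  shows weight_form_carrier: "weight_form_action Q M N \<in> carrier_mat (mdim M * mdim N) (mdim M * mdim N)"
    and weight_form_apply: "l \<in> weights Q \<Longrightarrow> m \<in> weights Q \<Longrightarrow> x \<in> weight_space Q M l \<Longrightarrow> y \<in> weight_space Q N m \<Longrightarrow>
      weight_form_action Q M N *\<^sub>v kron_vec x y = q (form Q l m) \<cdot>\<^sub>v kron_vec x y"
proof -
  let ?d = "mdim M * mdim N"
  let ?P = "\<lambda>D. D \<in> carrier_mat ?d ?d \<and> (\<forall>l\<in>weights Q. \<forall>m\<in>weights Q. \<forall>x\<in>weight_space Q M l. \<forall>y\<in>weight_space Q N m.
        D *\<^sub>v kron_vec x y = q (form Q l m) \<cdot>\<^sub>v kron_vec x y)"
  obtain D where PD: "?P D" using weight_pair_diag[OF M N, of "\<lambda>l m. q (form Q l m)"] by blast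
  have "?P (THE D. ?P D)"
  proof (rule theI[of ?P, OF PD])
    fix D' assume D': "?P D'"
    show "D' = D"
    proof (rule weight_kron_eqI[OF M N])
      fix l m x y assume "l \<in> weights Q" "m \<in> weights Q" "x \<in> weight_space Q M l" "y \<in> weight_space Q N m"
      then show "D' *\<^sub>v kron_vec x y = D *\<^sub>v kron_vec x y" using D' PD by simp
    qed (use D' PD in blast)+
  qed
  then show "weight_form_action Q M N \<in> carrier_mat ?d ?d"
    "l \<in> weights Q \<Longrightarrow> m \<in> weights Q \<Longrightarrow> x \<in> weight_space Q M l \<Longrightarrow> y \<in> weight_space Q N m \<Longrightarrow>
      weight_form_action Q M N *\<^sub>v kron_vec x y = q (form Q l m) \<cdot>\<^sub>v kron_vec x y"
    unfolding weight_form_action_def by blast+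
qed

lemma weight_form_invertible:
  assumes M: "weight_module M" and N: "weight_module N"
  shows "\<exists>D'\<in>carrier_mat (mdim M * mdim N) (mdim M * mdim N). D' * weight_form_action Q M N = 1\<^sub>m (mdim M * mdim N)"
proof -
  let ?d = "mdim M * mdim N"
  obtain D' where D': "D' \<in> carrier_mat ?d ?d" and app: "\<And>l m x y. l \<in> weights Q \<Longrightarrow> m \<in> weights Q \<Longrightarrow>
      x \<in> weight_space Q M l \<Longrightarrow> y \<in> weight_space Q N m \<Longrightarrow> D' *\<^sub>v kron_vec x y = q (- form Q l m) \<cdot>\<^sub>v kron_vec x y"
    using weight_pair_diag[OF M N, of "\<lambda>l m. q (- form Q l m)"] by blast
  have "D' * weight_form_action Q M N = 1\<^sub>m ?d"
  proof (rule weight_kron_eqI[OF M N, where a = ?d])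
    fix l m x y assume h: "l \<in> weights Q" "m \<in> weights Q" "x \<in> weight_space Q M l" "y \<in> weight_space Q N m"
      and c: "x \<in> carrier_vec (mdim M)" "y \<in> carrier_vec (mdim N)"
    show "D' * weight_form_action Q M N *\<^sub>v kron_vec x y = 1\<^sub>m ?d *\<^sub>v kron_vec x y"
      unfolding assoc_mult_mat_vec[OF D' weight_form_carrier[OF M N] kron_vec_carrier[OF c]] weight_form_apply[OF M N h]
        mult_mat_vec[OF D' kron_vec_carrier[OF c]] app[OF h]
      using kron_vec_carrier[OF c] by (simp add: smult_smult_assoc)
  qed (use D' weight_form_carrier[OF M N] in simp_all)
  then show ?thesis using D' by blast
qed

definition theta :: "('i list \<Rightarrow> 'i list \<Rightarrow> 'k) \<Rightarrow> nat \<Rightarrow> ('i, 'k) qmodule \<Rightarrow> ('i, 'k) qmodule \<Rightarrow> 'k mat" where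
  "theta c B M N = mat_lincomb (mdim M * mdim N) (\<lambda>(u, w). c u w)
     (\<lambda>(u, w). kron (word_act (mdim M) (actE M) u) (word_act (mdim N) (actF N) w)) (word_pairs B)"

lemma theta_carrier[simp]: "theta c B M N \<in> carrier_mat (mdim M * mdim N) (mdim M * mdim N)"
  by (simp add: theta_def)

lemma quasi_R_eq_theta: "quasi_R_action c M N = theta c (mdim M) M N"
  by (simp add: quasi_R_action_def theta_def word_pairs_def)

lemma theta_bound_aux:
  assumes M: "weight_module M" and N: "weight_module N" and B: "A \<le> B" "mdim M \<le> A \<or> mdim N \<le> A"
  shows "theta c A M N = theta c B M N"
  unfolding theta_def
proof (rule mat_lincomb_mono_neutral[OF finite_word_pairs word_pairs_mono[OF B(1)]])
  fix s :: "'i list \<times> 'i list" assume s: "s \<in> word_pairs B - word_pairs A"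
  obtain u w where uw: "s = (u, w)" by (cases s)
  then have len: "A \<le> length u" "length w = length u" using s by (auto simp: word_pairs_def dest: mset_eq_length)
  have c: "word_act (mdim M) (actE M) u \<in> carrier_mat (mdim M) (mdim M)" "word_act (mdim N) (actF N) w \<in> carrier_mat (mdim N) (mdim N)"
    using M N by simp_all
  have "word_act (mdim M) (actE M) u = 0\<^sub>m (mdim M) (mdim M) \<or> word_act (mdim N) (actF N) w = 0\<^sub>m (mdim N) (mdim N)"
    using B(2) len word_act_E_vanish[OF M, of u] word_act_F_vanish[OF N, of w] by linarith
  then show "(case s of (u, w) \<Rightarrow> kron (word_act (mdim M) (actE M) u) (word_act (mdim N) (actF N) w)) =
      0\<^sub>m (mdim M * mdim N) (mdim M * mdim N)"
    using c uw by (auto simp: kron_zero)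
qed

text \<open>Words at least as long as the dimension of either module act by zero there, so all these
  truncations agree. \<open>quasi_R_action\<close> truncates by the first module, while later
  arguments want a bound from the second one, or a bound common to two different first
  modules.\<close>

lemma theta_bound:
  assumes M: "weight_module M" and N: "weight_module N" and B: "mdim M \<le> B \<or> mdim N \<le> B"
  shows "quasi_R_action c M N = theta c B M N"
proof -
  \<comment> \<open>Both truncations are compared with the shortest admissible one.\<close>
  let ?m = "min (mdim M) (mdim N)"
  have "theta c ?m M N = theta c (mdim M) M N" using M N by (intro theta_bound_aux) auto
  moreover have "theta c ?m M N = theta c B M N" using M N B by (intro theta_bound_aux) auto
  ultimately show ?thesis by (simp add: quasi_R_eq_theta)
qed

text \<open>The product of the two legs of the quasi-R-matrix with the inverse antipode applied to
  the E-leg; u is reversed since an antipode reverses products. The bound is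
  \<open>Suc (mdim N)\<close> so that the pair of empty words belongs to the sum even when
  \<open>mdim N\<close> is 0.\<close>

definition casimir_sum :: "('i list \<Rightarrow> 'i list \<Rightarrow> 'k) \<Rightarrow> ('i, 'k) qmodule \<Rightarrow> 'k mat" where
  "casimir_sum c N = mat_lincomb (mdim N) (\<lambda>(u, w). c u w)
     (\<lambda>(u, w). word_act (mdim N) (actF N) w * word_act (mdim N) (antipode N) (rev u)) (word_pairs (Suc (mdim N)))"

lemma casimir_sum_carrier[simp]: "casimir_sum c N \<in> carrier_mat (mdim N) (mdim N)"
  by (simp add: casimir_sum_def)

text \<open>On a vector killed by all E the antipode allows moving the first leg of the quasi-R-matrix to
  the second one, where it becomes a Casimir-type element.\<close>

lemma theta_singular:
  assumes M: "weight_module M" and N: "weight_module N" and z: "z \<in> carrier_vec (mdim M * mdim N)"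
    and E: "\<And>i. actE (tensor M N) i *\<^sub>v z = 0\<^sub>v (mdim M * mdim N)"
  shows "quasi_R_action c M N *\<^sub>v z = kron (1\<^sub>m (mdim M)) (casimir_sum c N) *\<^sub>v z"
proof -
  let ?m = "mdim M" and ?n = "mdim N"
  let ?d = "?m * ?n"
  note cM = weight_module_carrier[OF M] and cN = weight_module_carrier[OF N] antipode_carrier[OF N]
  have L: "kron A (1\<^sub>m ?n) \<in> carrier_mat ?d ?d" if "A \<in> carrier_mat ?m ?m" for A :: "'k mat" using that by (intro kron_carrier) auto
  have R: "kron (1\<^sub>m ?m) B \<in> carrier_mat ?d ?d" if "B \<in> carrier_mat ?n ?n" for B :: "'k mat" using that by (intro kron_carrier) auto
  note assoc = assoc_mult_mat_vec[of _ ?d ?d _ ?d]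
  note LR = kron_one_mult_vec(1,2)[OF z] and RR = kron_one_mult_vec(3)[OF z]
  \<comment> \<open>Apply the inverse of K_i on the second leg to the equation saying that E_i kills
    z.\<close>
  have step: "kron (actE M i) (1\<^sub>m ?n) *\<^sub>v z = kron (1\<^sub>m ?m) (antipode N i) *\<^sub>v z" for i
  proof -
    have "kron (actE M i) (actK N i) *\<^sub>v z + kron (1\<^sub>m ?m) (actE N i) *\<^sub>v z = 0\<^sub>v ?d"
      using E[of i] cM cN z add_mult_distrib_mat_vec[of "kron (actE M i) (actK N i)" ?d ?d "kron (1\<^sub>m ?m) (actE N i)" z]
      by (simp add: kron_carrier)
    then have "kron (1\<^sub>m ?m) (actKi N i) *\<^sub>v (kron (actE M i) (actK N i) *\<^sub>v z + kron (1\<^sub>m ?m) (actE N i) *\<^sub>v z) = 0\<^sub>v ?d"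
      using R[OF cN(4)] by simp
    moreover have "kron (1\<^sub>m ?m) (actKi N i) *\<^sub>v (kron (actE M i) (actK N i) *\<^sub>v z + kron (1\<^sub>m ?m) (actE N i) *\<^sub>v z) =
        kron (1\<^sub>m ?m) (actKi N i) *\<^sub>v (kron (actE M i) (actK N i) *\<^sub>v z) + kron (1\<^sub>m ?m) (actKi N i) *\<^sub>v (kron (1\<^sub>m ?m) (actE N i) *\<^sub>v z)"
      using cM cN z by (intro mult_add_distrib_mat_vec[of _ ?d ?d] square_mult_vec_carrier kron_carrier) auto
    moreover have "kron (1\<^sub>m ?m) (actKi N i) *\<^sub>v (kron (actE M i) (actK N i) *\<^sub>v z) = kron (actE M i) (1\<^sub>m ?n) *\<^sub>v z"
    proof -
      have "kron (1\<^sub>m ?m) (actKi N i) * kron (actE M i) (actK N i) = kron (actE M i) (1\<^sub>m ?n)"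
        using kron_mult[OF one_carrier_mat cM(1) cN(4) cN(3), of i i i] weight_module_rel(2)[OF N] left_mult_one_mat[OF cM(1)]
        by simp
      then show ?thesis
        using assoc_mult_mat_vec[OF R[OF cN(4)] kron_carrier[OF cM(1) cN(3)] z, of i i i] by metis
    qed
    moreover have "kron (1\<^sub>m ?m) (actKi N i) *\<^sub>v (kron (1\<^sub>m ?m) (actE N i) *\<^sub>v z) = kron (1\<^sub>m ?m) (actKi N i * actE N i) *\<^sub>v z"
      using RR cN by simp
    moreover have "kron (1\<^sub>m ?m) (antipode N i) *\<^sub>v z = - (kron (1\<^sub>m ?m) (actKi N i * actE N i) *\<^sub>v z)"
    proof -
      have "antipode N i = (- 1) \<cdot>\<^sub>m (actKi N i * actE N i)" unfolding antipode_def using cN by (auto intro!: eq_matI)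
      then have "kron (1\<^sub>m ?m) (antipode N i) = (- 1) \<cdot>\<^sub>m kron (1\<^sub>m ?m) (actKi N i * actE N i)" by (simp add: kron_linear(4))
      then show ?thesis using z cN R[of "actKi N i * actE N i"] by (auto simp: smult_mat_vec[of _ ?d ?d] intro!: eq_vecI)
    qed
    ultimately have "kron (actE M i) (1\<^sub>m ?n) *\<^sub>v z + kron (1\<^sub>m ?m) (actKi N i * actE N i) *\<^sub>v z = 0\<^sub>v ?d" by simp
    moreover have "a = - b" if "a + b = 0\<^sub>v ?d" "a \<in> carrier_vec ?d" "b \<in> carrier_vec ?d" for a b :: "'k vec"
    proof (rule eq_vecI)
      fix k assume "k < dim_vec (- b)"
      then show "a $ k = (- b) $ k" using arg_cong[OF that(1), of "\<lambda>v. v $ k"] that(2,3) by (simp add: eq_neg_iff_add_eq_0)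
    qed (use that in simp)
    ultimately show ?thesis
      using \<open>kron (1\<^sub>m ?m) (antipode N i) *\<^sub>v z = - (kron (1\<^sub>m ?m) (actKi N i * actE N i) *\<^sub>v z)\<close>
        square_mult_vec_carrier[OF L[OF cM(1)] z] square_mult_vec_carrier[OF R z, of "actKi N i * actE N i"] cN by simp
  qed
  have wE: "word_act ?m (actE M) u \<in> carrier_mat ?m ?m" "word_act ?n (actF N) u \<in> carrier_mat ?n ?n"
    "word_act ?n (antipode N) u \<in> carrier_mat ?n ?n" for u using cM cN by simp_all
  \<comment> \<open>Letters move across one at a time. Operators on different legs commute, so each
    new letter ends up to the right of those already moved, and the word is reversed.\<close>
  have word: "kron (word_act ?m (actE M) u) (1\<^sub>m ?n) *\<^sub>v z = kron (1\<^sub>m ?m) (word_act ?n (antipode N) (rev u)) *\<^sub>v z" for u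
  proof (induction u)
    case Nil then show ?case by simp
  next
    case (Cons i u)
    have "kron (word_act ?m (actE M) (i # u)) (1\<^sub>m ?n) *\<^sub>v z = kron (actE M i) (1\<^sub>m ?n) *\<^sub>v (kron (word_act ?m (actE M) u) (1\<^sub>m ?n) *\<^sub>v z)"
      unfolding kron_one_mult_vec(4)[OF z cM(1) wE(1)] by simp
    also have "\<dots> = kron (1\<^sub>m ?m) (word_act ?n (antipode N) (rev u)) *\<^sub>v (kron (actE M i) (1\<^sub>m ?n) *\<^sub>v z)"
      unfolding Cons LR[OF cM(1) wE(3)] ..
    also have "\<dots> = kron (1\<^sub>m ?m) (word_act ?n (antipode N) (rev u) * antipode N i) *\<^sub>v z"
      unfolding step by (rule RR[OF wE(3) cN(5)])
    also have "word_act ?n (antipode N) (rev u) * antipode N i = word_act ?n (antipode N) (rev (i # u))"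
      using cN by (simp add: word_act_append right_mult_one_mat[OF cN(5)])
    finally show ?case .
  qed
  have "quasi_R_action c M N *\<^sub>v z = theta c (Suc ?n) M N *\<^sub>v z"
    using theta_bound[OF M N, of "Suc ?n"] by simp
  also have "\<dots> = mat_lincomb ?d (\<lambda>(u, w). c u w)
     (\<lambda>s. kron (1\<^sub>m ?m) (case s of (u, w) \<Rightarrow> word_act ?n (actF N) w * word_act ?n (antipode N) (rev u))) (word_pairs (Suc ?n)) *\<^sub>v z"
    unfolding theta_def
  proof (rule mat_lincomb_mult_vec_cong[OF _ _ z z])
    fix s :: "'i list \<times> 'i list"
    obtain u w where s: "s = (u, w)" by (cases s)
    show "(case s of (u, w) \<Rightarrow> kron (word_act ?m (actE M) u) (word_act ?n (actF N) w)) \<in> carrier_mat ?d ?d"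
      unfolding s using wE by (auto intro!: kron_carrier)
    show "kron (1\<^sub>m ?m) (case s of (u, w) \<Rightarrow> word_act ?n (actF N) w * word_act ?n (antipode N) (rev u)) \<in> carrier_mat ?d ?d"
      unfolding s using wE by (auto intro!: R)
    have "kron (word_act ?m (actE M) u) (word_act ?n (actF N) w) *\<^sub>v z =
        kron (1\<^sub>m ?m) (word_act ?n (actF N) w) *\<^sub>v (kron (word_act ?m (actE M) u) (1\<^sub>m ?n) *\<^sub>v z)"
      using LR(2)[OF wE(1,2)] by simp
    also have "\<dots> = kron (1\<^sub>m ?m) (word_act ?n (actF N) w * word_act ?n (antipode N) (rev u)) *\<^sub>v z"
      unfolding word by (rule RR[OF wE(2,3)])
    finally show "(case s of (u, w) \<Rightarrow> kron (word_act ?m (actE M) u) (word_act ?n (actF N) w)) *\<^sub>v z =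
      kron (1\<^sub>m ?m) (case s of (u, w) \<Rightarrow> word_act ?n (actF N) w * word_act ?n (antipode N) (rev u)) *\<^sub>v z"
      unfolding s by simp
  qed
  also have "\<dots> = kron (1\<^sub>m ?m) (casimir_sum c N) *\<^sub>v z"
    unfolding casimir_sum_def using wE by (subst kron_one_mat_lincomb) auto
  finally show ?thesis .
qed

end

section \<open>The Casimir operator\<close>

lemma smult_add_swap:
  fixes a b :: "'k::field vec"
  assumes "a \<in> carrier_vec n" "b \<in> carrier_vec n"
  shows "p * p' = s \<Longrightarrow> r = s * t \<Longrightarrow> p \<cdot>\<^sub>v (p' \<cdot>\<^sub>v a) + r \<cdot>\<^sub>v b = s \<cdot>\<^sub>v (t \<cdot>\<^sub>v b + a)"
    and "p * p' = s \<Longrightarrow> r = s * t \<Longrightarrow> r \<cdot>\<^sub>v a + p \<cdot>\<^sub>v (p' \<cdot>\<^sub>v b) = s \<cdot>\<^sub>v (b + t \<cdot>\<^sub>v a)"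
  using assms by (auto simp: algebra_simps intro!: eq_vecI)

locale braided = qdatum Q for Q :: "('i::finite, 'k::field_char_0) quantum_datum" +
  fixes R :: "('i, 'k) qmodule \<Rightarrow> ('i, 'k) qmodule \<Rightarrow> 'k mat"
    and c :: "'i list \<Rightarrow> 'i list \<Rightarrow> 'k"
  assumes c_Nil: "c [] [] = 1"
    and R_eq: "weight_module M \<Longrightarrow> weight_module N \<Longrightarrow>
      R M N = flip_mat (mdim M) (mdim N) * (weight_form_action Q M N * quasi_R_action c M N)"
    and R_hom: "weight_module M \<Longrightarrow> weight_module N \<Longrightarrow> module_hom (tensor M N) (tensor N M) (R M N)"
begin

lemma R_carrier: "weight_module M \<Longrightarrow> weight_module N \<Longrightarrow> R M N \<in> carrier_mat (mdim N * mdim M) (mdim M * mdim N)"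
  using R_hom by (simp add: module_hom_def)

lemma quasi_R_carrier[simp]: "quasi_R_action c M N \<in> carrier_mat (mdim M * mdim N) (mdim M * mdim N)"
  by (simp add: quasi_R_eq_theta)

lemma R_apply:
  assumes M: "weight_module M" and N: "weight_module N" and v: "v \<in> carrier_vec (mdim M * mdim N)"
  shows "R M N *\<^sub>v v = flip_mat (mdim M) (mdim N) *\<^sub>v (weight_form_action Q M N *\<^sub>v (quasi_R_action c M N *\<^sub>v v))"
  unfolding R_eq[OF M N]
  using assoc_mult_mat_vec[OF flip_mat_carrier mult_carrier_mat[OF weight_form_carrier[OF M N] quasi_R_carrier] v]
    assoc_mult_mat_vec[OF weight_form_carrier[OF M N] quasi_R_carrier v] by metis

lemma flip_form_inj:
  assumes M: "weight_module M" and N: "weight_module N"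
    and v: "v \<in> carrier_vec (mdim M * mdim N)" and w: "w \<in> carrier_vec (mdim M * mdim N)"
    and eq: "flip_mat (mdim M) (mdim N) *\<^sub>v (weight_form_action Q M N *\<^sub>v v) =
      flip_mat (mdim M) (mdim N) *\<^sub>v (weight_form_action Q M N *\<^sub>v w)"
  shows "v = w"
proof -
  let ?m = "mdim M" and ?n = "mdim N"
  let ?D = "weight_form_action Q M N"
  obtain D' where D': "D' \<in> carrier_mat (?m * ?n) (?m * ?n)" "D' * ?D = 1\<^sub>m (?m * ?n)"
    using weight_form_invertible[OF M N] by blast
  note D = weight_form_carrier[OF M N]
  have "D' *\<^sub>v (flip_mat ?n ?m *\<^sub>v (flip_mat ?m ?n *\<^sub>v (?D *\<^sub>v u))) = u" if u: "u \<in> carrier_vec (?m * ?n)" for u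
  proof -
    have Du: "?D *\<^sub>v u \<in> carrier_vec (?m * ?n)" using D u by simp
    have "flip_mat ?n ?m *\<^sub>v (flip_mat ?m ?n *\<^sub>v (?D *\<^sub>v u)) = ?D *\<^sub>v u"
      using assoc_mult_mat_vec[OF flip_mat_carrier flip_mat_carrier Du] Du unfolding flip_mat_flip by simp
    then show ?thesis using assoc_mult_mat_vec[OF D'(1) D u] D'(2) u by simp
  qed
  from this[OF v] this[OF w] eq show ?thesis by metis
qed

section \<open>The quasi-R-matrix as an intertwiner\<close>

definition bar_E :: "('i, 'k) qmodule \<Rightarrow> ('i, 'k) qmodule \<Rightarrow> 'i \<Rightarrow> 'k mat" where
  "bar_E M N i = kron (actE M i) (actKi N i) + kron (1\<^sub>m (mdim M)) (actE N i)"

text \<open>\<open>bar_E\<close> and \<open>bar_F\<close> form the bar-conjugate comultiplication,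
  in which K and its inverse are exchanged. The quasi-R-matrix intertwines the original
  comultiplication with this one.\<close>

definition bar_F :: "('i, 'k) qmodule \<Rightarrow> ('i, 'k) qmodule \<Rightarrow> 'i \<Rightarrow> 'k mat" where
  "bar_F M N i = kron (actF M i) (1\<^sub>m (mdim N)) + kron (actK M i) (actF N i)"

lemma bar_carrier:
  assumes M: "weight_module M" and N: "weight_module N"
  shows "bar_E M N i \<in> carrier_mat (mdim M * mdim N) (mdim M * mdim N)"
    "bar_F M N i \<in> carrier_mat (mdim M * mdim N) (mdim M * mdim N)"
  using M N by (auto simp: bar_E_def bar_F_def intro!: kron_carrier add_carrier_mat)

lemma bar_apply:
  assumes M: "weight_module M" and N: "weight_module N"
    and x: "x \<in> weight_space Q M l" and y: "y \<in> weight_space Q N m"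
  shows "bar_E M N i *\<^sub>v kron_vec x y = q (- root_form i m) \<cdot>\<^sub>v kron_vec (actE M i *\<^sub>v x) y + kron_vec x (actE N i *\<^sub>v y)"
    and "bar_F M N i *\<^sub>v kron_vec x y = kron_vec (actF M i *\<^sub>v x) y + q (root_form i l) \<cdot>\<^sub>v kron_vec x (actF N i *\<^sub>v y)"
proof -
  let ?m = "mdim M" and ?n = "mdim N"
  note xc = wt_carrier[OF x] and yc = wt_carrier[OF y]
  note c = weight_module_carrier[OF M] weight_module_carrier[OF N]
  note k = kron_mult_kron_vec[of _ ?m ?m _ ?n ?n]
  have add: "(kron A B + kron A' B') *\<^sub>v kron_vec x y = kron A B *\<^sub>v kron_vec x y + kron A' B' *\<^sub>v kron_vec x y"
    if "A \<in> carrier_mat ?m ?m" "B \<in> carrier_mat ?n ?n" "A' \<in> carrier_mat ?m ?m" "B' \<in> carrier_mat ?n ?n" for A B A' B'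
    using that xc yc by (intro add_mult_distrib_mat_vec[of _ "?m * ?n" "?m * ?n"] kron_carrier kron_vec_carrier)
  note sc = K_weight[OF x] K_weight[OF y] Ki_weight[OF M x] Ki_weight[OF N y]
  show "bar_E M N i *\<^sub>v kron_vec x y = q (- root_form i m) \<cdot>\<^sub>v kron_vec (actE M i *\<^sub>v x) y + kron_vec x (actE N i *\<^sub>v y)"
    unfolding bar_E_def using c xc yc by (simp add: add k sc kron_vec_linear(3,4))
  show "bar_F M N i *\<^sub>v kron_vec x y = kron_vec (actF M i *\<^sub>v x) y + q (root_form i l) \<cdot>\<^sub>v kron_vec x (actF N i *\<^sub>v y)"
    unfolding bar_F_def using c xc yc by (simp add: add k sc kron_vec_linear(3,4))
qed

text \<open>On a tensor product of weight vectors, passing E_i or F_i through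
  \<open>weight_form_action\<close> changes its scalar by exactly the power of q by which the
  bar-conjugate comultiplication differs from the flipped original one.\<close>

lemma bar_intertwine:
  assumes M: "weight_module M" and N: "weight_module N" and v: "v \<in> carrier_vec (mdim M * mdim N)"
  shows "actE (tensor N M) i *\<^sub>v (flip_mat (mdim M) (mdim N) *\<^sub>v (weight_form_action Q M N *\<^sub>v v)) =
      flip_mat (mdim M) (mdim N) *\<^sub>v (weight_form_action Q M N *\<^sub>v (bar_E M N i *\<^sub>v v))" (is ?E)
    and "actF (tensor N M) i *\<^sub>v (flip_mat (mdim M) (mdim N) *\<^sub>v (weight_form_action Q M N *\<^sub>v v)) =
      flip_mat (mdim M) (mdim N) *\<^sub>v (weight_form_action Q M N *\<^sub>v (bar_F M N i *\<^sub>v v))" (is ?F)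
proof -
  let ?m = "mdim M" and ?n = "mdim N"
  let ?D = "weight_form_action Q M N" and ?f = "flip_mat (mdim M) (mdim N) :: 'k mat"
  note D = weight_form_carrier[OF M N]
  note f = flip_mat_carrier[of ?m ?n, where 'a = 'k]
  note T = tensor_carrier[OF N M] and bar = bar_carrier[OF M N]
  have fD: "?f * ?D \<in> carrier_mat (?n * ?m) (?m * ?n)" using f D by (rule mult_carrier_mat)
  have vec: "A * (?f * ?D) *\<^sub>v u = A *\<^sub>v (?f *\<^sub>v (?D *\<^sub>v u))" "?f * (?D * B) *\<^sub>v u = ?f *\<^sub>v (?D *\<^sub>v (B *\<^sub>v u))"
    if "A \<in> carrier_mat (?n * ?m) (?n * ?m)" "B \<in> carrier_mat (?m * ?n) (?m * ?n)" "u \<in> carrier_vec (?m * ?n)" for A B u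
    using assoc_mult_mat_vec[OF that(1) fD that(3)] assoc_mult_mat_vec[OF f D that(3)]
      assoc_mult_mat_vec[OF f square_mult_carrier[OF D that(2)] that(3)] assoc_mult_mat_vec[OF D that(2,3)] by simp_all
  have main: "actE (tensor N M) i *\<^sub>v (?f *\<^sub>v (?D *\<^sub>v z)) = ?f *\<^sub>v (?D *\<^sub>v (bar_E M N i *\<^sub>v z)) \<and>
        actF (tensor N M) i *\<^sub>v (?f *\<^sub>v (?D *\<^sub>v z)) = ?f *\<^sub>v (?D *\<^sub>v (bar_F M N i *\<^sub>v z))"
    if z: "z = kron_vec x y" and lm: "l \<in> weights Q" "m \<in> weights Q"
      and x: "x \<in> weight_space Q M l" and y: "y \<in> weight_space Q N m" for z x y l m
  proof -
    note xc = wt_carrier[OF x] and yc = wt_carrier[OF y]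
    note cM = weight_module_carrier[OF M] and cN = weight_module_carrier[OF N]
    let ?s = "q (form Q l m)"
    have kc: "kron_vec a b \<in> carrier_vec (?m * ?n)" "kron_vec b a \<in> carrier_vec (?n * ?m)"
      if "a \<in> carrier_vec ?m" "b \<in> carrier_vec ?n" for a b :: "'k vec" using that by simp_all
    have fDw: "?f *\<^sub>v (?D *\<^sub>v kron_vec a b) = q (form Q la lb) \<cdot>\<^sub>v kron_vec b a"
      if "la \<in> weights Q" "lb \<in> weights Q" "a \<in> weight_space Q M la" "b \<in> weight_space Q N lb" for a b la lb
      using weight_form_apply[OF M N that] flip_mat_kron_vec[OF wt_carrier[OF that(3)] wt_carrier[OF that(4)]]
        mult_mat_vec[OF f kc(1)[OF wt_carrier[OF that(3)] wt_carrier[OF that(4)]]] by simp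
    note dist = mult_add_distrib_mat_vec[OF D] mult_add_distrib_mat_vec[OF f] mult_mat_vec[OF D] mult_mat_vec[OF f]
    have Ex: "actE M i *\<^sub>v x \<in> carrier_vec ?m" "actF M i *\<^sub>v x \<in> carrier_vec ?m" using cM xc by auto
    have Ey: "actE N i *\<^sub>v y \<in> carrier_vec ?n" "actF N i *\<^sub>v y \<in> carrier_vec ?n" using cN yc by auto
    note fDs = fDw[OF lm x y] fDw[OF weights_add[OF lm(1) weights_simple_root] lm(2) E_weight[OF M x] y]
      fDw[OF lm(1) weights_add[OF lm(2) weights_simple_root] x E_weight[OF N y]]
      fDw[OF weights_diff[OF lm(1) weights_simple_root] lm(2) F_weight[OF M x] y]
      fDw[OF lm(1) weights_diff[OF lm(2) weights_simple_root] x F_weight[OF N y]]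
    have "actE (tensor N M) i *\<^sub>v (?f *\<^sub>v (?D *\<^sub>v z)) =
        ?s \<cdot>\<^sub>v (q (root_form i l) \<cdot>\<^sub>v kron_vec (actE N i *\<^sub>v y) x + kron_vec y (actE M i *\<^sub>v x))"
      unfolding z fDs mult_mat_vec[OF tensor_carrier(1)[OF N M] kc(2)[OF xc yc]] tensor_apply[OF N M y x] ..
    moreover have "?f *\<^sub>v (?D *\<^sub>v (bar_E M N i *\<^sub>v z)) =
        q (- root_form i m) \<cdot>\<^sub>v (?f *\<^sub>v (?D *\<^sub>v kron_vec (actE M i *\<^sub>v x) y)) + ?f *\<^sub>v (?D *\<^sub>v kron_vec x (actE N i *\<^sub>v y))"
      unfolding z bar_apply[OF M N x y] using D kc(1)[OF Ex(1) yc] kc(1)[OF xc Ey(1)] by (simp add: dist)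
    moreover have "\<dots> = ?s \<cdot>\<^sub>v (q (root_form i l) \<cdot>\<^sub>v kron_vec (actE N i *\<^sub>v y) x + kron_vec y (actE M i *\<^sub>v x))"
      unfolding fDs
      by (rule smult_add_swap(1)[OF kc(2)[OF Ex(1) yc] kc(2)[OF xc Ey(1)]])
        (simp_all add: form_sym[of l "simple_root i"] q_add[symmetric])
    moreover have "actF (tensor N M) i *\<^sub>v (?f *\<^sub>v (?D *\<^sub>v z)) =
        ?s \<cdot>\<^sub>v (kron_vec (actF N i *\<^sub>v y) x + q (- root_form i m) \<cdot>\<^sub>v kron_vec y (actF M i *\<^sub>v x))"
      unfolding z fDs mult_mat_vec[OF tensor_carrier(2)[OF N M] kc(2)[OF xc yc]] tensor_apply[OF N M y x] ..
    moreover have "?f *\<^sub>v (?D *\<^sub>v (bar_F M N i *\<^sub>v z)) =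
        ?f *\<^sub>v (?D *\<^sub>v kron_vec (actF M i *\<^sub>v x) y) + q (root_form i l) \<cdot>\<^sub>v (?f *\<^sub>v (?D *\<^sub>v kron_vec x (actF N i *\<^sub>v y)))"
      unfolding z bar_apply[OF M N x y] using D kc(1)[OF Ex(2) yc] kc(1)[OF xc Ey(2)] by (simp add: dist)
    moreover have "\<dots> = ?s \<cdot>\<^sub>v (kron_vec (actF N i *\<^sub>v y) x + q (- root_form i m) \<cdot>\<^sub>v kron_vec y (actF M i *\<^sub>v x))"
      unfolding fDs
      by (rule smult_add_swap(2)[OF kc(2)[OF Ex(2) yc] kc(2)[OF xc Ey(2)]])
        (simp_all add: form_sym[of l "simple_root i"] q_add[symmetric])
    ultimately show "actE (tensor N M) i *\<^sub>v (?f *\<^sub>v (?D *\<^sub>v z)) = ?f *\<^sub>v (?D *\<^sub>v (bar_E M N i *\<^sub>v z)) \<and>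
        actF (tensor N M) i *\<^sub>v (?f *\<^sub>v (?D *\<^sub>v z)) = ?f *\<^sub>v (?D *\<^sub>v (bar_F M N i *\<^sub>v z))" by simp
  qed
  have "actE (tensor N M) i * (?f * ?D) = ?f * (?D * bar_E M N i)"
    by (rule weight_kron_eqI[OF M N mult_carrier_mat[OF T(1) fD] mult_carrier_mat[OF f square_mult_carrier[OF D bar(1)]]])
      (simp only: vec[OF T(1) bar(1)] kron_vec_carrier conjunct1[OF main])
  then show ?E using vec[OF T(1) bar(1) v] by metis
  have "actF (tensor N M) i * (?f * ?D) = ?f * (?D * bar_F M N i)"
    by (rule weight_kron_eqI[OF M N mult_carrier_mat[OF T(2) fD] mult_carrier_mat[OF f square_mult_carrier[OF D bar(2)]]])
      (simp only: vec[OF T(2) bar(2)] kron_vec_carrier conjunct2[OF main])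
  then show ?F using vec[OF T(2) bar(2) v] by metis
qed

text \<open>The linearity of R with the invertible operator formed by the flip and the weight form
  cancelled.\<close>

lemma theta_intertwine:
  assumes M: "weight_module M" and N: "weight_module N" and v: "v \<in> carrier_vec (mdim M * mdim N)"
  shows "quasi_R_action c M N *\<^sub>v (actE (tensor M N) i *\<^sub>v v) = bar_E M N i *\<^sub>v (quasi_R_action c M N *\<^sub>v v)"
    and "quasi_R_action c M N *\<^sub>v (actF (tensor M N) i *\<^sub>v v) = bar_F M N i *\<^sub>v (quasi_R_action c M N *\<^sub>v v)"
proof -
  let ?d = "mdim M * mdim N"
  note T = tensor_carrier[OF M N] and T' = tensor_carrier[OF N M] and Rc = R_carrier[OF M N]
  have th: "quasi_R_action c M N *\<^sub>v v \<in> carrier_vec ?d" using v by simp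
  have "R M N * actE (tensor M N) i = actE (tensor N M) i * R M N"
    using R_hom[OF M N] unfolding module_hom_def by blast
  then have eqE: "R M N *\<^sub>v (actE (tensor M N) i *\<^sub>v v) = actE (tensor N M) i *\<^sub>v (R M N *\<^sub>v v)"
    by (simp only: assoc_mult_mat_vec[OF Rc T(1) v, symmetric] assoc_mult_mat_vec[OF T'(1) Rc v, symmetric])
  show "quasi_R_action c M N *\<^sub>v (actE (tensor M N) i *\<^sub>v v) = bar_E M N i *\<^sub>v (quasi_R_action c M N *\<^sub>v v)"
    by (rule flip_form_inj[OF M N square_mult_vec_carrier[OF quasi_R_carrier square_mult_vec_carrier[OF T(1) v]]
        square_mult_vec_carrier[OF bar_carrier(1)[OF M N] th]])
      (rule eqE[unfolded R_apply[OF M N v] R_apply[OF M N square_mult_vec_carrier[OF T(1) v]] bar_intertwine[OF M N th]])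
  have "R M N * actF (tensor M N) i = actF (tensor N M) i * R M N"
    using R_hom[OF M N] unfolding module_hom_def by blast
  then have eqF: "R M N *\<^sub>v (actF (tensor M N) i *\<^sub>v v) = actF (tensor N M) i *\<^sub>v (R M N *\<^sub>v v)"
    by (simp only: assoc_mult_mat_vec[OF Rc T(2) v, symmetric] assoc_mult_mat_vec[OF T'(2) Rc v, symmetric])
  show "quasi_R_action c M N *\<^sub>v (actF (tensor M N) i *\<^sub>v v) = bar_F M N i *\<^sub>v (quasi_R_action c M N *\<^sub>v v)"
    by (rule flip_form_inj[OF M N square_mult_vec_carrier[OF quasi_R_carrier square_mult_vec_carrier[OF T(2) v]]
        square_mult_vec_carrier[OF bar_carrier(2)[OF M N] th]])
      (rule eqF[unfolded R_apply[OF M N v] R_apply[OF M N square_mult_vec_carrier[OF T(2) v]] bar_intertwine[OF M N th]])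
qed

text \<open>In the tensor product of the dual of N with N the vector \<open>coev\<close> is killed
  by E and F. Hence its image under the quasi-R-matrix is killed by \<open>bar_E\<close> and
  \<open>bar_F\<close>, and by \<open>theta_singular\<close> that image is
  \<open>casimir_sum\<close> applied to the second leg. Sliding all operators to the second leg
  leaves an identity between operators on N.\<close>

lemma casimir_sum_EF:
  assumes N: "weight_module N"
  shows "actKi N i * casimir_sum c N * antipode N i + actE N i * casimir_sum c N = 0\<^sub>m (mdim N) (mdim N)"
    and "casimir_sum c N * antipode_F N i + actF N i * casimir_sum c N * actKi N i = 0\<^sub>m (mdim N) (mdim N)"
proof -
  let ?n = "mdim N" and ?M = "dual_module N" and ?P = "casimir_sum c N" and ?z = "coev (mdim N) :: 'k vec"
  let ?I = "1\<^sub>m ?n :: 'k mat"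
  have M: "weight_module ?M" using N by simp
  note cN = weight_module_carrier[OF N] antipode_carrier[OF N]
  have P: "?P \<in> carrier_mat ?n ?n" by simp
  have z: "?z \<in> carrier_vec (?n * ?n)" by simp
  \<comment> \<open>An operator transposed on the first leg reappears as the rightmost factor on the
    second.\<close>
  have slide: "kron (transpose_mat A) B *\<^sub>v (kron ?I C *\<^sub>v ?z) = kron ?I (B * C * A) *\<^sub>v ?z"
    if A: "A \<in> carrier_mat ?n ?n" and B: "B \<in> carrier_mat ?n ?n" and C: "C \<in> carrier_mat ?n ?n" for A B C :: "'k mat"
  proof -
    have At: "transpose_mat A \<in> carrier_mat ?n ?n" using A by simp
    have Cz: "kron ?I C *\<^sub>v ?z \<in> carrier_vec (?n * ?n)"
      by (rule square_mult_vec_carrier[OF kron_carrier[OF one_carrier_mat C] z])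
    have "kron (transpose_mat A) B *\<^sub>v (kron ?I C *\<^sub>v ?z) = kron ?I B *\<^sub>v (kron (transpose_mat A) ?I *\<^sub>v (kron ?I C *\<^sub>v ?z))"
      by (rule kron_one_mult_vec(2)[OF Cz At B, symmetric])
    also have "kron (transpose_mat A) ?I *\<^sub>v (kron ?I C *\<^sub>v ?z) = kron ?I C *\<^sub>v (kron (transpose_mat A) ?I *\<^sub>v ?z)"
      unfolding kron_one_mult_vec(1)[OF z At C] kron_one_mult_vec(2)[OF z At C] ..
    also have "\<dots> = kron ?I (C * A) *\<^sub>v ?z"
      unfolding kron_transpose_coev[OF A] by (rule kron_one_mult_vec(3)[OF z C A])
    also have "kron ?I B *\<^sub>v (kron ?I (C * A) *\<^sub>v ?z) = kron ?I (B * (C * A)) *\<^sub>v ?z"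
      using C A by (intro kron_one_mult_vec(3)[OF z B]) simp
    also have "B * (C * A) = B * C * A" using A B C by (simp add: assoc_mult_mat[of _ ?n ?n _ ?n _ ?n])
    finally show ?thesis .
  qed
  have one: "kron ?I A *\<^sub>v ?z = kron ?I A *\<^sub>v (kron ?I ?I *\<^sub>v ?z)" for A
    using z by (simp add: kron_one)
  have slide2: "kron ?I B *\<^sub>v (kron ?I C *\<^sub>v ?z) = kron ?I (B * C) *\<^sub>v ?z"
    if "B \<in> carrier_mat ?n ?n" "C \<in> carrier_mat ?n ?n" for B C :: "'k mat"
    by (rule kron_one_mult_vec(3)[OF z that])
  have add: "(kron A B + kron A' B') *\<^sub>v w = kron A B *\<^sub>v w + kron A' B' *\<^sub>v w"
    if "A \<in> carrier_mat ?n ?n" "B \<in> carrier_mat ?n ?n" "A' \<in> carrier_mat ?n ?n" "B' \<in> carrier_mat ?n ?n"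
      "w \<in> carrier_vec (?n * ?n)" for A B A' B' :: "'k mat" and w
    using that by (intro add_mult_distrib_mat_vec[of _ "?n * ?n" "?n * ?n"] kron_carrier)
  have add2: "kron ?I A *\<^sub>v ?z + kron ?I B *\<^sub>v ?z = kron ?I (A + B) *\<^sub>v ?z"
    if "A \<in> carrier_mat ?n ?n" "B \<in> carrier_mat ?n ?n" for A B :: "'k mat"
    unfolding kron_linear(2)[OF one_carrier_mat that]
    by (rule add_mult_distrib_mat_vec[symmetric, OF kron_carrier[OF one_carrier_mat that(1)] kron_carrier[OF one_carrier_mat that(2)] z])
  have zero: "kron ?I (0\<^sub>m ?n ?n) *\<^sub>v ?z = 0\<^sub>v (?n * ?n)"
    using z by (auto simp: kron_zero intro!: eq_vecI)
  have id2: "kron ?I ?I *\<^sub>v ?z = ?z" using z by (simp add: kron_one)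
  have tI: "transpose_mat ?I = ?I" by simp
  \<comment> \<open>Here the choice of the inverse antipode enters: K_i times
    \<open>antipode N i\<close> is minus E_i.\<close>
  have E0: "actE (tensor ?M N) i *\<^sub>v ?z = 0\<^sub>v (?n * ?n)" for i
  proof -
    have "actE (tensor ?M N) i *\<^sub>v ?z = kron (transpose_mat (antipode N i)) (actK N i) *\<^sub>v ?z + kron ?I (actE N i) *\<^sub>v ?z"
      using cN z by (simp add: add)
    also have "kron (transpose_mat (antipode N i)) (actK N i) *\<^sub>v ?z = kron ?I (actK N i * ?I * antipode N i) *\<^sub>v ?z"
      using slide[OF cN(5)[of i] cN(3)[of i] one_carrier_mat] unfolding id2 .
    also have "actK N i * ?I * antipode N i = - actE N i"
    proof -
      have "actK N i * antipode N i = - (actK N i * (actKi N i * actE N i))"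
        unfolding antipode_def using cN[of i] by (subst uminus_mult_right_mat) auto
      also have "actK N i * (actKi N i * actE N i) = actE N i"
        using assoc_mult_mat[OF cN(3)[of i] cN(4)[of i] cN(1)[of i]] left_mult_one_mat[OF cN(1)[of i]] by (simp add: weight_module_rel[OF N])
      finally show ?thesis using right_mult_one_mat[OF cN(3)[of i]] by simp
    qed
    also have "kron ?I (- actE N i) *\<^sub>v ?z + kron ?I (actE N i) *\<^sub>v ?z = 0\<^sub>v (?n * ?n)"
      using add2[of "- actE N i" "actE N i"] cN zero by (simp add: uminus_l_inv_mat[of _ ?n ?n])
    finally show ?thesis .
  qed
  have F0: "actF (tensor ?M N) i *\<^sub>v ?z = 0\<^sub>v (?n * ?n)" for i
  proof -
    have "actF (tensor ?M N) i *\<^sub>v ?z = kron (transpose_mat (antipode_F N i)) ?I *\<^sub>v ?z + kron (transpose_mat (actK N i)) (actF N i) *\<^sub>v ?z"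
      using cN z by (simp add: add)
    also have "kron (transpose_mat (actK N i)) (actF N i) *\<^sub>v ?z = kron ?I (actF N i * ?I * actK N i) *\<^sub>v ?z"
      using slide[OF cN(3)[of i] cN(2)[of i] one_carrier_mat] unfolding id2 .
    also have "actF N i * ?I * actK N i = actF N i * actK N i" using right_mult_one_mat[OF cN(2)[of i]] by simp
    also have "kron (transpose_mat (antipode_F N i)) ?I *\<^sub>v ?z = kron ?I (antipode_F N i) *\<^sub>v ?z"
      by (rule kron_transpose_coev[OF cN(6)[of i]])
    also have "kron ?I (antipode_F N i) *\<^sub>v ?z + kron ?I (actF N i * actK N i) *\<^sub>v ?z = 0\<^sub>v (?n * ?n)"
      using add2[of "antipode_F N i" "actF N i * actK N i"] cN zero
      by (simp add: antipode_F_def uminus_l_inv_mat[of _ ?n ?n])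
    finally show ?thesis .
  qed
  have th: "quasi_R_action c ?M N *\<^sub>v ?z = kron ?I ?P *\<^sub>v ?z"
    using theta_singular[OF M N, of ?z c] z E0 by simp
  have zM: "?z \<in> carrier_vec (mdim ?M * ?n)" by simp
  have Q0: "quasi_R_action c ?M N *\<^sub>v 0\<^sub>v (?n * ?n) = 0\<^sub>v (?n * ?n)"
    using quasi_R_carrier[of ?M N] by (simp del: quasi_R_carrier)
  have Pz: "kron ?I ?P *\<^sub>v ?z \<in> carrier_vec (?n * ?n)"
    by (rule square_mult_vec_carrier[OF kron_carrier[OF one_carrier_mat P] z])
  have "bar_E ?M N i *\<^sub>v (kron ?I ?P *\<^sub>v ?z) = 0\<^sub>v (?n * ?n)"
    using theta_intertwine(1)[OF M N zM, of i] unfolding E0 th Q0 by simp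
  moreover have "bar_E ?M N i *\<^sub>v (kron ?I ?P *\<^sub>v ?z) = kron ?I (actKi N i * ?P * antipode N i + actE N i * ?P) *\<^sub>v ?z"
    unfolding bar_E_def dual_sel
    using add[OF _ cN(4)[of i] one_carrier_mat cN(1)[of i] Pz, of "transpose_mat (antipode N i)"] cN(5)[of i]
      slide[OF cN(5)[of i] cN(4)[of i] P] slide2[OF cN(1)[of i] P]
      add2[OF square_mult_carrier[OF square_mult_carrier[OF cN(4)[of i] P] cN(5)[of i]] square_mult_carrier[OF cN(1)[of i] P]] by simp
  ultimately have "kron ?I (actKi N i * ?P * antipode N i + actE N i * ?P) *\<^sub>v ?z = kron ?I (0\<^sub>m ?n ?n) *\<^sub>v ?z"
    using zero by simp
  then show "actKi N i * ?P * antipode N i + actE N i * ?P = 0\<^sub>m ?n ?n"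
    using cN P by (intro kron_one_coev_inj[of _ ?n] add_carrier_mat square_mult_carrier) auto
  have "bar_F ?M N i *\<^sub>v (kron ?I ?P *\<^sub>v ?z) = 0\<^sub>v (?n * ?n)"
    using theta_intertwine(2)[OF M N zM, of i] unfolding F0 th Q0 by simp
  moreover have "bar_F ?M N i *\<^sub>v (kron ?I ?P *\<^sub>v ?z) = kron ?I (?P * antipode_F N i + actF N i * ?P * actKi N i) *\<^sub>v ?z"
    unfolding bar_F_def dual_sel
    using add[OF _ one_carrier_mat _ cN(2)[of i] Pz, of "transpose_mat (antipode_F N i)" "transpose_mat (actKi N i)"] cN(6)[of i] cN(4)[of i]
      slide[OF cN(6)[of i] one_carrier_mat P] slide[OF cN(4)[of i] cN(2)[of i] P] left_mult_one_mat[OF P]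
      add2[OF square_mult_carrier[OF P cN(6)[of i]] square_mult_carrier[OF square_mult_carrier[OF cN(2)[of i] P] cN(4)[of i]]] by simp
  ultimately have "kron ?I (?P * antipode_F N i + actF N i * ?P * actKi N i) *\<^sub>v ?z = kron ?I (0\<^sub>m ?n ?n) *\<^sub>v ?z"
    using zero by simp
  then show "?P * antipode_F N i + actF N i * ?P * actKi N i = 0\<^sub>m ?n ?n"
    using cN P by (intro kron_one_coev_inj[of _ ?n] add_carrier_mat square_mult_carrier) auto
qed

end

lemma mat_lincomb_insert:
  fixes X :: "'x \<Rightarrow> 'k::field mat"
  assumes "finite S" "s \<notin> S" "X s \<in> carrier_mat d d"
  shows "mat_lincomb d c X (insert s S) = c s \<cdot>\<^sub>m X s + mat_lincomb d c X S"
  using assms by (intro eq_matI) (auto simp: mat_lincomb_def)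

lemma mat_lincomb_mult_vec_closed:
  fixes X :: "'x \<Rightarrow> 'k::field mat"
  assumes "finite S" and X: "\<And>s. s \<in> S \<Longrightarrow> X s \<in> carrier_mat d d" and x: "x \<in> carrier_vec d"
    and V: "0\<^sub>v d \<in> V" "\<And>v w. v \<in> V \<Longrightarrow> w \<in> V \<Longrightarrow> v + w \<in> V" "\<And>a v. v \<in> V \<Longrightarrow> a \<cdot>\<^sub>v v \<in> V"
    and mem: "\<And>s. s \<in> S \<Longrightarrow> X s *\<^sub>v x \<in> V"
  shows "mat_lincomb d c X S *\<^sub>v x \<in> V"
  using assms(1) X mem
proof (induction S rule: finite_induct)
  case empty
  have "mat_lincomb d c X {} *\<^sub>v x = 0\<^sub>v d" using x by (auto simp: mat_lincomb_def scalar_prod_def intro!: eq_vecI)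
  then show ?case using V by simp
next
  case (insert s S)
  have Xs: "X s \<in> carrier_mat d d" using insert by simp
  have "mat_lincomb d c X (insert s S) *\<^sub>v x = c s \<cdot>\<^sub>v (X s *\<^sub>v x) + mat_lincomb d c X S *\<^sub>v x"
    unfolding mat_lincomb_insert[where X = X, OF insert(1,2) Xs]
    using Xs x by (simp add: add_mult_distrib_mat_vec[of _ d d] smult_mat_vec[of _ d d])
  then show ?case using insert V by simp
qed

lemma smult_add_eq_zero_imp:
  fixes a b :: "'k::field vec"
  assumes "a \<in> carrier_vec d" "b \<in> carrier_vec d" "(- s) \<cdot>\<^sub>v a + t \<cdot>\<^sub>v b = 0\<^sub>v d" "s \<noteq> 0"
  shows "a = (inverse s * t) \<cdot>\<^sub>v b"
proof (rule eq_vecI)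
  fix k assume "k < dim_vec ((inverse s * t) \<cdot>\<^sub>v b)"
  then have k: "k < d" using assms by simp
  have "- s * a $ k + t * b $ k = 0"
    using arg_cong[OF assms(3), of "\<lambda>v. v $ k"] assms(1,2) k by simp
  then have "s * a $ k = t * b $ k" by simp
  then show "a $ k = ((inverse s * t) \<cdot>\<^sub>v b) $ k"
    using assms k by (simp add: field_simps)
qed (use assms in simp)

context braided
begin

lemma word_act_antipode_weight:
  assumes M: "weight_module M" and x: "x \<in> weight_space Q M l"
  shows "word_act (mdim M) (antipode M) u *\<^sub>v x \<in> weight_space Q M (l + root_sum u)"
proof (induction u)
  case Nil
  have "1\<^sub>m (mdim M) *\<^sub>v x \<in> weight_space Q M (l + root_sum [])"
    using x wt_carrier[OF x] by simp
  then show ?case by simp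
next
  case (Cons i u)
  have 1: "word_act (mdim M) (antipode M) (i # u) *\<^sub>v x = antipode M i *\<^sub>v (word_act (mdim M) (antipode M) u *\<^sub>v x)"
    using M wt_carrier[OF x] by (simp add: assoc_mult_mat_vec[of _ "mdim M" "mdim M" _ "mdim M"])
  have 2: "l + root_sum u + simple_root i = l + root_sum (i # u)" by (simp add: algebra_simps)
  show ?case unfolding 1 antipode_apply[OF M Cons]
    using weight_space_smult[OF M E_weight[OF M Cons, of i]] unfolding 2 .
qed

lemma casimir_term_weight:
  assumes M: "weight_module M" and x: "x \<in> weight_space Q M l" and uw: "mset u = mset w"
  shows "word_act (mdim M) (actF M) w * word_act (mdim M) (antipode M) (rev u) *\<^sub>v x \<in> weight_space Q M l"
proof -
  have 1: "word_act (mdim M) (actF M) w * word_act (mdim M) (antipode M) (rev u) *\<^sub>v x =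
      word_act (mdim M) (actF M) w *\<^sub>v (word_act (mdim M) (antipode M) (rev u) *\<^sub>v x)"
    using M wt_carrier[OF x] by (simp add: assoc_mult_mat_vec[of _ "mdim M" "mdim M" _ "mdim M"])
  have "root_sum (rev u) = root_sum w" using uw by (intro root_sum_mset) simp
  then have 2: "l + root_sum (rev u) - root_sum w = l" by simp
  show ?thesis unfolding 1
    using word_act_F_weight[OF M word_act_antipode_weight[OF M x, of "rev u"], of w] unfolding 2 .
qed

lemma casimir_sum_weight:
  assumes M: "weight_module M" and x: "x \<in> weight_space Q M l"
  shows "casimir_sum c M *\<^sub>v x \<in> weight_space Q M l"
  unfolding casimir_sum_def
proof (rule mat_lincomb_mult_vec_closed[OF finite_word_pairs _ wt_carrier[OF x]])
  fix s :: "'i list \<times> 'i list" assume s: "s \<in> word_pairs (Suc (mdim M))"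
  show "(case s of (u, w) \<Rightarrow> word_act (mdim M) (actF M) w * word_act (mdim M) (antipode M) (rev u)) \<in> carrier_mat (mdim M) (mdim M)"
    using M by (cases s) simp
  show "(case s of (u, w) \<Rightarrow> word_act (mdim M) (actF M) w * word_act (mdim M) (antipode M) (rev u)) *\<^sub>v x \<in> weight_space Q M l"
    using s casimir_term_weight[OF M x] by (cases s) (simp add: word_pairs_def)
qed (use M in simp_all)

section \<open>The Casimir operator and singular vectors\<close>

definition casimir :: "('i, 'k) qmodule \<Rightarrow> 'k mat" where
  "casimir M = casimir_sum c M * weight_diag M (\<lambda>l. q (- cas l))"

lemma casimir_carrier[simp]: "weight_module M \<Longrightarrow> casimir M \<in> carrier_mat (mdim M) (mdim M)"
  by (simp add: casimir_def)

lemma casimir_apply: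
  assumes M: "weight_module M" and l: "l \<in> weights Q" and x: "x \<in> weight_space Q M l"
  shows "casimir M *\<^sub>v x = q (- cas l) \<cdot>\<^sub>v (casimir_sum c M *\<^sub>v x)"
  unfolding casimir_def assoc_mult_mat_vec[OF casimir_sum_carrier weight_diag_carrier[OF M] wt_carrier[OF x]]
    weight_diag_apply[OF M l x] by (rule mult_mat_vec[OF casimir_sum_carrier wt_carrier[OF x]])

lemma casimir_weight:
  assumes M: "weight_module M" and l: "l \<in> weights Q" and x: "x \<in> weight_space Q M l"
  shows "casimir M *\<^sub>v x \<in> weight_space Q M l"
  unfolding casimir_apply[OF assms] by (rule weight_space_smult[OF M casimir_sum_weight[OF M x]])

text \<open>By \<open>casimir_sum_EF\<close>, \<open>casimir_sum\<close> commutes with E_i and F_i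
  only up to powers of q that depend on the weight. The factor q(- cas l) compensates:
  \<open>cas\<close> grows by 2 (alpha_i, l + alpha_i) from l to l + alpha_i.\<close>

lemma casimir_commute:
  assumes M: "weight_module M"
  shows "casimir M * actE M i = actE M i * casimir M"
    and "casimir M * actF M i = actF M i * casimir M"
    and "casimir M * actK M i = actK M i * casimir M"
proof -
  let ?d = "mdim M" and ?P = "casimir_sum c M"
  note cM = weight_module_carrier[OF M] antipode_carrier[OF M]
  have P: "?P \<in> carrier_mat ?d ?d" by simp
  have C: "casimir M \<in> carrier_mat ?d ?d" using M by simp
  note scal = mult_mat_vec[of _ ?d ?d]
  show "casimir M * actE M i = actE M i * casimir M"
  proof (rule weight_module_eqI[OF M square_mult_carrier[OF C cM(1)] square_mult_carrier[OF cM(1) C]])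
    fix l x assume l: "l \<in> weights Q" and x: "x \<in> weight_space Q M l"
    note xc = wt_carrier[OF x]
    let ?s = "q (- root_form i (l + simple_root i))"
    note Ex = E_weight[OF M x, of i]
    have PEx: "?P *\<^sub>v (actE M i *\<^sub>v x) \<in> weight_space Q M (l + simple_root i)" by (rule casimir_sum_weight[OF M Ex])
    have "(actKi M i * ?P * antipode M i + actE M i * ?P) *\<^sub>v x = 0\<^sub>v ?d"
      unfolding casimir_sum_EF[OF M] using xc by (auto intro!: eq_vecI)
    moreover have "(actKi M i * ?P * antipode M i + actE M i * ?P) *\<^sub>v x =
        actKi M i *\<^sub>v (?P *\<^sub>v (antipode M i *\<^sub>v x)) + actE M i *\<^sub>v (?P *\<^sub>v x)"
      using cM P xc by (simp add: add_mult_distrib_mat_vec[of _ ?d ?d] assoc_mult_mat_vec[of _ ?d ?d _ ?d])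
    moreover have "actKi M i *\<^sub>v (?P *\<^sub>v (antipode M i *\<^sub>v x)) = (- (?s * ?s)) \<cdot>\<^sub>v (?P *\<^sub>v (actE M i *\<^sub>v x))"
      unfolding antipode_apply[OF M x] mult_mat_vec[OF P wt_carrier[OF Ex]] mult_mat_vec[OF cM(4) wt_carrier[OF PEx]]
        Ki_weight[OF M PEx] by (simp add: smult_smult_assoc)
    ultimately have "(- (?s * ?s)) \<cdot>\<^sub>v (?P *\<^sub>v (actE M i *\<^sub>v x)) + 1 \<cdot>\<^sub>v (actE M i *\<^sub>v (?P *\<^sub>v x)) = 0\<^sub>v ?d" by simp
    then have rel: "?P *\<^sub>v (actE M i *\<^sub>v x) = (inverse (?s * ?s) * 1) \<cdot>\<^sub>v (actE M i *\<^sub>v (?P *\<^sub>v x))"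
      by (rule smult_add_eq_zero_imp[OF wt_carrier[OF PEx] square_mult_vec_carrier[OF cM(1) square_mult_vec_carrier[OF P xc]]]) simp
    \<comment> \<open>The increment of \<open>cas\<close> is 4 (\<open>sy i\<close>) + 2 (alpha_i,
      l), which equals 2 (alpha_i, l + alpha_i).\<close>
    have coef: "q (- cas (l + simple_root i)) * (inverse (?s * ?s) * 1) = q (- cas l)"
    proof -
      have "inverse (?s * ?s) = q (2 * root_form i (l + simple_root i))"
        by (simp only: q_add[symmetric] q_minus[symmetric]) simp
      then show ?thesis
        by (simp add: q_add[symmetric] cas_add cas_simple_root form_sym[of l "simple_root i"])
    qed
    have "casimir M * actE M i *\<^sub>v x = casimir M *\<^sub>v (actE M i *\<^sub>v x)" by (rule assoc_mult_mat_vec[OF C cM(1) xc])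
    also have "\<dots> = q (- cas (l + simple_root i)) \<cdot>\<^sub>v (?P *\<^sub>v (actE M i *\<^sub>v x))"
      by (rule casimir_apply[OF M weights_add[OF l weights_simple_root] Ex])
    also have "\<dots> = q (- cas l) \<cdot>\<^sub>v (actE M i *\<^sub>v (?P *\<^sub>v x))"
      unfolding rel smult_smult_assoc coef ..
    also have "\<dots> = actE M i *\<^sub>v (casimir M *\<^sub>v x)"
      unfolding casimir_apply[OF M l x] mult_mat_vec[OF cM(1) square_mult_vec_carrier[OF P xc]] ..
    also have "\<dots> = actE M i * casimir M *\<^sub>v x" by (rule assoc_mult_mat_vec[OF cM(1) C xc, symmetric])
    finally show "casimir M * actE M i *\<^sub>v x = actE M i * casimir M *\<^sub>v x" .
  qed
  show "casimir M * actF M i = actF M i * casimir M"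
  proof (rule weight_module_eqI[OF M square_mult_carrier[OF C cM(2)] square_mult_carrier[OF cM(2) C]])
    fix l x assume l: "l \<in> weights Q" and x: "x \<in> weight_space Q M l"
    note xc = wt_carrier[OF x]
    let ?s = "q (root_form i l)" and ?t = "q (- root_form i l)"
    note Fx = F_weight[OF M x, of i]
    have PFx: "?P *\<^sub>v (actF M i *\<^sub>v x) \<in> weight_space Q M (l - simple_root i)" by (rule casimir_sum_weight[OF M Fx])
    have Px: "?P *\<^sub>v x \<in> carrier_vec ?d" by (rule square_mult_vec_carrier[OF P xc])
    have "(?P * antipode_F M i + actF M i * ?P * actKi M i) *\<^sub>v x = 0\<^sub>v ?d"
      unfolding casimir_sum_EF[OF M] using xc by (auto intro!: eq_vecI)
    moreover have "(?P * antipode_F M i + actF M i * ?P * actKi M i) *\<^sub>v x =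
        ?P *\<^sub>v (antipode_F M i *\<^sub>v x) + actF M i *\<^sub>v (?P *\<^sub>v (actKi M i *\<^sub>v x))"
      using cM P xc by (simp add: add_mult_distrib_mat_vec[of _ ?d ?d] assoc_mult_mat_vec[of _ ?d ?d _ ?d])
    moreover have "?P *\<^sub>v (antipode_F M i *\<^sub>v x) = (- ?s) \<cdot>\<^sub>v (?P *\<^sub>v (actF M i *\<^sub>v x))"
      unfolding antipode_apply[OF M x] by (rule mult_mat_vec[OF P wt_carrier[OF Fx]])
    moreover have "actF M i *\<^sub>v (?P *\<^sub>v (actKi M i *\<^sub>v x)) = ?t \<cdot>\<^sub>v (actF M i *\<^sub>v (?P *\<^sub>v x))"
      unfolding Ki_weight[OF M x] mult_mat_vec[OF P xc] by (rule mult_mat_vec[OF cM(2) Px])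
    ultimately have "(- ?s) \<cdot>\<^sub>v (?P *\<^sub>v (actF M i *\<^sub>v x)) + ?t \<cdot>\<^sub>v (actF M i *\<^sub>v (?P *\<^sub>v x)) = 0\<^sub>v ?d" by simp
    then have rel: "?P *\<^sub>v (actF M i *\<^sub>v x) = (inverse ?s * ?t) \<cdot>\<^sub>v (actF M i *\<^sub>v (?P *\<^sub>v x))"
      by (rule smult_add_eq_zero_imp[OF wt_carrier[OF PFx] square_mult_vec_carrier[OF cM(2) Px]]) simp
    have coef: "q (- cas (l - simple_root i)) * (inverse ?s * ?t) = q (- cas l)"
    proof -
      have "cas (l - simple_root i) = cas l - 2 * root_form i l"
        using cas_add[of l "- simple_root i"] by (simp add: cas_minus_simple_root form_sym[of l "simple_root i"])
      then show ?thesis by (simp add: q_minus[symmetric] q_add[symmetric])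
    qed
    have "casimir M * actF M i *\<^sub>v x = casimir M *\<^sub>v (actF M i *\<^sub>v x)" by (rule assoc_mult_mat_vec[OF C cM(2) xc])
    also have "\<dots> = q (- cas (l - simple_root i)) \<cdot>\<^sub>v (?P *\<^sub>v (actF M i *\<^sub>v x))"
      by (rule casimir_apply[OF M weights_diff[OF l weights_simple_root] Fx])
    also have "\<dots> = q (- cas l) \<cdot>\<^sub>v (actF M i *\<^sub>v (?P *\<^sub>v x))"
      unfolding rel smult_smult_assoc coef ..
    also have "\<dots> = actF M i *\<^sub>v (casimir M *\<^sub>v x)"
      unfolding casimir_apply[OF M l x] mult_mat_vec[OF cM(2) Px] ..
    also have "\<dots> = actF M i * casimir M *\<^sub>v x" by (rule assoc_mult_mat_vec[OF cM(2) C xc, symmetric])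
    finally show "casimir M * actF M i *\<^sub>v x = actF M i * casimir M *\<^sub>v x" .
  qed
  show "casimir M * actK M i = actK M i * casimir M"
  proof (rule weight_module_eqI[OF M square_mult_carrier[OF C cM(3)] square_mult_carrier[OF cM(3) C]])
    fix l x assume l: "l \<in> weights Q" and x: "x \<in> weight_space Q M l"
    note xc = wt_carrier[OF x]
    show "casimir M * actK M i *\<^sub>v x = actK M i * casimir M *\<^sub>v x"
      unfolding assoc_mult_mat_vec[OF C cM(3) xc] assoc_mult_mat_vec[OF cM(3) C xc] K_weight[OF x]
        K_weight[OF casimir_weight[OF M l x]] by (rule mult_mat_vec[OF C xc])
  qed
qed

definition singular :: "('i, 'k) qmodule \<Rightarrow> ('i \<Rightarrow> rat) \<Rightarrow> 'k vec \<Rightarrow> bool" where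
  "singular M l x \<longleftrightarrow> l \<in> weights Q \<and> x \<in> weight_space Q M l \<and> (\<forall>i. actE M i *\<^sub>v x = 0\<^sub>v (mdim M))"

lemma casimir_term_singular:
  assumes M: "weight_module M" and x: "x \<in> carrier_vec (mdim M)"
  shows "word_act (mdim M) (actF M) w * word_act (mdim M) (antipode M) (rev (i # u)) *\<^sub>v x =
    word_act (mdim M) (actF M) w *\<^sub>v (word_act (mdim M) (antipode M) (rev u) *\<^sub>v (antipode M i *\<^sub>v x))"
proof -
  let ?d = "mdim M"
  note cM = weight_module_carrier[OF M] antipode_carrier[OF M]
  have W: "word_act ?d (actF M) v \<in> carrier_mat ?d ?d" "word_act ?d (antipode M) v \<in> carrier_mat ?d ?d" for v
    using cM by simp_all
  have "word_act ?d (antipode M) (rev (i # u)) = word_act ?d (antipode M) (rev u) * antipode M i"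
    using cM by (simp add: word_act_append right_mult_one_mat[OF cM(5)])
  then show ?thesis
    using assoc_mult_mat_vec[OF W(1) W(2) x, of w "rev (i # u)"] assoc_mult_mat_vec[OF W(2) cM(5) x, of "rev u" i]
    by (simp del: word_act_Cons)
qed

lemma antipode_eq_zero:
  assumes M: "weight_module M" and x: "x \<in> carrier_vec (mdim M)"
  shows "antipode M i *\<^sub>v x = - (actKi M i *\<^sub>v (actE M i *\<^sub>v x))"
  unfolding antipode_def using M x
  by (subst uminus_mult_mat_vec) (auto simp: assoc_mult_mat_vec[of _ "mdim M" "mdim M" _ "mdim M"] carrier_matD[OF weight_module_carrier(1)[OF M]])

text \<open>The empty words contribute x. In every other term the antipode of the first letter of u
  acts first, as u is reversed, and it sends x into V because E does; V is stable under all that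
  follows. The version modulo a subspace serves complete reducibility; V consisting of 0 gives the
  case of singular vectors.\<close>

lemma casimir_sum_modulo:
  assumes M: "weight_module M" and x: "x \<in> carrier_vec (mdim M)"
    and V: "V \<subseteq> carrier_vec (mdim M)" "0\<^sub>v (mdim M) \<in> V" "\<And>v w. v \<in> V \<Longrightarrow> w \<in> V \<Longrightarrow> v + w \<in> V" "\<And>a v. v \<in> V \<Longrightarrow> a \<cdot>\<^sub>v v \<in> V"
    and VE: "\<And>v i. v \<in> V \<Longrightarrow> actE M i *\<^sub>v v \<in> V" and VF: "\<And>v i. v \<in> V \<Longrightarrow> actF M i *\<^sub>v v \<in> V"
    and VK: "\<And>v i. v \<in> V \<Longrightarrow> actKi M i *\<^sub>v v \<in> V"
    and Ex: "\<And>i. actE M i *\<^sub>v x \<in> V"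
  shows "\<exists>v\<in>V. casimir_sum c M *\<^sub>v x = x + v"
proof -
  let ?d = "mdim M"
  note cM = weight_module_carrier[OF M] antipode_carrier[OF M]
  let ?X = "\<lambda>(u, w). word_act ?d (actF M) w * word_act ?d (antipode M) (rev u)"
  let ?S = "word_pairs (Suc ?d) - {([], [])} :: ('i list \<times> 'i list) set"
  have W: "word_act ?d (actF M) v \<in> carrier_mat ?d ?d" "word_act ?d (antipode M) v \<in> carrier_mat ?d ?d" for v
    using cM by simp_all
  have X: "?X s \<in> carrier_mat ?d ?d" for s using W by (cases s) simp
  have neg: "- v \<in> V" if "v \<in> V" for v
  proof -
    have "- 1 \<cdot>\<^sub>v v = - v" by (rule eq_vecI) auto
    then show ?thesis using V(4)[OF that, of "- 1"] by simp
  qed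
  have A: "antipode M i *\<^sub>v v \<in> V" if "actE M i *\<^sub>v v \<in> V" "v \<in> carrier_vec ?d" for i v
    unfolding antipode_eq_zero[OF M that(2)] by (rule neg[OF VK[OF that(1)]])
  have AV: "antipode M i *\<^sub>v v \<in> V" if "v \<in> V" for i v
    using A[OF VE[OF that]] that V(1) by blast
  have wV: "word_act ?d Y u *\<^sub>v v \<in> V" if Y: "\<And>i. Y i \<in> carrier_mat ?d ?d" "\<And>v i. v \<in> V \<Longrightarrow> Y i *\<^sub>v v \<in> V" and v: "v \<in> V" for Y u v
  proof (induction u)
    case Nil then show ?case using v V(1) by auto
  next
    case (Cons i u)
    have "word_act ?d Y (i # u) *\<^sub>v v = Y i *\<^sub>v (word_act ?d Y u *\<^sub>v v)"
      using assoc_mult_mat_vec[OF Y(1) word_act_carrier[of Y, OF Y(1)], of v i u] v V(1) by auto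
    then show ?case using Y(2)[OF Cons] by simp
  qed
  have "([], []) \<in> word_pairs (Suc ?d)" by (simp add: word_pairs_def)
  then have S: "word_pairs (Suc ?d) = insert ([], []) ?S" by auto
  have "casimir_sum c M = c [] [] \<cdot>\<^sub>m ?X ([], []) + mat_lincomb ?d (\<lambda>(u, w). c u w) ?X ?S"
    unfolding casimir_sum_def
    by (subst S, subst mat_lincomb_insert) (use X finite_word_pairs in auto)
  also have "c [] [] \<cdot>\<^sub>m ?X ([], []) = 1\<^sub>m ?d" by (simp add: c_Nil) (auto intro!: eq_matI)
  finally have "casimir_sum c M *\<^sub>v x = x + mat_lincomb ?d (\<lambda>(u, w). c u w) ?X ?S *\<^sub>v x"
    using x by (simp add: add_mult_distrib_mat_vec[of _ ?d ?d])
  moreover have "mat_lincomb ?d (\<lambda>(u, w). c u w) ?X ?S *\<^sub>v x \<in> V"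
  proof (rule mat_lincomb_mult_vec_closed[OF _ X x V(2-4)])
    fix s assume s: "s \<in> ?S"
    obtain u w where uw: "s = (u, w)" by (cases s)
    then have "u \<noteq> []" using s by (auto simp: word_pairs_def)
    then obtain i u' where u: "u = i # u'" by (cases u) auto
    have "word_act ?d (actF M) w *\<^sub>v (word_act ?d (antipode M) (rev u') *\<^sub>v (antipode M i *\<^sub>v x)) \<in> V"
      by (rule wV[OF cM(2) VF wV[OF cM(5) AV A[OF Ex x]]])
    then show "?X s *\<^sub>v x \<in> V" unfolding uw u using casimir_term_singular[OF M x, of w i u'] by (simp del: rev.simps)
  qed (use finite_word_pairs in auto)
  ultimately show ?thesis by blast
qed

lemma casimir_sum_singular:
  assumes M: "weight_module M" and x: "x \<in> carrier_vec (mdim M)" and E: "\<And>i. actE M i *\<^sub>v x = 0\<^sub>v (mdim M)"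
  shows "casimir_sum c M *\<^sub>v x = x"
proof -
  have "\<exists>v\<in>{0\<^sub>v (mdim M)}. casimir_sum c M *\<^sub>v x = x + v"
    by (rule casimir_sum_modulo[OF M x]) (use M E in auto)
  then show ?thesis using x by simp
qed

lemma casimir_singular:
  assumes M: "weight_module M" and x: "singular M l x"
  shows "casimir M *\<^sub>v x = q (- cas l) \<cdot>\<^sub>v x"
  using x casimir_apply[OF M, of l x] casimir_sum_singular[OF M, of x] wt_carrier[of x M l]
  by (simp add: singular_def)

end

section \<open>Complete reducibility\<close>

lemma lin_mult_closed:
  fixes A :: "'k::field mat"
  assumes A: "A \<in> carrier_mat d d" and S: "S \<subseteq> carrier_vec d"
    and AS: "\<And>x. x \<in> S \<Longrightarrow> A *\<^sub>v x \<in> lin d T" and x: "x \<in> lin d S"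
  shows "A *\<^sub>v x \<in> lin d T"
proof -
  have "x \<in> carrier_vec d \<and> A *\<^sub>v x \<in> lin d T"
    using x
  proof (induction rule: lin.induct)
    case zero
    show ?case using A by (simp add: lin.zero)
  next
    case (base x)
    then show ?case using S AS by blast
  next
    case (add x y)
    then show ?case using mult_add_distrib_mat_vec[OF A] by (simp add: lin.add)
  next
    case (smult x a)
    then show ?case using mult_mat_vec[OF A] by (simp add: lin.smult)
  qed
  then show ?thesis ..
qed

lemma zero_mat_mult_vec: "x \<in> carrier_vec d \<Longrightarrow> 0\<^sub>m n d *\<^sub>v (x :: 'k::field vec) = 0\<^sub>v n"
  by (intro eq_vecI) auto

lemma word_act_commute:
  fixes X :: "'x \<Rightarrow> 'k::field mat"
  assumes X: "\<And>a. X a \<in> carrier_mat d d" and A: "A \<in> carrier_mat d d"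
    and comm: "\<And>a. X a * A = A * X a"
  shows "word_act d X u * A = A * word_act d X u"
proof (induction u)
  case Nil
  show ?case using A by simp
next
  case (Cons a u)
  have W: "word_act d X u \<in> carrier_mat d d" using X by simp
  have "X a * word_act d X u * A = X a * (A * word_act d X u)"
    unfolding assoc_mult_mat[OF X W A] Cons ..
  also have "\<dots> = A * (X a * word_act d X u)"
    unfolding assoc_mult_mat[OF X A W, symmetric] comm assoc_mult_mat[OF A X W] ..
  finally show ?case by simp
qed

text \<open>A sum of vectors, each killed by some \<open>G a\<close>, is killed by the product of
  these operators, as they commute. The product over finitely many vectors then kills all of them at
  once.\<close>

lemma word_act_kills_lin:
  fixes G :: "'x \<Rightarrow> 'k::field mat"
  assumes G: "\<And>a. G a \<in> carrier_mat d d" and comm: "\<And>a b. G a * G b = G b * G a"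
    and Z: "finite Z" "Z \<subseteq> lin d {z \<in> carrier_vec d. \<exists>a\<in>S. G a *\<^sub>v z = 0\<^sub>v d}"
  shows "\<exists>as. set as \<subseteq> S \<and> (\<forall>z\<in>Z. word_act d G as *\<^sub>v z = 0\<^sub>v d)"
proof -
  let ?S = "{z \<in> carrier_vec d. \<exists>a\<in>S. G a *\<^sub>v z = 0\<^sub>v d}"
  have W: "word_act d G u \<in> carrier_mat d d" for u using G by simp
  have WW: "word_act d G u * word_act d G v = word_act d G v * word_act d G u" for u v
    by (rule word_act_commute[OF G W]) (rule word_act_commute[OF G G comm, symmetric])
  have left: "word_act d G (u @ v) *\<^sub>v z = 0\<^sub>v d" if "word_act d G v *\<^sub>v z = 0\<^sub>v d" "z \<in> carrier_vec d" for u v z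
    unfolding word_act_append[OF G] assoc_mult_mat_vec[OF W W that(2)] that(1)
    by (rule mult_mat_zero_vec[OF W])
  have right: "word_act d G (u @ v) *\<^sub>v z = 0\<^sub>v d" if "word_act d G u *\<^sub>v z = 0\<^sub>v d" "z \<in> carrier_vec d" for u v z
    using left[OF that, of v] unfolding word_act_append[OF G] WW[of u v] .
  have one: "z \<in> carrier_vec d \<and> (\<exists>as. set as \<subseteq> S \<and> word_act d G as *\<^sub>v z = 0\<^sub>v d)" if "z \<in> lin d ?S" for z
    using that
  proof (induction rule: lin.induct)
    case zero
    have "word_act d G [] *\<^sub>v 0\<^sub>v d = 0\<^sub>v d" by simp
    then show ?case by (intro conjI exI[of _ "[]"]) auto
  next
    case (base x)
    then obtain a where a: "a \<in> S" "G a *\<^sub>v x = 0\<^sub>v d" "x \<in> carrier_vec d" by blast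
    have "word_act d G [a] *\<^sub>v x = 0\<^sub>v d" using a by (simp add: right_mult_one_mat[OF G])
    then show ?case using a by (intro conjI exI[of _ "[a]"]) auto
  next
    case (add x y)
    then obtain u v where u: "set u \<subseteq> S" "word_act d G u *\<^sub>v x = 0\<^sub>v d" and v: "set v \<subseteq> S" "word_act d G v *\<^sub>v y = 0\<^sub>v d"
      by blast
    have xy: "x \<in> carrier_vec d" "y \<in> carrier_vec d" using add by simp_all
    have "word_act d G (u @ v) *\<^sub>v (x + y) = 0\<^sub>v d"
      using right[OF u(2) xy(1), of v] left[OF v(2) xy(2), of u] mult_add_distrib_mat_vec[OF W xy, of "u @ v"] by simp
    then show ?case using u v xy by (intro conjI exI[of _ "u @ v"]) auto
  next
    case (smult x a)
    then obtain u where u: "set u \<subseteq> S" "word_act d G u *\<^sub>v x = 0\<^sub>v d" and x: "x \<in> carrier_vec d" by blast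
    have "word_act d G u *\<^sub>v (a \<cdot>\<^sub>v x) = 0\<^sub>v d" unfolding mult_mat_vec[OF W x] u by simp
    then show ?case using u x by auto
  qed
  show ?thesis using Z
  proof (induction Z rule: finite_induct)
    case empty
    then show ?case by (intro exI[of _ "[]"]) auto
  next
    case (insert z Z)
    then obtain u where u: "set u \<subseteq> S" "\<forall>z\<in>Z. word_act d G u *\<^sub>v z = 0\<^sub>v d" by blast
    obtain v where v: "set v \<subseteq> S" "word_act d G v *\<^sub>v z = 0\<^sub>v d" and z: "z \<in> carrier_vec d" using one[of z] insert by blast
    have ZC: "y \<in> carrier_vec d" if "y \<in> Z" for y using one[of y] insert that by blast
    show ?case
    proof (intro exI[of _ "u @ v"] conjI ballI)
      show "set (u @ v) \<subseteq> S" using u v by simp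
      fix y assume "y \<in> insert z Z"
      then show "word_act d G (u @ v) *\<^sub>v y = 0\<^sub>v d" using left[OF v(2) z] right[OF _ ZC] u by blast
    qed
  qed
qed

context qdatum
begin

section \<open>Dominance of highest weights\<close>

lemma q_bracket_mult:
  "(q x - q (- x)) * (q y - q (- y)) = (q (x + y) + q (- (x + y))) - (q (x - y) + q (- (x - y)))"
proof -
  have "- (x + y) = - x + - y" "- (x - y) = - x + y" by simp_all
  then show ?thesis by (simp only: q_add diff_conv_add_uminus) (simp add: algebra_simps)
qed

text \<open>The sl2 identity that the q-integers of m, m - 2, ..., m - 2n add up to the product of
  those of n + 1 and m - n, with m the coroot pairing of l, cleared of denominators. The left side
  is the coefficient in the action of E_i on the (n + 1)-st power of F_i.\<close>

lemma sum_qbr: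
  "(\<Sum>k\<le>n. qbr i (l - (\<lambda>j. of_nat k * simple_root i j))) * (q (sy i) - q (- sy i)) ^ 2 =
    (q (sy i * of_nat (n + 1)) - q (- (sy i * of_nat (n + 1)))) *
    (q (sy i * (coroot_pairing Q l i - of_nat n)) - q (- (sy i * (coroot_pairing Q l i - of_nat n))))"
proof (induction n)
  case 0
  have "l - (\<lambda>j. of_nat 0 * simple_root i j) = l" by (simp add: fun_eq_iff)
  then show ?case using q_sy[of i] by (simp add: qbr_def root_form_eq power2_eq_square)
next
  case (Suc n)
  let ?s = "sy i" and ?m = "coroot_pairing Q l i"
  have "coroot_pairing Q (l - (\<lambda>j. of_nat (Suc n) * simple_root i j)) i = ?m - 2 * of_nat (Suc n)"
  proof -
    have "coroot_pairing Q (l - (\<lambda>j. of_nat (Suc n) * simple_root i j)) i =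
        ?m - of_nat (Suc n) * coroot_pairing Q (simple_root i) i"
      unfolding coroot_pairing_def by (simp add: algebra_simps sum.distrib sum_subtractf sum_distrib_left)
    then show ?thesis by (simp add: coroot_pairing_simple_root cartan_diag)
  qed
  then have new: "qbr i (l - (\<lambda>j. of_nat (Suc n) * simple_root i j)) * (q ?s - q (- ?s)) ^ 2 =
      (q ?s - q (- ?s)) * (q (?s * (?m - 2 * of_nat (Suc n))) - q (- (?s * (?m - 2 * of_nat (Suc n)))))"
    using q_sy[of i] unfolding qbr_def root_form_eq power2_eq_square by simp
  have "(q ?s - q (- ?s)) * (q (?s * (?m - 2 * of_nat (Suc n))) - q (- (?s * (?m - 2 * of_nat (Suc n))))) +
      (q (?s * of_nat (n + 1)) - q (- (?s * of_nat (n + 1)))) *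
      (q (?s * (?m - of_nat n)) - q (- (?s * (?m - of_nat n)))) =
      (q (?s * of_nat (Suc n + 1)) - q (- (?s * of_nat (Suc n + 1)))) *
      (q (?s * (?m - of_nat (Suc n))) - q (- (?s * (?m - of_nat (Suc n)))))"
  proof -
    have 1: "?s + ?s * (?m - 2 * of_nat (Suc n)) = - (?s * of_nat (n + 1) - ?s * (?m - of_nat n))"
      "?s - ?s * (?m - 2 * of_nat (Suc n)) = ?s * of_nat (Suc n + 1) - ?s * (?m - of_nat (Suc n))"
      "?s * of_nat (n + 1) + ?s * (?m - of_nat n) = ?s * of_nat (Suc n + 1) + ?s * (?m - of_nat (Suc n))"
      by (simp_all add: algebra_simps)
    show ?thesis unfolding q_bracket_mult 1 by simp
  qed
  then show ?case unfolding sum.atMost_Suc distrib_right Suc new by (subst add.commute)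
qed

text \<open>The sl2 argument in the quotient of M by S, where x behaves as a highest weight vector:
  E_i sends the (n + 1)-st F_i-iterate of x to a multiple of the n-th one modulo S. At the last
  iterate outside S the multiple must vanish, which forces the coroot pairing to equal n.\<close>

lemma dominant_modulo:
  assumes M: "weight_module M" and l: "l \<in> weights Q" and x: "x \<in> weight_space Q M l" and xS: "x \<notin> S"
    and S: "S \<subseteq> carrier_vec (mdim M)" "0\<^sub>v (mdim M) \<in> S" "\<And>v w. v \<in> S \<Longrightarrow> w \<in> S \<Longrightarrow> v + w \<in> S"
      "\<And>a v. v \<in> S \<Longrightarrow> a \<cdot>\<^sub>v v \<in> S"
    and SE: "\<And>v. v \<in> S \<Longrightarrow> actE M i *\<^sub>v v \<in> S" and SF: "\<And>v. v \<in> S \<Longrightarrow> actF M i *\<^sub>v v \<in> S"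
    and Ex: "actE M i *\<^sub>v x \<in> S"
  shows "coroot_pairing Q l i \<ge> 0"
proof -
  let ?d = "mdim M"
  note cM = weight_module_carrier[OF M]
  define a where "a n = word_act ?d (actF M) (replicate n i) *\<^sub>v x" for n
  define e where "e n = (\<Sum>k\<le>n. qbr i (l - (\<lambda>j. of_nat k * simple_root i j)))" for n
  have a0: "a 0 = x" using wt_carrier[OF x] by (simp add: a_def)
  have W: "word_act ?d (actF M) u \<in> carrier_mat ?d ?d" for u using cM by simp
  have aS: "a (Suc n) = actF M i *\<^sub>v a n" for n
    unfolding a_def replicate_Suc word_act_Cons by (rule assoc_mult_mat_vec[OF cM(2) W wt_carrier[OF x]])
  have aw: "a n \<in> weight_space Q M (l - (\<lambda>j. of_nat n * simple_root i j))" for n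
  proof -
    have "root_sum (replicate n i) = (\<lambda>j. of_nat n * simple_root i j)"
      by (induction n) (auto simp: algebra_simps fun_eq_iff)
    then show ?thesis using word_act_F_weight[OF M x, of "replicate n i"] by (simp add: a_def)
  qed
  note ac = wt_carrier[OF aw]
  have key: "\<exists>v\<in>S. actE M i *\<^sub>v a (Suc n) = e n \<cdot>\<^sub>v a n + v" for n
  proof (induction n)
    case 0
    have 1: "qbr i l = e 0"
      unfolding e_def by (simp add: fun_diff_def)
    have "actE M i *\<^sub>v a (Suc 0) = actF M i *\<^sub>v (actE M i *\<^sub>v x) + e 0 \<cdot>\<^sub>v x"
      unfolding aS a0 EF_weight[OF M x] 1[symmetric] by simp
    also have "\<dots> = e 0 \<cdot>\<^sub>v a 0 + actF M i *\<^sub>v (actE M i *\<^sub>v x)"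
      unfolding a0 using SF[OF Ex] S(1) wt_carrier[OF x] by (intro comm_add_vec[of _ ?d]) auto
    finally show ?case using SF[OF Ex] by blast
  next
    case (Suc n)
    then obtain v where v: "v \<in> S" "actE M i *\<^sub>v a (Suc n) = e n \<cdot>\<^sub>v a n + v" by blast
    let ?c = "qbr i (l - (\<lambda>j. of_nat (Suc n) * simple_root i j))"
    have vc: "v \<in> carrier_vec ?d" using v S(1) by blast
    have ec: "e n \<cdot>\<^sub>v a n \<in> carrier_vec ?d" using ac by simp
    have Fv: "actF M i *\<^sub>v v \<in> carrier_vec ?d" by (rule square_mult_vec_carrier[OF cM(2) vc])
    have "actE M i *\<^sub>v a (Suc (Suc n)) = actF M i *\<^sub>v (actE M i *\<^sub>v a (Suc n)) + ?c \<cdot>\<^sub>v a (Suc n)"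
      unfolding aS[of "Suc n"] EF_weight[OF M aw] by simp
    also have "actF M i *\<^sub>v (actE M i *\<^sub>v a (Suc n)) = e n \<cdot>\<^sub>v a (Suc n) + actF M i *\<^sub>v v"
      unfolding v(2) mult_add_distrib_mat_vec[OF cM(2) ec vc] mult_mat_vec[OF cM(2) ac] aS[symmetric] ..
    also have "e n \<cdot>\<^sub>v a (Suc n) + actF M i *\<^sub>v v + ?c \<cdot>\<^sub>v a (Suc n) = e (Suc n) \<cdot>\<^sub>v a (Suc n) + actF M i *\<^sub>v v"
    proof -
      have 1: "e (Suc n) = e n + ?c" by (simp add: e_def)
      define w where "w = a (Suc n)"
      define z where "z = actF M i *\<^sub>v v"
      have "w \<in> carrier_vec ?d" "z \<in> carrier_vec ?d" using ac Fv by (simp_all add: w_def z_def)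
      then show ?thesis unfolding 1 w_def[symmetric] z_def[symmetric] by (intro eq_vecI) (auto simp: algebra_simps)
    qed
    finally show ?case using SF[OF v(1)] by blast
  qed
  have "a ?d \<in> S"
    unfolding a_def using word_act_F_vanish[OF M, of "replicate ?d i"] zero_mat_mult_vec[OF wt_carrier[OF x]] S(2) by simp
  moreover have "\<forall>n. a n \<notin> S" if "\<And>n. a n \<notin> S \<Longrightarrow> a (Suc n) \<notin> S"
  proof
    show "a n \<notin> S" for n by (induction n) (use xS a0 that in auto)
  qed
  \<comment> \<open>The iterates start with x outside S and reach 0, which is in S, after
    \<open>mdim M\<close> steps.\<close>
  ultimately obtain n where n: "a (Suc n) \<in> S" "a n \<notin> S" by blast
  obtain v where v: "v \<in> S" "actE M i *\<^sub>v a (Suc n) = e n \<cdot>\<^sub>v a n + v" using key by blast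
  have "e n \<cdot>\<^sub>v a n = actE M i *\<^sub>v a (Suc n) + (- 1) \<cdot>\<^sub>v v"
    unfolding v(2) using S(1) v(1) ac[of n] by (intro eq_vecI) auto
  then have ea: "e n \<cdot>\<^sub>v a n \<in> S" using S(3)[OF SE[OF n(1)] S(4)[OF v(1)]] by simp
  have "e n = 0"
  proof (rule ccontr)
    assume "e n \<noteq> 0"
    then have "a n = inverse (e n) \<cdot>\<^sub>v (e n \<cdot>\<^sub>v a n)" by (simp add: smult_smult_assoc)
    then show False using S(4)[OF ea] n(2) by metis
  qed
  moreover define u where "u = sy i * of_nat (n + 1)"
  moreover define w where "w = sy i * (coroot_pairing Q l i - of_nat n)"
  ultimately have "(q u - q (- u)) * (q w - q (- w)) = 0"
    using sum_qbr[of i l n] unfolding e_def[symmetric] by simp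
  moreover have "u > 0" using symm_pos[of i] by (simp add: u_def)
  ultimately have "w = 0" by simp
  then have "coroot_pairing Q l i = of_nat n" using symm_pos[of i] by (simp add: w_def)
  then show ?thesis by simp
qed

end

context braided
begin

text \<open>Two weights are recorded: l is that of the singular vector at the origin and determines
  the Casimir eigenvalue, while m is that of the vector itself and lies below l.\<close>

inductive generated :: "('i, 'k) qmodule \<Rightarrow> ('i \<Rightarrow> rat) \<Rightarrow> ('i \<Rightarrow> rat) \<Rightarrow> 'k vec \<Rightarrow> bool" for M where
  singular: "singular M l x \<Longrightarrow> x \<noteq> 0\<^sub>v (mdim M) \<Longrightarrow> generated M l l x"
| step: "generated M l m x \<Longrightarrow> generated M l (m - simple_root i) (actF M i *\<^sub>v x)"

lemma generated_weight:
  assumes M: "weight_module M" and "generated M l m x"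
  shows "l \<in> weights Q \<and> m \<in> weights Q \<and> x \<in> weight_space Q M m \<and> (\<forall>j. m j \<le> l j)"
  using assms(2)
proof (induction rule: generated.induct)
  case (singular l x)
  then show ?case by (simp add: singular_def)
next
  case (step l m x i)
  have "(m - simple_root i) j \<le> l j" for j
  proof -
    have "m j \<le> l j" using step.IH by blast
    moreover have "simple_root i j \<ge> 0" by (simp add: simple_root_def)
    ultimately show ?thesis by simp
  qed
  then show ?case using step.IH F_weight[OF M, of x m i] weights_diff[OF _ weights_simple_root, of m i] by blast
qed

lemma generated_carrier: "weight_module M \<Longrightarrow> generated M l m x \<Longrightarrow> x \<in> carrier_vec (mdim M)"
  using generated_weight wt_carrier by blast

lemma generated_casimir:
  assumes M: "weight_module M" and "generated M l m x"
  shows "casimir M *\<^sub>v x = q (- cas l) \<cdot>\<^sub>v x"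
  using assms(2)
proof (induction rule: generated.induct)
  case (singular l x)
  then show ?case by (simp add: casimir_singular[OF M])
next
  case (step l m x i)
  note cM = weight_module_carrier[OF M] casimir_carrier[OF M]
  note xc = generated_carrier[OF M step.hyps]
  show ?case
    unfolding assoc_mult_mat_vec[OF cM(5) cM(2) xc, symmetric] casimir_commute(2)[OF M]
      assoc_mult_mat_vec[OF cM(2) cM(5) xc] step.IH by (rule mult_mat_vec[OF cM(2) xc])
qed

lemma generated_dominant:
  assumes M: "weight_module M" and "generated M l m x"
  shows "coroot_pairing Q l i \<ge> 0"
  using assms(2)
proof (induction rule: generated.induct)
  case (singular l x)
  show ?case
    by (rule dominant_modulo[OF M, of l x "{0\<^sub>v (mdim M)}"])
      (use singular M in \<open>auto simp: singular_def\<close>)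
qed

lemma generated_F:
  assumes M: "weight_module M" and x: "x \<in> lin (mdim M) {x. \<exists>m. generated M l m x}"
  shows "actF M i *\<^sub>v x \<in> lin (mdim M) {x. \<exists>m. generated M l m x}"
proof (rule lin_mult_closed[OF weight_module_carrier(2)[OF M] _ _ x])
  show "{x. \<exists>m. generated M l m x} \<subseteq> carrier_vec (mdim M)" using generated_carrier[OF M] by blast
  fix y assume "y \<in> {x. \<exists>m. generated M l m x}"
  then show "actF M i *\<^sub>v y \<in> lin (mdim M) {x. \<exists>m. generated M l m x}"
    using generated.step by (intro lin.base) blast
qed

text \<open>E_i is moved through the F's towards the singular vector, where it gives 0; each
  commutator acts as a scalar on a weight vector.\<close>

lemma generated_E:
  assumes M: "weight_module M" and "generated M l m x"
  shows "actE M i *\<^sub>v x \<in> lin (mdim M) {x. \<exists>m. generated M l m x}"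
  using assms(2)
proof (induction rule: generated.induct)
  case (singular l x)
  then show ?case by (simp add: singular_def lin.zero)
next
  case (step l m x j)
  have x: "x \<in> weight_space Q M m" using generated_weight[OF M step.hyps] by blast
  have "x \<in> lin (mdim M) {x. \<exists>m. generated M l m x}" using step.hyps by (intro lin.base) blast
  then show ?case unfolding EF_weight[OF M x]
    by (intro lin.add lin.smult generated_F[OF M step.IH])
qed

definition gen_vectors :: "('i, 'k) qmodule \<Rightarrow> 'k vec set" where
  "gen_vectors M = {x. \<exists>l m. generated M l m x}"

lemma gen_vectors_carrier: "weight_module M \<Longrightarrow> gen_vectors M \<subseteq> carrier_vec (mdim M)"
  using generated_carrier by (auto simp: gen_vectors_def)

lemma gen_vectors_closed:
  assumes M: "weight_module M" and x: "x \<in> lin (mdim M) (gen_vectors M)"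
  shows "actE M i *\<^sub>v x \<in> lin (mdim M) (gen_vectors M)" "actF M i *\<^sub>v x \<in> lin (mdim M) (gen_vectors M)"
    "actKi M i *\<^sub>v x \<in> lin (mdim M) (gen_vectors M)" "casimir M *\<^sub>v x \<in> lin (mdim M) (gen_vectors M)"
proof -
  note cM = weight_module_carrier[OF M] casimir_carrier[OF M]
  note C = gen_vectors_carrier[OF M]
  have sub: "y \<in> lin (mdim M) (gen_vectors M)" if "y \<in> lin (mdim M) {x. \<exists>m. generated M l m x}" for y l
    using that by (rule lin_mono) (auto simp: gen_vectors_def)
  have in_lin: "y \<in> lin (mdim M) (gen_vectors M)" if "generated M l m y" for l m y
    using that by (intro lin.base) (auto simp: gen_vectors_def)
  show "actE M i *\<^sub>v x \<in> lin (mdim M) (gen_vectors M)"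
  proof (rule lin_mult_closed[OF cM(1) C _ x])
    fix y assume "y \<in> gen_vectors M"
    then obtain l m where y: "generated M l m y" by (auto simp: gen_vectors_def)
    show "actE M i *\<^sub>v y \<in> lin (mdim M) (gen_vectors M)" by (rule sub[OF generated_E[OF M y]])
  qed
  show "actF M i *\<^sub>v x \<in> lin (mdim M) (gen_vectors M)"
  proof (rule lin_mult_closed[OF cM(2) C _ x])
    fix y assume "y \<in> gen_vectors M"
    then obtain l m where y: "generated M l m y" by (auto simp: gen_vectors_def)
    show "actF M i *\<^sub>v y \<in> lin (mdim M) (gen_vectors M)" by (rule in_lin[OF generated.step[OF y]])
  qed
  show "actKi M i *\<^sub>v x \<in> lin (mdim M) (gen_vectors M)"
  proof (rule lin_mult_closed[OF cM(4) C _ x])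
    fix y assume "y \<in> gen_vectors M"
    then obtain l m where y: "generated M l m y" by (auto simp: gen_vectors_def)
    then have "y \<in> weight_space Q M m" using generated_weight[OF M] by blast
    then show "actKi M i *\<^sub>v y \<in> lin (mdim M) (gen_vectors M)"
      unfolding Ki_weight[OF M] using lin.smult[OF in_lin[OF y]] by (simp add: Ki_weight[OF M])
  qed
  show "casimir M *\<^sub>v x \<in> lin (mdim M) (gen_vectors M)"
  proof (rule lin_mult_closed[OF cM(5) C _ x])
    fix y assume "y \<in> gen_vectors M"
    then obtain l m where y: "generated M l m y" by (auto simp: gen_vectors_def)
    show "casimir M *\<^sub>v y \<in> lin (mdim M) (gen_vectors M)"
      unfolding generated_casimir[OF M y] by (rule lin.smult[OF in_lin[OF y]])
  qed
qed

text \<open>If the span S is proper, there are a weight n and \<open>x \<notin> S\<close> of weight n with all \<open>E\<^sub>i x \<in> S\<close>. The Casimir operator C acts on x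
  modulo S as \<open>q(- cas n)\<close>, whereas each \<open>E\<^sub>i x\<close> is a sum of eigenvectors for eigenvalues \<open>q(- a)\<close> with
  \<open>a > cas n\<close>. A product of operators \<open>C - q(- a)\<close> thus sends x to a singular vector, which is in S but is
  congruent to a nonzero multiple of x.\<close>

theorem spans_gen_vectors:
  assumes M: "weight_module M"
  shows "spans (mdim M) (gen_vectors M)"
proof (rule ccontr)
  assume nsp: "\<not> spans (mdim M) (gen_vectors M)"
  let ?d = "mdim M"
  define S where "S = lin ?d (gen_vectors M)"
  note cM = weight_module_carrier[OF M] casimir_carrier[OF M]
  note clos = gen_vectors_closed[OF M, folded S_def]
  have SC: "S \<subseteq> carrier_vec ?d" using lin_carrier[OF _ gen_vectors_carrier[OF M]] by (auto simp: S_def)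
  have S0: "0\<^sub>v ?d \<in> S" and Sadd: "\<And>v w. v \<in> S \<Longrightarrow> w \<in> S \<Longrightarrow> v + w \<in> S" and Ssm: "\<And>a v. v \<in> S \<Longrightarrow> a \<cdot>\<^sub>v v \<in> S"
    by (auto simp: S_def intro: lin.intros)
  have "\<not> (\<Union>l\<in>weights Q. weight_space Q M l) \<subseteq> S"
    using spans_lin[OF spans_weight_spaces[OF M] _ gen_vectors_carrier[OF M]] nsp unfolding S_def by blast
  then obtain l y where l: "l \<in> weights Q" and y: "y \<in> weight_space Q M l" "y \<notin> S" by blast
  let ?w = "\<lambda>u. word_act ?d (actE M) u *\<^sub>v y"
  have len: "length u < ?d" if "?w u \<notin> S" for u
  proof (rule ccontr)
    assume "\<not> length u < ?d"
    then have "?w u = 0\<^sub>v ?d" using word_act_E_vanish[OF M, of u] zero_mat_mult_vec[OF wt_carrier[OF y(1)]] by simp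
    then show False using that S0 by simp
  qed
  have "?w [] \<notin> S" using y wt_carrier[OF y(1)] by simp
  \<comment> \<open>A longest word u in E with value outside S exists because long words act by
    zero. Maximality puts every E_i x into S.\<close>
  then obtain u where u: "?w u \<notin> S" and max: "\<And>u'. ?w u' \<notin> S \<Longrightarrow> length u' \<le> length u"
    using Lattices_Big.ex_has_greatest_nat[of "\<lambda>u. ?w u \<notin> S" "[]" length ?d] len by blast
  define x where "x = ?w u"
  define n where "n = l + root_sum u"
  have n: "n \<in> weights Q" unfolding n_def by (rule weights_add[OF l root_sum_weights])
  have x: "x \<in> weight_space Q M n" unfolding x_def n_def by (rule word_act_E_weight[OF M y(1)])
  note xc = wt_carrier[OF x]
  have xS: "x \<notin> S" using u by (simp add: x_def)
  have Ex: "actE M i *\<^sub>v x \<in> S" for i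
  proof (rule ccontr)
    assume "actE M i *\<^sub>v x \<notin> S"
    moreover have "?w (i # u) = actE M i *\<^sub>v x"
      unfolding x_def word_act_Cons by (rule assoc_mult_mat_vec[OF cM(1) word_act_carrier[OF cM(1)] wt_carrier[OF y(1)]])
    ultimately show False using max[of "i # u"] by simp
  qed
  have dom: "coroot_pairing Q n i \<ge> 0" for i
    by (rule dominant_modulo[OF M n x xS SC S0 Sadd Ssm clos(1) clos(2) Ex])
  define G where "G a = casimir M + (- q (- a)) \<cdot>\<^sub>m 1\<^sub>m ?d" for a
  have G: "G a \<in> carrier_mat ?d ?d" for a using cM(5) by (simp add: G_def)
  have G_apply: "G a *\<^sub>v z = casimir M *\<^sub>v z + (- q (- a)) \<cdot>\<^sub>v z" if "z \<in> carrier_vec ?d" for a z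
    using cM(5) that by (simp add: G_def add_mult_distrib_mat_vec[of _ ?d ?d] smult_mat_vec[of _ ?d ?d])
  have G_comm: "G a * A = A * G a" if A: "A \<in> carrier_mat ?d ?d" "casimir M * A = A * casimir M" for a A
    using A cM(5) mult_smult_distrib[OF A(1) one_carrier_mat, of "- q (- a)"]
    by (simp add: G_def add_mult_distrib_mat[of _ ?d ?d] mult_add_distrib_mat[of _ ?d ?d]
      mult_smult_assoc_mat[of _ ?d ?d])
  have GG: "G a * G b = G b * G a" for a b
    by (rule G_comm[OF G]) (rule G_comm[OF cM(5) refl, symmetric])
  have W: "word_act ?d G as \<in> carrier_mat ?d ?d" for as using G by simp
  define H where "H = {z \<in> carrier_vec ?d. \<exists>a\<in>{cas n<..}. G a *\<^sub>v z = 0\<^sub>v ?d}"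
  have HC: "H \<subseteq> carrier_vec ?d" by (auto simp: H_def)
  \<comment> \<open>E_i x is a combination of generated vectors, and projecting to weight n +
    alpha_i keeps only those of that weight. These come from singular vectors whose weight k is
    dominant and lies above n + alpha_i, so \<open>cas_less\<close> gives cas k > cas n.\<close>
  have EH: "actE M i *\<^sub>v x \<in> lin ?d H" for i
  proof -
    let ?P = "weight_diag M (\<lambda>m. if m = n + simple_root i then 1 else 0)"
    have "?P *\<^sub>v (actE M i *\<^sub>v x) \<in> lin ?d H"
    proof (rule lin_mult_closed[OF weight_diag_carrier[OF M] gen_vectors_carrier[OF M] _ Ex[unfolded S_def]])
      fix z assume "z \<in> gen_vectors M"
      then obtain k m where z: "generated M k m z" by (auto simp: gen_vectors_def)
      note zw = generated_weight[OF M z]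
      note zc = generated_carrier[OF M z]
      show "?P *\<^sub>v z \<in> lin ?d H"
      proof (cases "m = n + simple_root i")
        case True
        have le: "n j \<le> k j" "j = i \<Longrightarrow> n j < k j" for j
        proof -
          have "n j + simple_root i j \<le> k j" using zw unfolding True by simp
          then show "n j \<le> k j" "j = i \<Longrightarrow> n j < k j" by (auto simp: simple_root_def split: if_splits)
        qed
        then have "k \<noteq> n" by (metis less_irrefl)
        then have "cas n < cas k" by (intro cas_less dom generated_dominant[OF M z] le(1))
        moreover have "G (cas k) *\<^sub>v z = 0\<^sub>v ?d"
          unfolding G_apply[OF zc] generated_casimir[OF M z] using zc by (intro eq_vecI) auto
        ultimately have "z \<in> H" using zc by (auto simp: H_def)
        moreover have "?P *\<^sub>v z = z" using weight_diag_apply[OF M, of m z] zw True by simp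
        ultimately show ?thesis by (simp add: lin.base)
      next
        case False
        then have "?P *\<^sub>v z = 0\<^sub>v ?d" using weight_diag_apply[OF M, of m z] zw zc by simp
        then show ?thesis by (simp add: lin.zero)
      qed
    qed
    then show ?thesis
      using weight_diag_apply[OF M weights_add[OF n weights_simple_root] E_weight[OF M x], of _ i] by simp
  qed
  have "\<exists>as. set as \<subseteq> {cas n<..} \<and> (\<forall>z\<in>range (\<lambda>i. actE M i *\<^sub>v x). word_act ?d G as *\<^sub>v z = 0\<^sub>v ?d)"
    by (rule word_act_kills_lin[OF G GG]) (use EH in \<open>auto simp: H_def\<close>)
  then obtain as where as: "set as \<subseteq> {cas n<..}" and kill: "\<And>i. word_act ?d G as *\<^sub>v (actE M i *\<^sub>v x) = 0\<^sub>v ?d"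
    by blast
  \<comment> \<open>Modulo S each factor \<open>G a\<close> multiplies x by q(- cas n) - q(- a),
    which is nonzero since a exceeds cas n.\<close>
  have "word_act ?d G as *\<^sub>v x \<in> weight_space Q M n \<and> (\<exists>k v. k \<noteq> 0 \<and> v \<in> S \<and> word_act ?d G as *\<^sub>v x = k \<cdot>\<^sub>v x + v)"
    using as
  proof (induction as)
    case Nil
    have "word_act ?d G [] *\<^sub>v x = 1 \<cdot>\<^sub>v x + 0\<^sub>v ?d" "word_act ?d G [] *\<^sub>v x = x" using xc by simp_all
    then show ?case using x S0 one_neq_zero[where 'a = 'k] by (intro conjI exI[of _ 1] exI[of _ "0\<^sub>v ?d"]) auto
  next
    case (Cons a as)
    define z where "z = word_act ?d G as *\<^sub>v x"
    obtain k v where z: "z \<in> weight_space Q M n" "k \<noteq> 0" "v \<in> S" "z = k \<cdot>\<^sub>v x + v"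
      using Cons unfolding z_def by auto
    have vc: "v \<in> carrier_vec ?d" using z(3) SC by blast
    have Gz: "word_act ?d G (a # as) *\<^sub>v x = G a *\<^sub>v z"
      unfolding word_act_Cons z_def by (rule assoc_mult_mat_vec[OF G W xc])
    obtain w where w: "w \<in> S" "casimir_sum c M *\<^sub>v x = x + w"
      using casimir_sum_modulo[OF M xc SC S0 Sadd Ssm clos(1) clos(2) clos(3) Ex] by blast
    have wc: "w \<in> carrier_vec ?d" using w SC by blast
    have kx: "k \<cdot>\<^sub>v x \<in> carrier_vec ?d" using xc by simp
    have "G a *\<^sub>v z = k \<cdot>\<^sub>v (G a *\<^sub>v x) + G a *\<^sub>v v"
      unfolding z(4) mult_add_distrib_mat_vec[OF G kx vc] mult_mat_vec[OF G xc] ..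
    also have "G a *\<^sub>v x = (q (- cas n) - q (- a)) \<cdot>\<^sub>v x + q (- cas n) \<cdot>\<^sub>v w"
      unfolding G_apply[OF xc] casimir_apply[OF M n x] w(2) using xc wc
      by (intro eq_vecI) (auto simp: algebra_simps)
    also have "k \<cdot>\<^sub>v ((q (- cas n) - q (- a)) \<cdot>\<^sub>v x + q (- cas n) \<cdot>\<^sub>v w) + G a *\<^sub>v v =
        (k * (q (- cas n) - q (- a))) \<cdot>\<^sub>v x + ((k * q (- cas n)) \<cdot>\<^sub>v w + G a *\<^sub>v v)"
    proof -
      define b where "b = G a *\<^sub>v v"
      have "b \<in> carrier_vec ?d" unfolding b_def by (rule square_mult_vec_carrier[OF G vc])
      then show ?thesis unfolding b_def[symmetric] using xc wc by (intro eq_vecI) (auto simp: algebra_simps)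
    qed
    finally have eq: "G a *\<^sub>v z = (k * (q (- cas n) - q (- a))) \<cdot>\<^sub>v x + ((k * q (- cas n)) \<cdot>\<^sub>v w + G a *\<^sub>v v)" .
    have "G a *\<^sub>v v \<in> S" unfolding G_apply[OF vc] by (rule Sadd[OF clos(4)[OF z(3)] Ssm[OF z(3)]])
    then have "(k * q (- cas n)) \<cdot>\<^sub>v w + G a *\<^sub>v v \<in> S" by (rule Sadd[OF Ssm[OF w(1)]])
    moreover have "k * (q (- cas n) - q (- a)) \<noteq> 0" using z(2) Cons.prems by auto
    moreover have "G a *\<^sub>v z \<in> weight_space Q M n"
      unfolding G_apply[OF wt_carrier[OF z(1)]]
      by (rule weight_space_add[OF M casimir_weight[OF M n z(1)] weight_space_smult[OF M z(1)]])
    ultimately show ?case unfolding Gz using eq by blast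
  qed
  then obtain k v where P: "word_act ?d G as *\<^sub>v x \<in> weight_space Q M n"
    and kv: "k \<noteq> 0" "v \<in> S" "word_act ?d G as *\<^sub>v x = k \<cdot>\<^sub>v x + v" by blast
  define p where "p = word_act ?d G as *\<^sub>v x"
  \<comment> \<open>E_i commutes with the Casimir operator, hence with the word, and the word was
    chosen to kill E_i x.\<close>
  have "actE M i *\<^sub>v p = 0\<^sub>v ?d" for i
  proof -
    have "word_act ?d G as * actE M i = actE M i * word_act ?d G as"
      by (rule word_act_commute[OF G cM(1)]) (rule G_comm[OF cM(1) casimir_commute(1)[OF M]])
    then show ?thesis
      unfolding p_def assoc_mult_mat_vec[OF cM(1) W xc, symmetric] using assoc_mult_mat_vec[OF W cM(1) xc] kill by metis
  qed
  then have "singular M n p" using n P by (simp add: singular_def p_def)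
  then have "p = 0\<^sub>v ?d \<or> p \<in> gen_vectors M" using generated.singular[of M n p] unfolding gen_vectors_def by blast
  then have pS: "p \<in> S" using S0 by (auto simp: S_def intro: lin.base)
  have "x = inverse k \<cdot>\<^sub>v (p + (- 1) \<cdot>\<^sub>v v)"
  proof -
    have "v \<in> carrier_vec ?d" using kv(2) SC by blast
    then have "p + (- 1) \<cdot>\<^sub>v v = k \<cdot>\<^sub>v x" unfolding p_def kv(3) using xc by (intro eq_vecI) auto
    then show ?thesis using kv(1) by (simp add: smult_smult_assoc)
  qed
  moreover have "inverse k \<cdot>\<^sub>v (p + (- 1) \<cdot>\<^sub>v v) \<in> S" by (intro Ssm Sadd pS kv(2))
  ultimately show False using xS by simp
qed

end

section \<open>Powers of operators with eigenvalues powers of q\<close>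

context qdatum
begin

definition q_eigen :: "nat \<Rightarrow> 'k mat \<Rightarrow> rat \<Rightarrow> 'k vec set" where
  "q_eigen d T r = {v \<in> carrier_vec d. T *\<^sub>v v = q r \<cdot>\<^sub>v v}"

text \<open>The operators to which \<open>q_power\<close> is applied: on them its defining
  description has exactly one solution.\<close>

definition qdiag :: "nat \<Rightarrow> 'k mat \<Rightarrow> bool" where
  "qdiag d T \<longleftrightarrow> T \<in> carrier_mat d d \<and> spans d (\<Union>r. q_eigen d T r)"

lemma qdiag_carrier: "qdiag d T \<Longrightarrow> T \<in> carrier_mat d d"
  by (simp add: qdiag_def)

lemma q_eigen_carrier: "v \<in> q_eigen d T r \<Longrightarrow> v \<in> carrier_vec d"
  by (simp add: q_eigen_def)

lemma qdiag_eqI: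
  assumes "qdiag d T" "A \<in> carrier_mat n d" "B \<in> carrier_mat n d"
    and "\<And>r v. v \<in> q_eigen d T r \<Longrightarrow> A *\<^sub>v v = B *\<^sub>v v"
  shows "A = B"
  by (rule mat_eqI_spans[OF assms(2,3), of "\<Union>r. q_eigen d T r"]) (use assms in \<open>auto simp: qdiag_def\<close>)

text \<open>Functional calculus: the simultaneous diagonalisation with a one-element family, whose
  labels are the exponents of q.\<close>

lemma qdiag_function:
  assumes T: "qdiag d T"
  obtains S where "S \<in> carrier_mat d d" "\<And>r v. v \<in> q_eigen d T r \<Longrightarrow> S *\<^sub>v v = phi r \<cdot>\<^sub>v v"
proof -
  have e: "joint_eigenspace d (\<lambda>_ :: unit. T) (\<lambda>_. q r) = q_eigen d T r" for r
    by (auto simp: joint_eigenspace_def q_eigen_def)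
  have "inj (\<lambda>r (_ :: unit). q r)" by (auto simp: inj_def fun_eq_iff)
  then have "\<exists>S\<in>carrier_mat d d. \<forall>r\<in>UNIV. \<forall>v\<in>joint_eigenspace d (\<lambda>_ :: unit. T) (\<lambda>_. q r). S *\<^sub>v v = phi r \<cdot>\<^sub>v v"
    by (intro joint_eigenspaces(2)) (use T in \<open>auto simp: qdiag_def e\<close>)
  then show ?thesis using that unfolding e by blast
qed

lemma q_power:
  assumes T: "qdiag d T"
  shows q_power_carrier: "q_power Q s T \<in> carrier_mat d d"
    and q_power_apply: "v \<in> q_eigen d T r \<Longrightarrow> q_power Q s T *\<^sub>v v = q (s * r) \<cdot>\<^sub>v v"
proof -
  let ?P = "\<lambda>S. S \<in> carrier_mat (dim_row T) (dim_row T) \<and>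
     (\<forall>x. \<forall>v \<in> carrier_vec (dim_row T). T *\<^sub>v v = q x \<cdot>\<^sub>v v \<longrightarrow> S *\<^sub>v v = q (s * x) \<cdot>\<^sub>v v)"
  have d: "dim_row T = d" using qdiag_carrier[OF T] by simp
  obtain S where S: "S \<in> carrier_mat d d" "\<And>r v. v \<in> q_eigen d T r \<Longrightarrow> S *\<^sub>v v = q (s * r) \<cdot>\<^sub>v v"
    using qdiag_function[OF T, of "\<lambda>r. q (s * r)"] by blast
  have PS: "?P S" using S by (auto simp: q_eigen_def d)
  have uniq: "S' = S" if "?P S'" for S'
    by (rule qdiag_eqI[OF T, where n = d]) (use that S in \<open>auto simp: q_eigen_def d\<close>)
  have "?P (THE S. ?P S)" by (rule theI[of ?P, OF PS uniq])
  then have P: "?P (q_power Q s T)" unfolding q_power_def .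
  then show "q_power Q s T \<in> carrier_mat d d"
    and "v \<in> q_eigen d T r \<Longrightarrow> q_power Q s T *\<^sub>v v = q (s * r) \<cdot>\<^sub>v v"
    unfolding d by (auto simp: q_eigen_def)
qed

text \<open>X carries eigenvectors of T to eigenvectors of T' for the same exponent. This is the
  naturality of the powers.\<close>

lemma q_power_intertwine:
  assumes T: "qdiag d T" and T': "qdiag n T'" and X: "X \<in> carrier_mat n d" and eq: "X * T = T' * X"
  shows "X * q_power Q s T = q_power Q s T' * X"
proof (rule qdiag_eqI[OF T mult_carrier_mat[OF X q_power_carrier[OF T]] mult_carrier_mat[OF q_power_carrier[OF T'] X]])
  fix r v assume v: "v \<in> q_eigen d T r"
  note vc = q_eigen_carrier[OF v]
  have "T' *\<^sub>v (X *\<^sub>v v) = X *\<^sub>v (T *\<^sub>v v)"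
    unfolding assoc_mult_mat_vec[OF qdiag_carrier[OF T'] X vc, symmetric] eq[symmetric]
    by (rule assoc_mult_mat_vec[OF X qdiag_carrier[OF T] vc])
  then have "X *\<^sub>v v \<in> q_eigen n T' r"
    using v X mult_mat_vec[OF X vc] by (simp add: q_eigen_def)
  then show "X * q_power Q s T *\<^sub>v v = q_power Q s T' * X *\<^sub>v v"
    unfolding assoc_mult_mat_vec[OF X q_power_carrier[OF T] vc] assoc_mult_mat_vec[OF q_power_carrier[OF T'] X vc]
      q_power_apply[OF T v] mult_mat_vec[OF X vc] by (rule q_power_apply[OF T', symmetric])
qed

lemma q_power_commute:
  assumes "qdiag d T" "X \<in> carrier_mat d d" "X * T = T * X"
  shows "X * q_power Q s T = q_power Q s T * X"
  using q_power_intertwine[OF assms(1) assms(1) assms(2,3)] .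

lemma q_power_add:
  assumes T: "qdiag d T"
  shows "q_power Q s T * q_power Q t T = q_power Q (s + t) T"
proof (rule qdiag_eqI[OF T square_mult_carrier[OF q_power_carrier[OF T] q_power_carrier[OF T]] q_power_carrier[OF T]])
  fix r v assume v: "v \<in> q_eigen d T r"
  note vc = q_eigen_carrier[OF v]
  show "q_power Q s T * q_power Q t T *\<^sub>v v = q_power Q (s + t) T *\<^sub>v v"
    unfolding assoc_mult_mat_vec[OF q_power_carrier[OF T] q_power_carrier[OF T] vc] q_power_apply[OF T v]
      mult_mat_vec[OF q_power_carrier[OF T] vc] by (simp add: smult_smult_assoc q_add algebra_simps)
qed

lemma
  assumes T: "qdiag d T"
  shows q_power_one: "q_power Q 1 T = T" and q_power_zero: "q_power Q 0 T = 1\<^sub>m d"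
proof -
  show "q_power Q 1 T = T"
  proof (rule qdiag_eqI[OF T q_power_carrier[OF T] qdiag_carrier[OF T]])
    fix r v assume v: "v \<in> q_eigen d T r"
    show "q_power Q 1 T *\<^sub>v v = T *\<^sub>v v" unfolding q_power_apply[OF T v] using v by (simp add: q_eigen_def)
  qed
  show "q_power Q 0 T = 1\<^sub>m d"
  proof (rule qdiag_eqI[OF T q_power_carrier[OF T] one_carrier_mat])
    fix r v assume v: "v \<in> q_eigen d T r"
    show "q_power Q 0 T *\<^sub>v v = 1\<^sub>m d *\<^sub>v v" unfolding q_power_apply[OF T v] using v by (simp add: q_eigen_def)
  qed
qed

lemma qdiag_q_power:
  assumes T: "qdiag d T"
  shows "qdiag d (q_power Q s T)"
proof -
  have "v \<in> q_eigen d (q_power Q s T) (s * r)" if v: "v \<in> q_eigen d T r" for v r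
    using q_power_apply[OF T v] q_eigen_carrier[OF v] unfolding q_eigen_def by blast
  then have "(\<Union>r. q_eigen d T r) \<subseteq> (\<Union>r. q_eigen d (q_power Q s T) r)" by blast
  then have "spans d (\<Union>r. q_eigen d (q_power Q s T) r)"
  proof (rule spans_mono[rotated])
    show "spans d (\<Union>r. q_eigen d T r)" using T by (simp add: qdiag_def)
  qed (use q_eigen_carrier in blast)
  then show ?thesis using q_power_carrier[OF T] by (simp add: qdiag_def)
qed

text \<open>The spectral projection of T to exponent r commutes with T', so it maps eigenvectors of
  T' to common eigenvectors. Expanding v in eigenvectors of T' and projecting expresses an
  r-eigenvector v of T through common ones.\<close>

lemma spans_common_eigenvectors:
  assumes T: "qdiag d T" and T': "qdiag d T'" and comm: "T * T' = T' * T"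
  shows "spans d (\<Union>r r'. q_eigen d T r \<inter> q_eigen d T' r')" (is "spans d ?U")
proof -
  note cT = qdiag_carrier[OF T] qdiag_carrier[OF T']
  have "v \<in> lin d ?U" if v: "v \<in> q_eigen d T r" for v r
  proof -
    obtain P where P: "P \<in> carrier_mat d d"
      and P_app: "\<And>t v. v \<in> q_eigen d T t \<Longrightarrow> P *\<^sub>v v = (if t = r then 1 else 0) \<cdot>\<^sub>v v"
      using qdiag_function[OF T, of "\<lambda>t. if t = r then 1 else 0"] by metis
    have PT: "T * P = q r \<cdot>\<^sub>m P"
    proof (rule qdiag_eqI[OF T, where n = d])
      fix t w assume w: "w \<in> q_eigen d T t"
      note wc = q_eigen_carrier[OF w]
      show "T * P *\<^sub>v w = q r \<cdot>\<^sub>m P *\<^sub>v w"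
        unfolding assoc_mult_mat_vec[OF cT(1) P wc] smult_mat_vec[OF P wc] P_app[OF w] mult_mat_vec[OF cT(1) wc]
        using w by (auto simp: q_eigen_def)
    qed (use P cT in simp_all)
    have PT': "T' * P = P * T'"
    proof (rule qdiag_eqI[OF T, where n = d])
      fix t w assume w: "w \<in> q_eigen d T t"
      note wc = q_eigen_carrier[OF w]
      have "T *\<^sub>v (T' *\<^sub>v w) = T' *\<^sub>v (T *\<^sub>v w)"
        unfolding assoc_mult_mat_vec[OF cT wc, symmetric] comm by (rule assoc_mult_mat_vec[OF cT(2,1) wc])
      then have "T' *\<^sub>v w \<in> q_eigen d T t" using w cT mult_mat_vec[OF cT(2) wc] by (simp add: q_eigen_def)
      then show "T' * P *\<^sub>v w = P * T' *\<^sub>v w"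
        unfolding assoc_mult_mat_vec[OF cT(2) P wc] assoc_mult_mat_vec[OF P cT(2) wc] P_app[OF w] mult_mat_vec[OF cT(2) wc]
        using P_app[of "T' *\<^sub>v w" t] by simp
    qed (use P cT in simp_all)
    have "P *\<^sub>v v \<in> lin d ?U"
    proof (rule lin_mult_closed[OF P])
      show "(\<Union>r. q_eigen d T' r) \<subseteq> carrier_vec d" by (auto simp: q_eigen_def)
      show "v \<in> lin d (\<Union>r. q_eigen d T' r)" using T' q_eigen_carrier[OF v] by (auto simp: qdiag_def spans_def)
      fix w assume "w \<in> (\<Union>r. q_eigen d T' r)"
      then obtain r' where w: "w \<in> q_eigen d T' r'" by blast
      note wc = q_eigen_carrier[OF w]
      have "P *\<^sub>v w \<in> q_eigen d T r"
        using assoc_mult_mat_vec[OF cT(1) P wc] smult_mat_vec[OF P wc, of "q r"] square_mult_vec_carrier[OF P wc]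
        unfolding PT by (simp add: q_eigen_def)
      moreover have "T' *\<^sub>v (P *\<^sub>v w) = q r' \<cdot>\<^sub>v (P *\<^sub>v w)"
        unfolding assoc_mult_mat_vec[OF cT(2) P wc, symmetric] PT' assoc_mult_mat_vec[OF P cT(2) wc]
        using w mult_mat_vec[OF P wc] by (simp add: q_eigen_def)
      ultimately show "P *\<^sub>v w \<in> lin d ?U"
        using square_mult_vec_carrier[OF P wc] by (intro lin.base) (auto simp: q_eigen_def)
    qed
    then show ?thesis using P_app[OF v] by simp
  qed
  then have 1: "(\<Union>r. q_eigen d T r) \<subseteq> lin d ?U" by blast
  have 2: "spans d (\<Union>r. q_eigen d T r)" using T by (simp add: qdiag_def)
  have 3: "?U \<subseteq> carrier_vec d" using q_eigen_carrier by blast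
  show ?thesis by (rule spans_lin[OF 2 1 3])
qed

lemma
  assumes T: "qdiag d T" and T': "qdiag d T'" and comm: "T * T' = T' * T"
  shows qdiag_mult: "qdiag d (T * T')"
    and q_power_mult: "q_power Q s (T * T') = q_power Q s T * q_power Q s T'"
proof -
  let ?U = "\<Union>r r'. q_eigen d T r \<inter> q_eigen d T' r'"
  note cT = qdiag_carrier[OF T] qdiag_carrier[OF T']
  note sp = spans_common_eigenvectors[OF assms]
  have eig: "v \<in> q_eigen d (T * T') (r + r')" if "v \<in> q_eigen d T r" "v \<in> q_eigen d T' r'" for v r r'
    using that assoc_mult_mat_vec[OF cT, of v] mult_mat_vec[OF cT(1), of v]
    by (simp add: q_eigen_def smult_smult_assoc q_add mult.commute)
  have "spans d (\<Union>r. q_eigen d (T * T') r)"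
    by (rule spans_mono[OF sp]) (use eig in \<open>auto simp: q_eigen_def\<close>)
  then show TT': "qdiag d (T * T')" using cT by (simp add: qdiag_def)
  note cP = q_power_carrier[OF T] q_power_carrier[OF T']
  show "q_power Q s (T * T') = q_power Q s T * q_power Q s T'"
  proof (rule mat_eqI_spans[OF q_power_carrier[OF TT'] square_mult_carrier[OF cP] sp])
    fix v assume "v \<in> ?U"
    then obtain r r' where v: "v \<in> q_eigen d T r" "v \<in> q_eigen d T' r'" by blast
    note vc = q_eigen_carrier[OF v(1)]
    show "q_power Q s (T * T') *\<^sub>v v = q_power Q s T * q_power Q s T' *\<^sub>v v"
      unfolding assoc_mult_mat_vec[OF cP vc] q_power_apply[OF T' v(2)] mult_mat_vec[OF cP(1) vc]
        q_power_apply[OF T v(1)] q_power_apply[OF TT' eig[OF v]]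
      by (simp add: smult_smult_assoc q_add[symmetric] algebra_simps)
  qed
qed

lemma
  assumes T: "qdiag d T" and T': "qdiag n T'"
  shows qdiag_kron: "qdiag (d * n) (kron T T')"
    and q_power_kron: "q_power Q s (kron T T') = kron (q_power Q s T) (q_power Q s T')"
proof -
  note cT = qdiag_carrier[OF T] qdiag_carrier[OF T']
  note sp = spans_kron_vec[of d "\<Union>r. q_eigen d T r" n "\<Union>r. q_eigen n T' r"]
  have eig: "kron_vec v w \<in> q_eigen (d * n) (kron T T') (r + r')" if "v \<in> q_eigen d T r" "w \<in> q_eigen n T' r'" for v w r r'
    using that kron_mult_kron_vec[OF cT, of v w]
    by (simp add: q_eigen_def kron_vec_linear smult_smult_assoc q_add mult.commute)
  have "spans (d * n) (\<Union>r. q_eigen (d * n) (kron T T') r)"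
  proof (rule spans_mono[OF sp])
    show "{kron_vec x y |x y. x \<in> (\<Union>r. q_eigen d T r) \<and> y \<in> (\<Union>r. q_eigen n T' r)} \<subseteq> (\<Union>r. q_eigen (d * n) (kron T T') r)"
      using eig by blast
  qed (use T T' in \<open>auto simp: qdiag_def q_eigen_carrier\<close>)
  then show TT': "qdiag (d * n) (kron T T')" using cT by (simp add: qdiag_def)
  note cP = q_power_carrier[OF T] q_power_carrier[OF T']
  show "q_power Q s (kron T T') = kron (q_power Q s T) (q_power Q s T')"
  proof (rule mat_eqI_spans[OF q_power_carrier[OF TT'] kron_carrier[OF cP] sp])
    fix z assume "z \<in> {kron_vec x y |x y. x \<in> (\<Union>r. q_eigen d T r) \<and> y \<in> (\<Union>r. q_eigen n T' r)}"
    then obtain v w r r' where z: "z = kron_vec v w" and v: "v \<in> q_eigen d T r" and w: "w \<in> q_eigen n T' r'" by blast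
    show "q_power Q s (kron T T') *\<^sub>v z = kron (q_power Q s T) (q_power Q s T') *\<^sub>v z"
      unfolding z kron_mult_kron_vec[OF cP q_eigen_carrier[OF v] q_eigen_carrier[OF w]]
        q_power_apply[OF T v] q_power_apply[OF T' w] q_power_apply[OF TT' eig[OF v w]] kron_vec_linear
      by (simp add: smult_smult_assoc q_add algebra_simps)
  qed (use T T' in \<open>simp_all add: qdiag_def\<close>)
qed

lemma qdiag_one: "qdiag d (1\<^sub>m d)"
proof -
  have "carrier_vec d \<subseteq> q_eigen d (1\<^sub>m d) 0" by (auto simp: q_eigen_def)
  then have "spans d (\<Union>r. q_eigen d (1\<^sub>m d) r)"
    by (intro spans_mono[OF spans_carrier]) (auto simp: q_eigen_def)
  then show ?thesis by (simp add: qdiag_def)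
qed

lemma q_power_one_mat: "q_power Q s (1\<^sub>m d) = 1\<^sub>m d"
proof (rule qdiag_eqI[OF qdiag_one q_power_carrier[OF qdiag_one] one_carrier_mat])
  fix r v assume v: "v \<in> q_eigen d (1\<^sub>m d) r"
  have "v \<in> q_eigen d (1\<^sub>m d) 0" using q_eigen_carrier[OF v] by (simp add: q_eigen_def)
  from q_power_apply[OF qdiag_one this] show "q_power Q s (1\<^sub>m d) *\<^sub>v v = 1\<^sub>m d *\<^sub>v v"
    using q_eigen_carrier[OF v] by simp
qed

lemma q_power_kron_one:
  assumes T: "qdiag d T"
  shows "qdiag (d * n) (kron T (1\<^sub>m n))" "q_power Q s (kron T (1\<^sub>m n)) = kron (q_power Q s T) (1\<^sub>m n)"
  by (rule qdiag_kron[OF T qdiag_one]) (rule q_power_kron[OF T qdiag_one, unfolded q_power_one_mat])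

lemma q_power_inverse:
  assumes "qdiag d T"
  shows "T * q_power Q (- 1) T = 1\<^sub>m d"
proof -
  have "q_power Q 1 T * q_power Q (- 1) T = q_power Q 0 T" unfolding q_power_add[OF assms] by simp
  then show ?thesis unfolding q_power_one[OF assms] q_power_zero[OF assms] .
qed

end

section \<open>The double braiding\<close>

context qdatum
begin

section \<open>Module homomorphisms\<close>

lemma module_hom_carrier: "module_hom M N f \<Longrightarrow> f \<in> carrier_mat (mdim N) (mdim M)"
  by (simp add: module_hom_def)

lemma module_hom_commute:
  assumes "module_hom M N f"
  shows "f * actE M i = actE N i * f" "f * actF M i = actF N i * f"
    "f * actK M i = actK N i * f" "f * actKi M i = actKi N i * f"
  using assms by (simp_all add: module_hom_def)

lemma intertwine_apply:
  fixes f :: "'k mat"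
  assumes "f \<in> carrier_mat n m" "X \<in> carrier_mat m m" "Y \<in> carrier_mat n n" "f * X = Y * f" "x \<in> carrier_vec m"
  shows "f *\<^sub>v (X *\<^sub>v x) = Y *\<^sub>v (f *\<^sub>v x)"
  using assoc_mult_mat_vec[OF assms(1,2,5)] assoc_mult_mat_vec[OF assms(3,1,5)] assms(4) by simp

lemma intertwine_mult:
  fixes f g :: "'k mat"
  assumes f: "f \<in> carrier_mat n m" and g: "g \<in> carrier_mat p n" and X: "X \<in> carrier_mat m m" and Y: "Y \<in> carrier_mat n n" and Z: "Z \<in> carrier_mat p p"
    and eq: "f * X = Y * f" "g * Y = Z * g"
  shows "(g * f) * X = Z * (g * f)"
  unfolding assoc_mult_mat[OF g f X] eq(1) assoc_mult_mat[OF g Y f, symmetric] eq(2) by (rule assoc_mult_mat[OF Z g f])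

lemma module_hom_apply:
  assumes M: "weight_module M" and N: "weight_module N" and f: "module_hom M N f" and x: "x \<in> carrier_vec (mdim M)"
  shows "f *\<^sub>v (actE M i *\<^sub>v x) = actE N i *\<^sub>v (f *\<^sub>v x)" "f *\<^sub>v (actF M i *\<^sub>v x) = actF N i *\<^sub>v (f *\<^sub>v x)"
    "f *\<^sub>v (actK M i *\<^sub>v x) = actK N i *\<^sub>v (f *\<^sub>v x)" "f *\<^sub>v (actKi M i *\<^sub>v x) = actKi N i *\<^sub>v (f *\<^sub>v x)"
  by (intro intertwine_apply[OF module_hom_carrier[OF f] _ _ _ x] module_hom_commute[OF f] weight_module_carrier M N)+

lemma module_hom_mult:
  assumes M: "weight_module M" and N: "weight_module N" and P: "weight_module P"
    and f: "module_hom M N f" and g: "module_hom N P g"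
  shows "module_hom M P (g * f)"
proof -
  note cf = module_hom_carrier[OF f] module_hom_carrier[OF g]
  note im = intertwine_mult[OF cf]
  have "g * f \<in> carrier_mat (mdim P) (mdim M)" by (rule mult_carrier_mat[OF cf(2,1)])
  moreover have "g * f * actE M i = actE P i * (g * f)" for i
    by (rule im[OF weight_module_carrier(1)[OF M] weight_module_carrier(1)[OF N] weight_module_carrier(1)[OF P]
      module_hom_commute(1)[OF f] module_hom_commute(1)[OF g]])
  moreover have "g * f * actF M i = actF P i * (g * f)" for i
    by (rule im[OF weight_module_carrier(2)[OF M] weight_module_carrier(2)[OF N] weight_module_carrier(2)[OF P]
      module_hom_commute(2)[OF f] module_hom_commute(2)[OF g]])
  moreover have "g * f * actK M i = actK P i * (g * f)" for i
    by (rule im[OF weight_module_carrier(3)[OF M] weight_module_carrier(3)[OF N] weight_module_carrier(3)[OF P]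
      module_hom_commute(3)[OF f] module_hom_commute(3)[OF g]])
  moreover have "g * f * actKi M i = actKi P i * (g * f)" for i
    by (rule im[OF weight_module_carrier(4)[OF M] weight_module_carrier(4)[OF N] weight_module_carrier(4)[OF P]
      module_hom_commute(4)[OF f] module_hom_commute(4)[OF g]])
  ultimately show ?thesis unfolding module_hom_def by blast
qed

lemma module_hom_weight:
  assumes M: "weight_module M" and N: "weight_module N" and f: "module_hom M N f" and x: "x \<in> weight_space Q M l"
  shows "f *\<^sub>v x \<in> weight_space Q N l"
  using module_hom_apply(3)[OF M N f wt_carrier[OF x]] mult_mat_vec[OF module_hom_carrier[OF f] wt_carrier[OF x]]
    K_weight[OF x] module_hom_carrier[OF f] wt_carrier[OF x]
  unfolding weight_space_def by simp

lemma module_hom_one: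
  assumes M: "weight_module M"
  shows "module_hom M M (1\<^sub>m (mdim M))"
proof -
  note cM = weight_module_carrier[OF M]
  show ?thesis
    unfolding module_hom_def left_mult_one_mat[OF cM(1)] left_mult_one_mat[OF cM(2)] left_mult_one_mat[OF cM(3)] left_mult_one_mat[OF cM(4)]
      right_mult_one_mat[OF cM(1)] right_mult_one_mat[OF cM(2)] right_mult_one_mat[OF cM(3)] right_mult_one_mat[OF cM(4)] by simp
qed

text \<open>Polarisation of \<open>cas\<close>: twice (l, m) is cas (l + m) - cas l - cas m. The
  square of the weight form thus supplies the factors that complete \<open>casimir_sum\<close> to
  \<open>casimir\<close> on M and on N, and a scalar on each weight space of the tensor
  product.\<close>

lemma weight_form_square:
  assumes M: "weight_module M" and N: "weight_module N"
  shows "weight_form_action Q M N * weight_form_action Q M N =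
    kron (weight_diag M (\<lambda>l. q (- cas l))) (weight_diag N (\<lambda>l. q (- cas l))) * weight_diag (tensor M N) (\<lambda>l. q (cas l))"
proof (rule weight_kron_eqI[OF M N, where a = "mdim M * mdim N"])
  let ?d = "mdim M * mdim N"
  note D = weight_form_carrier[OF M N]
  note MN = weight_module_tensor[OF M N]
  have G: "weight_diag (tensor M N) f \<in> carrier_mat ?d ?d" for f using weight_diag_carrier[OF MN, of f] by simp
  note dc = weight_diag_carrier[OF M] weight_diag_carrier[OF N]
  show "weight_form_action Q M N * weight_form_action Q M N \<in> carrier_mat ?d ?d" using D by simp
  show "kron (weight_diag M (\<lambda>l. q (- cas l))) (weight_diag N (\<lambda>l. q (- cas l))) * weight_diag (tensor M N) (\<lambda>l. q (cas l)) \<in> carrier_mat ?d ?d"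
    by (rule square_mult_carrier[OF kron_carrier[OF dc] G])
  fix l m x y assume l: "l \<in> weights Q" and m: "m \<in> weights Q" and x: "x \<in> weight_space Q M l" and y: "y \<in> weight_space Q N m"
    and xc: "x \<in> carrier_vec (mdim M)" and yc: "y \<in> carrier_vec (mdim N)"
  have xy: "kron_vec x y \<in> carrier_vec ?d" using xc yc by simp
  have e: "q (form Q l m) * q (form Q l m) = q (cas (l + m)) * (q (- cas m) * q (- cas l))"
    by (simp add: q_add[symmetric] cas_add)
  show "weight_form_action Q M N * weight_form_action Q M N *\<^sub>v kron_vec x y =
      kron (weight_diag M (\<lambda>l. q (- cas l))) (weight_diag N (\<lambda>l. q (- cas l))) * weight_diag (tensor M N) (\<lambda>l. q (cas l)) *\<^sub>v kron_vec x y"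
    unfolding assoc_mult_mat_vec[OF D D xy] weight_form_apply[OF M N l m x y] mult_mat_vec[OF D xy]
      assoc_mult_mat_vec[OF kron_carrier[OF dc] G xy] weight_diag_apply[OF MN weights_add[OF l m] kron_weight[OF M N x y]]
      mult_mat_vec[OF kron_carrier[OF dc] xy] kron_mult_kron_vec[OF dc xc yc] weight_diag_apply[OF M l x] weight_diag_apply[OF N m y]
      kron_vec_linear smult_smult_assoc e ..
qed

end

context braided
begin

text \<open>\<open>casimir_sum\<close> is a combination of products of generators, and the remaining
  factor depends only on weights, which module maps preserve.\<close>

lemma casimir_module_hom:
  assumes M: "weight_module M" and f: "module_hom M M f"
  shows "f * casimir M = casimir M * f"
proof (rule weight_module_eqI[OF M, where n = "mdim M"])
  let ?d = "mdim M"
  note cM = weight_module_carrier[OF M] antipode_carrier[OF M]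
  note fc = module_hom_carrier[OF f]
  note C = casimir_carrier[OF M]
  show "f * casimir M \<in> carrier_mat ?d ?d" "casimir M * f \<in> carrier_mat ?d ?d" using fc C by simp_all
  have fF: "actF M i * f = f * actF M i" for i by (rule module_hom_commute(2)[OF f, symmetric])
  have fA: "antipode M i * f = f * antipode M i" for i
  proof -
    have KE: "f * (actKi M i * actE M i) = (actKi M i * actE M i) * f"
      using assoc_mult_mat[OF fc cM(4) cM(1), of i i] assoc_mult_mat[OF cM(4) fc cM(1), of i i] assoc_mult_mat[OF cM(4) cM(1) fc, of i i]
        module_hom_commute(1,4)[OF f, of i] by simp
    have "actKi M i * actE M i \<in> carrier_mat ?d ?d" using cM by simp
    then have "dim_col (actKi M i * actE M i) = dim_row f" "dim_col f = dim_row (actKi M i * actE M i)" using fc by auto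
    then show ?thesis unfolding antipode_def using KE uminus_mult_left_mat uminus_mult_right_mat by metis
  qed
  have W: "word_act ?d (actF M) u \<in> carrier_mat ?d ?d" "word_act ?d (antipode M) u \<in> carrier_mat ?d ?d" for u using cM by simp_all
  have WF: "word_act ?d (actF M) u * f = f * word_act ?d (actF M) u" for u
    by (rule word_act_commute[OF cM(2) fc fF])
  have WA: "word_act ?d (antipode M) u * f = f * word_act ?d (antipode M) u" for u
    by (rule word_act_commute[OF cM(5) fc fA])
  have P: "f * casimir_sum c M = casimir_sum c M * f"
  proof -
    let ?X = "\<lambda>(u, w). word_act ?d (actF M) w * word_act ?d (antipode M) (rev u)"
    have X: "?X s \<in> carrier_mat ?d ?d" for s using W by (cases s) simp
    have "f * ?X s = ?X s * f" for s
    proof (cases s)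
      case (Pair u w)
      have "f * (word_act ?d (actF M) w * word_act ?d (antipode M) (rev u)) =
          word_act ?d (actF M) w * word_act ?d (antipode M) (rev u) * f"
        unfolding assoc_mult_mat[OF fc W(1) W(2), symmetric] assoc_mult_mat[OF W(1) W(2) fc] WA WF[symmetric]
        by (rule assoc_mult_mat[OF W(1) fc W(2)])
      then show ?thesis unfolding Pair by simp
    qed
    then show ?thesis
      unfolding casimir_sum_def mult_mat_lincomb(1)[OF fc X] mult_mat_lincomb(2)[OF fc X] by (intro mat_lincomb_cong)
  qed
  fix l x assume l: "l \<in> weights Q" and x: "x \<in> weight_space Q M l"
  note xc = wt_carrier[OF x]
  note Px = square_mult_vec_carrier[OF casimir_sum_carrier xc]
  show "f * casimir M *\<^sub>v x = casimir M * f *\<^sub>v x"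
    unfolding assoc_mult_mat_vec[OF fc C xc] assoc_mult_mat_vec[OF C fc xc] casimir_apply[OF M l x]
      casimir_apply[OF M l module_hom_weight[OF M M f x]] mult_mat_vec[OF fc Px]
    using intertwine_apply[OF fc casimir_sum_carrier casimir_sum_carrier P xc] by simp
qed

lemma casimir_module_end: "weight_module M \<Longrightarrow> module_hom M M (casimir M)"
proof -
  assume M: "weight_module M"
  have "casimir M * actKi M i = actKi M i * casimir M" for i
  proof (rule weight_module_eqI[OF M, where n = "mdim M"])
    note cM = weight_module_carrier[OF M] casimir_carrier[OF M]
    show "casimir M * actKi M i \<in> carrier_mat (mdim M) (mdim M)" "actKi M i * casimir M \<in> carrier_mat (mdim M) (mdim M)"
      using cM by simp_all
    fix l x assume l: "l \<in> weights Q" and x: "x \<in> weight_space Q M l"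
    note xc = wt_carrier[OF x]
    show "casimir M * actKi M i *\<^sub>v x = actKi M i * casimir M *\<^sub>v x"
      unfolding assoc_mult_mat_vec[OF cM(5) cM(4) xc] assoc_mult_mat_vec[OF cM(4) cM(5) xc] Ki_weight[OF M x]
        Ki_weight[OF M casimir_weight[OF M l x]] by (rule mult_mat_vec[OF cM(5) xc])
  qed
  then show ?thesis
    unfolding module_hom_def using casimir_carrier[OF M] casimir_commute[OF M] by blast
qed

lemma qdiag_casimir:
  assumes M: "weight_module M"
  shows "qdiag (mdim M) (casimir M)"
proof -
  have "x \<in> q_eigen (mdim M) (casimir M) (- cas l)" if "generated M l m x" for l m x
    using generated_casimir[OF M that] generated_carrier[OF M that] by (simp add: q_eigen_def)
  then have "gen_vectors M \<subseteq> (\<Union>r. q_eigen (mdim M) (casimir M) r)"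
    unfolding gen_vectors_def by blast
  then have "spans (mdim M) (\<Union>r. q_eigen (mdim M) (casimir M) r)"
    by (rule spans_mono[OF spans_gen_vectors[OF M]]) (auto simp: q_eigen_def)
  then show ?thesis using casimir_carrier[OF M] by (simp add: qdiag_def)
qed

lemma module_hom_kron:
  assumes M: "weight_module M" and M': "weight_module M'" and N: "weight_module N" and N': "weight_module N'"
    and f: "module_hom M M' f" and g: "module_hom N N' g"
  shows "module_hom (tensor M N) (tensor M' N') (kron f g)"
proof -
  note fc = module_hom_carrier[OF f] and gc = module_hom_carrier[OF g]
  note cs = weight_module_carrier[OF M] weight_module_carrier[OF M']
  note ct = weight_module_carrier[OF N] weight_module_carrier[OF N']
  have fg: "kron f g \<in> carrier_mat (mdim (tensor M' N')) (mdim (tensor M N))" using kron_carrier[OF fc gc] by simp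
  have k: "kron f g * kron X Y = kron X' Y' * kron f g"
    if "X \<in> carrier_mat (mdim M) (mdim M)" "X' \<in> carrier_mat (mdim M') (mdim M')"
      "Y \<in> carrier_mat (mdim N) (mdim N)" "Y' \<in> carrier_mat (mdim N') (mdim N')"
      "f * X = X' * f" "g * Y = Y' * g" for X X' Y Y'
    unfolding kron_mult[OF fc that(1) gc that(3)] kron_mult[OF that(2) fc that(4) gc] that(5,6) ..
  have one: "f * 1\<^sub>m (mdim M) = 1\<^sub>m (mdim M') * f" "g * 1\<^sub>m (mdim N) = 1\<^sub>m (mdim N') * g" using fc gc by simp_all
  note kc = kron_carrier[OF cs(1) ct(3)] kron_carrier[OF one_carrier_mat ct(1)] kron_carrier[OF cs(5) ct(7)] kron_carrier[OF one_carrier_mat ct(5)]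
    kron_carrier[OF cs(2) one_carrier_mat] kron_carrier[OF cs(4) ct(2)] kron_carrier[OF cs(6) one_carrier_mat] kron_carrier[OF cs(8) ct(6)]
  have "kron f g * actE (tensor M N) i = actE (tensor M' N') i * kron f g" for i
    unfolding tensor_sel mult_add_distrib_mat[OF fg[unfolded tensor_sel] kc(1) kc(2)]
      add_mult_distrib_mat[OF kc(3) kc(4) fg[unfolded tensor_sel]]
      k[OF cs(1) cs(5) ct(3) ct(7) module_hom_commute(1)[OF f] module_hom_commute(3)[OF g]]
      k[OF one_carrier_mat one_carrier_mat ct(1) ct(5) one(1) module_hom_commute(1)[OF g]] ..
  moreover have "kron f g * actF (tensor M N) i = actF (tensor M' N') i * kron f g" for i
    unfolding tensor_sel mult_add_distrib_mat[OF fg[unfolded tensor_sel] kc(5) kc(6)]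
      add_mult_distrib_mat[OF kc(7) kc(8) fg[unfolded tensor_sel]]
      k[OF cs(2) cs(6) one_carrier_mat one_carrier_mat module_hom_commute(2)[OF f] one(2)]
      k[OF cs(4) cs(8) ct(2) ct(6) module_hom_commute(4)[OF f] module_hom_commute(2)[OF g]] ..
  moreover have "kron f g * actK (tensor M N) i = actK (tensor M' N') i * kron f g" for i
    unfolding tensor_sel by (rule k[OF cs(3) cs(7) ct(3) ct(7) module_hom_commute(3)[OF f] module_hom_commute(3)[OF g]])
  moreover have "kron f g * actKi (tensor M N) i = actKi (tensor M' N') i * kron f g" for i
    unfolding tensor_sel by (rule k[OF cs(4) cs(8) ct(4) ct(8) module_hom_commute(4)[OF f] module_hom_commute(4)[OF g]])
  ultimately show ?thesis using fg unfolding module_hom_def by blast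
qed

section \<open>The double braiding\<close>

definition double_braiding :: "('i, 'k) qmodule \<Rightarrow> ('i, 'k) qmodule \<Rightarrow> 'k mat" where
  "double_braiding M N = R N M * R M N"

lemma double_braiding_hom:
  assumes "weight_module M" "weight_module N"
  shows "module_hom (tensor M N) (tensor M N) (double_braiding M N)"
  unfolding double_braiding_def using assms by (intro module_hom_mult[OF _ _ _ R_hom R_hom]) simp_all

text \<open>By \<open>theta_singular\<close> the first braiding acts on z through
  \<open>casimir_sum\<close> of N on the second leg. The result is again killed by all E, so the
  second braiding contributes \<open>casimir_sum\<close> of M. Once everything is moved past the
  flips, the two weight forms combine to their square, and \<open>weight_form_square\<close>
  completes both sums to Casimir operators.\<close>

lemma double_braiding_singular:
  assumes M: "weight_module M" and N: "weight_module N" and z: "singular (tensor M N) l z"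
  shows "double_braiding M N *\<^sub>v z = q (cas l) \<cdot>\<^sub>v (kron (casimir M) (casimir N) *\<^sub>v z)"
proof -
  let ?m = "mdim M" and ?n = "mdim N"
  let ?d = "?m * ?n" and ?e = "?n * ?m"
  let ?PM = "casimir_sum c M" and ?PN = "casimir_sum c N"
  let ?D = "weight_form_action Q M N" and ?D' = "weight_form_action Q N M"
  let ?fl = "flip_mat ?m ?n :: 'k mat" and ?fl' = "flip_mat ?n ?m :: 'k mat"
  let ?G = "weight_diag (tensor M N) (\<lambda>l. q (cas l))"
  let ?dM = "weight_diag M (\<lambda>l. q (- cas l))" and ?dN = "weight_diag N (\<lambda>l. q (- cas l))"
  have MN: "weight_module (tensor M N)" and NM: "weight_module (tensor N M)" using M N by simp_all
  have l: "l \<in> weights Q" and zw: "z \<in> weight_space Q (tensor M N) l" and zE: "\<And>i. actE (tensor M N) i *\<^sub>v z = 0\<^sub>v ?d"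
    using z by (simp_all add: singular_def del: tensor_sel(2-5))
  have zc: "z \<in> carrier_vec ?d" using wt_carrier[OF zw] by simp
  note D = weight_form_carrier[OF M N] and D' = weight_form_carrier[OF N M]
  note P = casimir_sum_carrier[of c M] casimir_sum_carrier[of c N]
  have k1: "kron (1\<^sub>m ?m) ?PN \<in> carrier_mat ?d ?d" and k2: "kron ?PM (1\<^sub>m ?n) \<in> carrier_mat ?d ?d"
    and k3: "kron (1\<^sub>m ?n) ?PM \<in> carrier_mat ?e ?e" and k4: "kron ?PM ?PN \<in> carrier_mat ?d ?d"
    by (simp_all add: kron_carrier)
  have G: "?G \<in> carrier_mat ?d ?d" using weight_diag_carrier[OF MN] by simp
  note dc = weight_diag_carrier[OF M] weight_diag_carrier[OF N]
  have RE: "R M N *\<^sub>v z \<in> carrier_vec ?e" "actE (tensor N M) i *\<^sub>v (R M N *\<^sub>v z) = 0\<^sub>v ?e" for i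
  proof -
    show "R M N *\<^sub>v z \<in> carrier_vec ?e" using R_carrier[OF M N] zc by simp
    show "actE (tensor N M) i *\<^sub>v (R M N *\<^sub>v z) = 0\<^sub>v ?e"
      using module_hom_apply(1)[OF MN NM R_hom[OF M N] wt_carrier[OF zw], of i] zE[of i]
        mult_mat_zero_vec[OF R_carrier[OF M N]] by simp
  qed
  define y where "y = kron (1\<^sub>m ?m) ?PN *\<^sub>v z"
  have yc: "y \<in> carrier_vec ?d" unfolding y_def by (rule square_mult_vec_carrier[OF k1 zc])
  have Dy: "?D *\<^sub>v y \<in> carrier_vec ?d" by (rule square_mult_vec_carrier[OF D yc])
  have Rz: "R M N *\<^sub>v z = ?fl *\<^sub>v (?D *\<^sub>v y)"
    unfolding R_apply[OF M N zc] theta_singular[OF M N zc zE] y_def ..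
  have flip1: "kron (1\<^sub>m ?n) ?PM * ?fl = ?fl * kron ?PM (1\<^sub>m ?n)"
  proof (rule mat_eqI_kron[OF mult_carrier_mat[OF k3 flip_mat_carrier] mult_carrier_mat[OF flip_mat_carrier k2] spans_carrier spans_carrier])
    fix x v :: "'k vec" assume xv: "x \<in> carrier_vec ?m" "v \<in> carrier_vec ?n"
    note kv = kron_vec_carrier[OF xv]
    show "kron (1\<^sub>m ?n) ?PM * ?fl *\<^sub>v kron_vec x v = ?fl * kron ?PM (1\<^sub>m ?n) *\<^sub>v kron_vec x v"
      unfolding assoc_mult_mat_vec[OF k3 flip_mat_carrier kv] assoc_mult_mat_vec[OF flip_mat_carrier k2 kv]
        flip_mat_kron_vec[OF xv] kron_one_left_mult_vec[OF P(1) xv(2,1)] kron_one_right_mult_vec[OF P(1) xv]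
        flip_mat_kron_vec[OF square_mult_vec_carrier[OF P(1) xv(1)] xv(2)] ..
  qed
  have flip2: "?D' * ?fl = ?fl * ?D"
  proof (rule weight_kron_eqI[OF M N mult_carrier_mat[OF D' flip_mat_carrier] mult_carrier_mat[OF flip_mat_carrier D]])
    fix a b x v assume a: "a \<in> weights Q" "b \<in> weights Q" and xv: "x \<in> weight_space Q M a" "v \<in> weight_space Q N b"
      and xvc: "x \<in> carrier_vec ?m" "v \<in> carrier_vec ?n"
    note kv = kron_vec_carrier[OF xvc]
    show "?D' * ?fl *\<^sub>v kron_vec x v = ?fl * ?D *\<^sub>v kron_vec x v"
      unfolding assoc_mult_mat_vec[OF D' flip_mat_carrier kv] assoc_mult_mat_vec[OF flip_mat_carrier D kv]
        flip_mat_kron_vec[OF xvc] weight_form_apply[OF M N a xv] weight_form_apply[OF N M a(2,1) xv(2,1)]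
        mult_mat_vec[OF flip_mat_carrier kv] form_sym[of b a] ..
  qed
  have comm: "?D * (kron ?PM (1\<^sub>m ?n)) = kron ?PM (1\<^sub>m ?n) * ?D" "?D * (kron (1\<^sub>m ?m) ?PN) = kron (1\<^sub>m ?m) ?PN * ?D"
  proof -
    show "?D * (kron ?PM (1\<^sub>m ?n)) = kron ?PM (1\<^sub>m ?n) * ?D"
    proof (rule weight_kron_eqI[OF M N square_mult_carrier[OF D k2] square_mult_carrier[OF k2 D]])
      fix a b x v assume a: "a \<in> weights Q" "b \<in> weights Q" and xv: "x \<in> weight_space Q M a" "v \<in> weight_space Q N b"
        and xvc: "x \<in> carrier_vec ?m" "v \<in> carrier_vec ?n"
      note kv = kron_vec_carrier[OF xvc]
      show "?D * kron ?PM (1\<^sub>m ?n) *\<^sub>v kron_vec x v = kron ?PM (1\<^sub>m ?n) * ?D *\<^sub>v kron_vec x v"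
        unfolding assoc_mult_mat_vec[OF D k2 kv] assoc_mult_mat_vec[OF k2 D kv] kron_one_right_mult_vec[OF P(1) xvc]
          weight_form_apply[OF M N a xv] weight_form_apply[OF M N a casimir_sum_weight[OF M xv(1)] xv(2)]
          mult_mat_vec[OF k2 kv] kron_one_right_mult_vec[OF P(1) xvc] ..
    qed
    show "?D * (kron (1\<^sub>m ?m) ?PN) = kron (1\<^sub>m ?m) ?PN * ?D"
    proof (rule weight_kron_eqI[OF M N square_mult_carrier[OF D k1] square_mult_carrier[OF k1 D]])
      fix a b x v assume a: "a \<in> weights Q" "b \<in> weights Q" and xv: "x \<in> weight_space Q M a" "v \<in> weight_space Q N b"
        and xvc: "x \<in> carrier_vec ?m" "v \<in> carrier_vec ?n"
      note kv = kron_vec_carrier[OF xvc]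
      show "?D * kron (1\<^sub>m ?m) ?PN *\<^sub>v kron_vec x v = kron (1\<^sub>m ?m) ?PN * ?D *\<^sub>v kron_vec x v"
        unfolding assoc_mult_mat_vec[OF D k1 kv] assoc_mult_mat_vec[OF k1 D kv] kron_one_left_mult_vec[OF P(2) xvc]
          weight_form_apply[OF M N a xv] weight_form_apply[OF M N a xv(1) casimir_sum_weight[OF N xv(2)]]
          mult_mat_vec[OF k1 kv] kron_one_left_mult_vec[OF P(2) xvc] ..
    qed
  qed
  have "double_braiding M N *\<^sub>v z = R N M *\<^sub>v (R M N *\<^sub>v z)"
    unfolding double_braiding_def by (rule assoc_mult_mat_vec[OF R_carrier[OF N M] R_carrier[OF M N] zc])
  also have "\<dots> = ?fl' *\<^sub>v (?D' *\<^sub>v (kron (1\<^sub>m ?n) ?PM *\<^sub>v (?fl *\<^sub>v (?D *\<^sub>v y))))"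
    unfolding R_apply[OF N M RE(1)] theta_singular[OF N M RE(1) RE(2)] unfolding Rz ..
  also have "kron (1\<^sub>m ?n) ?PM *\<^sub>v (?fl *\<^sub>v (?D *\<^sub>v y)) = ?fl *\<^sub>v (kron ?PM (1\<^sub>m ?n) *\<^sub>v (?D *\<^sub>v y))"
    unfolding assoc_mult_mat_vec[OF k3 flip_mat_carrier Dy, symmetric] flip1 by (rule assoc_mult_mat_vec[OF flip_mat_carrier k2 Dy])
  also have "kron ?PM (1\<^sub>m ?n) *\<^sub>v (?D *\<^sub>v y) = ?D *\<^sub>v (kron ?PM (1\<^sub>m ?n) *\<^sub>v y)"
    unfolding assoc_mult_mat_vec[OF k2 D yc, symmetric] comm(1)[symmetric] by (rule assoc_mult_mat_vec[OF D k2 yc])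
  also have "kron ?PM (1\<^sub>m ?n) *\<^sub>v y = kron ?PM ?PN *\<^sub>v z"
    unfolding y_def by (rule kron_one_mult_vec(1)[OF zc P])
  also have "?D' *\<^sub>v (?fl *\<^sub>v (?D *\<^sub>v (kron ?PM ?PN *\<^sub>v z))) = ?fl *\<^sub>v (?D *\<^sub>v (?D *\<^sub>v (kron ?PM ?PN *\<^sub>v z)))"
  proof -
    have w: "?D *\<^sub>v (kron ?PM ?PN *\<^sub>v z) \<in> carrier_vec ?d"
      by (rule square_mult_vec_carrier[OF D square_mult_vec_carrier[OF k4 zc]])
    show ?thesis unfolding assoc_mult_mat_vec[OF D' flip_mat_carrier w, symmetric] flip2
      by (rule assoc_mult_mat_vec[OF flip_mat_carrier D w])
  qed
  also have "?fl' *\<^sub>v (?fl *\<^sub>v (?D *\<^sub>v (?D *\<^sub>v (kron ?PM ?PN *\<^sub>v z)))) = ?D *\<^sub>v (?D *\<^sub>v (kron ?PM ?PN *\<^sub>v z))"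
  proof -
    have w: "?D *\<^sub>v (?D *\<^sub>v (kron ?PM ?PN *\<^sub>v z)) \<in> carrier_vec ?d"
      by (rule square_mult_vec_carrier[OF D square_mult_vec_carrier[OF D square_mult_vec_carrier[OF k4 zc]]])
    show ?thesis unfolding assoc_mult_mat_vec[OF flip_mat_carrier flip_mat_carrier w, symmetric] flip_mat_flip
      by (rule one_mult_mat_vec[OF w])
  qed
  also have "\<dots> = kron ?PM ?PN *\<^sub>v (?D *\<^sub>v (?D *\<^sub>v z))"
  proof -
    have Dk: "?D * kron ?PM ?PN = kron ?PM ?PN * ?D"
      unfolding kron_one_mult(1)[OF P, symmetric] assoc_mult_mat[OF k2 k1 D] comm(2)[symmetric] assoc_mult_mat[OF k2 D k1, symmetric]
        comm(1)[symmetric] by (rule assoc_mult_mat[OF D k2 k1, symmetric])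
    note ia = intertwine_apply[OF D k4 k4 Dk]
    show ?thesis unfolding ia[OF zc] by (rule ia[OF square_mult_vec_carrier[OF D zc]])
  qed
  also have "?D *\<^sub>v (?D *\<^sub>v z) = kron ?dM ?dN *\<^sub>v (q (cas l) \<cdot>\<^sub>v z)"
    unfolding assoc_mult_mat_vec[OF D D zc, symmetric] weight_form_square[OF M N]
      assoc_mult_mat_vec[OF kron_carrier[OF dc] G zc] weight_diag_apply[OF MN l zw] ..
  also have "kron ?PM ?PN *\<^sub>v (kron ?dM ?dN *\<^sub>v (q (cas l) \<cdot>\<^sub>v z)) = q (cas l) \<cdot>\<^sub>v (kron ?PM ?PN * kron ?dM ?dN *\<^sub>v z)"
  proof -
    have kd: "kron ?dM ?dN \<in> carrier_mat ?d ?d" by (rule kron_carrier[OF dc])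
    show ?thesis
      unfolding mult_mat_vec[OF kd zc] mult_mat_vec[OF k4 square_mult_vec_carrier[OF kd zc]] assoc_mult_mat_vec[OF k4 kd zc] ..
  qed
  also have "kron ?PM ?PN * kron ?dM ?dN = kron (casimir M) (casimir N)"
    unfolding casimir_def by (rule kron_mult[OF P(1) dc(1) P(2) dc(2)])
  finally show ?thesis .
qed

lemma double_braiding_casimir:
  assumes M: "weight_module M" and N: "weight_module N"
  shows "double_braiding M N * casimir (tensor M N) = kron (casimir M) (casimir N)"
proof -
  let ?T = "tensor M N" and ?J = "double_braiding M N" and ?K = "kron (casimir M) (casimir N)"
  let ?d = "mdim ?T"
  have T: "weight_module ?T" using M N by simp
  note J = double_braiding_hom[OF M N]
  have K: "module_hom ?T ?T ?K" by (rule module_hom_kron[OF M M N N casimir_module_end[OF M] casimir_module_end[OF N]])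
  note C = casimir_carrier[OF T] and Jc = module_hom_carrier[OF J] and Kc = module_hom_carrier[OF K]
  note F = weight_module_carrier(2)[OF T]
  \<comment> \<open>Both operators commute with F, so the identity spreads from a singular vector of
    weight l to all that it generates, where the Casimir operator of the tensor product is q(- cas
    l).\<close>
  have gen: "?J *\<^sub>v x = q (cas l) \<cdot>\<^sub>v (?K *\<^sub>v x)" if "generated ?T l m x" for l m x
    using that
  proof (induction rule: generated.induct)
    case (singular l x)
    show ?case by (rule double_braiding_singular[OF M N singular(1)])
  next
    case (step l m x i)
    note xc = generated_carrier[OF T step.hyps]
    show ?case
      unfolding module_hom_apply(2)[OF T T J xc] module_hom_apply(2)[OF T T K xc] step.IH
      by (rule mult_mat_vec[OF F square_mult_vec_carrier[OF Kc xc]])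
  qed
  show ?thesis
  proof (rule mat_eqI_spans[OF square_mult_carrier[OF Jc C] Kc spans_gen_vectors[OF T]])
    fix x assume "x \<in> gen_vectors ?T"
    then obtain l m where x: "generated ?T l m x" by (auto simp: gen_vectors_def)
    note xc = generated_carrier[OF T x]
    show "?J * casimir ?T *\<^sub>v x = ?K *\<^sub>v x"
      unfolding assoc_mult_mat_vec[OF Jc C xc] generated_casimir[OF T x] mult_mat_vec[OF Jc xc] gen[OF x] smult_smult_assoc
      by simp
  qed
qed

text \<open>The double braiding is the product of the Casimir operators of the factors with the
  inverse of that of the tensor product, and the two operators commute.\<close>

lemma qdiag_double_braiding:
  assumes M: "weight_module M" and N: "weight_module N"
  shows "qdiag (mdim M * mdim N) (double_braiding M N)"
proof -
  let ?T = "tensor M N" and ?J = "double_braiding M N" and ?K = "kron (casimir M) (casimir N)"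
  let ?C = "casimir ?T"
  let ?C' = "q_power Q (- 1) ?C"
  have T: "weight_module ?T" using M N by simp
  note C = qdiag_casimir[OF T]
  note Cc = qdiag_carrier[OF C] and Cc' = q_power_carrier[OF C, of "- 1"] and Jc = module_hom_carrier[OF double_braiding_hom[OF M N]]
  have K: "qdiag (mdim ?T) ?K" using qdiag_kron[OF qdiag_casimir[OF M] qdiag_casimir[OF N]] by simp
  have JC: "?J * ?C = ?C * ?J" by (rule casimir_module_hom[OF T double_braiding_hom[OF M N]])
  have KJ: "?K * ?C' = ?J"
    unfolding double_braiding_casimir[OF M N, symmetric] assoc_mult_mat[OF Jc Cc Cc'] q_power_inverse[OF C] by (rule right_mult_one_mat[OF Jc])
  have "?K * ?C = ?C * ?K"
    unfolding double_braiding_casimir[OF M N, symmetric] assoc_mult_mat[OF Cc Jc Cc, symmetric] JC[symmetric] ..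
  then have "?K * ?C' = ?C' * ?K" by (rule q_power_commute[OF C qdiag_carrier[OF K]])
  from qdiag_mult[OF K qdiag_q_power[OF C] this] show ?thesis unfolding KJ by simp
qed

text \<open>Naturality in the first argument, derived from the Casimir identity: f tensored with 1
  commutes with the Casimir operator of the tensor product and with the product of those of M and N,
  and the former is invertible.\<close>

lemma double_braiding_commute:
  assumes M: "weight_module M" and N: "weight_module N" and f: "module_hom M M f"
  shows "double_braiding M N * kron f (1\<^sub>m (mdim N)) = kron f (1\<^sub>m (mdim N)) * double_braiding M N"
proof -
  let ?T = "tensor M N" and ?J = "double_braiding M N" and ?K = "kron (casimir M) (casimir N)"
  let ?C = "casimir ?T" and ?f = "kron f (1\<^sub>m (mdim N))"
  let ?C' = "q_power Q (- 1) ?C"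
  have T: "weight_module ?T" using M N by simp
  have fh: "module_hom ?T ?T ?f" by (rule module_hom_kron[OF M M N N f module_hom_one[OF N]])
  note C = qdiag_casimir[OF T]
  note Cc = qdiag_carrier[OF C] and Cc' = q_power_carrier[OF C, of "- 1"] and Jc = module_hom_carrier[OF double_braiding_hom[OF M N]]
    and fc = module_hom_carrier[OF fh] and f0 = module_hom_carrier[OF f]
  note Jf = square_mult_carrier[OF Jc fc] and fJ = square_mult_carrier[OF fc Jc]
  have fC: "?f * ?C = ?C * ?f" by (rule casimir_module_hom[OF T fh])
  have "?J * ?f * ?C = ?f * ?J * ?C"
    unfolding assoc_mult_mat[OF Jc fc Cc] fC assoc_mult_mat[OF Jc Cc fc, symmetric] assoc_mult_mat[OF fc Jc Cc] double_braiding_casimir[OF M N]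
      kron_mult[OF casimir_carrier[OF M] f0 casimir_carrier[OF N] one_carrier_mat]
      kron_mult[OF f0 casimir_carrier[OF M] one_carrier_mat casimir_carrier[OF N]] casimir_module_hom[OF M f]
    using casimir_carrier[OF N] by simp
  then have "?J * ?f * ?C * ?C' = ?f * ?J * ?C * ?C'" by simp
  then show ?thesis
    unfolding assoc_mult_mat[OF Jf Cc Cc'] assoc_mult_mat[OF fJ Cc Cc'] q_power_inverse[OF C]
      right_mult_one_mat[OF Jf] right_mult_one_mat[OF fJ] .
qed

end

section \<open>Hexagon identities for highest weight modules\<close>

text \<open>Tensoring with a fixed vector as a matrix: equations that start from \<open>v0\<close>
  on the left become matrix equations, which may be tested on weight vectors and pure tensors in the
  other factors.\<close>

lemma mat_kron_vec_left:
  fixes v :: "'k::field vec"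
  assumes v: "v \<in> carrier_vec d"
  obtains A where "A \<in> carrier_mat (d * n) n" "\<And>z. z \<in> carrier_vec n \<Longrightarrow> A *\<^sub>v z = kron_vec v z"
proof -
  let ?e = "vec 1 (\<lambda>_. 1) :: 'k vec"
  define B where "B = mat d 1 (\<lambda>(i, _). v $ i)"
  have B: "B \<in> carrier_mat d 1" by (simp add: B_def)
  have Be: "B *\<^sub>v ?e = v" using v by (intro eq_vecI) (auto simp: B_def scalar_prod_def)
  show ?thesis
  proof (rule that[of "kron B (1\<^sub>m n)"])
    show "kron B (1\<^sub>m n) \<in> carrier_mat (d * n) n" using kron_carrier[OF B one_carrier_mat[of n]] by simp
    fix z :: "'k vec" assume z: "z \<in> carrier_vec n"
    show "kron B (1\<^sub>m n) *\<^sub>v z = kron_vec v z"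
      using kron_mult_kron_vec[OF B one_carrier_mat vec_carrier z, of "\<lambda>_. 1"] z
      unfolding Be kron_vec_one by simp
  qed
qed

context qdatum
begin

section \<open>The strict monoidal structure\<close>

lemma unit_module_sel[simp]:
  "mdim unit_module = 1" "actE unit_module i = 0\<^sub>m 1 1" "actF unit_module i = 0\<^sub>m 1 1"
  "actK unit_module i = 1\<^sub>m 1" "actKi unit_module i = 1\<^sub>m 1"
  by (simp_all add: unit_module_def)

lemma weight_space_unit:
  fixes U :: "('i, 'k) qmodule"
  assumes "U = unit_module"
  shows "weight_space Q U 0 = carrier_vec 1"
  unfolding weight_space_def assms by auto

lemma weight_module_unit: "weight_module (unit_module :: ('i, 'k) qmodule)"
proof (rule weight_moduleI[OF _ _ _ _ spans_carrier])
  fix x :: "'k vec" assume "x \<in> carrier_vec (mdim (unit_module :: ('i, 'k) qmodule))"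
  then have x: "x \<in> carrier_vec 1" by simp
  have z: "0\<^sub>m 1 1 *\<^sub>v y = 0\<^sub>v 1" if "y \<in> carrier_vec 1" for y :: "'k vec" using that by (rule zero_mat_mult_vec)
  have wz: "0\<^sub>v 1 \<in> weight_space Q (unit_module :: ('i, 'k) qmodule) m" for m
    unfolding weight_space_def by simp
  have qb: "qbr i 0 = 0" for i by (simp add: qbr_def)
  have "x \<in> weight_space Q unit_module 0" unfolding weight_space_unit[OF refl] by (rule x)
  moreover have "(if i = j then qbr i 0 else 0) \<cdot>\<^sub>v x = 0\<^sub>v 1" for i j using x by (simp add: qb)
  ultimately show "\<exists>l\<in>weights Q. x \<in> weight_space Q unit_module l \<and>
      (\<forall>i. actKi unit_module i *\<^sub>v x = q (- root_form i l) \<cdot>\<^sub>v x \<and>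
        actE unit_module i *\<^sub>v x \<in> weight_space Q unit_module (l + simple_root i) \<and>
        actF unit_module i *\<^sub>v x \<in> weight_space Q unit_module (l - simple_root i) \<and>
        (\<forall>j. actE unit_module i *\<^sub>v (actF unit_module j *\<^sub>v x) =
          actF unit_module j *\<^sub>v (actE unit_module i *\<^sub>v x) + (if i = j then qbr i l else 0) \<cdot>\<^sub>v x))"
    by (intro bexI[of _ 0] conjI allI) (use x wz in \<open>simp_all add: z del: One_nat_def\<close>)
qed simp_all

lemma tensor_unit:
  assumes M: "weight_module M"
  shows "tensor unit_module M = M" "tensor M unit_module = M"
proof -
  note cM = weight_module_carrier[OF M]
  have k0: "kron (0\<^sub>m 1 1) A = 0\<^sub>m d d" "kron A (0\<^sub>m 1 1) = 0\<^sub>m d d" if "A \<in> carrier_mat d d" for A :: "'k mat" and d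
    using that by (simp_all add: kron_zero)
  note simps = fun_eq_iff k0[OF cM(3)] k0[OF cM(4)] k0[OF one_carrier_mat] kron_one_one
    left_add_zero_mat[OF cM(1)] left_add_zero_mat[OF cM(2)] right_add_zero_mat[OF cM(1)] right_add_zero_mat[OF cM(2)]
  show "tensor unit_module M = M" "tensor M unit_module = M"
    by (rule qmodule.equality; simp add: simps del: One_nat_def)+
qed

text \<open>An equality of modules, not merely an isomorphism: \<open>kron\<close> is strictly
  associative and the iterated comultiplications agree term by term.\<close>

lemma tensor_assoc:
  assumes "weight_module L" "weight_module M" "weight_module N"
  shows "tensor (tensor L M) N = tensor L (tensor M N)"
proof (rule qmodule.equality)
  note c1 = weight_module_carrier[OF assms(1)] and c2 = weight_module_carrier[OF assms(2)] and c3 = weight_module_carrier[OF assms(3)]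
  show "actE (tensor (tensor L M) N) = actE (tensor L (tensor M N))"
  proof
    fix i
    show "actE (tensor (tensor L M) N) i = actE (tensor L (tensor M N)) i"
      unfolding tensor_sel kron_linear(1)[OF kron_carrier[OF c1(1) c2(3)] kron_carrier[OF one_carrier_mat c2(1)] c3(3)]
        kron_linear(2)[OF one_carrier_mat kron_carrier[OF c2(1) c3(3)] kron_carrier[OF one_carrier_mat c3(1)]]
        kron_assoc kron_one[symmetric]
      by (rule assoc_add_mat) (rule kron_carrier c1 c2 c3 one_carrier_mat)+
  qed
  show "actF (tensor (tensor L M) N) = actF (tensor L (tensor M N))"
  proof
    fix i
    show "actF (tensor (tensor L M) N) i = actF (tensor L (tensor M N)) i"
      unfolding tensor_sel kron_linear(1)[OF kron_carrier[OF c1(2) one_carrier_mat] kron_carrier[OF c1(4) c2(2)] one_carrier_mat]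
        kron_linear(2)[OF c1(4) kron_carrier[OF c2(2) one_carrier_mat] kron_carrier[OF c2(4) c3(2)]]
        kron_assoc kron_one[symmetric]
      by (rule assoc_add_mat) (rule kron_carrier c1 c2 c3 one_carrier_mat)+
  qed
qed (simp_all add: fun_eq_iff kron_assoc mult.assoc)

text \<open>The vectors v for which f and g agree on all tensors of v with z form a submodule of V.
  It contains the generator \<open>v0\<close>, so it is everything.\<close>

lemma module_hom_eqI:
  assumes V: "weight_module V" and N: "weight_module N" and P: "weight_module P"
    and v0: "v0 \<in> carrier_vec (mdim V)" and cyc: "\<And>W. is_submodule V W \<Longrightarrow> v0 \<in> W \<Longrightarrow> W = carrier_vec (mdim V)"
    and f: "module_hom (tensor V N) P f" and g: "module_hom (tensor V N) P g"
    and eq: "\<And>z. z \<in> carrier_vec (mdim N) \<Longrightarrow> f *\<^sub>v kron_vec v0 z = g *\<^sub>v kron_vec v0 z"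
  shows "f = g"
proof -
  let ?d = "mdim V" and ?n = "mdim N" and ?p = "mdim P"
  note cV = weight_module_carrier[OF V] and cN = weight_module_carrier[OF N] and cP = weight_module_carrier[OF P]
  have VN: "weight_module (tensor V N)" using V N by simp
  have fg: "f \<in> carrier_mat ?p (?d * ?n)" "g \<in> carrier_mat ?p (?d * ?n)"
    using module_hom_carrier[OF f] module_hom_carrier[OF g] by simp_all
  define W where "W = {v \<in> carrier_vec ?d. \<forall>z\<in>carrier_vec ?n. f *\<^sub>v kron_vec v z = g *\<^sub>v kron_vec v z}"
  have WC: "v \<in> carrier_vec ?d" if "v \<in> W" for v using that by (simp add: W_def)
  have Wz: "f *\<^sub>v kron_vec v z = g *\<^sub>v kron_vec v z" if "v \<in> W" "z \<in> carrier_vec ?n" for v z using that by (simp add: W_def)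
  have add: "v + w \<in> W" if "v \<in> W" "w \<in> W" for v w
    using that fg unfolding W_def
    by (auto simp: kron_vec_linear(1)[of _ ?d _ _ ?n] mult_add_distrib_mat_vec[of _ ?p "?d * ?n"])
  have sm: "a \<cdot>\<^sub>v v \<in> W" if "v \<in> W" for v a
    using that fg unfolding W_def
    by (auto simp: kron_vec_linear(3) mult_mat_vec[of _ ?p "?d * ?n"])
  have zero: "0\<^sub>v ?d \<in> W"
  proof -
    have "v0 \<in> W" using v0 eq by (simp add: W_def)
    from sm[OF this, of 0] show ?thesis using v0 by simp
  qed
  have T: "f *\<^sub>v (X *\<^sub>v kron_vec v z) = g *\<^sub>v (X *\<^sub>v kron_vec v z)"
    if "v \<in> W" "z \<in> carrier_vec ?n" "X \<in> carrier_mat (?d * ?n) (?d * ?n)" "Y \<in> carrier_mat ?p ?p" "f * X = Y * f" "g * X = Y * g" for v z X Y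
    using intertwine_apply[OF fg(1) that(3,4,5), of "kron_vec v z"] intertwine_apply[OF fg(2) that(3,4,6), of "kron_vec v z"]
      Wz[OF that(1,2)] WC[OF that(1)] that(2) by simp
  have KKi: "actK N i *\<^sub>v (actKi N i *\<^sub>v z) = z" "actKi N i *\<^sub>v (actK N i *\<^sub>v z) = z" if "z \<in> carrier_vec ?n" for z i
    using assoc_mult_mat_vec[OF cN(3) cN(4) that, of i i] assoc_mult_mat_vec[OF cN(4) cN(3) that, of i i] weight_module_rel(1,2)[OF N, of i] that by simp_all
  note cT = tensor_carrier[OF V N]
  have WK: "actK V i *\<^sub>v v \<in> W" if v: "v \<in> W" for v i
  proof -
    have "f *\<^sub>v kron_vec (actK V i *\<^sub>v v) z = g *\<^sub>v kron_vec (actK V i *\<^sub>v v) z" if z: "z \<in> carrier_vec ?n" for z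
    proof -
      have z': "actKi N i *\<^sub>v z \<in> carrier_vec ?n" using cN z by simp
      show ?thesis
        using T[OF v z' cT(3) cP(3) module_hom_commute(3)[OF f] module_hom_commute(3)[OF g], of i]
        unfolding tensor_sel kron_mult_kron_vec[OF cV(3) cN(3) WC[OF v] z'] KKi(1)[OF z] .
    qed
    then show ?thesis using cV WC[OF v] by (simp add: W_def)
  qed
  have WKi: "actKi V i *\<^sub>v v \<in> W" if v: "v \<in> W" for v i
  proof -
    have "f *\<^sub>v kron_vec (actKi V i *\<^sub>v v) z = g *\<^sub>v kron_vec (actKi V i *\<^sub>v v) z" if z: "z \<in> carrier_vec ?n" for z
    proof -
      have z': "actK N i *\<^sub>v z \<in> carrier_vec ?n" using cN z by simp
      show ?thesis
        using T[OF v z' cT(4) cP(4) module_hom_commute(4)[OF f] module_hom_commute(4)[OF g], of i]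
        unfolding tensor_sel kron_mult_kron_vec[OF cV(4) cN(4) WC[OF v] z'] KKi(2)[OF z] .
    qed
    then show ?thesis using cV WC[OF v] by (simp add: W_def)
  qed
  have cancel: "f *\<^sub>v a = g *\<^sub>v a"
    if "f *\<^sub>v (a + b) = g *\<^sub>v (a + b)" "f *\<^sub>v b = g *\<^sub>v b" "a \<in> carrier_vec (?d * ?n)" "b \<in> carrier_vec (?d * ?n)" for a b
  proof -
    define fa ga gb where defs: "fa = f *\<^sub>v a" "ga = g *\<^sub>v a" "gb = g *\<^sub>v b"
    have c: "fa \<in> carrier_vec ?p" "ga \<in> carrier_vec ?p" "gb \<in> carrier_vec ?p" using fg that unfolding defs by simp_all
    have "fa + gb = ga + gb"
      using that(1) unfolding mult_add_distrib_mat_vec[OF fg(1) that(3,4)] mult_add_distrib_mat_vec[OF fg(2) that(3,4)] that(2) defs .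
    then have "fa $ k + gb $ k = ga $ k + gb $ k" if "k < ?p" for k using c that by (metis carrier_vecD index_add_vec(1))
    then have "fa = ga" using c by (intro eq_vecI) auto
    then show ?thesis unfolding defs .
  qed
  \<comment> \<open>Replacing z by its image under the inverse of K_i removes K_i from the first
    term of the comultiplication; the second term still has v on the left.\<close>
  have WE: "actE V i *\<^sub>v v \<in> W" if v: "v \<in> W" for v i
  proof -
    have "f *\<^sub>v kron_vec (actE V i *\<^sub>v v) z = g *\<^sub>v kron_vec (actE V i *\<^sub>v v) z" if z: "z \<in> carrier_vec ?n" for z
    proof (rule cancel)
      have z': "actKi N i *\<^sub>v z \<in> carrier_vec ?n" using cN z by simp
      have Ez: "actE N i *\<^sub>v (actKi N i *\<^sub>v z) \<in> carrier_vec ?n" using cN z' by simp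
      note kv = kron_vec_carrier[OF WC[OF v] z']
      have "actE (tensor V N) i *\<^sub>v kron_vec v (actKi N i *\<^sub>v z) =
          kron_vec (actE V i *\<^sub>v v) z + kron_vec v (actE N i *\<^sub>v (actKi N i *\<^sub>v z))"
        unfolding tensor_sel add_mult_distrib_mat_vec[OF kron_carrier[OF cV(1) cN(3)] kron_carrier[OF one_carrier_mat cN(1)] kv]
          kron_mult_kron_vec[OF cV(1) cN(3) WC[OF v] z'] kron_one_left_mult_vec[OF cN(1) WC[OF v] z'] KKi(1)[OF z] ..
      then show "f *\<^sub>v (kron_vec (actE V i *\<^sub>v v) z + kron_vec v (actE N i *\<^sub>v (actKi N i *\<^sub>v z))) =
          g *\<^sub>v (kron_vec (actE V i *\<^sub>v v) z + kron_vec v (actE N i *\<^sub>v (actKi N i *\<^sub>v z)))"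
        using T[OF v z' cT(1) cP(1) module_hom_commute(1)[OF f] module_hom_commute(1)[OF g], of i] by (simp del: tensor_sel(2))
      show "f *\<^sub>v kron_vec v (actE N i *\<^sub>v (actKi N i *\<^sub>v z)) = g *\<^sub>v kron_vec v (actE N i *\<^sub>v (actKi N i *\<^sub>v z))"
        by (rule Wz[OF v Ez])
      show "kron_vec (actE V i *\<^sub>v v) z \<in> carrier_vec (?d * ?n)" using cV WC[OF v] z by simp
      show "kron_vec v (actE N i *\<^sub>v (actKi N i *\<^sub>v z)) \<in> carrier_vec (?d * ?n)" using WC[OF v] Ez by simp
    qed
    then show ?thesis using cV WC[OF v] by (simp add: W_def)
  qed
  \<comment> \<open>The second term of the comultiplication has the inverse of K_i applied to v; the
    closure \<open>WKi\<close> takes care of it.\<close>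
  have WF: "actF V i *\<^sub>v v \<in> W" if v: "v \<in> W" for v i
  proof -
    have "f *\<^sub>v kron_vec (actF V i *\<^sub>v v) z = g *\<^sub>v kron_vec (actF V i *\<^sub>v v) z" if z: "z \<in> carrier_vec ?n" for z
    proof (rule cancel)
      have Fz: "actF N i *\<^sub>v z \<in> carrier_vec ?n" using cN z by simp
      note kv = kron_vec_carrier[OF WC[OF v] z]
      have "actF (tensor V N) i *\<^sub>v kron_vec v z =
          kron_vec (actF V i *\<^sub>v v) z + kron_vec (actKi V i *\<^sub>v v) (actF N i *\<^sub>v z)"
        unfolding tensor_sel add_mult_distrib_mat_vec[OF kron_carrier[OF cV(2) one_carrier_mat] kron_carrier[OF cV(4) cN(2)] kv]
          kron_mult_kron_vec[OF cV(4) cN(2) WC[OF v] z] kron_one_right_mult_vec[OF cV(2) WC[OF v] z] ..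
      then show "f *\<^sub>v (kron_vec (actF V i *\<^sub>v v) z + kron_vec (actKi V i *\<^sub>v v) (actF N i *\<^sub>v z)) =
          g *\<^sub>v (kron_vec (actF V i *\<^sub>v v) z + kron_vec (actKi V i *\<^sub>v v) (actF N i *\<^sub>v z))"
        using T[OF v z cT(2) cP(2) module_hom_commute(2)[OF f] module_hom_commute(2)[OF g], of i] by (simp del: tensor_sel(3))
      show "f *\<^sub>v kron_vec (actKi V i *\<^sub>v v) (actF N i *\<^sub>v z) = g *\<^sub>v kron_vec (actKi V i *\<^sub>v v) (actF N i *\<^sub>v z)"
        by (rule Wz[OF WKi[OF v] Fz])
      show "kron_vec (actF V i *\<^sub>v v) z \<in> carrier_vec (?d * ?n)" using cV WC[OF v] z by simp
      show "kron_vec (actKi V i *\<^sub>v v) (actF N i *\<^sub>v z) \<in> carrier_vec (?d * ?n)" using WC[OF WKi[OF v]] Fz by simp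
    qed
    then show ?thesis using cV WC[OF v] by (simp add: W_def)
  qed
  interpret vs: vec_space "TYPE('k)" ?d .
  have "lin ?d W = W" using lin_least[of _ ?d W W] zero add sm by (auto intro: lin.base)
  then have "VectorSpace.subspace class_ring W (module_vec TYPE('k) ?d)"
    using vs.span_is_subspace[of W] lin_eq_span[of W ?d] WC by auto
  then have "is_submodule V W"
    unfolding is_submodule_def using WE WF WK WKi by blast
  moreover have "v0 \<in> W" using v0 eq by (simp add: W_def)
  ultimately have W: "W = carrier_vec ?d" by (rule cyc)
  show ?thesis
    by (rule mat_eqI_kron[OF fg spans_carrier spans_carrier]) (rule Wz[unfolded W])
qed

end

lemma kron_vec_eqI:
  fixes A B :: "'k::field mat"
  assumes "A \<in> carrier_mat a (m * n)" "B \<in> carrier_mat a (m * n)"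
    and "\<And>x y. x \<in> carrier_vec m \<Longrightarrow> y \<in> carrier_vec n \<Longrightarrow> A *\<^sub>v kron_vec x y = B *\<^sub>v kron_vec x y"
  shows "A = B"
  by (rule mat_eqI_kron[OF assms(1,2) spans_carrier spans_carrier]) (rule assms(3))

locale highest_weight = braided Q R c
  for Q :: "('i::finite, 'k::field_char_0) quantum_datum" and R c +
  fixes V :: "('i, 'k) qmodule" and l0 :: "'i \<Rightarrow> rat" and v0 :: "'k vec"
  assumes V: "weight_module V" and l0: "l0 \<in> weights Q" and v0: "v0 \<in> weight_space Q V l0"
    and E_v0: "actE V i *\<^sub>v v0 = 0\<^sub>v (mdim V)"
    and cyclic: "is_submodule V W \<Longrightarrow> v0 \<in> W \<Longrightarrow> W = carrier_vec (mdim V)"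
begin

lemmas v0_carrier = wt_carrier[OF v0]

lemma hom_eqI:
  assumes N: "weight_module N" and P: "weight_module P" and f: "module_hom (tensor V N) P f" and g: "module_hom (tensor V N) P g"
    and eq: "\<And>l z. l \<in> weights Q \<Longrightarrow> z \<in> weight_space Q N l \<Longrightarrow> f *\<^sub>v kron_vec v0 z = g *\<^sub>v kron_vec v0 z"
  shows "f = g"
proof (rule module_hom_eqI[OF V N P v0_carrier cyclic f g])
  obtain A where A: "A \<in> carrier_mat (mdim V * mdim N) (mdim N)" "\<And>z. z \<in> carrier_vec (mdim N) \<Longrightarrow> A *\<^sub>v z = kron_vec v0 z"
    using mat_kron_vec_left[OF v0_carrier] by blast
  have fg: "f \<in> carrier_mat (mdim P) (mdim V * mdim N)" "g \<in> carrier_mat (mdim P) (mdim V * mdim N)"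
    using module_hom_carrier[OF f] module_hom_carrier[OF g] by simp_all
  have "f * A = g * A"
  proof (rule weight_module_eqI[OF N mult_carrier_mat[OF fg(1) A(1)] mult_carrier_mat[OF fg(2) A(1)]])
    fix l z assume l: "l \<in> weights Q" and z: "z \<in> weight_space Q N l"
    show "f * A *\<^sub>v z = g * A *\<^sub>v z"
      unfolding assoc_mult_mat_vec[OF fg(1) A(1) wt_carrier[OF z]] assoc_mult_mat_vec[OF fg(2) A(1) wt_carrier[OF z]] A(2)[OF wt_carrier[OF z]]
      by (rule eq[OF l z])
  qed
  then show "f *\<^sub>v kron_vec v0 z = g *\<^sub>v kron_vec v0 z" if "z \<in> carrier_vec (mdim N)" for z
    unfolding A(2)[OF that, symmetric] assoc_mult_mat_vec[OF fg(1) A(1) that, symmetric] assoc_mult_mat_vec[OF fg(2) A(1) that, symmetric] by simp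
qed


text \<open>Every nonempty word in E kills \<open>v0\<close>, so only the constant term of the
  quasi-R-matrix acts.\<close>

lemma R_v0:
  assumes N: "weight_module N" and m: "m \<in> weights Q" and z: "z \<in> weight_space Q N m"
  shows "R V N *\<^sub>v kron_vec v0 z = q (form Q l0 m) \<cdot>\<^sub>v kron_vec z v0"
proof -
  let ?d = "mdim V" and ?n = "mdim N"
  note zc = wt_carrier[OF z] and vc = v0_carrier
  have vz: "kron_vec v0 z \<in> carrier_vec (?d * ?n)" using vc zc by simp
  note cV = weight_module_carrier[OF V] and cN = weight_module_carrier[OF N]
  have WV: "word_act ?d (actE V) u \<in> carrier_mat ?d ?d" and WN: "word_act ?n (actF N) u \<in> carrier_mat ?n ?n" for u
    using cV cN by simp_all
  have kill: "word_act ?d (actE V) u *\<^sub>v v0 = 0\<^sub>v ?d" if "u \<noteq> []" for u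
    using that
  proof (induction u rule: rev_induct)
    case (snoc i u)
    have "word_act ?d (actE V) (u @ [i]) = word_act ?d (actE V) u * actE V i"
      unfolding word_act_append[OF cV(1)] by (simp add: right_mult_one_mat[OF cV(1)])
    then show ?case using assoc_mult_mat_vec[OF WV cV(1) vc, of u i] mult_mat_zero_vec[OF WV, of u] by (simp add: E_v0)
  qed simp
  let ?X = "\<lambda>(u, w). kron (word_act ?d (actE V) u) (word_act ?n (actF N) w)"
  let ?S = "word_pairs (Suc ?n) - {([], [])} :: ('i list \<times> 'i list) set"
  have X: "?X s \<in> carrier_mat (?d * ?n) (?d * ?n)" for s using kron_carrier[OF WV WN] by (cases s) simp
  have "quasi_R_action c V N *\<^sub>v kron_vec v0 z = kron_vec v0 z"
  proof -
    have "([], []) \<in> word_pairs (Suc ?n)" by (simp add: word_pairs_def)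
    then have S: "word_pairs (Suc ?n) = insert ([], []) ?S" by auto
    have "quasi_R_action c V N = c [] [] \<cdot>\<^sub>m ?X ([], []) + mat_lincomb (?d * ?n) (\<lambda>(u, w). c u w) ?X ?S"
      unfolding theta_bound[OF V N disjI2[OF le_SucI[OF order_refl]]] theta_def
      by (subst S, subst mat_lincomb_insert[where d = "?d * ?n"]) (use X finite_word_pairs in auto)
    also have "c [] [] \<cdot>\<^sub>m ?X ([], []) = 1\<^sub>m (?d * ?n)" by (simp add: c_Nil kron_one) (auto intro!: eq_matI)
    finally have "quasi_R_action c V N *\<^sub>v kron_vec v0 z =
        kron_vec v0 z + mat_lincomb (?d * ?n) (\<lambda>(u, w). c u w) ?X ?S *\<^sub>v kron_vec v0 z"
      using vz by (simp add: add_mult_distrib_mat_vec[of _ "?d * ?n" "?d * ?n"])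
    moreover have "mat_lincomb (?d * ?n) (\<lambda>(u, w). c u w) ?X ?S *\<^sub>v kron_vec v0 z \<in> {0\<^sub>v (?d * ?n)}"
    proof (rule mat_lincomb_mult_vec_closed[OF _ X vz])
      fix s assume s: "s \<in> ?S"
      obtain u w where uw: "s = (u, w)" by (cases s)
      then have u: "u \<noteq> []" using s by (auto simp: word_pairs_def)
      have "?X s *\<^sub>v kron_vec v0 z = 0\<^sub>v (?d * ?n)"
        unfolding uw prod.case kron_mult_kron_vec[OF WV WN vc zc] kill[OF u] kron_vec_linear(5)
        using square_mult_vec_carrier[OF WN zc, of w] by (simp add: carrier_matD(1)[OF WN])
      then show "?X s *\<^sub>v kron_vec v0 z \<in> {0\<^sub>v (?d * ?n)}" by simp
    qed (use finite_word_pairs in auto)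
    ultimately show ?thesis using vz by simp
  qed
  then show ?thesis
    unfolding R_apply[OF V N vz] using weight_form_apply[OF V N l0 m v0 z] mult_mat_vec[OF flip_mat_carrier vz] flip_mat_kron_vec[OF vc zc] by simp
qed

text \<open>Both sides are module maps out of a product beginning with V, so they are compared on
  \<open>v0\<close> tensored with weight vectors x and y. There R is a flip times a power of q in
  all three places, and the exponents add up.\<close>

lemma hexagon_right:
  assumes B: "weight_module B" and C: "weight_module C"
  shows "R V (tensor B C) = kron (1\<^sub>m (mdim B)) (R V C) * kron (R V B) (1\<^sub>m (mdim C))"
proof -
  let ?d = "mdim V" and ?b = "mdim B" and ?c = "mdim C"
  have BC: "weight_module (tensor B C)" and VB: "weight_module (tensor V B)" and BV: "weight_module (tensor B V)"
    and VC: "weight_module (tensor V C)" and CV: "weight_module (tensor C V)"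
    and T1: "weight_module (tensor V (tensor B C))" and T2: "weight_module (tensor B (tensor V C))" and T3: "weight_module (tensor B (tensor C V))"
    using V B C by simp_all
  let ?f = "kron (R V B) (1\<^sub>m ?c)" and ?g = "kron (1\<^sub>m ?b) (R V C)"
  have f: "module_hom (tensor V (tensor B C)) (tensor B (tensor V C)) ?f"
    using module_hom_kron[OF VB BV C C R_hom[OF V B] module_hom_one[OF C]] unfolding tensor_assoc[OF V B C] tensor_assoc[OF B V C] .
  have g: "module_hom (tensor B (tensor V C)) (tensor B (tensor C V)) ?g"
    by (rule module_hom_kron[OF B B VC CV module_hom_one[OF B] R_hom[OF V C]])
  have h: "module_hom (tensor V (tensor B C)) (tensor B (tensor C V)) (R V (tensor B C))"
    using R_hom[OF V BC] unfolding tensor_assoc[OF B C V] .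
  note gf = module_hom_mult[OF T1 T2 T3 f g]
  have gc: "?g \<in> carrier_mat (?b * (?c * ?d)) (?b * (?d * ?c))" using module_hom_carrier[OF g] by simp
  have fc: "?f \<in> carrier_mat (?b * (?d * ?c)) (?d * (?b * ?c))" using module_hom_carrier[OF f] by simp
  note Rc = R_carrier[OF V B] R_carrier[OF V C]
  have hc: "R V (tensor B C) \<in> carrier_mat (?b * (?c * ?d)) (?d * (?b * ?c))" using module_hom_carrier[OF h] by simp
  obtain A where A: "A \<in> carrier_mat (?d * (?b * ?c)) (?b * ?c)" "\<And>z. z \<in> carrier_vec (?b * ?c) \<Longrightarrow> A *\<^sub>v z = kron_vec v0 z"
    using mat_kron_vec_left[OF v0_carrier] by blast
  have eq: "R V (tensor B C) * A = (?g * ?f) * A"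
  proof (rule weight_kron_eqI[OF B C mult_carrier_mat[OF hc A(1)] mult_carrier_mat[OF mult_carrier_mat[OF gc fc] A(1)]])
    fix l m x y assume lm: "l \<in> weights Q" "m \<in> weights Q" and x: "x \<in> weight_space Q B l" and y: "y \<in> weight_space Q C m"
      and xc: "x \<in> carrier_vec ?b" and yc: "y \<in> carrier_vec ?c"
    note xy = kron_vec_carrier[OF xc yc] and vx = kron_vec_carrier[OF v0_carrier xc] and vxy = kron_vec_carrier[OF v0_carrier kron_vec_carrier[OF xc yc]]
      and vy = kron_vec_carrier[OF v0_carrier yc] and xv = kron_vec_carrier[OF xc v0_carrier]
    have "R V (tensor B C) * A *\<^sub>v kron_vec x y = q (form Q l0 (l + m)) \<cdot>\<^sub>v kron_vec x (kron_vec y v0)"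
      unfolding assoc_mult_mat_vec[OF hc A(1) xy] A(2)[OF xy] R_v0[OF BC weights_add[OF lm] kron_weight[OF B C x y]] kron_vec_assoc ..
    moreover have "?f *\<^sub>v kron_vec v0 (kron_vec x y) = q (form Q l0 l) \<cdot>\<^sub>v kron_vec x (kron_vec v0 y)"
      unfolding kron_vec_assoc[symmetric] kron_mult_kron_vec[OF Rc(1) one_carrier_mat vx yc] R_v0[OF B lm(1) x] kron_vec_linear
      using yc by simp
    moreover have "?g *\<^sub>v kron_vec x (kron_vec v0 y) = q (form Q l0 m) \<cdot>\<^sub>v kron_vec x (kron_vec y v0)"
      unfolding kron_mult_kron_vec[OF one_carrier_mat Rc(2) xc vy] R_v0[OF C lm(2) y] kron_vec_linear
      using xc by simp
    ultimately show "R V (tensor B C) * A *\<^sub>v kron_vec x y = (?g * ?f) * A *\<^sub>v kron_vec x y"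
      unfolding assoc_mult_mat_vec[OF mult_carrier_mat[OF gc fc] A(1) xy] A(2)[OF xy] assoc_mult_mat_vec[OF gc fc vxy]
      using mult_mat_vec[OF gc kron_vec_carrier[OF xc vy]] by (simp add: smult_smult_assoc q_add mult.commute)
  qed
  show ?thesis
  proof (rule hom_eqI[OF BC T3 h gf])
    fix l z assume z: "z \<in> weight_space Q (tensor B C) l"
    have zc: "z \<in> carrier_vec (?b * ?c)" using wt_carrier[OF z] by simp
    show "R V (tensor B C) *\<^sub>v kron_vec v0 z = ?g * ?f *\<^sub>v kron_vec v0 z"
      using arg_cong[OF eq, of "\<lambda>X. X *\<^sub>v z"]
      unfolding assoc_mult_mat_vec[OF hc A(1) zc] assoc_mult_mat_vec[OF mult_carrier_mat[OF gc fc] A(1) zc] A(2)[OF zc] .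
  qed
qed

text \<open>Since E_i kills \<open>v0\<close>, it acts on a tensor of \<open>v0\<close> with x only
  through x, so the quasi-R-matrix does not see \<open>v0\<close>. The bound \<open>mdim C\<close>
  serves both sides.\<close>

lemma theta_left_tensor:
  assumes B: "weight_module B" and C: "weight_module C" and z: "z \<in> carrier_vec (mdim B * mdim C)"
  shows "quasi_R_action c (tensor V B) C *\<^sub>v kron_vec v0 z = kron_vec v0 (quasi_R_action c B C *\<^sub>v z)"
proof -
  let ?d = "mdim V" and ?b = "mdim B" and ?c = "mdim C"
  let ?I = "1\<^sub>m ?d :: 'k mat"
  note cV = weight_module_carrier[OF V] and cB = weight_module_carrier[OF B] and cC = weight_module_carrier[OF C]
  have VB: "weight_module (tensor V B)" using V B by simp
  note cT = tensor_carrier[OF V B]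
  have WT: "word_act (?d * ?b) (actE (tensor V B)) u \<in> carrier_mat (?d * ?b) (?d * ?b)" for u by (rule word_act_carrier[OF cT(1)])
  have WB: "word_act ?b (actE B) u \<in> carrier_mat ?b ?b" for u by (rule word_act_carrier[OF cB(1)])
  have WC: "word_act ?c (actF C) u \<in> carrier_mat ?c ?c" for u by (rule word_act_carrier[OF cC(2)])
  have word: "word_act (?d * ?b) (actE (tensor V B)) u *\<^sub>v kron_vec v0 x = kron_vec v0 (word_act ?b (actE B) u *\<^sub>v x)"
    if x: "x \<in> carrier_vec ?b" for u x
  proof (induction u)
    case Nil
    show ?case using kron_vec_carrier[OF v0_carrier x] x by simp
  next
    case (Cons i u)
    define y where "y = word_act ?b (actE B) u *\<^sub>v x"
    have y: "y \<in> carrier_vec ?b" unfolding y_def by (rule square_mult_vec_carrier[OF WB x])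
    note vy = kron_vec_carrier[OF v0_carrier y]
    have "actE (tensor V B) i *\<^sub>v kron_vec v0 y = kron_vec v0 (actE B i *\<^sub>v y)"
      unfolding tensor_sel add_mult_distrib_mat_vec[OF kron_carrier[OF cV(1) cB(3)] kron_carrier[OF one_carrier_mat cB(1)] vy]
        kron_mult_kron_vec[OF cV(1) cB(3) v0_carrier y] kron_one_left_mult_vec[OF cB(1) v0_carrier y] E_v0 kron_vec_linear(5)
      using carrier_matD(1)[OF cB(3), of i] left_zero_vec[OF kron_vec_carrier[OF v0_carrier square_mult_vec_carrier[OF cB(1) y]], of i] by simp
    then show ?case
      unfolding word_act_Cons assoc_mult_mat_vec[OF cT(1) WT kron_vec_carrier[OF v0_carrier x]] assoc_mult_mat_vec[OF cB(1) WB x] Cons y_def .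
  qed
  obtain A where A: "A \<in> carrier_mat (?d * (?b * ?c)) (?b * ?c)" "\<And>z. z \<in> carrier_vec (?b * ?c) \<Longrightarrow> A *\<^sub>v z = kron_vec v0 z"
    using mat_kron_vec_left[OF v0_carrier] by blast
  let ?X = "\<lambda>(u, w). kron (word_act (?d * ?b) (actE (tensor V B)) u) (word_act ?c (actF C) w)"
  let ?Y = "\<lambda>(u, w). kron (word_act ?b (actE B) u) (word_act ?c (actF C) w)"
  have X: "?X s \<in> carrier_mat (?d * (?b * ?c)) (?d * (?b * ?c))" for s
    using kron_carrier[OF WT WC] by (cases s) (simp add: mult.assoc)
  have Y: "?Y s \<in> carrier_mat (?b * ?c) (?b * ?c)" for s using kron_carrier[OF WB WC] by (cases s) simp
  have XY: "?X s *\<^sub>v kron_vec v0 w = kron ?I (?Y s) *\<^sub>v kron_vec v0 w" if w: "w \<in> carrier_vec (?b * ?c)" for s w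
  proof -
    have "?X s * A = A * ?Y s"
    proof (rule kron_vec_eqI[OF mult_carrier_mat[OF X A(1)] mult_carrier_mat[OF A(1) Y]])
      fix x y :: "'k vec" assume x: "x \<in> carrier_vec ?b" and y: "y \<in> carrier_vec ?c"
      note xy = kron_vec_carrier[OF x y]
      obtain u v where s: "s = (u, v)" by (cases s)
      show "?X s * A *\<^sub>v kron_vec x y = A * ?Y s *\<^sub>v kron_vec x y"
        unfolding assoc_mult_mat_vec[OF X A(1) xy] assoc_mult_mat_vec[OF A(1) Y xy] A(2)[OF xy] A(2)[OF square_mult_vec_carrier[OF Y xy]]
        unfolding s prod.case kron_mult_kron_vec[OF WB WC x y] kron_vec_assoc[symmetric]
          kron_mult_kron_vec[OF WT WC kron_vec_carrier[OF v0_carrier x] y] word[OF x] ..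
    qed
    then have "?X s *\<^sub>v (A *\<^sub>v w) = A *\<^sub>v (?Y s *\<^sub>v w)"
      unfolding assoc_mult_mat_vec[OF X A(1) w, symmetric] assoc_mult_mat_vec[OF A(1) Y w, symmetric] by simp
    then show ?thesis
      unfolding A(2)[OF w] A(2)[OF square_mult_vec_carrier[OF Y w]] kron_one_left_mult_vec[OF Y v0_carrier w] .
  qed
  have "quasi_R_action c (tensor V B) C = mat_lincomb (?d * (?b * ?c)) (\<lambda>(u, w). c u w) ?X (word_pairs ?c)"
    unfolding theta_bound[OF VB C disjI2[OF order_refl]] theta_def by (simp add: mult.assoc del: tensor_sel(2))
  then have "quasi_R_action c (tensor V B) C *\<^sub>v kron_vec v0 z =
      mat_lincomb (?d * (?b * ?c)) (\<lambda>(u, w). c u w) ?X (word_pairs ?c) *\<^sub>v kron_vec v0 z" by (rule arg_cong)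
  also have "\<dots> = mat_lincomb (?d * (?b * ?c)) (\<lambda>(u, w). c u w) (\<lambda>s. kron ?I (?Y s)) (word_pairs ?c) *\<^sub>v kron_vec v0 z"
    using kron_vec_carrier[OF v0_carrier z]
    by (intro mat_lincomb_mult_vec_cong[OF X kron_carrier[OF one_carrier_mat Y]] XY[OF z])
  also have "\<dots> = kron ?I (mat_lincomb (?b * ?c) (\<lambda>(u, w). c u w) ?Y (word_pairs ?c)) *\<^sub>v kron_vec v0 z"
    unfolding kron_one_mat_lincomb[OF Y] ..
  also have "mat_lincomb (?b * ?c) (\<lambda>(u, w). c u w) ?Y (word_pairs ?c) = quasi_R_action c B C"
    unfolding theta_bound[OF B C disjI2[OF order_refl]] theta_def ..
  finally show ?thesis unfolding kron_one_left_mult_vec[OF quasi_R_carrier v0_carrier z] .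
qed

text \<open>On \<open>v0\<close> tensored with z the quasi-R-matrix of B and C remains and has no
  explicit value. By \<open>theta_left_tensor\<close> it is the same on both sides and is split off
  as w; only flips and weight forms have to be compared, which can be done on weight
  vectors.\<close>

lemma hexagon_left:
  assumes B: "weight_module B" and C: "weight_module C"
  shows "R (tensor V B) C = kron (R V C) (1\<^sub>m (mdim B)) * kron (1\<^sub>m (mdim V)) (R B C)"
proof -
  let ?d = "mdim V" and ?b = "mdim B" and ?c = "mdim C"
  have BC: "weight_module (tensor B C)" and VB: "weight_module (tensor V B)" and CB: "weight_module (tensor C B)"
    and VC: "weight_module (tensor V C)" and CV: "weight_module (tensor C V)"
    and T1: "weight_module (tensor V (tensor B C))" and T2: "weight_module (tensor V (tensor C B))" and T3: "weight_module (tensor C (tensor V B))"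
    using V B C by simp_all
  let ?f = "kron (1\<^sub>m ?d) (R B C)" and ?g = "kron (R V C) (1\<^sub>m ?b)"
  have f: "module_hom (tensor V (tensor B C)) (tensor V (tensor C B)) ?f"
    by (rule module_hom_kron[OF V V BC CB module_hom_one[OF V] R_hom[OF B C]])
  have g: "module_hom (tensor V (tensor C B)) (tensor C (tensor V B)) ?g"
    using module_hom_kron[OF VC CV B B R_hom[OF V C] module_hom_one[OF B]] unfolding tensor_assoc[OF V C B] tensor_assoc[OF C V B] .
  have h: "module_hom (tensor V (tensor B C)) (tensor C (tensor V B)) (R (tensor V B) C)"
    using R_hom[OF VB C] unfolding tensor_assoc[OF V B C] .
  note gf = module_hom_mult[OF T1 T2 T3 f g]
  have gc: "?g \<in> carrier_mat (?c * (?d * ?b)) (?d * (?c * ?b))" using module_hom_carrier[OF g] by simp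
  have fc: "?f \<in> carrier_mat (?d * (?c * ?b)) (?d * (?b * ?c))" using module_hom_carrier[OF f] by simp
  have hc: "R (tensor V B) C \<in> carrier_mat (?c * (?d * ?b)) (?d * (?b * ?c))" using module_hom_carrier[OF h] by simp
  note Rc = R_carrier[OF B C] R_carrier[OF V C]
  note D = weight_form_carrier[OF B C]
  have D2: "weight_form_action Q (tensor V B) C \<in> carrier_mat (?d * (?b * ?c)) (?d * (?b * ?c))"
    using weight_form_carrier[OF VB C] by (simp add: mult.assoc)
  have F2: "flip_mat (?d * ?b) ?c \<in> carrier_mat (?c * (?d * ?b)) (?d * (?b * ?c))"
    using flip_mat_carrier[of "?d * ?b" ?c] by (simp add: mult.assoc)
  obtain A where A: "A \<in> carrier_mat (?d * (?b * ?c)) (?b * ?c)" "\<And>z. z \<in> carrier_vec (?b * ?c) \<Longrightarrow> A *\<^sub>v z = kron_vec v0 z"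
    using mat_kron_vec_left[OF v0_carrier] by blast
  obtain A' where A': "A' \<in> carrier_mat (?d * (?c * ?b)) (?c * ?b)" "\<And>z. z \<in> carrier_vec (?c * ?b) \<Longrightarrow> A' *\<^sub>v z = kron_vec v0 z"
    using mat_kron_vec_left[OF v0_carrier] by blast
  note FD = mult_carrier_mat[OF flip_mat_carrier D] and FD2 = mult_carrier_mat[OF F2 D2]
  \<comment> \<open>The comparison without quasi-R-matrices: the exponent (l0 + l, m) splits into
    (l, m) from B and C and (l0, m) from \<open>R_v0\<close>.\<close>
  have eq: "flip_mat (?d * ?b) ?c * weight_form_action Q (tensor V B) C * A = ?g * A' * (flip_mat ?b ?c * weight_form_action Q B C)"
  proof (rule weight_kron_eqI[OF B C mult_carrier_mat[OF FD2 A(1)] mult_carrier_mat[OF mult_carrier_mat[OF gc A'(1)] FD]])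
    fix l m x y assume lm: "l \<in> weights Q" "m \<in> weights Q" and x: "x \<in> weight_space Q B l" and y: "y \<in> weight_space Q C m"
      and xc: "x \<in> carrier_vec ?b" and yc: "y \<in> carrier_vec ?c"
    note xy = kron_vec_carrier[OF xc yc] and vx = kron_vec_carrier[OF v0_carrier xc] and vxy = kron_vec_carrier[OF v0_carrier kron_vec_carrier[OF xc yc]]
      and yx = kron_vec_carrier[OF yc xc] and vy = kron_vec_carrier[OF v0_carrier yc]
    note vxy' = vxy[folded kron_vec_assoc]
    have "flip_mat (?d * ?b) ?c * weight_form_action Q (tensor V B) C * A *\<^sub>v kron_vec x y = q (form Q (l0 + l) m) \<cdot>\<^sub>v kron_vec y (kron_vec v0 x)"
      unfolding assoc_mult_mat_vec[OF FD2 A(1) xy] A(2)[OF xy] assoc_mult_mat_vec[OF F2 D2 vxy]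
      unfolding kron_vec_assoc[symmetric, of v0] weight_form_apply[OF VB C weights_add[OF l0 lm(1)] lm(2) kron_weight[OF V B v0 x] y]
        mult_mat_vec[OF F2 vxy'] unfolding flip_mat_kron_vec[OF vx yc] ..
    also have "\<dots> = q (form Q l m) \<cdot>\<^sub>v (q (form Q l0 m) \<cdot>\<^sub>v kron_vec y (kron_vec v0 x))"
      by (simp add: smult_smult_assoc q_add mult.commute)
    also have "q (form Q l0 m) \<cdot>\<^sub>v kron_vec y (kron_vec v0 x) = ?g *\<^sub>v (A' *\<^sub>v kron_vec y x)"
      unfolding A'(2)[OF yx] kron_vec_assoc[symmetric] kron_mult_kron_vec[OF Rc(2) one_carrier_mat vy xc] R_v0[OF C lm(2) y] kron_vec_linear
      using xc by simp
    also have "q (form Q l m) \<cdot>\<^sub>v (?g *\<^sub>v (A' *\<^sub>v kron_vec y x)) = ?g * A' *\<^sub>v (q (form Q l m) \<cdot>\<^sub>v kron_vec y x)"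
      unfolding mult_mat_vec[OF mult_carrier_mat[OF gc A'(1)] yx] assoc_mult_mat_vec[OF gc A'(1) yx] ..
    also have "q (form Q l m) \<cdot>\<^sub>v kron_vec y x = flip_mat ?b ?c * weight_form_action Q B C *\<^sub>v kron_vec x y"
      unfolding assoc_mult_mat_vec[OF flip_mat_carrier D xy] weight_form_apply[OF B C lm x y] mult_mat_vec[OF flip_mat_carrier xy] flip_mat_kron_vec[OF xc yc] ..
    also have "?g * A' *\<^sub>v (flip_mat ?b ?c * weight_form_action Q B C *\<^sub>v kron_vec x y) =
        ?g * A' * (flip_mat ?b ?c * weight_form_action Q B C) *\<^sub>v kron_vec x y"
      by (rule assoc_mult_mat_vec[OF mult_carrier_mat[OF gc A'(1)] FD xy, symmetric])
    finally show "flip_mat (?d * ?b) ?c * weight_form_action Q (tensor V B) C * A *\<^sub>v kron_vec x y =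
      ?g * A' * (flip_mat ?b ?c * weight_form_action Q B C) *\<^sub>v kron_vec x y" .
  qed
  show ?thesis
  proof (rule hom_eqI[OF BC T3 h gf])
    fix l z assume z: "z \<in> weight_space Q (tensor B C) l"
    have zc: "z \<in> carrier_vec (?b * ?c)" using wt_carrier[OF z] by simp
    define w where "w = quasi_R_action c B C *\<^sub>v z"
    have w: "w \<in> carrier_vec (?b * ?c)" unfolding w_def by (rule square_mult_vec_carrier[OF quasi_R_carrier zc])
    note vz = kron_vec_carrier[OF v0_carrier zc] and vw = kron_vec_carrier[OF v0_carrier w]
    have vz': "kron_vec v0 z \<in> carrier_vec (mdim (tensor V B) * ?c)" using vz by (simp add: mult.assoc)
    have Rz: "R B C *\<^sub>v z = flip_mat ?b ?c * weight_form_action Q B C *\<^sub>v w"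
      unfolding R_apply[OF B C zc] w_def[symmetric] by (rule assoc_mult_mat_vec[OF flip_mat_carrier D w, symmetric])
    have "R (tensor V B) C *\<^sub>v kron_vec v0 z = flip_mat (?d * ?b) ?c *\<^sub>v (weight_form_action Q (tensor V B) C *\<^sub>v kron_vec v0 w)"
      unfolding R_apply[OF VB C vz'] theta_left_tensor[OF B C zc] w_def by simp
    also have "\<dots> = flip_mat (?d * ?b) ?c * weight_form_action Q (tensor V B) C * A *\<^sub>v w"
      unfolding assoc_mult_mat_vec[OF FD2 A(1) w] A(2)[OF w] assoc_mult_mat_vec[OF F2 D2 vw] ..
    also have "\<dots> = ?g *\<^sub>v (A' *\<^sub>v (R B C *\<^sub>v z))"
      unfolding eq assoc_mult_mat_vec[OF mult_carrier_mat[OF gc A'(1)] FD w] Rz[symmetric]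
      by (rule assoc_mult_mat_vec[OF gc A'(1) mult_mat_vec_carrier[OF Rc(1) zc]])
    also have "A' *\<^sub>v (R B C *\<^sub>v z) = ?f *\<^sub>v kron_vec v0 z"
      unfolding A'(2)[OF mult_mat_vec_carrier[OF Rc(1) zc]] kron_mult_kron_vec[OF one_carrier_mat Rc(1) v0_carrier zc]
      using v0_carrier by simp
    also have "?g *\<^sub>v (?f *\<^sub>v kron_vec v0 z) = ?g * ?f *\<^sub>v kron_vec v0 z"
      by (rule assoc_mult_mat_vec[OF gc fc vz, symmetric])
    finally show "R (tensor V B) C *\<^sub>v kron_vec v0 z = ?g * ?f *\<^sub>v kron_vec v0 z" .
  qed
qed

end

section \<open>The local rule\<close>

lemma mat_product_simps[simp]: "mat_product d [] = 1\<^sub>m d" "mat_product d (A # As) = A * mat_product d As"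
  by (simp_all add: mat_product_def)

lemma mat_product_carrier:
  "(\<And>A. A \<in> set As \<Longrightarrow> A \<in> carrier_mat d d) \<Longrightarrow> mat_product d As \<in> carrier_mat d d"
  by (induction As) auto

lemma mat_product_snoc:
  fixes A :: "'k::field mat"
  assumes "A \<in> carrier_mat d d" "\<And>B. B \<in> set As \<Longrightarrow> B \<in> carrier_mat d d"
  shows "mat_product d (As @ [A]) = mat_product d As * A"
  using assms(2)
proof (induction As)
  case Nil
  show ?case using assms(1) by simp
next
  case (Cons B As)
  have "B \<in> carrier_mat d d" "mat_product d As \<in> carrier_mat d d" using Cons.prems by (auto intro!: mat_product_carrier)
  then show ?case using Cons assms(1) by (simp add: assoc_mult_mat[of _ d d _ d _ d])
qed

lemma kron_mat_product:
  fixes As :: "'k::field mat list"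
  assumes "\<And>A. A \<in> set As \<Longrightarrow> A \<in> carrier_mat d d"
  shows "kron (mat_product d As) (1\<^sub>m n) = mat_product (d * n) (map (\<lambda>A. kron A (1\<^sub>m n)) As)"
    and "kron (1\<^sub>m n) (mat_product d As) = mat_product (n * d) (map (kron (1\<^sub>m n)) As)"
  using assms
proof (induction As)
  case Nil
  {
    case 1 show ?case by (simp add: kron_one)
  next
    case 2 show ?case by (simp add: kron_one)
  }
next
  case (Cons B As)
  have B: "B \<in> carrier_mat d d" and P: "mat_product d As \<in> carrier_mat d d"
    if "\<And>A. A \<in> set (B # As) \<Longrightarrow> A \<in> carrier_mat d d"
    using that by (auto intro!: mat_product_carrier)
  {
    case 1
    have IH: "kron (mat_product d As) (1\<^sub>m n) = mat_product (d * n) (map (\<lambda>A. kron A (1\<^sub>m n)) As)"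
      by (rule Cons.IH(1)) (use 1 in simp)
    show ?case unfolding list.map mat_product_simps IH[symmetric] by (rule kron_one_mult(4)[OF B[OF 1] P[OF 1], symmetric])
  next
    case 2
    have IH: "kron (1\<^sub>m n) (mat_product d As) = mat_product (n * d) (map (kron (1\<^sub>m n)) As)"
      by (rule Cons.IH(2)) (use 2 in simp)
    show ?case unfolding list.map mat_product_simps IH[symmetric] by (rule kron_one_mult(3)[OF B[OF 2] P[OF 2], symmetric])
  }
qed

context highest_weight
begin

section \<open>Braidings with tensor powers as braid words\<close>

abbreviation dV :: nat where "dV \<equiv> mdim V"

lemma weight_module_power: "weight_module (tensor_power k V)"
  by (induction k) (simp_all add: weight_module_unit V)

lemma mdim_power[simp]: "mdim (tensor_power k V) = dV ^ k"
  by (induction k) (simp_all add: mult.commute)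

text \<open>\<open>hexagon_left\<close> splits off V on the left, whereas
  \<open>tensor_power\<close> grows on the right.\<close>

lemma tensor_power_Suc_left: "tensor_power (Suc k) V = tensor V (tensor_power k V)"
proof (induction k)
  case 0
  show ?case by (simp add: tensor_unit[OF V])
next
  case (Suc k)
  have "tensor_power (Suc (Suc k)) V = tensor (tensor V (tensor_power k V)) V" unfolding tensor_power.simps(2)[of "Suc k"] Suc ..
  also have "\<dots> = tensor V (tensor (tensor_power k V) V)" by (rule tensor_assoc[OF V weight_module_power V])
  finally show ?case by simp
qed

text \<open>The unit module has dimension 1 and weight 0, so both the quasi-R-matrix and the weight
  form are trivial against it. This starts the inductions below.\<close>

lemma R_unit: "R V unit_module = 1\<^sub>m dV" "R unit_module V = 1\<^sub>m dV"
proof -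
  let ?U = "unit_module :: ('i, 'k) qmodule"
  note U = weight_module_unit
  have W: "word_pairs 1 = {([], [])}" by (auto simp: word_pairs_def)
  have lc: "mat_lincomb d (\<lambda>(u, w). c u w) X {([], [])} = 1\<^sub>m d" if "X ([], []) = 1\<^sub>m d" for d X
    using that by (intro eq_matI) (auto simp: mat_lincomb_def c_Nil)
  have Th: "quasi_R_action c V ?U = 1\<^sub>m (dV * 1)" "quasi_R_action c ?U V = 1\<^sub>m (1 * dV)"
  proof -
    have b: "dV \<le> 1 \<or> mdim ?U \<le> 1" "mdim ?U \<le> 1 \<or> dV \<le> 1" by simp_all
    show "quasi_R_action c V ?U = 1\<^sub>m (dV * 1)"
      unfolding theta_bound[OF V U b(1)] theta_def W unit_module_sel
      by (rule lc) (simp add: kron_one del: One_nat_def)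
    show "quasi_R_action c ?U V = 1\<^sub>m (1 * dV)"
      unfolding theta_bound[OF U V b(2)] theta_def W unit_module_sel
      by (rule lc) (simp add: kron_one del: One_nat_def)
  qed
  have sp: "spans 1 (weight_space Q ?U 0)" unfolding weight_space_unit[OF refl] by (rule spans_carrier)
  note D = weight_form_carrier[OF V U, unfolded unit_module_sel] weight_form_carrier[OF U V, unfolded unit_module_sel]
  have one: "1 \<cdot>\<^sub>v x = x" for x :: "'k vec" by simp
  have D1: "weight_form_action Q V ?U = 1\<^sub>m (dV * 1)"
  proof (rule mat_eqI_kron[OF D(1) one_carrier_mat spans_weight_spaces[OF V] sp])
    fix x y assume "x \<in> weight_vectors V" and y: "y \<in> weight_space Q ?U 0" and xy: "x \<in> carrier_vec dV" "y \<in> carrier_vec 1"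
    then obtain l where l: "l \<in> weights Q" "x \<in> weight_space Q V l" by blast
    show "weight_form_action Q V ?U *\<^sub>v kron_vec x y = 1\<^sub>m (dV * 1) *\<^sub>v kron_vec x y"
      unfolding weight_form_apply[OF V U l(1) weights_zero l(2) y] form_zero q_zero one
      by (rule one_mult_mat_vec[OF kron_vec_carrier[OF xy], symmetric])
  qed
  have D2: "weight_form_action Q ?U V = 1\<^sub>m (1 * dV)"
  proof (rule mat_eqI_kron[OF D(2) one_carrier_mat sp spans_weight_spaces[OF V]])
    fix x y assume x: "x \<in> weight_space Q ?U 0" and "y \<in> weight_vectors V" and xy: "x \<in> carrier_vec 1" "y \<in> carrier_vec dV"
    then obtain l where l: "l \<in> weights Q" "y \<in> weight_space Q V l" by blast
    show "weight_form_action Q ?U V *\<^sub>v kron_vec x y = 1\<^sub>m (1 * dV) *\<^sub>v kron_vec x y"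
      unfolding weight_form_apply[OF U V weights_zero l(1) x l(2)] form_zero q_zero one
      by (rule one_mult_mat_vec[OF kron_vec_carrier[OF xy], symmetric])
  qed
  have fl: "flip_mat dV 1 = (1\<^sub>m dV :: 'k mat)" "flip_mat 1 dV = (1\<^sub>m dV :: 'k mat)"
    by (auto simp: flip_mat_def intro!: eq_matI)
  show "R V ?U = 1\<^sub>m dV" unfolding R_eq[OF V U] Th D1 unit_module_sel fl by simp
  show "R ?U V = 1\<^sub>m dV" unfolding R_eq[OF U V] Th D2 unit_module_sel fl by simp
qed

lemma R_VV_carrier: "R V V \<in> carrier_mat (dV * dV) (dV * dV)"
  by (rule R_carrier[OF V V])

lemma braid_gen_carrier:
  assumes "1 \<le> i" "i \<le> k"
  shows "braid_gen R V k i \<in> carrier_mat (dV ^ (k + 1)) (dV ^ (k + 1))"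
proof -
  have "dV ^ (i - 1) * (dV * dV * dV ^ (k - i)) = dV ^ ((i - 1) + 2 + (k - i))"
    by (simp add: power_add power2_eq_square mult.assoc)
  also have "(i - 1) + 2 + (k - i) = k + 1" using assms by simp
  finally have e: "dV ^ (i - 1) * (dV * dV * dV ^ (k - i)) = dV ^ (k + 1)" .
  show ?thesis
    using kron_carrier[OF one_carrier_mat[of "dV ^ (i - 1)"] kron_carrier[OF R_VV_carrier one_carrier_mat[of "dV ^ (k - i)"]]]
    unfolding braid_gen_def e .
qed

text \<open>A new strand on the right keeps the numbering of the generators, one on the left shifts
  it by one.\<close>

lemma braid_gen_Suc:
  assumes "1 \<le> i" "i \<le> k"
  shows "braid_gen R V (Suc k) i = kron (braid_gen R V k i) (1\<^sub>m dV)"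
    and "braid_gen R V (Suc k) (Suc i) = kron (1\<^sub>m dV) (braid_gen R V k i)"
proof -
  have 1: "dV ^ (Suc k - i) = dV ^ (k - i) * dV" and 2: "dV ^ (Suc i - 1) = dV * dV ^ (i - 1)"
    using assms by (simp_all add: Suc_diff_le power_eq_if[of _ i] mult.commute)
  show "braid_gen R V (Suc k) i = kron (braid_gen R V k i) (1\<^sub>m dV)"
    unfolding braid_gen_def 1 kron_one[symmetric] kron_assoc ..
  show "braid_gen R V (Suc k) (Suc i) = kron (1\<^sub>m dV) (braid_gen R V k i)"
    unfolding braid_gen_def 2 kron_one[symmetric] kron_assoc by simp
qed

lemma braid_gen_last: "braid_gen R V (Suc k) (Suc k) = kron (1\<^sub>m (dV ^ k)) (R V V)"
  by (simp add: braid_gen_def kron_one_one del: One_nat_def)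

lemma braid_gen_first: "braid_gen R V (Suc k) 1 = kron (R V V) (1\<^sub>m (dV ^ k))"
  by (simp add: braid_gen_def kron_one_one del: One_nat_def)

lemma map_braid_gen_kron:
  assumes "set is \<subseteq> {1..k}"
  shows "mat_product (dV ^ (Suc k + 1)) (map (braid_gen R V (Suc k)) is) =
      kron (mat_product (dV ^ (k + 1)) (map (braid_gen R V k) is)) (1\<^sub>m dV)"
    and "mat_product (dV ^ (Suc k + 1)) (map (\<lambda>i. braid_gen R V (Suc k) (Suc i)) is) =
      kron (1\<^sub>m dV) (mat_product (dV ^ (k + 1)) (map (braid_gen R V k) is))"
proof -
  have carr: "A \<in> carrier_mat (dV ^ (k + 1)) (dV ^ (k + 1))" if "A \<in> set (map (braid_gen R V k) is)" for A
    using that assms braid_gen_carrier[of _ k] by auto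
  have 1: "map (braid_gen R V (Suc k)) is = map (\<lambda>A. kron A (1\<^sub>m dV)) (map (braid_gen R V k) is)"
    and 2: "map (\<lambda>i. braid_gen R V (Suc k) (Suc i)) is = map (kron (1\<^sub>m dV)) (map (braid_gen R V k) is)"
    using assms braid_gen_Suc[of _ k] by auto
  have d: "dV ^ (Suc k + 1) = dV ^ (k + 1) * dV" "dV ^ (Suc k + 1) = dV * dV ^ (k + 1)" by simp_all
  show "mat_product (dV ^ (Suc k + 1)) (map (braid_gen R V (Suc k)) is) =
      kron (mat_product (dV ^ (k + 1)) (map (braid_gen R V k) is)) (1\<^sub>m dV)"
    unfolding 1 d(1) by (rule kron_mat_product(1)[OF carr, symmetric])
  show "mat_product (dV ^ (Suc k + 1)) (map (\<lambda>i. braid_gen R V (Suc k) (Suc i)) is) =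
      kron (1\<^sub>m dV) (mat_product (dV ^ (k + 1)) (map (braid_gen R V k) is))"
    unfolding 2 d(2) by (rule kron_mat_product(2)[OF carr, symmetric])
qed

text \<open>\<open>hexagon_right\<close> adds a strand on the right: the new generator is the last
  one, and it acts after the others.\<close>

lemma R_power_right:
  "R V (tensor_power k V) = mat_product (dV ^ (k + 1)) (map (braid_gen R V k) (rev [1..<k + 1]))"
proof (induction k)
  case 0
  show ?case by (simp add: R_unit)
next
  case (Suc k)
  have l: "rev [1..<Suc k + 1] = Suc k # rev [1..<k + 1]" by simp
  have "R V (tensor_power (Suc k) V) =
      kron (1\<^sub>m (dV ^ k)) (R V V) * kron (R V (tensor_power k V)) (1\<^sub>m dV)"
    unfolding tensor_power.simps(2) hexagon_right[OF weight_module_power V] mdim_power ..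
  also have "\<dots> = mat_product (dV ^ (Suc k + 1)) (map (braid_gen R V (Suc k)) (rev [1..<Suc k + 1]))"
    unfolding l list.map(2) mat_product_simps(2) braid_gen_last Suc
    by (subst map_braid_gen_kron(1)) auto
  finally show ?case .
qed

text \<open>\<open>hexagon_left\<close> splits off the first strand: the word for the remaining
  strands is shifted by one and preceded by the first generator.\<close>

lemma R_power_left:
  "R (tensor_power k V) V = mat_product (dV ^ (k + 1)) (map (braid_gen R V k) [1..<k + 1])"
proof (induction k)
  case 0
  show ?case by (simp add: R_unit)
next
  case (Suc k)
  have "[1..<Suc k + 1] = 1 # [Suc 1..<Suc (k + 1)]" by (simp add: upt_rec)
  also have "[Suc 1..<Suc (k + 1)] = map Suc [1..<k + 1]" by (rule map_Suc_upt[symmetric])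
  finally have l: "[1..<Suc k + 1] = 1 # map Suc [1..<k + 1]" .
  have m: "map (braid_gen R V (Suc k)) (map Suc [1..<k + 1]) = map (\<lambda>i. braid_gen R V (Suc k) (Suc i)) [1..<k + 1]"
    by simp
  have "R (tensor_power (Suc k) V) V =
      kron (R V V) (1\<^sub>m (dV ^ k)) * kron (1\<^sub>m dV) (R (tensor_power k V) V)"
    unfolding tensor_power_Suc_left hexagon_left[OF weight_module_power V] mdim_power ..
  also have "\<dots> = mat_product (dV ^ (Suc k + 1)) (map (braid_gen R V (Suc k)) [1..<Suc k + 1])"
    unfolding l list.map(2) mat_product_simps(2) braid_gen_first m Suc
    by (subst map_braid_gen_kron(2)) auto
  finally show ?case .
qed

text \<open>The hexagon that splits off the last strand of the left argument.
  \<open>hexagon_left\<close> splits off only the first; regrouping the braid word from its other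
  end gives the rest.\<close>

lemma R_power_left_Suc:
  "R (tensor_power (Suc k) V) V = kron (R (tensor_power k V) V) (1\<^sub>m dV) * braid_gen R V (Suc k) (Suc k)"
proof -
  have l: "[1..<Suc k + 1] = [1..<k + 1] @ [Suc k]" by simp
  have s: "set [1..<k + 1] \<subseteq> {1..k}" by auto
  show ?thesis
    unfolding R_power_left l map_append list.map
    by (subst mat_product_snoc) (use braid_gen_carrier[of _ "Suc k"] map_braid_gen_kron(1)[OF s] in auto)
qed

lemma jucys_murphy_eq: "jucys_murphy R V n n = double_braiding (tensor_power n V) V"
  unfolding jucys_murphy_def double_braiding_def R_power_left R_power_right ..

lemma jucys_murphy_pred:
  "jucys_murphy R V (Suc m) m = kron (double_braiding (tensor_power m V) V) (1\<^sub>m dV)"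
proof -
  let ?A = "tensor_power m V"
  have s: "set [1..<m + 1] \<subseteq> {1..m}" "set (rev [1..<m + 1]) \<subseteq> {1..m}" by auto
  have "R ?A V \<in> carrier_mat (dV ^ (m + 1)) (dV ^ (m + 1))" "R V ?A \<in> carrier_mat (dV ^ (m + 1)) (dV ^ (m + 1))"
    using R_carrier[OF weight_module_power V, of m] R_carrier[OF V weight_module_power, of m] by (simp_all add: mult.commute)
  then show ?thesis
    unfolding jucys_murphy_def map_braid_gen_kron(1)[OF s(1)] map_braid_gen_kron(1)[OF s(2)]
      R_power_left[symmetric] R_power_right[symmetric] double_braiding_def by (rule kron_one_mult(4)[rotated])
qed

theorem local_rule_eq:
  "local_rule (unitarised Q R) (tensor_power m V) V V =
    q_power Q (1 / 2) (jucys_murphy R V (Suc m) m) * braid_gen R V (Suc m) (Suc m) *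
    q_power Q (- 1 / 2) (jucys_murphy R V (Suc m) (Suc m))"
proof -
  let ?A = "tensor_power m V"
  let ?W = "tensor ?A V"
  define d where "d = dV ^ m * dV * dV"
  define J where "J = double_braiding ?W V"
  define J' where "J' = kron (double_braiding ?A V) (1\<^sub>m dV)"
  define t where "t = kron (1\<^sub>m (dV ^ m)) (R V V)"
  define r where "r = kron (R ?A V) (1\<^sub>m dV)"
  define s where "s = kron (R V ?A) (1\<^sub>m dV)"
  have A: "weight_module ?A" by (rule weight_module_power)
  have W: "weight_module ?W" using A V by simp
  have tc: "t \<in> carrier_mat d d"
    using kron_carrier[OF one_carrier_mat R_VV_carrier, of "dV ^ m"] by (simp add: t_def d_def mult.assoc)
  have rc: "r \<in> carrier_mat d d" using kron_carrier[OF R_carrier[OF A V] one_carrier_mat, of dV] by (simp add: r_def d_def ac_simps)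
  have sc: "s \<in> carrier_mat d d" using kron_carrier[OF R_carrier[OF V A] one_carrier_mat, of dV] by (simp add: s_def d_def ac_simps)
  have J: "qdiag d J" using qdiag_double_braiding[OF W V] by (simp add: J_def d_def)
  have J': "qdiag d J'" using q_power_kron_one(1)[OF qdiag_double_braiding[OF A V], of dV] by (simp add: J'_def d_def)
  note Jc = qdiag_carrier[OF J] and J'c = qdiag_carrier[OF J']
  have RVW: "R V ?W = t * s" unfolding t_def s_def hexagon_right[OF A V] mdim_power ..
  have RWV: "R ?W V = r * t" using R_power_left_Suc[of m] unfolding braid_gen_last by (simp add: r_def t_def)
  have sr: "s * r = J'"
    unfolding s_def r_def J'_def double_braiding_def
  proof (rule kron_one_mult(4))
    show "R V ?A \<in> carrier_mat (dV * dV ^ m) (dV * dV ^ m)" "R ?A V \<in> carrier_mat (dV * dV ^ m) (dV * dV ^ m)"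
      using R_carrier[OF V A] R_carrier[OF A V] by (simp_all add: mult.commute)
  qed
  \<comment> \<open>J is (t s)(r t) by the two hexagons, and the middle factor s r is
    \<open>J'\<close>.\<close>
  have JtJt: "J = t * J' * t"
    unfolding J_def double_braiding_def RVW RWV sr[symmetric]
    using tc sc rc by (simp add: assoc_mult_mat[of _ d d _ d _ d])
  \<comment> \<open>\<open>J'\<close> is an endomorphism of the first factor W tensored with the
    identity, so the naturality of the double braiding applies.\<close>
  have comm: "J * J' = J' * J"
    unfolding J_def J'_def by (rule double_braiding_commute[OF W V double_braiding_hom[OF A V]])
  define P where "P = q_power Q (1 / 2) J"
  define P' where "P' = q_power Q (1 / 2) J'"
  define N where "N = q_power Q (- 1 / 2) J"
  have Pc: "P \<in> carrier_mat d d" and P'c: "P' \<in> carrier_mat d d" and Nc: "N \<in> carrier_mat d d"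
    unfolding P_def P'_def N_def by (rule q_power_carrier[OF J] q_power_carrier[OF J'])+
  note assoc = assoc_mult_mat[of _ d d _ d _ d]
  have X: "qdiag d (J' * J)" and XP: "q_power Q (1 / 2) (J' * J) = P' * P"
    unfolding P_def P'_def by (rule qdiag_mult[OF J' J comm[symmetric]], rule q_power_mult[OF J' J comm[symmetric]])
  have "t * (J' * J) = J' * J * t"
  proof -
    note tJ = square_mult_carrier[OF tc J'c] and J't = square_mult_carrier[OF J'c tc]
    have "t * (J' * J) = t * J' * J" by (rule assoc_mult_mat[OF tc J'c Jc, symmetric])
    also have "\<dots> = t * J' * (t * (J' * t))" unfolding JtJt assoc_mult_mat[OF tc J'c tc] ..
    also have "\<dots> = J * (J' * t)" unfolding JtJt by (rule assoc_mult_mat[OF tJ tc J't, symmetric])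
    also have "\<dots> = J' * J * t" unfolding comm[symmetric] by (rule assoc_mult_mat[OF Jc J'c tc, symmetric])
    finally show ?thesis .
  qed
  then have tP: "t * (P' * P) = P' * P * t" unfolding XP[symmetric] by (rule q_power_commute[OF X tc])
  have PP: "P' * P = P * P'"
    unfolding P_def by (rule q_power_commute[OF J P'c]) (unfold P'_def, rule q_power_commute[OF J' Jc comm, symmetric])
  have NP: "N * P = 1\<^sub>m d" "P * N = 1\<^sub>m d"
    unfolding N_def P_def q_power_add[OF J] using q_power_zero[OF J] by simp_all
  \<comment> \<open>Inserting \<open>P * N\<close> creates the product of the two square roots,
    which commutes with t; afterwards N cancels P on the left.\<close>
  have key: "N * t * P' = P' * t * N"
  proof -
    have "N * t * P' = N * t * P' * (P * N)" unfolding NP using Nc tc P'c by simp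
    also have "\<dots> = N * (t * (P' * P)) * N" using Nc tc P'c Pc by (simp add: assoc)
    also have "\<dots> = N * (P * P' * t) * N" unfolding tP unfolding PP ..
    also have "\<dots> = (N * P) * P' * t * N" using Nc tc P'c Pc by (simp add: assoc)
    also have "\<dots> = P' * t * N" unfolding NP using P'c by simp
    finally show ?thesis .
  qed
  \<comment> \<open>Unitarisation takes the power of the double braiding of V with W, while J is
    that of W with V. The braiding of V with W intertwines the two, hence also their powers.\<close>
  have U1: "unitarised Q R V ?W = N * (t * s)"
  proof -
    have VW: "qdiag d (double_braiding V ?W)" using qdiag_double_braiding[OF V W] by (simp add: d_def ac_simps)
    have c: "t * s \<in> carrier_mat d d" "r * t \<in> carrier_mat d d" using tc sc rc by simp_all
    have "(t * s) * double_braiding V ?W = J * (t * s)"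
      unfolding J_def double_braiding_def RVW RWV using c by (simp add: assoc[OF c(1) c(2) c(1)])
    from q_power_intertwine[OF VW J c(1) this] show ?thesis
      unfolding unitarised_def N_def double_braiding_def RVW by simp
  qed
  have U2: "kron (unitarised Q R ?A V) (1\<^sub>m dV) = r * q_power Q (- 1 / 2) J'"
  proof -
    note db = qdiag_double_braiding[OF A V]
    have "R ?A V \<in> carrier_mat (dV ^ m * dV) (dV ^ m * dV)"
      using R_carrier[OF A V] by (simp add: mult.commute)
    moreover have "q_power Q (- 1 / 2) (double_braiding ?A V) \<in> carrier_mat (dV ^ m * dV) (dV ^ m * dV)"
      using q_power_carrier[OF db] by simp
    ultimately show ?thesis
      unfolding unitarised_def J'_def r_def double_braiding_def[symmetric] q_power_kron_one(2)[OF db]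
      by (rule kron_one_mult(4)[symmetric])
  qed
  \<comment> \<open>The factors s and r of the two braidings meet in the local rule and produce
    \<open>J'\<close>; with the power -1/2 from \<open>U2\<close> this leaves the power 1/2.\<close>
  have J'P: "J' * q_power Q (- 1 / 2) J' = P'"
    using q_power_add[OF J', of 1 "- 1 / 2"] unfolding q_power_one[OF J'] P'_def by simp
  have N'c: "q_power Q (- 1 / 2) J' \<in> carrier_mat d d" by (rule q_power_carrier[OF J'])
  have "local_rule (unitarised Q R) ?A V V = N * (t * s) * (r * q_power Q (- 1 / 2) J')"
    unfolding local_rule_def U1 U2 ..
  also have "\<dots> = N * t * (s * r * q_power Q (- 1 / 2) J')"
    using Nc tc sc rc N'c by (simp add: assoc)
  also have "\<dots> = P' * t * N" unfolding sr J'P by (rule key)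
  finally show ?thesis
    unfolding jucys_murphy_pred braid_gen_last jucys_murphy_eq tensor_power.simps(2) P'_def N_def t_def J_def J'_def .
qed

end

theorem theorem4p3:
  fixes Q :: "('i::finite, 'k::field_char_0) quantum_datum"
    and R :: "('i, 'k) qmodule \<Rightarrow> ('i, 'k) qmodule \<Rightarrow> 'k mat"
    and V :: "('i, 'k) qmodule"
    and n :: nat
  assumes "is_quantum_datum Q"
    and "standard_braiding Q R"
    and "highest_weight_module Q V"
    and "n > 0"
  shows "local_rule (unitarised Q R) (tensor_power (n - 1) V) V V =
    q_power Q (1 / 2) (jucys_murphy R V n (n - 1)) * braid_gen R V n n *
    q_power Q (- 1 / 2) (jucys_murphy R V n n)"
proof -
  interpret qdatum Q by unfold_locales (rule assms(1))
  obtain c where c: "c [] [] = 1"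
    "\<And>M N. type1_module Q M \<Longrightarrow> type1_module Q N \<Longrightarrow>
      R M N = flip_mat (mdim M) (mdim N) * (weight_form_action Q M N * quasi_R_action c M N) \<and>
      module_hom (tensor M N) (tensor N M) (R M N)"
    using assms(2) unfolding standard_braiding_def by blast
  obtain l v where lv: "l \<in> weights Q" "v \<in> weight_space Q V l" "\<And>i. actE V i *\<^sub>v v = 0\<^sub>v (mdim V)"
      "\<And>W. is_submodule V W \<Longrightarrow> v \<in> W \<Longrightarrow> W = carrier_vec (mdim V)"
    and V: "weight_module V"
    using assms(3) unfolding highest_weight_module_def type1_iff_weight_module by blast
  interpret highest_weight Q R c V l v
    by unfold_locales (use c lv V type1_iff_weight_module in blast)+
  obtain m where "n = Suc m" using assms(4) by (cases n) auto
  then show ?thesis using local_rule_eq[of m] by simp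
qed

end
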